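(* Let $\ell\in\mathbb{N}\cup\{0\}$, $p\in(1,\infty)$, $a\in(0,1]$, and let $q\in L^p(0,1)$ be real-valued. Let $\beta_n\in\mathbb{R}\cup\{\infty\}$ and $\lambda_n\in\sigma(\ell,q,\beta_n)$ for $n\in\mathbb{N}$, put $\Lambda=\{\lambda_n\mid n\in\mathbb{N}\}$, suppose $\lambda_n\nrightarrow-\infty$ (the sequence does not tend to $-\infty$), and let $S\subset\Lambda$. Suppose the system $$S_\ell(\Lambda,S):=\begin{cases}\{x^{2k}\mid k=0,1,\dots,\ell\}\cup C(\Lambda,S), & 0\notin\Lambda,\\ \{x^{2k}\mid k=0,1,\dots,\ell+1\}\cup C(\Lambda,S), & 0\in\Lambda,\ 0\notin S,\\ \{x^{2k}\mid k=0,1,\dots,\ell+2\}\cup C(\Lambda,S), & 0\in S,\end{cases}$$ where $$C(\Lambda,S):=\{\cos(2\sqrt{\lambda_n}\,x)\mid\lambda_n\in\Lambda\}\cup\{x\sin(2\sqrt{\lambda_n}\,x)\mid\lambda_n\in S\},$$ is closed in $L^p(0,a)$. Then $q$ on $(a,1)$, $\Lambda$, and $S$ (with the norming constants $\zeta(\lambda_n,\beta_n,q)$, $\lambda_n\in S$, known) uniquely determine $q$ on $(0,a)$; that is, if $\hat q\in L^p(0,1)$ is real-valued, $\hat q=q$ a.e. on $(a,1)$, $\lambda_n\in\sigma(\ell,\hat q,\beta_n)$ for all $n\in\mathbb{N}$, and $\zeta(\lambda_n,\beta_n,\hat q)=\zeta(\lambda_n,\beta_n,q)$ for all $\lambda_n\in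 S$, then $\hat q=q$ a.e. on $(0,a)$.
   Context: $\mathbb{N}=\{1,2,3,\dots\}$. For $\ell\ge-1/2$, a real-valued $q\in L^1(0,1)$ and $\beta\in\mathbb{R}\cup\{\infty\}$, consider on $(0,1)$ the equation $$-f''(x)+\frac{\ell(\ell+1)}{x^2}f(x)+q(x)f(x)=\lambda f(x)$$ with boundary conditions: $\lim_{x\to0}f(x)/x^{\ell+1}$ exists and is finite, and $f'(1)+\beta f(1)=0$, the latter meaning $f(1)=0$ if $\beta=\infty$. $\sigma(\ell,q,\beta)$ denotes the set of eigenvalues of this problem (real, simple, discrete). Let $\psi_\ell(\lambda,x,q)$ be the solution of the equation with $\psi_\ell(\lambda,1,q)=1$, $\psi_\ell'(\lambda,1,q)=-\beta$ if $\beta\in\mathbb{R}$, and $\psi_\ell(\lambda,1,q)=0$, $\psi_\ell'(\lambda,1,q)=-1$ if $\beta=\infty$. For $\lambda\in\sigma(\ell,q,\beta)$ the norming constant is $\zeta(\lambda,\beta,q)=\int_0^1|\psi_\ell(\lambda,x,q)|^2\,dx$. For $p\in(1,\infty)$ and $1/p+1/p'=1$, a system $\{\varphi_n\}\subset L^{p'}(0,a)$ is called closed in $L^p(0,a)$ if $h\in L^p(0,a)$ and $\int_0^a h(x)\varphi_n(x)\,dx=0$ for all $n$ implies $h=0$. *)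

theory Defs
  imports "HOL-Analysis.Analysis"
begin

text \<open>The space \<open>L\<^sup>p(a,b)\<close>, as a predicate on representatives
  (values outside \<open>(a,b)\<close> are irrelevant).\<close>

definition Lp :: "real \<Rightarrow> real \<Rightarrow> real \<Rightarrow> (real \<Rightarrow> 'a::{banach,second_countable_topology}) \<Rightarrow> bool"
  where "Lp p a b f \<longleftrightarrow>
    set_borel_measurable lebesgue {a<..<b} f \<and>
    set_integrable lebesgue {a<..<b} (\<lambda>x. norm (f x) powr p)"

text \<open>\<open>f\<close> solves \<open>-f'' + l(l+1)/x\<^sup>2 f + q f = \<lambda> f\<close> on \<open>(0,1]\<close> in the sense usual for integrable
  \<open>q\<close>: \<open>f\<close> is differentiable on \<open>(0,1]\<close> (one-sidedly at 1), its derivative \<open>f'\<close> is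
  locally absolutely continuous on \<open>(0,1]\<close>, i.e. the integral of a locally
  integrable \<open>f''\<close>, and the equation holds almost everywhere.\<close>

definition sl_solution ::
    "real \<Rightarrow> (real \<Rightarrow> real) \<Rightarrow> complex \<Rightarrow> (real \<Rightarrow> complex) \<Rightarrow> (real \<Rightarrow> complex) \<Rightarrow> bool"
  where "sl_solution l q lam f f' \<longleftrightarrow>
    (\<forall>x\<in>{0<..1}. (f has_vector_derivative f' x) (at x within {0<..1})) \<and>
    (\<exists>f''. (\<forall>x\<in>{0<..1}. set_integrable lebesgue {x..1} f'' \<and>
                          f' 1 - f' x = (LINT t:{x..1}|lebesgue. f'' t)) \<and>
           (AE x in lebesgue. x \<in> {0<..<1} \<longrightarrow>
              - f'' x + of_real (l * (l + 1) / x\<^sup>2) * f x + of_real (q x) * f x = lam * f x))"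

text \<open>The parameter \<open>\<beta> \<in> \<real> \<union> {\<infinity>}\<close> is an extended real different from \<open>-\<infinity>\<close>.\<close>

definition sl_spectrum :: "real \<Rightarrow> (real \<Rightarrow> real) \<Rightarrow> ereal \<Rightarrow> complex set"
  where "sl_spectrum l q \<beta> = {lam. \<exists>f f'.
    sl_solution l q lam f f' \<and> (\<exists>x\<in>{0<..1}. f x \<noteq> 0) \<and>
    (\<exists>L. ((\<lambda>x. f x / of_real (x powr (l + 1))) \<longlongrightarrow> L) (at_right 0)) \<and>
    (if \<beta> = \<infinity> then f 1 = 0 else f' 1 + of_real (real_of_ereal \<beta>) * f 1 = 0)}"

text \<open>The solution \<open>\<psi>\<close> is determined on \<open>(0,1]\<close> by its initial values at 1; only the choice of
  values outside \<open>(0,1]\<close> is arbitrary.\<close>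

definition sl_psi :: "real \<Rightarrow> (real \<Rightarrow> real) \<Rightarrow> ereal \<Rightarrow> complex \<Rightarrow> real \<Rightarrow> complex"
  where "sl_psi l q \<beta> lam = (SOME f. \<exists>f'. sl_solution l q lam f f' \<and>
    (if \<beta> = \<infinity> then f 1 = 0 \<and> f' 1 = - 1
     else f 1 = 1 \<and> f' 1 = - of_real (real_of_ereal \<beta>)))"

definition norming_const :: "real \<Rightarrow> (real \<Rightarrow> real) \<Rightarrow> ereal \<Rightarrow> complex \<Rightarrow> real"
  where "norming_const l q \<beta> lam =
    (LINT x:{0<..<1}|lebesgue. (cmod (sl_psi l q \<beta> lam x))\<^sup>2)"

text \<open>The dual exponent of \<open>p\<close> is \<open>p / (p - 1)\<close>.\<close>

definition closed_system :: "real \<Rightarrow> real \<Rightarrow> (real \<Rightarrow> complex) set \<Rightarrow> bool"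
  where "closed_system p a \<Phi> \<longleftrightarrow>
    (\<forall>\<phi>\<in>\<Phi>. Lp (p / (p - 1)) 0 a \<phi>) \<and>
    (\<forall>h :: real \<Rightarrow> complex. Lp p 0 a h \<longrightarrow>
       (\<forall>\<phi>\<in>\<Phi>. (LINT x:{0<..<a}|lebesgue. h x * \<phi> x) = 0) \<longrightarrow>
       (AE x in lebesgue. x \<in> {0<..<a} \<longrightarrow> h x = 0))"

text \<open>For negative \<open>\<lambda>\<close> the square root is imaginary, hence the complex-valued functions.\<close>

definition C_system :: "real set \<Rightarrow> real set \<Rightarrow> (real \<Rightarrow> complex) set"
  where "C_system \<Lambda> S =
    {(\<lambda>x. cos (2 * csqrt (of_real lam) * of_real x)) | lam. lam \<in> \<Lambda>} \<union>
    {(\<lambda>x. of_real x * sin (2 * csqrt (of_real lam) * of_real x)) | lam. lam \<in> S}"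

definition S_system :: "nat \<Rightarrow> real set \<Rightarrow> real set \<Rightarrow> (real \<Rightarrow> complex) set"
  where "S_system l \<Lambda> S =
    {(\<lambda>x. of_real (x ^ (2 * k))) | k.
       k \<le> (if 0 \<in> S then l + 2 else if 0 \<in> \<Lambda> then l + 1 else l)} \<union> C_system \<Lambda> S"

end

theory Submission
  imports Defs "HOL-Complex_Analysis.Complex_Analysis" "HOL-Real_Asymp.Real_Asymp"
begin

text \<open>Let \<open>\<phi>\<close>, \<open>\<phi>h\<close> be the regular solutions (those behaving like \<open>x^(l+1)\<close> at 0) for \<open>q\<close> and for the second
potential \<open>qh\<close>, and put \<open>F(\<lambda>) = \<integral> (qh - q) \<phi> \<phi>h dx\<close>. By Green's identity \<open>F\<close> is a Wronskian at 1, so a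
common eigenvalue is a zero of \<open>F\<close> whatever the boundary parameter is, and equality of the norming constants makes
the zero double (\<open>prod_fun_eq_0\<close>, \<open>prod_fun_double_zero\<close>).

The link with the system of cosines is that a product of two regular solutions is, up to a constant, a cosine
transform with the doubled frequency: for \<open>z^2 = \<lambda>\<close>, \<open>z^(2l+2) \<phi> \<phi>h = \<alpha>^2/2 (1 - (-1)^l cos 2zx) +
\<integral>\<^sub>0\<^sup>x K(x,t) cos 2zt dt\<close> with \<open>\<bar>K\<bar> \<le> C/x\<close> (\<open>prod_phi_transform\<close>). The kernel is not built from a transformation
operator: the remainder is an even entire function of exponential type \<open>2x\<close>, whose values at the nodes
\<open>n \<pi>/(2x)\<close> are \<open>O(n^(-1-\<delta>))\<close> after the first Born term has been split off, and the sampling theorem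
\<open>cosine_sampling\<close> recovers it from these values as an absolutely convergent cosine series. The exponent \<open>\<delta>\<close>
comes from \<open>q\<close> in \<open>L^p\<close> with \<open>p > 1\<close>. Since \<open>qh - q\<close> vanishes on \<open>(a,1)\<close>, integration against it gives
\<open>\<lambda>^(l+1) F(\<lambda>) = c + \<integral>\<^sub>0\<^sup>a g(t) cos 2zt dt\<close> where \<open>g\<close> differs from a multiple of \<open>qh - q\<close> by a Volterra
term; a Hardy inequality keeps \<open>g\<close> in \<open>L^p\<close>, and \<open>g = 0\<close> forces \<open>qh = q\<close> (\<open>prod_fun_transform\<close>).

If \<open>c = 0\<close>, then \<open>g\<close> annihilates the closed system: the zeros give the cosines, the double zeros the functions
\<open>x sin\<close>, and the factor \<open>\<lambda>^(l+1)\<close> (with the zero of \<open>F\<close> at 0, if any) the even powers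
(\<open>closed_system_annihilator\<close>). If \<open>c\<close> were not 0, then by the Riemann-Lebesgue lemma \<open>F\<close> would have only finitely
many zeros on \<open>[0,\<infinity>)\<close>; but \<open>F\<close> has order one half and tends to 0 along that half-line, so it has a zero \<open>w\<close>
that is neither negative nor one of the prescribed ones (\<open>order_half_zero_off_negative_axis\<close>). Dividing by
\<open>\<lambda> - w\<close> turns the right-hand side into a cosine transform without constant term, whose density annihilates the
system as well; so \<open>F\<close> vanishes identically and \<open>c = 0\<close> (\<open>transform_constant_eq_0\<close>).\<close>

abbreviation "cplx \<equiv> complex_of_real"

abbreviation "unit_L1 f \<equiv> f absolutely_integrable_on {0..1::real}"

lemmas hk_add = Henstock_Kurzweil_Integration.integral_add
lemmas hk_cnj = Henstock_Kurzweil_Integration.integral_cnj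
lemmas hk_combine = Henstock_Kurzweil_Integration.integral_combine
lemmas hk_cong = Henstock_Kurzweil_Integration.integral_cong
lemmas hk_diff = Henstock_Kurzweil_Integration.integral_diff
lemmas hk_nonneg = Henstock_Kurzweil_Integration.integral_nonneg
lemmas bi_integrable_add = Bochner_Integration.integrable_add
lemmas bi_integrable_bound = Bochner_Integration.integrable_bound
lemmas bi_integrable_diff = Bochner_Integration.integrable_diff
lemmas bi_integral_add = Bochner_Integration.integral_add
lemmas bi_integral_cong = Bochner_Integration.integral_cong
lemmas bi_integral_diff = Bochner_Integration.integral_diff
lemmas bi_integral_dominated_convergence = Bochner_Integration.integral_dominated_convergence
lemmas bi_integral_nonneg = Bochner_Integration.integral_nonneg
lemmas bi_integral_sum = Bochner_Integration.integral_sum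

section \<open>Indefinite integrals\<close>

definition ac_on :: "real => real => (real => 'a::euclidean_space) => (real => 'a) => bool"
 where "ac_on a b F f \<longleftrightarrow> f absolutely_integrable_on {a..b} &
	(\<forall>x\<in>{a..b}. F x = F a + integral {a..x} f)"

lemma ac_onD:
 assumes "ac_on a b F f"
 shows "f absolutely_integrable_on {a..b}" "f integrable_on {a..b}"
	"!!x. x \<in> {a..b} ==> F x = F a + integral {a..x} f"
 using assms absolutely_integrable_on_def unfolding ac_on_def by blast+

lemma ac_on_diff_eq:
 assumes "ac_on a b F f" "a <= s" "s <= t" "t <= b"
 shows "F t - F s = integral {s..t} f"
proof -
 have "f integrable_on {a..t}"
	using ac_onD(2)[OF assms(1)] assms by (auto intro: integrable_subinterval_real)
 from hk_combine[OF assms(2,3) this]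
 show ?thesis using ac_onD(3)[OF assms(1), of t] ac_onD(3)[OF assms(1), of s] assms
	by (simp add: algebra_simps)
qed

lemma ac_on_subinterval:
 assumes "ac_on a b F f" "a <= c" "d <= b"
 shows "ac_on c d F f"
 unfolding ac_on_def
proof (intro conjI ballI)
 show "f absolutely_integrable_on {c..d}"
	by (rule absolutely_integrable_on_subinterval[OF ac_onD(1)[OF assms(1)]]) (use assms(2,3) in auto)
next
 fix x assume "x \<in> {c..d}"
 with ac_on_diff_eq[OF assms(1), of c x] assms(2,3)
 show "F x = F c + integral {c..x} f" by (auto simp: algebra_simps)
qed

lemma ac_on_continuous:
 assumes "ac_on a b F f" shows "continuous_on {a..b} F"
proof -
 have "continuous_on {a..b} (%x. F a + integral {a..x} f)"
	by (intro continuous_intros indefinite_integral_continuous_1 ac_onD(2)[OF assms])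
 then show ?thesis
	by (rule continuous_on_eq) (rule ac_onD(3)[OF assms, symmetric])
qed

lemma ac_onI_interior:
 assumes "a <= b" "continuous_on {a..b} F" "f absolutely_integrable_on {a..b}"
	and "!!x. x \<in> {a<..<b} ==> (F has_vector_derivative f x) (at x)"
 shows "ac_on a b F f"
 unfolding ac_on_def
proof (intro conjI ballI assms)
 fix x assume x: "x \<in> {a..b}"
 have "(f has_integral (F x - F a)) {a..x}"
	by (rule fundamental_theorem_of_calculus_interior)
	  (use x assms continuous_on_subset[OF assms(2)] in auto)
 then show "F x = F a + integral {a..x} f" by (simp add: integral_unique)
qed

lemma ac_onI_C1:
 assumes "a <= b" "continuous_on {a..b} f"
	and "!!x. x \<in> {a..b} ==> (F has_vector_derivative f x) (at x within {a..b})"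
 shows "ac_on a b F f"
proof (rule ac_onI_interior)
 show "continuous_on {a..b} F"
	using assms(3) has_vector_derivative_continuous continuous_on_eq_continuous_within by blast
 show "f absolutely_integrable_on {a..b}"
	using assms by (intro absolutely_integrable_continuous_real) auto
 show "(F has_vector_derivative f x) (at x)" if "x \<in> {a<..<b}" for x
	using assms(3)[of x] that at_within_interior[of x "{a..b}"] by auto
qed (use assms in auto)

lemma ac_on_const: "a <= b ==> ac_on a b (%x. c) (%x. 0)"
 by (rule ac_onI_C1) auto

lemma ac_on_add:
 assumes "ac_on a b F f" "ac_on a b G g"
 shows "ac_on a b (%x. F x + G x) (%x. f x + g x)"
 unfolding ac_on_def
proof (intro conjI ballI)
 show "(%x. f x + g x) absolutely_integrable_on {a..b}"
	using assms by (intro set_integral_add) (auto dest: ac_onD)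
 fix x assume x: "x \<in> {a..b}"
 have "f integrable_on {a..x}" "g integrable_on {a..x}"
	using ac_onD(2)[OF assms(1)] ac_onD(2)[OF assms(2)] x by (auto intro: integrable_subinterval_real)
 then show "F x + G x = F a + G a + integral {a..x} (%x. f x + g x)"
	using ac_onD(3)[OF assms(1) x] ac_onD(3)[OF assms(2) x]
	by (simp add: hk_add)
qed

lemma ac_on_diff:
 assumes "ac_on a b F f" "ac_on a b G g"
 shows "ac_on a b (%x. F x - G x) (%x. f x - g x)"
 unfolding ac_on_def
proof (intro conjI ballI)
 show "(%x. f x - g x) absolutely_integrable_on {a..b}"
	using assms by (intro set_integral_diff) (auto dest: ac_onD)
 fix x assume x: "x \<in> {a..b}"
 have "f integrable_on {a..x}" "g integrable_on {a..x}"
	using ac_onD(2)[OF assms(1)] ac_onD(2)[OF assms(2)] x by (auto intro: integrable_subinterval_real)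
 then show "F x - G x = F a - G a + integral {a..x} (%x. f x - g x)"
	using ac_onD(3)[OF assms(1) x] ac_onD(3)[OF assms(2) x]
	by (simp add: hk_diff)
qed

lemma ac_on_cong:
 assumes "ac_on a b F f" "!!x. x \<in> {a..b} ==> F x = G x" "!!x. x \<in> {a..b} ==> f x = g x"
 shows "ac_on a b G g"
proof (cases "a <= b")
 case True
 show ?thesis unfolding ac_on_def
 proof (intro conjI ballI)
	show "g absolutely_integrable_on {a..b}"
	 using set_integrable_cong[of lebesgue lebesgue "{a..b}" "{a..b}" f g] ac_onD(1)[OF assms(1)] assms(3)
	 by auto
	fix x assume x: "x \<in> {a..b}"
	have "integral {a..x} f = integral {a..x} g"
	 by (rule hk_cong) (use x assms(3) in auto)
	then show "G x = G a + integral {a..x} g"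
	 using ac_onD(3)[OF assms(1) x] assms(2)[of x] assms(2)[of a] x True by auto
 qed
qed (auto simp: ac_on_def set_integrable_def)

lemma ac_on_AE:
 assumes "ac_on a b F f" "negligible N" "!!x. x \<in> {a..b} - N ==> f x = g x"
 shows "ac_on a b F g"
 unfolding ac_on_def
proof (intro conjI ballI)
 show "g absolutely_integrable_on {a..b}"
	using absolutely_integrable_spike[OF ac_onD(1)[OF assms(1)] assms(2)] assms(3) by metis
 fix x assume x: "x \<in> {a..b}"
 have "integral {a..x} f = integral {a..x} g"
	by (rule integral_spike[OF assms(2)]) (use x assms(3) in auto)
 then show "F x = F a + integral {a..x} g" using ac_onD(3)[OF assms(1) x] by simp
qed

lemma absolutely_integrable_mult_continuous:
 fixes f g :: "real => 'a::{euclidean_space,real_normed_field}"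
 assumes "f absolutely_integrable_on {a..b}" "continuous_on {a..b} g"
 shows "(%x. g x * f x) absolutely_integrable_on {a..b}"
proof (rule absolutely_integrable_bounded_measurable_product[OF bilinear_times _ _ _ assms(1)])
 show "g \<in> borel_measurable (lebesgue_on {a..b})"
	using assms(2) by (intro continuous_imp_measurable_on_sets_lebesgue) auto
 show "bounded (g ` {a..b})"
	using assms(2) by (intro compact_imp_bounded compact_continuous_image) auto
qed auto

text \<open>The increments of \<open>D\<close> are infinitely smaller than those of \<open>V\<close>, hence \<open>D\<close> is constant.\<close>
lemma increments_negligible_imp_const:
 fixes D :: "real => 'a::real_normed_vector" and V :: "real => real"
 assumes "a <= b"
	and small: "!!e. e > 0 ==> \<exists>d>0. \<forall>s t. a <= s & s <= t & t <= b & t - s < d -->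
		norm (D t - D s) <= e * (V t - V s)"
 shows "D b = D a"
proof -
 have "norm (D b - D a) <= e * (V b - V a)" if e: "e > 0" for e
 proof -
	obtain d where d: "d > 0" "!!s t. a <= s ==> s <= t ==> t <= b ==> t - s < d ==>
		norm (D t - D s) <= e * (V t - V s)"
	 using small[OF e] by auto
	obtain n :: nat where n: "(b - a) / d < real n" using reals_Archimedean2 by blast
	let ?x = "%k. a + (b - a) * (real k / real n)"
	have "norm (D (?x k) - D a) <= e * (V (?x k) - V a)" if "k <= n" for k
	 using that
	proof (induction k)
	 case (Suc k)
	 have n0: "real n > 0" using Suc by auto
	 have "?x (Suc k) - ?x k = (b - a) / n" using n0 by (simp add: field_simps)
	 also have "... < d" using n d n0 by (simp add: field_simps)
	 finally have 1: "?x (Suc k) - ?x k < d" .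
	 have 2: "?x k <= ?x (Suc k)" using assms(1) n0 by (simp add: divide_right_mono mult_left_mono)
	 have "(b - a) * (real (Suc k) / real n) <= (b - a) * 1" using assms(1) n0 Suc(2)
		by (intro mult_left_mono) (auto simp: field_simps)
	 then have 3: "?x (Suc k) <= b" by simp
	 have 4: "a <= ?x k" using assms(1) by simp
	 have "norm (D (?x (Suc k)) - D a) <= norm (D (?x (Suc k)) - D (?x k)) + norm (D (?x k) - D a)"
		by (metis (no_types) norm_triangle_sub diff_add_cancel add_diff_eq norm_triangle_ineq)
	 also have "... <= e * (V (?x (Suc k)) - V (?x k)) + e * (V (?x k) - V a)"
		using d(2)[OF 4 2 3 1] Suc by simp
	 finally show ?case by (simp add: algebra_simps)
	qed auto
	from this[of n] show ?thesis
	proof (cases "n = 0")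
	 case True
	 then have "a = b" using n d(1) assms(1) by (auto simp: divide_simps split: if_splits)
	 then show ?thesis by simp
	qed auto
 qed
 then have *: "norm (D b - D a) <= e * \<bar>V b - V a\<bar>" if "e > 0" for e
	using that by (meson abs_ge_self mult_left_mono less_imp_le order_trans)
 have "norm (D b - D a) <= 0 + e" if "e > 0" for e
 proof -
	define e' where "e' = e / (\<bar>V b - V a\<bar> + 1)"
	have "e' > 0" using that by (simp add: e'_def add_nonneg_pos)
	moreover have "e' * \<bar>V b - V a\<bar> <= e' * (\<bar>V b - V a\<bar> + 1)"
	 using \<open>e' > 0\<close> by simp
	moreover have "e' * (\<bar>V b - V a\<bar> + 1) = e"
	 using abs_ge_zero[of "V b - V a"] unfolding e'_def by (simp add: add_nonneg_eq_0_iff)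
	ultimately show ?thesis using *[of e'] by linarith
 qed
 then have "norm (D b - D a) <= 0" by (rule field_le_epsilon)
 then show ?thesis by simp
qed

lemma ac_on_mult:
 fixes F G :: "real => 'a::{euclidean_space,real_normed_field}"
 assumes F: "ac_on a b F f" and G: "ac_on a b G g"
 shows "ac_on a b (%x. F x * G x) (%x. f x * G x + F x * g x)"
proof (cases "a <= b")
 case True
 note cF = ac_on_continuous[OF F] and cG = ac_on_continuous[OF G]
 let ?h = "%x. f x * G x + F x * g x"
 have ai1: "(%x. f x * G x) absolutely_integrable_on {a..b}"
	using absolutely_integrable_mult_continuous[OF ac_onD(1)[OF F] cG] by (simp add: mult.commute)
 have ai2: "(%x. F x * g x) absolutely_integrable_on {a..b}"
	using absolutely_integrable_mult_continuous[OF ac_onD(1)[OF G] cF] by simp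
 have ai: "?h absolutely_integrable_on {a..b}" using ai1 ai2 by (rule set_integral_add)
 show ?thesis unfolding ac_on_def
 proof (intro conjI ballI ai)
	fix x assume x: "x \<in> {a..b}"
	define D where "D = (%t. F t * G t - integral {a..t} ?h)"
	define V where "V = (%t. integral {a..t} (%y. norm (f y) + norm (g y)))"
	have nf: "(%y. norm (f y)) absolutely_integrable_on {a..b}" "(%y. norm (g y)) absolutely_integrable_on {a..b}"
	 using ac_onD(1)[OF F] ac_onD(1)[OF G] by (auto intro: set_integrable_norm)
	have sub: "h integrable_on {s..t}" if "h absolutely_integrable_on {a..b}" "a <= s" "t <= b"
	 for h :: "real => 'b::euclidean_space" and s t
	 using that absolutely_integrable_on_def[of "{a..b}" h]
	 by (auto intro: integrable_subinterval_real[of h a b])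
	have "D x = D a"
	proof (rule increments_negligible_imp_const[where V = V])
	 fix e :: real assume e: "e > 0"
	 have "uniformly_continuous_on {a..b} F" "uniformly_continuous_on {a..b} G"
		using cF cG by (auto intro: compact_uniformly_continuous)
	 then obtain d1 d2 where d: "d1 > 0" "d2 > 0"
		"!!s t. s \<in> {a..b} ==> t \<in> {a..b} ==> dist s t < d1 ==> dist (F s) (F t) < e"
		"!!s t. s \<in> {a..b} ==> t \<in> {a..b} ==> dist s t < d2 ==> dist (G s) (G t) < e"
		unfolding uniformly_continuous_on_def using e by metis
	 show "\<exists>d>0. \<forall>s t. a <= s & s <= t & t <= x & t - s < d -->
		norm (D t - D s) <= e * (V t - V s)"
	 proof (intro exI[of _ "min d1 d2"] conjI allI impI)
		fix s t assume st: "a <= s & s <= t & t <= x & t - s < min d1 d2"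
		then have tb: "t <= b" "a <= s" "s <= t" using x by auto
		have "integral {a..t} ?h = integral {a..s} ?h + integral {s..t} ?h"
		 using hk_combine[of a s t ?h] tb sub[OF ai] by auto
		moreover have "F t * G t - F s * G s = integral {s..t} (%y. f y * G t + F s * g y)"
		proof -
		 have "integral {s..t} (%y. f y * G t + F s * g y)
			 = integral {s..t} (%y. f y * G t) + integral {s..t} (%y. F s * g y)"
			by (intro hk_add integrable_on_mult_left integrable_on_mult_right
				sub[OF ac_onD(1)[OF F]] sub[OF ac_onD(1)[OF G]] tb)
		 also have "... = (F t - F s) * G t + F s * (G t - G s)"
			using ac_on_diff_eq[OF F, of s t] ac_on_diff_eq[OF G, of s t] tb by simp
		 finally show ?thesis by (simp add: algebra_simps)
		qed
		ultimately have "D t - D s = integral {s..t} (%y. f y * G t + F s * g y) - integral {s..t} ?h"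
		 by (simp add: D_def algebra_simps)
		also have "... = integral {s..t} (%y. (f y * G t + F s * g y) - ?h y)"
		 by (intro hk_diff[symmetric] sub[OF ai] integrable_add
			 integrable_on_mult_left integrable_on_mult_right sub[OF ac_onD(1)[OF F]] sub[OF ac_onD(1)[OF G]] tb)
		finally have eq: "D t - D s = integral {s..t} (%y. (f y * G t + F s * g y) - ?h y)" .
		have "norm (integral {s..t} (%y. (f y * G t + F s * g y) - ?h y))
			<= integral {s..t} (%y. e * (norm (f y) + norm (g y)))"
		proof (rule integral_norm_bound_integral)
		 show "(%y. (f y * G t + F s * g y) - ?h y) integrable_on {s..t}"
			by (intro integrable_diff integrable_add sub[OF ai]
			 integrable_on_mult_left integrable_on_mult_right sub[OF ac_onD(1)[OF F]] sub[OF ac_onD(1)[OF G]] tb)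
		 show "(%y. e * (norm (f y) + norm (g y))) integrable_on {s..t}"
			by (intro integrable_on_mult_right integrable_add sub[OF nf(1)] sub[OF nf(2)] tb)
		 fix y assume y: "y \<in> {s..t}"
		 have "(f y * G t + F s * g y) - ?h y = f y * (G t - G y) + (F s - F y) * g y"
			by (simp add: algebra_simps)
		 also have "norm ... <= norm (f y) * norm (G t - G y) + norm (F s - F y) * norm (g y)"
			by (metis norm_mult norm_triangle_ineq)
		 also have "... <= norm (f y) * e + e * norm (g y)"
		 proof (intro add_mono mult_left_mono mult_right_mono)
			show "norm (G t - G y) <= e" "norm (F s - F y) <= e"
			 using d(3)[of s y] d(4)[of t y] y st tb by (auto simp: dist_norm)
		 qed auto
		 finally show "norm ((f y * G t + F s * g y) - ?h y) <= e * (norm (f y) + norm (g y))"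
			by (simp add: algebra_simps)
		qed
		also have "... = e * (V t - V s)"
		 using hk_combine[of a s t "%y. norm (f y) + norm (g y)"] tb
		  sub[OF set_integral_add(1)[OF nf]] by (auto simp: V_def)
		finally show "norm (D t - D s) <= e * (V t - V s)" using eq by simp
	 qed (use d in auto)
	qed (use x in auto)
	then show "F x * G x = F a * G a + integral {a..x} ?h" by (simp add: D_def algebra_simps)
 qed
qed (auto simp: ac_on_def set_integrable_def)

lemma ac_on_cmult:
 fixes F :: "real => 'a::{euclidean_space,real_normed_field}"
 assumes "ac_on a b F f"
 shows "ac_on a b (%x. c * F x) (%x. c * f x)"
proof (cases "a <= b")
 case True
 from ac_on_mult[OF ac_on_const[OF True, of c] assms] show ?thesis by simp
qed (auto simp: ac_on_def set_integrable_def)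

lemma ac_on_indefinite:
 "f absolutely_integrable_on {a..b} ==> ac_on a b (%x. integral {a..x} f) f"
 by (simp add: ac_on_def)

lemma integral_pow_indefinite:
 fixes w :: "real => real"
 assumes "w absolutely_integrable_on {a..b}"
 defines "V \<equiv> %x. integral {a..x} w"
 shows "ac_on a b (%x. V x ^ Suc n / fact (Suc n)) (%x. w x * (V x ^ n / fact n))"
proof (induction n)
 case 0
 show ?case using ac_on_indefinite[OF assms(1)] by (simp add: V_def)
next
 case (Suc n)
 have "ac_on a b V w" using ac_on_indefinite[OF assms(1)] by (simp add: V_def)
 from ac_on_cmult[OF ac_on_mult[OF this Suc], of "1 / (real n + 2)"]
 show ?case
 proof (rule ac_on_cong)
	fix x assume "x \<in> {a..b}"
	show "1 / (real n + 2) * (V x * (V x ^ Suc n / fact (Suc n))) = V x ^ Suc (Suc n) / fact (Suc (Suc n))"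
	 by (simp add: field_simps)
	show "1 / (real n + 2) * (w x * (V x ^ Suc n / fact (Suc n)) + V x * (w x * (V x ^ n / fact n)))
	  = w x * (V x ^ Suc n / fact (Suc n))"
	 by (simp add: divide_simps) (simp add: algebra_simps)
 qed
qed

lemma gronwall:
 fixes u w :: "real => real"
 assumes w: "w absolutely_integrable_on {a..b}" "!!x. x \<in> {a..b} ==> 0 <= w x"
	and u: "continuous_on {a..b} u"
	and le: "!!x. x \<in> {a..b} ==> u x <= A + integral {a..x} (%y. w y * u y)"
	and A: "0 <= A" and x: "x \<in> {a..b}"
 shows "u x <= A * exp (integral {a..x} w)"
proof -
 define V where "V = (%x. integral {a..x} w)"
 have ab: "a <= b" using x by auto
 obtain M where M: "!!x. x \<in> {a..b} ==> \<bar>u x\<bar> <= M"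
	using compact_imp_bounded[OF compact_continuous_image[OF u]] unfolding bounded_iff by force
 have M0: "0 <= M" using M[of a] ab by auto
 have wu: "(%y. w y * u y) absolutely_integrable_on {a..b}"
	using absolutely_integrable_mult_continuous[OF w(1) u] by (simp add: mult.commute)
 have iw: "w integrable_on {a..b}" using w(1) absolutely_integrable_on_def by blast
 have V0: "0 <= V x" if "x \<in> {a..b}" for x
	unfolding V_def using that w(2)
	by (intro hk_nonneg integrable_subinterval_real[OF iw]) auto
 have step: "u x <= A * (\<Sum>k<n. V x ^ k / fact k) + M * (V x ^ n / fact n)" if "x \<in> {a..b}" for x n
	using that
 proof (induction n arbitrary: x)
	case 0
	then show ?case using M[of x] by simp
 next
	case (Suc n)
	let ?B = "%y. A * (\<Sum>k<n. w y * (V y ^ k / fact k)) + M * (w y * (V y ^ n / fact n))"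
	have ac: "ac_on a b (%x. V x ^ Suc k / fact (Suc k)) (%x. w x * (V x ^ k / fact k))" for k
	 using integral_pow_indefinite[OF w(1)] by (simp add: V_def)
	have hi: "((%y. w y * (V y ^ k / fact k)) has_integral (V x ^ Suc k / fact (Suc k))) {a..x}" for k
	proof -
	 have "(%y. w y * (V y ^ k / fact k)) integrable_on {a..x}"
		by (rule integrable_subinterval_real[OF ac_onD(2)[OF ac]]) (use Suc(2) in auto)
	 moreover have "integral {a..x} (%y. w y * (V y ^ k / fact k)) = V x ^ Suc k / fact (Suc k)"
		using ac_onD(3)[OF ac Suc(2)] by (simp add: V_def)
	 ultimately show ?thesis by (simp add: has_integral_iff)
	qed
	have B: "(?B has_integral (A * (\<Sum>k<n. V x ^ Suc k / fact (Suc k)) + M * (V x ^ Suc n / fact (Suc n)))) {a..x}"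
	 by (intro has_integral_add has_integral_mult_right has_integral_sum hi) auto
	have "u x <= A + integral {a..x} (%y. w y * u y)" using le Suc by auto
	also have "integral {a..x} (%y. w y * u y) <= integral {a..x} ?B"
	proof (rule integral_le)
	 show "(%y. w y * u y) integrable_on {a..x}"
		by (rule integrable_subinterval_real[OF set_lebesgue_integral_eq_integral(1)[OF wu]])
		  (use Suc(2) in auto)
	 show "?B integrable_on {a..x}" using B by blast
	 fix y assume y: "y \<in> {a..x}"
	 then have "w y * u y <= w y * (A * (\<Sum>k<n. V y ^ k / fact k) + M * (V y ^ n / fact n))"
		using Suc w(2)[of y] by (intro mult_left_mono) auto
	 then show "w y * u y <= ?B y" by (simp add: algebra_simps sum_distrib_left)
	qed
	also have "integral {a..x} ?B = (A * (\<Sum>k<n. V x ^ Suc k / fact (Suc k)) + M * (V x ^ Suc n / fact (Suc n)))"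
	 using B by blast
	also have "A + ... = A * (\<Sum>k<Suc n. V x ^ k / fact k) + M * (V x ^ Suc n / fact (Suc n))"
	 unfolding sum.lessThan_Suc_shift by (simp add: algebra_simps)
	finally show ?case by simp
 qed
 have s: "(%k. V x ^ k / fact k) sums exp (V x)"
	using exp_converges[of "V x"] by (simp add: divide_inverse mult.commute)
 have "(%n. A * (\<Sum>k<n. V x ^ k / fact k) + M * (V x ^ n / fact n)) \<longlonglongrightarrow> A * exp (V x) + M * 0"
	using s[unfolded sums_def] summable_LIMSEQ_zero[OF sums_summable[OF s]]
	by (intro tendsto_intros)
 then have "u x <= A * exp (V x) + M * 0"
	by (rule Lim_bounded2) (use step[OF x] in auto)
 then show ?thesis by (simp add: V_def)
qed

section \<open>The regular solution\<close>

lemma L1D: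
 fixes f :: "real => 'a::euclidean_space"
 assumes "f absolutely_integrable_on {a..b}" "a <= s" "t <= b"
 shows "f integrable_on {s..t}" "(%x. norm (f x)) integrable_on {s..t}"
	"f absolutely_integrable_on {s..t}" "(%x. norm (f x)) absolutely_integrable_on {s..t}"
proof -
 show *: "f absolutely_integrable_on {s..t}"
	by (rule absolutely_integrable_on_subinterval[OF assms(1)]) (use assms in auto)
 then show "(%x. norm (f x)) absolutely_integrable_on {s..t}" by (rule set_integrable_norm)
 show "f integrable_on {s..t}" "(%x. norm (f x)) integrable_on {s..t}"
	using * absolutely_integrable_on_def by blast+
qed

definition reg_flux :: "nat => (real => complex) => (real => complex) => real => complex"
 where "reg_flux l r v x = integral {0..x} (%y. of_real (y ^ (2*l+2)) * r y * v y)"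

definition reg_op :: "nat => (real => complex) => (real => complex) => real => complex"
 where "reg_op l r v x = integral {0..x} (%s. reg_flux l r v s / of_real (s ^ (2*l+2)))"

lemma reg_integrand:
 fixes r v :: "real => complex"
 assumes "unit_L1 r" "continuous_on {0..1} v"
 shows "(%y. of_real (y ^ (2*l+2)) * r y * v y) absolutely_integrable_on {0..1}"
proof -
 have "continuous_on {0..1} (%y. of_real (y ^ (2*l+2)) * v y)"
	using assms(2) by (intro continuous_intros)
 from absolutely_integrable_mult_continuous[OF assms(1) this]
 show ?thesis by (simp add: mult_ac)
qed

lemma ac_reg_flux:
 assumes "unit_L1 r" "continuous_on {0..1} v"
 shows "ac_on 0 1 (reg_flux l r v) (%y. of_real (y ^ (2*l+2)) * r y * v y)"
 using ac_on_indefinite[OF reg_integrand[OF assms, of l]]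
 unfolding reg_flux_def[abs_def] .

lemma norm_mult_integrable:
 fixes r v :: "real => complex"
 assumes "unit_L1 r" "continuous_on {0..1} v"
 shows "(%y. norm (r y) * norm (v y)) absolutely_integrable_on {0..1}"
 using absolutely_integrable_mult_continuous[OF L1D(4)[OF assms(1), of 0 1], of "%x. norm (v x)"] assms(2)
 by (simp add: mult.commute continuous_on_norm)

lemma norm_reg_flux_le:
 assumes r: "unit_L1 r" and v: "continuous_on {0..1} v" and x: "x \<in> {0..1}"
 shows "norm (reg_flux l r v x) <= x ^ (2*l+2) * integral {0..x} (%y. norm (r y) * norm (v y))"
proof -
 have "norm (reg_flux l r v x) <= integral {0..x} (%y. x ^ (2*l+2) * (norm (r y) * norm (v y)))"
	unfolding reg_flux_def
 proof (rule integral_norm_bound_integral)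
	show "(%y. of_real (y ^ (2*l+2)) * r y * v y) integrable_on {0..x}"
	 using L1D(1)[OF reg_integrand[OF r v]] x by auto
	show "(%y. x ^ (2*l+2) * (norm (r y) * norm (v y))) integrable_on {0..x}"
	 using L1D(1)[OF norm_mult_integrable[OF r v]] x by (intro integrable_on_mult_right) auto
	fix y assume y: "y \<in> {0..x}"
	have "norm (of_real (y ^ (2*l+2)) * r y * v y) = y ^ (2*l+2) * (norm (r y) * norm (v y))"
	 using y by (simp add: norm_mult norm_power del: of_real_power)
	also have "... <= x ^ (2*l+2) * (norm (r y) * norm (v y))"
	 using y by (intro mult_right_mono power_mono) auto
	finally show "norm (of_real (y ^ (2*l+2)) * r y * v y) <= x ^ (2*l+2) * (norm (r y) * norm (v y))" .
 qed
 then show ?thesis by simp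
qed

lemma norm_reg_density_le:
 assumes r: "unit_L1 r" and v: "continuous_on {0..1} v" and x: "x \<in> {0..1}"
 shows "norm (reg_flux l r v x / of_real (x ^ (2*l+2))) <= integral {0..x} (%y. norm (r y) * norm (v y))"
proof (cases "x = 0")
 case False
 then have "x ^ (2*l+2) > 0" using x by auto
 then show ?thesis using norm_reg_flux_le[OF assms, of l]
	by (simp add: norm_divide field_simps del: of_real_power power_Suc)
qed auto

lemma continuous_reg_density:
 assumes r: "unit_L1 r" and v: "continuous_on {0..1} v"
 shows "continuous_on {0..1} (%s. reg_flux l r v s / of_real (s ^ (2*l+2)))"
 unfolding continuous_on_eq_continuous_within
proof
 fix x :: real assume x: "x \<in> {0..1}"
 show "continuous (at x within {0..1}) (%s. reg_flux l r v s / of_real (s ^ (2*l+2)))"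
 proof (cases "x = 0")
	case False
	have "continuous (at x within {0..1}) (reg_flux l r v)"
	 using ac_on_continuous[OF ac_reg_flux[OF r v]] x continuous_on_eq_continuous_within by blast
	then show ?thesis using False by (intro continuous_intros) auto
 next
	case True
	let ?g = "%x. integral {0..x} (%y. norm (r y) * norm (v y))"
	have "continuous_on {0..1} ?g"
	 using L1D(1)[OF norm_mult_integrable[OF r v]]
	 by (intro indefinite_integral_continuous_1) auto
	then have "(?g \<longlongrightarrow> ?g 0) (at 0 within {0..1})"
	 unfolding continuous_on_def by (rule bspec) simp
	then have g0: "(?g \<longlongrightarrow> 0) (at 0 within {0..1})" by simp
	have "((%s. reg_flux l r v s / of_real (s ^ (2*l+2))) \<longlongrightarrow> 0) (at 0 within {0..1})"
	proof (rule Lim_null_comparison[OF _ g0])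
	 show "\<forall>\<^sub>F s in at 0 within {0..1}. norm (reg_flux l r v s / of_real (s ^ (2*l+2))) <= ?g s"
		using norm_reg_density_le[OF r v] by (auto simp: eventually_at_filter)
	qed
	then show ?thesis using True by (simp add: continuous_within)
 qed
qed

lemma reg_op_has_vector_derivative:
 assumes "unit_L1 r" "continuous_on {0..1} v" "x \<in> {0..1}"
 shows "(reg_op l r v has_vector_derivative reg_flux l r v x / of_real (x ^ (2*l+2))) (at x within {0..1})"
 unfolding reg_op_def[abs_def]
 by (rule integral_has_vector_derivative[OF continuous_reg_density[OF assms(1,2)] assms(3)])

lemma continuous_reg_op:
 assumes "unit_L1 r" "continuous_on {0..1} v"
 shows "continuous_on {0..1} (reg_op l r v)"
 using reg_op_has_vector_derivative[OF assms] has_vector_derivative_continuous continuous_on_eq_continuous_within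
 by blast

text \<open>The factor \<open>x\<close> gained here makes \<open>\<lambda>\<close> a small perturbation on \<open>[0, |\<lambda>|\<^sup>-\<^sup>1\<^sup>/\<^sup>2]\<close>.\<close>
lemma norm_reg_op_le:
 assumes r: "unit_L1 r" and v: "continuous_on {0..1} v" and x: "x \<in> {0..1}"
 shows "norm (reg_op l r v x) <= x * integral {0..x} (%y. norm (r y) * norm (v y))"
proof -
 let ?c = "integral {0..x} (%y. norm (r y) * norm (v y))"
 have "norm (integral {0..x} (%s. reg_flux l r v s / of_real (s ^ (2*l+2)))) <= integral {0..x} (%s. ?c)"
 proof (rule integral_norm_bound_integral)
	show "(%s. reg_flux l r v s / of_real (s ^ (2*l+2))) integrable_on {0..x}"
	 by (rule integrable_continuous_interval[OF continuous_on_subset[OF continuous_reg_density[OF r v]]])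
		 (use x in auto)
	fix s assume s: "s \<in> {0..x}"
	have "norm (reg_flux l r v s / of_real (s ^ (2*l+2))) <= integral {0..s} (%y. norm (r y) * norm (v y))"
	 using norm_reg_density_le[OF r v] s x by auto
	also have "... <= ?c"
	 by (rule integral_subset_le)
		 (use s x L1D(1)[OF norm_mult_integrable[OF r v]] in auto)
	finally show "norm (reg_flux l r v s / of_real (s ^ (2*l+2))) <= ?c" .
 qed auto
 then show ?thesis using x by (simp add: reg_op_def)
qed

lemma norm_reg_op_le':
 assumes r: "unit_L1 r" and v: "continuous_on {0..1} v" and x: "x \<in> {0..1}"
 shows "norm (reg_op l r v x) <= integral {0..x} (%y. norm (r y) * norm (v y))"
proof -
 have "0 <= integral {0..x} (%y. norm (r y) * norm (v y))"
	by (intro hk_nonneg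
		 L1D(1)[OF norm_mult_integrable[OF r v]]) (use x in auto)
 with norm_reg_op_le[OF assms, of l] show ?thesis
	using mult_right_mono[of x 1 "integral {0..x} (%y. norm (r y) * norm (v y))"] x by auto
qed

lemma reg_flux_diff:
 assumes r: "unit_L1 r" and v: "continuous_on {0..1} v" "continuous_on {0..1} w"
	and x: "x \<in> {0..1}"
 shows "reg_flux l r (%y. c * v y + d * w y) x = c * reg_flux l r v x + d * reg_flux l r w x"
proof -
 have "reg_flux l r (%y. c * v y + d * w y) x =
	integral {0..x} (%y. c * (of_real (y ^ (2*l+2)) * r y * v y) + d * (of_real (y ^ (2*l+2)) * r y * w y))"
	unfolding reg_flux_def by (simp add: algebra_simps)
 also have "... = c * reg_flux l r v x + d * reg_flux l r w x"
	unfolding reg_flux_def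
	using L1D(1)[OF reg_integrand[OF r v(1)], of 0 x]
	 L1D(1)[OF reg_integrand[OF r v(2)], of 0 x] x
	by (subst hk_add) (auto intro!: integrable_on_mult_right)
 finally show ?thesis .
qed

lemma reg_op_lincomb:
 assumes r: "unit_L1 r" and v: "continuous_on {0..1} v" "continuous_on {0..1} w"
	and x: "x \<in> {0..1}"
 shows "reg_op l r (%y. c * v y + d * w y) x = c * reg_op l r v x + d * reg_op l r w x"
proof -
 let ?f = "%v s. reg_flux l r v s / of_real (s ^ (2*l+2))"
 have i: "?f v integrable_on {0..x}" if "continuous_on {0..1} v" for v
	by (rule integrable_continuous_interval[OF continuous_on_subset[OF continuous_reg_density[OF r that]]])
	  (use x in auto)
 have "reg_op l r (%y. c * v y + d * w y) x = integral {0..x} (%s. c * ?f v s + d * ?f w s)"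
	unfolding reg_op_def
	by (rule hk_cong)
	  (use x reg_flux_diff[OF r v] in \<open>auto simp: add_divide_distrib simp del: of_real_power power_Suc\<close>)
 also have "... = c * reg_op l r v x + d * reg_op l r w x"
	unfolding reg_op_def
	by (subst hk_add[OF integrable_on_mult_right[OF i[OF v(1)]]
		 integrable_on_mult_right[OF i[OF v(2)]]]) (simp only: integral_mult_right)
 finally show ?thesis .
qed

primrec picard :: "nat => (real => complex) => nat => real => complex" where
 "picard l r 0 = (%x. 1)"
| "picard l r (Suc n) = reg_op l r (picard l r n)"

lemma continuous_picard:
 "unit_L1 r ==> continuous_on {0..1} (picard l r n)"
 by (induction n) (auto intro: continuous_reg_op)

lemma norm_picard_le:
 assumes r: "unit_L1 r" and x: "x \<in> {0..1}"
 shows "norm (picard l r n x) <= integral {0..x} (%y. norm (r y)) ^ n / fact n"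
 using x
proof (induction n arbitrary: x)
 case (Suc n)
 let ?w = "%y. norm (r y)"
 have w: "unit_L1 ?w" using L1D(4)[OF r, of 0 1] by auto
 let ?V = "%x. integral {0..x} ?w"
 have ac: "ac_on 0 1 (%x. ?V x ^ Suc n / fact (Suc n)) (%x. ?w x * (?V x ^ n / fact n))"
	by (rule integral_pow_indefinite[OF w])
 have "norm (picard l r (Suc n) x) <= integral {0..x} (%y. norm (r y) * norm (picard l r n y))"
	using norm_reg_op_le'[OF r continuous_picard[OF r] Suc.prems] by simp
 also have "... <= integral {0..x} (%x. ?w x * (?V x ^ n / fact n))"
 proof (rule integral_le)
	show "(%y. norm (r y) * norm (picard l r n y)) integrable_on {0..x}"
	 using L1D(1)[OF norm_mult_integrable[OF r continuous_picard[OF r]]] Suc.prems by auto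
	show "(%x. ?w x * (?V x ^ n / fact n)) integrable_on {0..x}"
	 by (rule integrable_subinterval_real[OF ac_onD(2)[OF ac]]) (use Suc.prems in auto)
	fix y assume "y \<in> {0..x}"
	then show "norm (r y) * norm (picard l r n y) <= norm (r y) * (?V y ^ n / fact n)"
	 using Suc by (intro mult_left_mono) auto
 qed
 also have "... = ?V x ^ Suc n / fact (Suc n)"
	using ac_onD(3)[OF ac Suc.prems] by simp
 finally show ?case .
qed auto

definition reg_sol :: "nat => (real => complex) => real => complex"
 where "reg_sol l r x = (\<Sum>n. picard l r n x)"

lemma picard_uniform_bound:
 assumes r: "unit_L1 r" and x: "x \<in> {0..1}"
	and M: "integral {0..1} (%y. norm (r y)) <= M"
 shows "norm (picard l r n x) <= M ^ n / fact n"
proof -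
 have "integral {0..x} (%y. norm (r y)) <= integral {0..1} (%y. norm (r y))"
	by (rule integral_subset_le) (use x L1D(2)[OF r] in auto)
 then have "integral {0..x} (%y. norm (r y)) <= M" using M by simp
 moreover have "0 <= integral {0..x} (%y. norm (r y))"
	by (intro hk_nonneg L1D(2)[OF r]) (use x in auto)
 ultimately have "integral {0..x} (%y. norm (r y)) ^ n / fact n <= M ^ n / fact n"
	by (intro divide_right_mono power_mono) auto
 then show ?thesis using norm_picard_le[OF r x, of l n] by linarith
qed

lemma summable_exp_real: "summable (%n. (M::real) ^ n / fact n)"
 using summable_exp[of M] by (simp add: divide_inverse mult.commute)

lemma reg_sol_uniform_limit:
 assumes r: "unit_L1 r"
 shows "uniform_limit {0..1} (%N x. \<Sum>n<N. picard l r n x) (reg_sol l r) sequentially"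
 unfolding reg_sol_def[abs_def]
 by (rule Weierstrass_m_test[OF picard_uniform_bound[OF r _ order_refl] summable_exp_real])

lemma continuous_reg_sol:
 assumes r: "unit_L1 r"
 shows "continuous_on {0..1} (reg_sol l r)"
 by (rule uniform_limit_theorem[OF _ reg_sol_uniform_limit[OF r]])
	 (intro always_eventually allI continuous_on_sum continuous_picard[OF r], auto)

lemma reg_sol_eq:
 assumes r: "unit_L1 r" and x: "x \<in> {0..1}"
 shows "reg_sol l r x = 1 + reg_op l r (reg_sol l r) x"
proof -
 let ?S = "%N x. \<Sum>n<N. picard l r n x"
 let ?V = "integral {0..1} (%y. norm (r y))"
 have cS: "continuous_on {0..1} (?S N)" for N by (auto intro!: continuous_on_sum continuous_picard[OF r])
 have opS: "1 + reg_op l r (?S N) x = ?S (Suc N) x" for N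
 proof (induction N)
	case 0
	show ?case by (simp add: reg_op_def reg_flux_def)
 next
	case (Suc N)
	have "reg_op l r (?S (Suc N)) x = reg_op l r (%y. 1 * ?S N y + 1 * picard l r N y) x" by simp
	also have "... = reg_op l r (?S N) x + picard l r (Suc N) x"
	 using reg_op_lincomb[OF r cS continuous_picard[OF r] x, of l 1 N 1 l N] by simp
	finally show ?case using Suc by (simp add: algebra_simps)
 qed
 have "(%N. reg_op l r (?S N) x) \<longlonglongrightarrow> reg_op l r (reg_sol l r) x"
 proof (rule metric_LIMSEQ_I)
	fix e :: real assume e: "e > 0"
	have V0: "0 <= ?V" by (intro hk_nonneg L1D(2)[OF r]) auto
	define e' where "e' = e / (?V + 1)"
	have e': "e' > 0" using e V0 by (simp add: e'_def)
	from uniform_limitD[OF reg_sol_uniform_limit[OF r] e', of l]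
	obtain N0 where N0: "!!N y. N \<ge> N0 ==> y \<in> {0..1} ==> dist (?S N y) (reg_sol l r y) < e'"
	 unfolding eventually_sequentially by blast
	have "dist (reg_op l r (?S N) x) (reg_op l r (reg_sol l r) x) < e" if "N \<ge> N0" for N
	proof -
	 let ?d = "%y. 1 * ?S N y + (-1) * reg_sol l r y"
	 have cd: "continuous_on {0..1} ?d" by (intro continuous_intros cS continuous_reg_sol[OF r])
	 have "reg_op l r (?S N) x - reg_op l r (reg_sol l r) x = reg_op l r ?d x"
		using reg_op_lincomb[OF r cS continuous_reg_sol[OF r] x, of l 1 N "-1" l] by simp
	 also have "norm ... <= integral {0..x} (%y. norm (r y) * norm (?d y))"
		by (rule norm_reg_op_le'[OF r cd x])
	 also have "... <= integral {0..x} (%y. norm (r y) * e')"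
	 proof (rule integral_le)
		show "(%y. norm (r y) * norm (?d y)) integrable_on {0..x}"
		 using L1D(1)[OF norm_mult_integrable[OF r cd]] x by auto
		show "(%y. norm (r y) * e') integrable_on {0..x}"
		 using x by (intro integrable_on_mult_left L1D(2)[OF r]) auto
		fix y assume "y \<in> {0..x}"
		then show "norm (r y) * norm (?d y) <= norm (r y) * e'"
		 using N0[OF that, of y] x by (intro mult_left_mono) (auto simp: dist_norm)
	 qed
	 also have "... = integral {0..x} (%y. norm (r y)) * e'" by simp
	 also have "... <= ?V * e'"
		using e' by (intro mult_right_mono integral_subset_le) (use x L1D(2)[OF r] in auto)
	 also have "... < e"
		using V0 e by (simp add: e'_def field_simps)
	 finally show ?thesis by (simp add: dist_norm)
	qed
	then show "\<exists>N0. \<forall>N\<ge>N0. dist (reg_op l r (?S N) x) (reg_op l r (reg_sol l r) x) < e" by blast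
 qed
 then have "(%N. 1 + reg_op l r (?S N) x) \<longlonglongrightarrow> 1 + reg_op l r (reg_sol l r) x" by (intro tendsto_intros)
 then have "(%N. ?S (Suc N) x) \<longlonglongrightarrow> 1 + reg_op l r (reg_sol l r) x" by (simp only: opS)
 moreover have "(%N. ?S (Suc N) x) \<longlonglongrightarrow> reg_sol l r x"
	using tendsto_uniform_limitI[OF reg_sol_uniform_limit[OF r] x] by (intro LIMSEQ_Suc) auto
 ultimately show ?thesis using LIMSEQ_unique by blast
qed

lemma norm_reg_sol_le:
 assumes r: "unit_L1 r" and x: "x \<in> {0..1}"
	and M: "integral {0..1} (%y. norm (r y)) <= M"
 shows "norm (reg_sol l r x) <= exp M"
proof -
 have s: "(%n. M ^ n / fact n) sums exp M"
	using exp_converges[of M] by (simp add: divide_inverse mult.commute)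
 show ?thesis unfolding reg_sol_def sums_unique[OF s]
	by (rule norm_suminf_le[OF picard_uniform_bound[OF r x M] sums_summable[OF s]])
qed

lemma reg_sol_0: "unit_L1 r ==> reg_sol l r 0 = 1"
 using reg_sol_eq[of r 0 l] by (simp add: reg_op_def)

lemma reg_sol_unique:
 assumes r: "unit_L1 r" and v: "continuous_on {0..1} v"
	and eq: "!!x. x \<in> {0..1} ==> v x = c + reg_op l r v x" and x: "x \<in> {0..1}"
 shows "v x = c * reg_sol l r x"
proof -
 let ?d = "%y. 1 * v y + (-c) * reg_sol l r y"
 have cd: "continuous_on {0..1} ?d" by (intro continuous_intros v continuous_reg_sol[OF r])
 have d: "?d y = reg_op l r ?d y" if "y \<in> {0..1}" for y
	using reg_op_lincomb[OF r v continuous_reg_sol[OF r] that, of l 1 "-c" l] eq[OF that] reg_sol_eq[OF r that, of l]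
	by (simp add: algebra_simps)
 have "norm (?d x) <= 0 * exp (integral {0..x} (%y. norm (r y)))"
 proof (rule gronwall[where a = 0 and b = 1])
	show "(%y. norm (r y)) absolutely_integrable_on {0..1}" using L1D(4)[OF r, of 0 1] by auto
	show "continuous_on {0..1} (%x. norm (?d x))" using cd by (intro continuous_on_norm)
	fix y :: real assume y: "y \<in> {0..1}"
	show "norm (?d y) <= 0 + integral {0..y} (%y. norm (r y) * norm (?d y))"
	 using norm_reg_op_le'[OF r cd y, of l] d[OF y] by (metis add_0)
 qed (use x in auto)
 then show ?thesis by simp
qed

lemma reg_sol_has_vector_derivative:
 assumes r: "unit_L1 r" and x: "x \<in> {0..1}"
 shows "(reg_sol l r has_vector_derivative reg_flux l r (reg_sol l r) x / of_real (x ^ (2*l+2))) (at x within {0..1})"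
proof -
 have "((%x. 1 + reg_op l r (reg_sol l r) x) has_vector_derivative 0 + reg_flux l r (reg_sol l r) x / of_real (x ^ (2*l+2))) (at x within {0..1})"
	by (intro has_vector_derivative_add has_vector_derivative_const
	  reg_op_has_vector_derivative[OF r continuous_reg_sol[OF r] x])
 then have *: "((%x. 1 + reg_op l r (reg_sol l r) x) has_vector_derivative reg_flux l r (reg_sol l r) x / of_real (x ^ (2*l+2))) (at x within {0..1})"
	by simp
 show ?thesis
	by (rule has_vector_derivative_transform[OF x _ *]) (use reg_sol_eq[OF r] in simp)
qed

text \<open>Criterion by which the explicit free solutions are recognised.\<close>
lemma reg_sol_eqI:
 assumes r: "unit_L1 r" and v: "continuous_on {0..1} v"
	and m: "!!x. x \<in> {0<..<1} ==> (v has_vector_derivative reg_flux l r v x / of_real (x ^ (2*l+2))) (at x)"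
	and x: "x \<in> {0..1}"
 shows "v x = v 0 * reg_sol l r x"
proof (rule reg_sol_unique[OF r v _ x])
 fix x :: real assume x: "x \<in> {0..1}"
 have "ac_on 0 1 v (%s. reg_flux l r v s / of_real (s ^ (2*l+2)))"
	by (rule ac_onI_interior[OF _ v absolutely_integrable_continuous_real[OF continuous_reg_density[OF r v]] m]) auto
 from ac_onD(3)[OF this x] show "v x = v 0 + reg_op l r v x" by (simp add: reg_op_def)
qed

section \<open>Eigenfunctions are multiples of the regular solution\<close>

definition sl_coeff :: "(real => real) => complex => real => complex"
 where "sl_coeff q lam y = of_real (q y) - lam"

lemma sl_coeff_integrable:
 assumes "unit_L1 q"
 shows "sl_coeff q lam absolutely_integrable_on {0..1}"
proof -
 have "(%x. cplx (q x)) absolutely_integrable_on {0..1}"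
	using absolutely_integrable_linear[OF assms, of cplx] bounded_linear_of_real
	by (simp add: o_def)
 then have "(%x. cplx (q x) - lam) absolutely_integrable_on {0..1}"
	by (intro set_integral_diff absolutely_integrable_on_const) auto
 then show ?thesis by (simp add: sl_coeff_def[abs_def])
qed

lemma ac_on_power:
 assumes "a <= b" shows "ac_on a b (%x. cplx (x ^ n)) (%x. of_real (real n * x ^ (n - 1)))"
proof (rule ac_onI_C1[OF assms])
 fix x assume "x \<in> {a..b}"
 show "((%x. cplx (x ^ n)) has_vector_derivative of_real (real n * x ^ (n - 1))) (at x within {a..b})"
	by (intro has_vector_derivative_of_real has_real_derivative_iff_has_vector_derivative[THEN iffD1])
	  (auto intro!: derivative_eq_intros)
qed (intro continuous_intros)

lemma ac_on_inverse_power: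
 assumes "0 < a" "a <= b"
 shows "ac_on a b (%x. cplx (inverse (x ^ n))) (%x. of_real (- real n * inverse (x ^ (n + 1))))"
proof (rule ac_onI_C1[OF assms(2)])
 fix x assume x: "x \<in> {a..b}"
 have "((%x. inverse (x ^ n)) has_real_derivative - real n * inverse (x ^ (n + 1))) (at x within {a..b})"
 proof (cases n)
	case (Suc k)
	have "((%x. inverse (x ^ Suc k)) has_real_derivative - (inverse (x ^ Suc k) * (real (Suc k) * x ^ k) * inverse (x ^ Suc k))) (at x within {a..b})"
	 using x assms DERIV_subset[OF DERIV_pow[of "Suc k" x]] by (intro DERIV_inverse') auto
	moreover have "- (inverse (x ^ Suc k) * (real (Suc k) * x ^ k) * inverse (x ^ Suc k)) = - real n * inverse (x ^ (n + 1))"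
	 using x assms Suc by (simp add: field_simps)
	ultimately show ?thesis using Suc by simp
 qed auto
 then show "((%x. cplx (inverse (x ^ n))) has_vector_derivative
	 of_real (- real n * inverse (x ^ (n + 1)))) (at x within {a..b})"
	by (intro has_vector_derivative_of_real) (simp add: has_real_derivative_iff_has_vector_derivative)
qed (use assms in \<open>auto intro!: continuous_intros\<close>)

lemma ac_on_zero_const:
 assumes "ac_on a b F f" "!!x. x \<in> {a..b} ==> f x = 0" "x \<in> {a..b}" "y \<in> {a..b}"
 shows "F x = F y"
proof -
 have "integral {a..z} f = 0" if "z \<in> {a..b}" for z
	by (rule integral_unique, rule has_integral_is_0) (use assms(2) that in auto)
 then show ?thesis using ac_onD(3)[OF assms(1,3)] ac_onD(3)[OF assms(1,4)] assms(3,4) by simp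
qed

lemma sl_solution_ac:
 assumes "sl_solution l q lam f f'" "0 < a"
 shows "ac_on a 1 f f'"
	and "ac_on a 1 f' (%x. of_real (l * (l + 1) / x\<^sup>2) * f x + sl_coeff q lam x * f x)"
proof -
 from assms(1) obtain f'' where f:
	 "!!x. x \<in> {0<..1} ==> (f has_vector_derivative f' x) (at x within {0<..1})"
	and f'': "!!x. x \<in> {0<..1} ==> set_integrable lebesgue {x..1} f''"
	 "!!x. x \<in> {0<..1} ==> f' 1 - f' x = (LINT t:{x..1}|lebesgue. f'' t)"
	and ae: "AE x in lebesgue. x \<in> {0<..<1} -->
			 - f'' x + of_real (l * (l + 1) / x\<^sup>2) * f x + of_real (q x) * f x = lam * f x"
	unfolding sl_solution_def by blast
 have ac': "ac_on a 1 f' f''" if "a <= 1"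
	unfolding ac_on_def
 proof (intro conjI ballI)
	show ai: "f'' absolutely_integrable_on {a..1}" using f''(1) that assms(2) by auto
	fix x assume x: "x \<in> {a..1}"
	have "integral {a..x} f'' + integral {x..1} f'' = integral {a..1} f''"
	 using x L1D(1)[OF ai order_refl order_refl]
	 by (intro hk_combine) auto
	moreover have *: "f' 1 - f' y = integral {y..1} f''" if "y \<in> {a..1}" for y
	 using f''(2)[of y] set_lebesgue_integral_eq_integral(2)[OF f''(1)[of y]] that assms(2) by auto
	have "f' 1 - f' x = integral {x..1} f''" "f' 1 - f' a = integral {a..1} f''"
	 using *[of x] *[of a] x by auto
	ultimately show "f' x = f' a + integral {a..x} f''"
	 by (metis (no_types, opaque_lifting) add_diff_cancel_right' diff_add_cancel diff_diff_eq2 add.commute)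
 qed
 show "ac_on a 1 f f'"
 proof (cases "a <= 1")
	case True
	show ?thesis
	proof (rule ac_onI_C1[OF True ac_on_continuous[OF ac'[OF True]]])
	 fix x assume "x \<in> {a..1}"
	 then show "(f has_vector_derivative f' x) (at x within {a..1})"
		using assms(2) by (intro has_vector_derivative_within_subset[OF f]) auto
	qed
 qed (auto simp: ac_on_def set_integrable_def)
 show "ac_on a 1 f' (%x. of_real (l * (l + 1) / x\<^sup>2) * f x + sl_coeff q lam x * f x)"
 proof (cases "a <= 1")
	case True
	from ae obtain N where N: "negligible N"
	 "!!x. x \<in> {0<..<1} - N ==> - f'' x + of_real (l * (l + 1) / x\<^sup>2) * f x + of_real (q x) * f x = lam * f x"
	 unfolding eventually_ae_filter_negligible by blast
	show ?thesis
	proof (rule ac_on_AE[OF ac'[OF True]])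
	 show "negligible (N \<union> {1})" using N(1) by auto
	 fix x assume "x \<in> {a..1} - (N \<union> {1})"
	 then have "x \<in> {0<..<1} - N" using assms(2) by auto
	 from N(2)[OF this] show "f'' x = of_real (l * (l + 1) / x\<^sup>2) * f x + sl_coeff q lam x * f x"
		by (simp add: sl_coeff_def algebra_simps)
	qed
 qed (auto simp: ac_on_def set_integrable_def)
qed

lemma sl_solution_regular:
 assumes sol: "sl_solution (real l) q lam f f'"
	and lim: "((%x. f x / of_real (x powr (real l + 1))) \<longlongrightarrow> L) (at_right 0)"
	and q: "unit_L1 q"
 defines "r \<equiv> sl_coeff q lam"
 assumes x: "x \<in> {0<..1}"
 shows "f x = L * (of_real (x ^ (l + 1)) * reg_sol l r x)"
	and "of_real (x ^ (l + 1)) * f' x - of_real ((real l + 1) * x ^ l) * f x = L * reg_flux l r (reg_sol l r) x"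
proof -
 have r: "unit_L1 r" unfolding r_def by (rule sl_coeff_integrable[OF q])
 define u where "u = (%x. if x = 0 then L else f x * of_real (inverse (x ^ (l + 1))))"
 define m where "m = (%x. of_real (x ^ (l + 1)) * f' x - of_real ((real l + 1) * x ^ l) * f x)"
 have uf: "f x = of_real (x ^ (l + 1)) * u x" if "x > 0" for x
 proof -
	have "of_real (x ^ (l+1)) * of_real (inverse (x ^ (l+1))) = (1::complex)"
	 using that by (simp flip: of_real_mult del: of_real_power of_real_inverse power_Suc)
	then have "f x * 1 = of_real (x ^ (l+1)) * (f x * of_real (inverse (x ^ (l+1))))" 
	 by (metis mult.assoc mult.commute)
	then show ?thesis using that by (simp add: u_def)
 qed
 have acu: "ac_on a 1 u (%x. m x / of_real (x ^ (2*l+2)))" if a: "0 < a" "a <= 1" for a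
 proof (rule ac_on_cong[OF ac_on_mult[OF sl_solution_ac(1)[OF sol a(1)] ac_on_inverse_power[OF a, of "l + 1"]]])
	fix x assume "x \<in> {a..1}"
	then have x: "x > 0" using a by auto
	show "f x * cplx (inverse (x ^ (l + 1))) = u x" using x by (simp add: u_def)
	show "f' x * cplx (inverse (x ^ (l + 1))) + f x * cplx (- real (l + 1) * inverse (x ^ (l + 1 + 1))) =
		 m x / cplx (x ^ (2 * l + 2))"
	proof -
	 have 1: "cplx (x ^ (2 * l + 2)) = of_real x ^ (l+1) * of_real x ^ (l+1)"
		by (simp add: mult_2 power_add)
	 define P Z where "P = cplx x ^ (l+1)" and "Z = cplx x"
	 have nz: "P ~= 0" "Z ~= 0" using x by (auto simp: P_def Z_def)
	 have e1: "cplx (inverse (x ^ (l + 1))) = inverse P" by (simp add: P_def)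
	 have e2: "cplx (- real (l + 1) * inverse (x ^ (l + 1 + 1))) = - of_nat (l+1) * inverse (P * Z)"
		by (simp add: P_def Z_def)
	 have e3: "m x = P * f' x - of_nat (l+1) * (P / Z) * f x"
		using x by (simp add: m_def P_def Z_def)
	 have "a * inverse P + b * (- c * inverse (P * Z)) = (P * a - c * (P / Z) * b) / (P * P)" for a b c
		using nz by (simp add: field_simps)
	 then show ?thesis unfolding e1 e2 e3 1 P_def[symmetric] by blast
	qed
 qed
 have acm: "ac_on a 1 m (%x. of_real (x ^ (2*l+2)) * r x * u x)" if a: "0 < a" "a <= 1" for a
 proof (rule ac_on_cong[OF ac_on_diff[OF
	  ac_on_mult[OF ac_on_power[OF a(2), of "l + 1"] sl_solution_ac(2)[OF sol a(1)]]
	  ac_on_mult[OF ac_on_cmult[OF ac_on_power[OF a(2), of l], of "of_real (real l + 1)"] sl_solution_ac(1)[OF sol a(1)]]]])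
	fix x assume "x \<in> {a..1}"
	then have x: "x > 0" using a by auto
	show "cplx (x ^ (l + 1)) * f' x - cplx (real l + 1) * cplx (x ^ l) * f x = m x"
	 by (simp add: m_def)
	have x1: "cplx (x ^ (l + 1)) * of_real (real l * (real l + 1) / x\<^sup>2)
		= cplx (real l + 1) * of_real (real l * x ^ (l - 1))"
	 using x by (cases l) (simp_all add: field_simps power2_eq_square)
	have x2: "cplx (x ^ (l + 1)) * r x * f x = of_real (x ^ (2*l+2)) * r x * u x"
	 unfolding uf[OF x] by (simp add: power_add mult_2 power2_eq_square)
	have "cplx (real (l + 1) * x ^ (l + 1 - 1)) * f' x +
		 cplx (x ^ (l + 1)) * (cplx (real l * (real l + 1) / x\<^sup>2) * f x + sl_coeff q lam x * f x) -
		 (cplx (real l + 1) * cplx (real l * x ^ (l - 1)) * f x +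
		 cplx (real l + 1) * cplx (x ^ l) * f' x)
	  = (cplx (x ^ (l + 1)) * of_real (real l * (real l + 1) / x\<^sup>2)) * f x
		 - (cplx (real l + 1) * of_real (real l * x ^ (l - 1))) * f x
		 + cplx (x ^ (l + 1)) * r x * f x"
	 by (simp add: r_def algebra_simps del: of_real_power)
	also have "... = of_real (x ^ (2*l+2)) * r x * u x" unfolding x1 x2 by simp
	finally show "cplx (real (l + 1) * x ^ (l + 1 - 1)) * f' x +
		 cplx (x ^ (l + 1)) * (cplx (real l * (real l + 1) / x\<^sup>2) * f x + sl_coeff q lam x * f x) -
		 (cplx (real l + 1) * cplx (real l * x ^ (l - 1)) * f x +
		 cplx (real l + 1) * cplx (x ^ l) * f' x) = of_real (x ^ (2*l+2)) * r x * u x" .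
 qed
 have cu: "continuous_on {0..1} u"
	unfolding continuous_on_def
 proof
	fix x :: real assume x: "x \<in> {0..1}"
	show "(u \<longlongrightarrow> u x) (at x within {0..1})"
	proof (cases "x = 0")
	 case True
	 have "\<forall>\<^sub>F x in at_right 0. f x / of_real (x powr (real l + 1)) = u x"
	 proof (rule eventually_at_rightI[of 0 1])
		fix x :: real assume x: "x \<in> {0<..<1}"
		have "x powr (real l + 1) = x ^ (l + 1)"
		 using x powr_realpow[of x "l + 1"] by (simp add: add.commute)
		then show "f x / of_real (x powr (real l + 1)) = u x" using x by (simp add: u_def field_simps)
	 qed auto
	 from Lim_transform_eventually[OF lim this] have "(u \<longlongrightarrow> L) (at_right 0)" .
	 moreover have "at 0 within {0..1} = at_right (0::real)"
		by (simp add: at_within_Icc_at_right)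
	 ultimately show ?thesis using True by (simp add: u_def)
	next
	 case False
	 then have "continuous_on {x/2..1} u" "x \<in> {x/2..1}"
		using ac_on_continuous[OF acu[of "x/2"]] x by auto
	 then have "(u \<longlongrightarrow> u x) (at x within {x/2..1})" by (auto simp: continuous_on_def)
	 moreover have "at x within {x/2..1} = at x within {0..1}"
		by (rule at_within_nhd[of _ "{x/2<..}"]) (use x False in auto)
	 ultimately show ?thesis by simp
	qed
 qed
 let ?R = "reg_flux l r u"
 define m0 where "m0 = m 1 - ?R 1"
 have m_eq: "m x = ?R x + m0" if "0 < x" "x <= 1" for x
 proof -
	have "ac_on x 1 (%x. m x - ?R x) (%y. of_real (y ^ (2*l+2)) * r y * u y - of_real (y ^ (2*l+2)) * r y * u y)"
	 using that by (intro ac_on_diff acm ac_on_subinterval[OF ac_reg_flux[OF r cu]]) auto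
	from ac_on_zero_const[OF this, of x 1] that show ?thesis by (simp add: m0_def algebra_simps)
 qed
 define d where "d = (%x. u x - reg_op l r u x)"
 have acop: "ac_on 0 1 (reg_op l r u) (%s. ?R s / of_real (s ^ (2*l+2)))"
	unfolding reg_op_def[abs_def]
	by (rule ac_on_indefinite[OF absolutely_integrable_continuous_real[OF continuous_reg_density[OF r cu]]])
 have d_eq: "d x + m0 * (of_real (inverse (x ^ (2*l+1))) / of_nat (2*l+1)) = d 1 + m0 / of_nat (2*l+1)"
	if x: "0 < x" "x <= 1" for x
 proof -
	have "ac_on x 1 (%y. d y + (m0 / of_nat (2*l+1)) * of_real (inverse (y ^ (2*l+1))))
	  (%y. (m y / of_real (y ^ (2*l+2)) - ?R y / of_real (y ^ (2*l+2))) +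
		 (m0 / of_nat (2*l+1)) * of_real (- real (2*l+1) * inverse (y ^ (2*l+1+1))))"
	 unfolding d_def
	 using x by (intro ac_on_add ac_on_diff acu ac_on_subinterval[OF acop] ac_on_cmult ac_on_inverse_power) auto
	then have "d x + (m0 / of_nat (2*l+1)) * of_real (inverse (x ^ (2*l+1))) =
		d 1 + (m0 / of_nat (2*l+1)) * of_real (inverse (1 ^ (2*l+1)))"
	proof (rule ac_on_zero_const)
	 fix y assume "y \<in> {x..1}"
	 then have y: "0 < y" "y <= 1" using x by auto
	 have n: "(of_nat (2*l+1) :: complex) ~= 0" by (metis of_nat_eq_0_iff add_eq_0_iff_both_eq_0 one_neq_zero)
	 have "(m0 / of_nat (2*l+1)) * of_real (- real (2*l+1) * inverse (y ^ (2*l+1+1))) = - m0 / of_real (y ^ (2*l+2))"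
		using n by (simp add: field_simps del: of_nat_Suc of_nat_add of_nat_mult)
	 then show "(m y / of_real (y ^ (2*l+2)) - ?R y / of_real (y ^ (2*l+2))) +
		 (m0 / of_nat (2*l+1)) * of_real (- real (2*l+1) * inverse (y ^ (2*l+1+1))) = 0"
		unfolding m_eq[OF y] by (simp add: add_divide_distrib)
	qed (use x in auto)
	then show ?thesis by simp
 qed
 have cd: "continuous_on {0..1} d" unfolding d_def by (intro continuous_intros cu continuous_reg_op r)
 have at0: "at 0 within {0..1} = at_right (0::real)" by (simp add: at_within_Icc_at_right)
 have "continuous_on {0..1} (%x. of_real (x ^ (2*l+1)) * (d 1 + m0 / of_nat (2*l+1) - d x))"
	by (intro continuous_intros cd)
 then have "((%x. of_real (x ^ (2*l+1)) * (d 1 + m0 / of_nat (2*l+1) - d x)) \<longlongrightarrow> 0) (at_right 0)"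
	unfolding continuous_on_def at0[symmetric] by (drule_tac bspec[of _ _ 0]) auto
 moreover have "\<forall>\<^sub>F x in at_right 0. of_real (x ^ (2*l+1)) * (d 1 + m0 / of_nat (2*l+1) - d x) = m0 / of_nat (2*l+1)"
 proof (rule eventually_at_rightI[of 0 1])
	fix x :: real assume x: "x \<in> {0<..<1}"
	have "d 1 + m0 / of_nat (2*l+1) - d x = m0 * (of_real (inverse (x ^ (2*l+1))) / of_nat (2*l+1))"
	 using d_eq[of x] x by (metis add_diff_cancel_left' greaterThanLessThan_iff less_imp_le)
	then show "of_real (x ^ (2*l+1)) * (d 1 + m0 / of_nat (2*l+1) - d x) = m0 / of_nat (2*l+1)"
	 using x by (simp add: field_simps del: of_nat_Suc of_nat_add of_nat_mult power_Suc)
 qed auto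
 ultimately have "((%x. m0 / of_nat (2*l+1)) \<longlongrightarrow> 0) (at_right (0::real))"
	by (rule Lim_transform_eventually)
 then have "m0 / of_nat (2*l+1) = 0" by (simp add: tendsto_const_iff)
 then have m0: "m0 = 0" by (metis divide_eq_0_iff of_nat_eq_0_iff add_eq_0_iff_both_eq_0 one_neq_zero)
 have d1: "d x = d 1" if "0 < x" "x <= 1" for x using d_eq[OF that] m0 by simp
 have "(d \<longlongrightarrow> d 0) (at_right 0)" using cd unfolding continuous_on_def at0[symmetric] by (rule bspec) auto
 moreover have "\<forall>\<^sub>F x in at_right 0. d x = d 1"
	by (rule eventually_at_rightI[of 0 1], rule d1) auto
 ultimately have "((%x::real. d 1) \<longlongrightarrow> d 0) (at_right 0)" by (rule Lim_transform_eventually)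
 then have "d 1 = d 0" by (simp add: tendsto_const_iff)
 moreover have "d 0 = L" by (simp add: d_def u_def reg_op_def)
 ultimately have dL: "d x = L" if "x \<in> {0..1}" for x
	using that d1[of x] by (cases "x = 0") auto
 have u_reg: "u x = L * reg_sol l r x" if "x \<in> {0..1}" for x
	by (rule reg_sol_unique[OF r cu _ that]) (use dL in \<open>auto simp: d_def algebra_simps\<close>)
 show "f x = L * (of_real (x ^ (l + 1)) * reg_sol l r x)"
	using uf[of x] u_reg[of x] x by simp
 have "m x = ?R x" using m_eq[of x] m0 x by simp
 also have "?R x = L * reg_flux l r (reg_sol l r) x"
 proof -
	have "?R x = reg_flux l r (%y. L * reg_sol l r y + 0 * reg_sol l r y) x"
	 unfolding reg_flux_def
	 by (rule hk_cong) (use x u_reg in auto)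
	also have "... = L * reg_flux l r (reg_sol l r) x"
	 using reg_flux_diff[OF r continuous_reg_sol[OF r] continuous_reg_sol[OF r], of x l L l 0 l] x by simp
	finally show ?thesis .
 qed
 finally show "of_real (x ^ (l + 1)) * f' x - of_real ((real l + 1) * x ^ l) * f x = L * reg_flux l r (reg_sol l r) x"
	by (simp add: m_def)
qed

section \<open>The spectral data in terms of the regular solution\<close>

lemma has_integral_reflect_1:
 fixes f :: "real => 'a::banach"
 assumes "(f has_integral i) {c..d}"
 shows "((%s. f (1 - s)) has_integral i) {1 - d..1 - c}"
proof -
 have "((%s. f ((-1) * s + 1)) has_integral (1 / \<bar>-1::real\<bar>) *\<^sub>R i) ((%x. (1 / -1) * x + - ((1 / -1) * 1)) ` {c..d})"
	using has_integral_affinity[of f i c d "-1" 1] assms by (simp add: cbox_interval)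
 moreover have "(%x::real. (1 / -1) * x + - ((1 / -1) * 1)) ` {c..d} = {1 - d..1 - c}"
 proof -
	have "(%x::real. (1 / -1) * x + - ((1 / -1) * 1)) = (%x. 1 - x)" by auto
	then show ?thesis by (simp only: image_diff_atLeastAtMost)
 qed
 ultimately show ?thesis by (simp add: algebra_simps)
qed

lemma sl_initial_value_unique:
 fixes d d' :: "real => complex"
 assumes a: "a <= 1" and d: "ac_on a 1 d d'" and d': "ac_on a 1 d' (%x. R x * d x)"
	and R: "R absolutely_integrable_on {a..1}" and init: "d 1 = 0" "d' 1 = 0"
	and x: "x \<in> {a..1}"
 shows "d x = 0"
proof -
 let ?D = "%x. norm (d x) + norm (d' x)"
 let ?W = "%x. 1 + norm (R x)"
 have cd: "continuous_on {a..1} d" "continuous_on {a..1} d'"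
	using ac_on_continuous[OF d] ac_on_continuous[OF d'] .
 have cD: "continuous_on {a..1} ?D" by (intro continuous_intros cd)
 have W: "?W absolutely_integrable_on {a..1}"
	using L1D(4)[OF R order_refl order_refl]
	by (intro set_integral_add absolutely_integrable_on_const) auto
 have WD: "(%x. ?W x * ?D x) absolutely_integrable_on {a..1}"
	using absolutely_integrable_mult_continuous[OF W cD] by (simp add: mult.commute)
 have le: "?D y <= integral {y..1} (%x. ?W x * ?D x)" if y: "y \<in> {a..1}" for y
 proof -
	have i1: "(%x. norm (d' x)) integrable_on {y..1}"
	 by (rule integrable_continuous_interval[OF continuous_on_subset[OF continuous_on_norm[OF cd(2)]]]) (use y in auto)
	have i2: "(%x. norm (R x * d x)) integrable_on {y..1}"
	 using L1D(2)[OF ac_onD(1)[OF d']] y by auto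
	have "norm (d y) = norm (integral {y..1} d')"
	 using ac_on_diff_eq[OF d, of y 1] y init by (metis atLeastAtMost_iff diff_0 norm_minus_cancel order_refl)
	also have "... <= integral {y..1} (%x. norm (d' x))"
	 by (rule integral_norm_bound_integral[OF L1D(1)[OF ac_onD(1)[OF d]] i1]) (use y in auto)
	finally have 1: "norm (d y) <= integral {y..1} (%x. norm (d' x))" .
	have "norm (d' y) = norm (integral {y..1} (%x. R x * d x))"
	 using ac_on_diff_eq[OF d', of y 1] y init by (metis atLeastAtMost_iff diff_0 norm_minus_cancel order_refl)
	also have "... <= integral {y..1} (%x. norm (R x * d x))"
	 by (rule integral_norm_bound_integral[OF L1D(1)[OF ac_onD(1)[OF d']] i2]) (use y in auto)
	finally have "?D y <= integral {y..1} (%x. norm (d' x)) + integral {y..1} (%x. norm (R x * d x))" using 1 by simp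
	also have "... = integral {y..1} (%x. norm (d' x) + norm (R x * d x))"
	 by (rule hk_add[OF i1 i2, symmetric])
	also have "... <= integral {y..1} (%x. ?W x * ?D x)"
	 by (rule integral_le[OF integrable_add[OF i1 i2] L1D(1)[OF WD]])
		 (use y in \<open>auto simp: norm_mult algebra_simps\<close>)
	finally show ?thesis .
 qed
 have refl: "(%s. ?W (1 - s)) absolutely_integrable_on {0..1 - a}"
 proof -
	have "(?W has_integral integral {a..1} ?W) {a..1}"
	 using W L1D(1)[OF W order_refl order_refl] by (simp add: has_integral_integral)
	from has_integral_reflect_1[OF this] have "(%s. ?W (1 - s)) integrable_on {0..1 - a}" by auto
	then show ?thesis by (rule nonnegative_absolutely_integrable_1) (auto simp: add_nonneg_nonneg)
 qed
 have "?D (1 - (1 - x)) <= 0 * exp (integral {0..1 - x} (%s. ?W (1 - s)))"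
 proof (rule gronwall[OF refl, where u = "%s. ?D (1 - s)"])
	show "continuous_on {0..1 - a} (%s. ?D (1 - s))"
	 by (rule continuous_on_compose2[OF cD]) (auto intro!: continuous_intros)
	fix s assume s: "s \<in> {0..1 - a}"
	have "((%x. ?W x * ?D x) has_integral integral {1 - s..1} (%x. ?W x * ?D x)) {1 - s..1}"
	 using L1D(1)[OF WD, of "1 - s" 1] s by (simp add: has_integral_integral)
	from has_integral_reflect_1[OF this]
	have "integral {0..s} (%y. ?W (1 - y) * ?D (1 - y)) = integral {1 - s..1} (%x. ?W x * ?D x)"
	 by (simp add: integral_unique)
	then show "?D (1 - s) <= 0 + integral {0..s} (%y. ?W (1 - y) * ?D (1 - y))"
	 using le[of "1 - s"] s by simp
 qed (use x in auto)
 then have "norm (d x) + norm (d' x) <= 0" by simp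
 then have "norm (d x) <= 0" using norm_ge_zero[of "d' x"] by linarith
 then show ?thesis by simp
qed

lemma sl_potential_integrable:
 assumes q: "unit_L1 q" and a: "0 < a"
 shows "(%x. of_real (c / x\<^sup>2) + sl_coeff q lam x) absolutely_integrable_on {a..1}"
proof (rule set_integral_add(1))
 show "(%x. cplx (c / x\<^sup>2)) absolutely_integrable_on {a..1}"
	using a by (intro absolutely_integrable_continuous_real continuous_intros) auto
 show "sl_coeff q lam absolutely_integrable_on {a..1}"
	by (rule L1D(3)[OF sl_coeff_integrable[OF q]]) (use a in auto)
qed

lemma sl_solution_unique:
 assumes f: "sl_solution l q lam f f'" and g: "sl_solution l q lam g g'"
	and q: "unit_L1 q"
	and init: "g 1 = c * f 1" "g' 1 = c * f' 1" and x: "x \<in> {0<..1}"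
 shows "g x = c * f x"
proof -
 have x0: "0 < x" using x by auto
 have "g x - c * f x = 0"
 proof (rule sl_initial_value_unique[where a = x])
	show "ac_on x 1 (%x. g x - c * f x) (%x. g' x - c * f' x)"
	 by (intro ac_on_diff ac_on_cmult sl_solution_ac(1)[OF f x0] sl_solution_ac(1)[OF g x0])
	have "ac_on x 1 (%x. g' x - c * f' x) (%x. (of_real (l * (l + 1) / x\<^sup>2) * g x + sl_coeff q lam x * g x)
		- c * (of_real (l * (l + 1) / x\<^sup>2) * f x + sl_coeff q lam x * f x))"
	 by (intro ac_on_diff ac_on_cmult sl_solution_ac(2)[OF f x0] sl_solution_ac(2)[OF g x0])
	then show "ac_on x 1 (%x. g' x - c * f' x) (%x. (of_real (l * (l + 1) / x\<^sup>2) + sl_coeff q lam x) * (g x - c * f x))"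
	 by (rule ac_on_cong) (auto simp: algebra_simps simp del: of_real_divide)
	show "(%x. of_real (l * (l + 1) / x\<^sup>2) + sl_coeff q lam x) absolutely_integrable_on {x..1}"
	 by (rule sl_potential_integrable[OF q x0])
 qed (use init x in auto)
 then show ?thesis by simp
qed

lemma sl_solution_cmult:
 assumes "sl_solution l q lam f f'"
 shows "sl_solution l q lam (%x. c * f x) (%x. c * f' x)"
proof -
 from assms obtain f'' where f:
	 "!!x. x \<in> {0<..1} ==> (f has_vector_derivative f' x) (at x within {0<..1})"
	 "!!x. x \<in> {0<..1} ==> set_integrable lebesgue {x..1} f''"
	 "!!x. x \<in> {0<..1} ==> f' 1 - f' x = (LINT t:{x..1}|lebesgue. f'' t)"
	and ae: "AE x in lebesgue. x \<in> {0<..<1} -->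
			 - f'' x + of_real (l * (l + 1) / x\<^sup>2) * f x + of_real (q x) * f x = lam * f x"
	unfolding sl_solution_def by blast
 show ?thesis unfolding sl_solution_def
 proof (intro conjI ballI exI[of _ "%x. c * f'' x"])
	show "((%x. c * f x) has_vector_derivative c * f' x) (at x within {0<..1})" if "x \<in> {0<..1}" for x
	 using f(1)[OF that] by (intro derivative_intros)
	show "set_integrable lebesgue {x..1} (%x. c * f'' x)" if "x \<in> {0<..1}" for x
	 using f(2)[OF that] by simp
	show "c * f' 1 - c * f' x = (LINT t:{x..1}|lebesgue. c * f'' t)" if "x \<in> {0<..1}" for x
	 using f(3)[OF that] by (simp flip: right_diff_distrib)
	show "AE x in lebesgue. x \<in> {0<..<1} --> - (c * f'' x) + cplx (l * (l + 1) / x\<^sup>2) * (c * f x)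
		 + of_real (q x) * (c * f x) = lam * (c * f x)"
	 using ae
	proof (rule AE_mp[OF _ AE_I2], intro impI)
	 fix x assume h: "x \<in> {0<..<1} --> - f'' x + of_real (l * (l + 1) / x\<^sup>2) * f x + of_real (q x) * f x = lam * f x"
		and x: "x \<in> {0<..<1}"
	 then have "c * (- f'' x + of_real (l * (l + 1) / x\<^sup>2) * f x + of_real (q x) * f x) = c * (lam * f x)" by simp
	 then show "- (c * f'' x) + cplx (l * (l + 1) / x\<^sup>2) * (c * f x)
		 + of_real (q x) * (c * f x) = lam * (c * f x)" by (simp add: algebra_simps)
	qed
 qed
qed

text \<open>The boundary condition at 1 for \<open>\<phi> = x\<^sup>l\<^sup>+\<^sup>1 v\<close> with \<open>m = x\<^sup>2\<^sup>l\<^sup>+\<^sup>2 v'\<close>, in terms of \<open>(v(1), m(1))\<close>.\<close>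
definition reg_bc :: "nat => ereal => complex => complex => bool"
 where "reg_bc l \<beta> v m \<longleftrightarrow>
	(if \<beta> = \<infinity> then v = 0 else m = - of_real (real l + 1 + real_of_ereal \<beta>) * v)"

lemma cnj_reg_sol:
 assumes q: "unit_L1 q" and x: "x \<in> {0..1}"
 shows "cnj (reg_sol l (sl_coeff q (of_real lam)) x) = reg_sol l (sl_coeff q (of_real lam)) x"
proof -
 let ?r = "sl_coeff q (of_real lam)" and ?v = "reg_sol l (sl_coeff q (of_real lam))"
 have r: "unit_L1 ?r" by (rule sl_coeff_integrable[OF q])
 have flux: "cnj (reg_flux l ?r v y) = reg_flux l ?r (%y. cnj (v y)) y" for v y
	unfolding reg_flux_def
	by (subst hk_cnj) (simp add: sl_coeff_def)
 have op: "cnj (reg_op l ?r v y) = reg_op l ?r (%y. cnj (v y)) y" for v y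
	unfolding reg_op_def by (subst hk_cnj) (simp add: flux)
 have c: "continuous_on {0..1} (%x. cnj (?v x))" using continuous_reg_sol[OF r] by (intro continuous_intros)
 have "cnj (?v y) = 1 + reg_op l ?r (%x. cnj (?v x)) y" if "y \<in> {0..1}" for y
	using reg_sol_eq[OF r that, of l] by (metis complex_cnj_add complex_cnj_one op)
 from reg_sol_unique[OF r c this x] show ?thesis by simp
qed

definition bc_scale :: "ereal => complex => complex => complex"
 where "bc_scale \<beta> v m = (if \<beta> = \<infinity> then - m else v)"

lemma spectrum_reg_bc:
 assumes q: "unit_L1 q"
	and spec: "cplx lam \<in> sl_spectrum (real l) q \<beta>"
 defines "v \<equiv> reg_sol l (sl_coeff q (of_real lam))"
 defines "m \<equiv> reg_flux l (sl_coeff q (of_real lam)) v"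
 shows "reg_bc l \<beta> (v 1) (m 1)" and "bc_scale \<beta> (v 1) (m 1) ~= 0"
	and "of_real (norming_const (real l) q \<beta> (of_real lam)) * (bc_scale \<beta> (v 1) (m 1))\<^sup>2 =
	 integral {0..1} (%x. of_real (x ^ (2*l+2)) * (v x * v x))"
proof -
 let ?lam = "cplx lam"
 let ?r = "sl_coeff q ?lam"
 have r: "unit_L1 ?r" by (rule sl_coeff_integrable[OF q])
 from spec obtain f f' L where sol: "sl_solution (real l) q ?lam f f'"
	and nz: "\<exists>x\<in>{0<..1}. f x ~= 0"
	and lim: "((%x. f x / of_real (x powr (real l + 1))) \<longlongrightarrow> L) (at_right 0)"
	and bc: "if \<beta> = \<infinity> then f 1 = 0 else f' 1 + of_real (real_of_ereal \<beta>) * f 1 = 0"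
	unfolding sl_spectrum_def by blast
 have fx: "f x = L * (of_real (x ^ (l + 1)) * v x)" if "x \<in> {0<..1}" for x
	using sl_solution_regular(1)[OF sol lim q that] by (simp add: v_def)
 have L: "L ~= 0" using nz fx by auto
 have f1: "f 1 = L * v 1" using fx[of 1] by simp
 have f'1: "f' 1 = L * m 1 + of_real (real l + 1) * f 1"
	using sl_solution_regular(2)[OF sol lim q, of 1] unfolding v_def[symmetric] m_def[symmetric]
	by (simp add: algebra_simps)
 show rbc: "reg_bc l \<beta> (v 1) (m 1)"
 proof (cases "\<beta> = \<infinity>")
	case True
	then show ?thesis using bc f1 L by (simp add: reg_bc_def)
 next
	case False
	then have "L * (m 1 + of_real (real l + 1 + real_of_ereal \<beta>) * v 1) = 0"
	 using bc f1 f'1 by (simp add: algebra_simps)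
	then have "m 1 + of_real (real l + 1 + real_of_ereal \<beta>) * v 1 = 0" using L by simp
	then have "m 1 = - (of_real (real l + 1 + real_of_ereal \<beta>) * v 1)" by (rule eq_neg_iff_add_eq_0[THEN iffD2])
	then show ?thesis using False by (simp only: reg_bc_def mult_minus_left if_False)
 qed
 let ?k = "bc_scale \<beta> (v 1) (m 1)"
 show k: "?k ~= 0"
 proof
	assume "?k = 0"
	then have "v 1 = 0" "m 1 = 0" using rbc by (auto simp: bc_scale_def reg_bc_def split: if_splits)
	then have z: "f 1 = 0" "f' 1 = 0" using f1 f'1 by auto
	have "f x = 0 * f x" if "x \<in> {0<..1}" for x
	 by (rule sl_solution_unique[OF sol sol q _ _ that]) (use z in auto)
	then show False using nz by auto
 qed
 let ?init = "%g g'. if \<beta> = \<infinity> then g 1 = 0 & g' 1 = - 1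
	 else g 1 = 1 & g' 1 = - cplx (real_of_ereal \<beta>)"
 have init: "?init (%x. 1 / (L * ?k) * f x) (%x. 1 / (L * ?k) * f' x)"
 proof (cases "\<beta> = \<infinity>")
	case True
	then show ?thesis using bc f1 f'1 L k by (simp add: bc_scale_def)
 next
	case False
	then have "f' 1 = - of_real (real_of_ereal \<beta>) * f 1" using bc by (simp add: eq_neg_iff_add_eq_0)
	then show ?thesis using False f1 L k by (simp add: bc_scale_def)
 qed
 let ?psi = "sl_psi (real l) q \<beta> ?lam"
 have "\<exists>g'. sl_solution (real l) q ?lam ?psi g' & ?init ?psi g'"
	unfolding sl_psi_def
	by (rule someI[of _ "%x. 1 / (L * ?k) * f x"]) (use init sl_solution_cmult[OF sol] in blast)
 then obtain g' where g: "sl_solution (real l) q ?lam ?psi g'" and gi: "?init ?psi g'" by blast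
 have psi: "?psi x = of_real (x ^ (l+1)) * v x / ?k" if "x \<in> {0<..1}" for x
 proof -
	have "?psi x = 1 / (L * ?k) * f x"
	 by (rule sl_solution_unique[OF sol g q _ _ that]) (use init gi in \<open>auto split: if_splits\<close>)
	then show ?thesis using fx[OF that] L by simp
 qed
 have vr: "v x = of_real (Re (v x))" if "x \<in> {0..1}" for x
	using cnj_reg_sol[OF q that, of l lam] by (simp add: v_def complex_eq_iff)
 have cv: "continuous_on {0..1} v" unfolding v_def by (rule continuous_reg_sol[OF r])
 have mr: "cnj (m 1) = m 1"
 proof -
	have "cnj (m 1) = integral {0..1} (%y. cnj (of_real (y ^ (2*l+2)) * ?r y * v y))"
	 unfolding m_def reg_flux_def by (subst hk_cnj) simp
	also have "... = m 1" unfolding m_def reg_flux_def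
	 by (rule hk_cong)
		 (use cnj_reg_sol[OF q] in \<open>auto simp: sl_coeff_def v_def\<close>)
	finally show ?thesis .
 qed
 have "cnj ?k = ?k" using mr cnj_reg_sol[OF q, of 1 l lam] by (simp add: bc_scale_def v_def)
 then obtain kr where kr: "?k = of_real kr" by (metis Reals_cnj_iff Reals_cases)
 have kr0: "kr ~= 0" using k kr by auto
 have "norming_const (real l) q \<beta> ?lam = (LINT x:{0<..<1}|lebesgue. (x ^ (2*l+2) * (Re (v x))\<^sup>2) / kr\<^sup>2)"
	unfolding norming_const_def
 proof (rule set_lebesgue_integral_cong)
	show "\<forall>x. x \<in> {0<..<1} --> (cmod (?psi x))\<^sup>2 = (x ^ (2*l+2) * (Re (v x))\<^sup>2) / kr\<^sup>2"
	proof (intro allI impI)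
	 fix x :: real assume x: "x \<in> {0<..<1}"
	 have "?psi x = of_real (x ^ (l+1) * Re (v x) / kr)"
		using psi[of x] vr[of x] x kr by (metis atLeastAtMost_iff greaterThanAtMost_iff greaterThanLessThan_iff less_imp_le of_real_divide of_real_mult)
	 then have "cmod (?psi x) = \<bar>x ^ (l+1) * Re (v x) / kr\<bar>" by (simp only: norm_of_real)
	 then show "(cmod (?psi x))\<^sup>2 = (x ^ (2*l+2) * (Re (v x))\<^sup>2) / kr\<^sup>2"
		by (simp add: power_mult_distrib power_divide power2_abs flip: power_mult power_Suc) (simp add: mult.commute)
	qed
 qed auto
 also have "... = integral {0<..<1} (%x. (x ^ (2*l+2) * (Re (v x))\<^sup>2) / kr\<^sup>2)"
 proof (rule set_lebesgue_integral_eq_integral(2))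
	have "(%x. (x ^ (2*l+2) * (Re (v x))\<^sup>2) / kr\<^sup>2) absolutely_integrable_on {0..1}"
	 using cv kr0 by (intro absolutely_integrable_continuous_real continuous_intros) auto
	then show "set_integrable lebesgue {0<..<1} (%x. (x ^ (2*l+2) * (Re (v x))\<^sup>2) / kr\<^sup>2)"
	 by (rule set_integrable_subset) auto
 qed
 also have "... = integral {0..1} (%x. (x ^ (2*l+2) * (Re (v x))\<^sup>2) / kr\<^sup>2)"
	by (rule integral_open_interval_real[symmetric])
 also have "... = integral {0..1} (%x. x ^ (2*l+2) * (Re (v x))\<^sup>2) / kr\<^sup>2" by simp
 finally have "norming_const (real l) q \<beta> ?lam * kr\<^sup>2 = integral {0..1} (%x. x ^ (2*l+2) * (Re (v x))\<^sup>2)"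
	using kr0 by simp
 then have "of_real (norming_const (real l) q \<beta> ?lam) * ?k\<^sup>2 = cplx (integral {0..1} (%x. x ^ (2*l+2) * (Re (v x))\<^sup>2))"
	unfolding kr by (metis of_real_mult of_real_power)
 also have "... = integral {0..1} (%x. cplx (x ^ (2*l+2) * (Re (v x))\<^sup>2))"
 proof -
	have "(%x. x ^ (2*l+2) * (Re (v x))\<^sup>2) integrable_on {0..1}"
	 using cv by (intro integrable_continuous_interval continuous_intros)
	from has_integral_linear[OF this[unfolded has_integral_integral] bounded_linear_of_real[where 'a = complex]]
	show ?thesis by (simp add: o_def integral_unique)
 qed
 also have "... = integral {0..1} (%x. of_real (x ^ (2*l+2)) * (v x * v x))"
 proof (rule hk_cong)
	fix x :: real assume "x \<in> {0..1}"
	from vr[OF this] show "cplx (x ^ (2*l+2) * (Re (v x))\<^sup>2) = of_real (x ^ (2*l+2)) * (v x * v x)"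
	 by (metis of_real_mult power2_eq_square)
 qed
 finally show "of_real (norming_const (real l) q \<beta> ?lam) * ?k\<^sup>2 =
	 integral {0..1} (%x. of_real (x ^ (2*l+2)) * (v x * v x))" .
qed

section \<open>Growth of the regular solution\<close>

definition phi :: "nat => (real => real) => complex => real => complex"
 where "phi l q lam x = of_real (x ^ (l+1)) * reg_sol l (sl_coeff q lam) x"

definition phi' :: "nat => (real => real) => complex => real => complex"
 where "phi' l q lam x = of_real ((real l + 1) * x ^ l) * reg_sol l (sl_coeff q lam) x +
	of_real (inverse (x ^ (l+1))) * reg_flux l (sl_coeff q lam) (reg_sol l (sl_coeff q lam)) x"

lemma ac_on_reg_sol:
 assumes "unit_L1 r"
 shows "ac_on 0 1 (reg_sol l r) (%x. reg_flux l r (reg_sol l r) x / of_real (x ^ (2*l+2)))"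
 by (rule ac_onI_C1[OF _ continuous_reg_density[OF assms continuous_reg_sol[OF assms]]
	 reg_sol_has_vector_derivative[OF assms]]) auto

lemma ac_on_phi:
 assumes q: "unit_L1 q" and a: "0 < a" "a <= 1"
 shows "ac_on a 1 (phi l q lam) (phi' l q lam)"
	and "ac_on a 1 (phi' l q lam) (%x. (of_real (real l * (real l + 1) / x\<^sup>2) + sl_coeff q lam x) * phi l q lam x)"
proof -
 let ?r = "sl_coeff q lam" let ?v = "reg_sol l ?r" let ?m = "reg_flux l ?r ?v"
 note r = sl_coeff_integrable[OF q, of lam]
 have v: "ac_on a 1 ?v (%x. ?m x / of_real (x ^ (2*l+2)))"
	by (rule ac_on_subinterval[OF ac_on_reg_sol[OF r]]) (use a in auto)
 have m: "ac_on a 1 ?m (%x. of_real (x ^ (2*l+2)) * ?r x * ?v x)"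
	by (rule ac_on_subinterval[OF ac_reg_flux[OF r continuous_reg_sol[OF r]]]) (use a in auto)
 have P: "cplx (x ^ (2*l+2)) = of_real x ^ l * of_real x ^ l * (of_real x * of_real x)" for x
	by (simp add: mult_2 power_add)
 show "ac_on a 1 (phi l q lam) (phi' l q lam)"
 proof (rule ac_on_cong[OF ac_on_mult[OF ac_on_power[OF a(2), of "l+1"] v]])
	fix x assume "x \<in> {a..1}"
	then have x: "cplx x ~= 0" using a by auto
	show "cplx (real (l + 1) * x ^ (l + 1 - 1)) * ?v x + cplx (x ^ (l + 1)) * (?m x / cplx (x ^ (2 * l + 2))) = phi' l q lam x"
	 unfolding phi'_def P using x by (simp add: field_simps)
 qed (simp add: phi_def)
 show "ac_on a 1 (phi' l q lam) (%x. (of_real (real l * (real l + 1) / x\<^sup>2) + sl_coeff q lam x) * phi l q lam x)"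
 proof (rule ac_on_cong[OF ac_on_add[OF ac_on_mult[OF ac_on_cmult[OF ac_on_power[OF a(2), of l], of "of_real (real l + 1)"] v]
		 ac_on_mult[OF ac_on_inverse_power[OF a, of "l+1"] m]]])
	fix x assume "x \<in> {a..1}"
	then have x: "x ~= 0" using a by auto
	define X where "X = cplx x"
	have X: "X ~= 0" using x by (simp add: X_def)
	have e1: "cplx (real l * x ^ (l - 1)) = of_nat l * X ^ l / X"
	 using X by (cases l) (simp_all add: X_def)
	have e2: "cplx (- real (l + 1) * inverse (x ^ (l + 1 + 1))) = - (of_nat l + 1) / (X ^ l * X * X)"
	 by (simp add: X_def field_simps)
	have e3: "cplx (inverse (x ^ (l+1))) = 1 / (X ^ l * X)" by (simp add: X_def field_simps)
	have e4: "cplx (real l * (real l + 1) / x\<^sup>2) = of_nat l * (of_nat l + 1) / (X * X)"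
	 by (simp add: X_def power2_eq_square)
	have "(L + 1) * (L * p / X) * v + (L + 1) * p * (m / (p * p * (X * X))) +
	  (- (L + 1) / (p * X * X) * m + 1 / (p * X) * (p * p * (X * X) * r * v)) = (L * (L + 1) / (X * X) + r) * (p * X * v)"
	 if "p ~= 0" for L p v m r :: complex
	 using X that by (simp add: field_simps)
	from this[of "X ^ l" "of_nat l" "?v x" "?m x" "?r x"] X
	show "cplx (real l + 1) * cplx (real l * x ^ (l - 1)) * ?v x +
		 cplx (real l + 1) * cplx (x ^ l) * (?m x / cplx (x ^ (2 * l + 2))) +
		 (cplx (- real (l + 1) * inverse (x ^ (l + 1 + 1))) * ?m x +
		 cplx (inverse (x ^ (l + 1))) * (cplx (x ^ (2 * l + 2)) * ?r x * ?v x)) =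
		 (cplx (real l * (real l + 1) / x\<^sup>2) + ?r x) * phi l q lam x"
	 unfolding e1 e2 e3 e4 P phi_def by (simp add: X_def mult_ac)
 qed (simp add: phi'_def)
qed

lemma norm_sin_cos_le:
 fixes z :: complex
 shows "norm (sin z) <= exp \<bar>Im z\<bar>" "norm (cos z) <= exp \<bar>Im z\<bar>"
proof -
 have e: "norm (exp (\<i> * z)) <= exp \<bar>Im z\<bar>" "norm (exp (- (\<i> * z))) <= exp \<bar>Im z\<bar>" by (simp_all add: norm_exp_eq_Re)
 have "norm (sin z) = norm (exp (\<i> * z) - exp (- (\<i> * z))) / 2" by (simp add: sin_exp_eq norm_divide norm_mult)
 also have "... <= (exp \<bar>Im z\<bar> + exp \<bar>Im z\<bar>) / 2"
	using norm_triangle_ineq4[of "exp (\<i> * z)" "exp (- (\<i> * z))"] e by (intro divide_right_mono) linarith+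
 finally show "norm (sin z) <= exp \<bar>Im z\<bar>" by simp
 have "norm (cos z) = norm (exp (\<i> * z) + exp (- (\<i> * z))) / 2" by (simp add: cos_exp_eq norm_divide)
 also have "... <= (exp \<bar>Im z\<bar> + exp \<bar>Im z\<bar>) / 2"
	using norm_triangle_ineq[of "exp (\<i> * z)" "exp (- (\<i> * z))"] e by (intro divide_right_mono) linarith+
 finally show "norm (cos z) <= exp \<bar>Im z\<bar>" by simp
qed

lemma norm_sin_cos_real_le:
 assumes "0 <= t"
 shows "norm (sin (z * of_real t)) <= exp (\<bar>Im z\<bar> * t)" "norm (cos (z * of_real t)) <= exp (\<bar>Im z\<bar> * t)"
 using norm_sin_cos_le[of "z * of_real t"] assms by (auto simp: abs_mult)

text \<open>Variation of constants for \<open>y'' + z\<^sup>2 y = w + z\<^sup>2 y\<close>.\<close>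
lemma variation_of_constants:
 fixes y y' w :: "real => complex"
 assumes y: "ac_on a b y y'" and y': "ac_on a b y' w" and z: "z ~= 0" and x: "x \<in> {a..b}"
 shows "y x = y a * cos (z * of_real (x - a)) + y' a * (sin (z * of_real (x - a)) / z) +
	 integral {a..x} (%s. sin (z * of_real (x - s)) / z * (w s + z\<^sup>2 * y s))"
proof -
 have ax: "a <= x" using x by auto
 have ds: "((%s. sin (z * of_real (x - s)) / z) has_vector_derivative - cos (z * of_real (x - s))) (at s within {a..x})" for s
 proof -
	have "((%w. sin (z * (of_real x - w)) / z) has_field_derivative - cos (z * (of_real x - of_real s))) (at (of_real s))"
	 using z by (auto intro!: derivative_eq_intros)
	from has_vector_derivative_real_field[OF this, of "{a..x}"] show ?thesis by (simp add: o_def)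
 qed
 have dc: "((%s. cos (z * of_real (x - s))) has_vector_derivative z * sin (z * of_real (x - s))) (at s within {a..x})" for s
 proof -
	have "((%w. cos (z * (of_real x - w))) has_field_derivative z * sin (z * (of_real x - of_real s))) (at (of_real s))"
	 by (auto intro!: derivative_eq_intros)
	from has_vector_derivative_real_field[OF this, of "{a..x}"] show ?thesis by (simp add: o_def)
 qed
 have S: "ac_on a x (%s. sin (z * of_real (x - s)) / z) (%s. - cos (z * of_real (x - s)))"
	by (rule ac_onI_C1[OF ax _ ds]) (intro continuous_intros)
 have C: "ac_on a x (%s. cos (z * of_real (x - s))) (%s. z * sin (z * of_real (x - s)))"
	by (rule ac_onI_C1[OF ax _ dc]) (intro continuous_intros)
 have y1: "ac_on a x y y'" "ac_on a x y' w"
	using ac_on_subinterval[OF y] ac_on_subinterval[OF y'] x by auto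
 have "ac_on a x (%s. y s * cos (z * of_real (x - s)) + y' s * (sin (z * of_real (x - s)) / z))
	 (%s. (y' s * cos (z * of_real (x - s)) + y s * (z * sin (z * of_real (x - s)))) +
		 (w s * (sin (z * of_real (x - s)) / z) + y' s * - cos (z * of_real (x - s))))"
	by (intro ac_on_add ac_on_mult y1 S C)
 then have "ac_on a x (%s. y s * cos (z * of_real (x - s)) + y' s * (sin (z * of_real (x - s)) / z))
	 (%s. sin (z * of_real (x - s)) / z * (w s + z\<^sup>2 * y s))"
	by (rule ac_on_cong) (use z in \<open>auto simp: field_simps power2_eq_square\<close>)
 from ac_onD(3)[OF this, of x] ax show ?thesis by simp
qed

text \<open>Away from the origin \<open>R\<close> is a perturbation of relative size \<open>1/|z|\<close>.\<close>
lemma oscillator_growth: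
 fixes y y' h :: "real => complex" and R :: "real => complex"
 assumes y: "ac_on a b y y'" and y': "ac_on a b y' (%s. (R s - z\<^sup>2) * y s + h s)"
	and z: "z ~= 0" and a0: "0 <= a" and R: "R absolutely_integrable_on {a..b}" and h: "h absolutely_integrable_on {a..b}"
	and M: "integral {a..b} (%s. norm (R s)) <= M * norm z"
	and x: "x \<in> {a..b}"
	and A: "exp (\<bar>Im z\<bar> * a) * norm (y a) + exp (\<bar>Im z\<bar> * a) * norm (y' a) / norm z + 
		 integral {a..x} (%s. norm (h s)) * exp (\<bar>Im z\<bar> * x) / norm z <= A"
 shows "norm (y x) <= A * exp M * exp (\<bar>Im z\<bar> * (x - a))"
proof -
 let ?k = "\<bar>Im z\<bar>"
 let ?u = "%s. exp (- ?k * (s - a)) * norm (y s)"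
 have cy: "continuous_on {a..x} y" using continuous_on_subset[OF ac_on_continuous[OF y]] x by auto
 have Rx: "R absolutely_integrable_on {a..x}" by (rule L1D(3)[OF R]) (use x in auto)
 have hx: "h absolutely_integrable_on {a..x}" by (rule L1D(3)[OF h]) (use x in auto)
 note nR = L1D(4)[OF Rx order_refl order_refl]
 have w: "(%s. norm (R s) / norm z) absolutely_integrable_on {a..x}" using nR by simp
 have cu: "continuous_on {a..x} ?u" by (intro continuous_intros cy)
 have A0: "0 <= A"
 proof -
	have "0 <= integral {a..x} (%s. norm (h s))"
	 by (intro hk_nonneg L1D(2)[OF hx]) auto
	then have "0 <= integral {a..x} (%s. norm (h s)) * exp (\<bar>Im z\<bar> * x) / norm z" by simp
	moreover have "0 <= exp (\<bar>Im z\<bar> * a) * norm (y a)" "0 <= exp (\<bar>Im z\<bar> * a) * norm (y' a) / norm z" by auto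
	ultimately show ?thesis using A by linarith
 qed
 have step: "?u t <= A + integral {a..t} (%s. norm (R s) / norm z * ?u s)" if t: "t \<in> {a..x}" for t
 proof -
	have tb: "t \<in> {a..b}" using t x by auto
	have Ryi: "(%s. norm (R s) / norm z * ?u s) integrable_on {a..t}"
	 using L1D(1)[OF absolutely_integrable_mult_continuous[OF w cu], of a t] t by (simp add: mult.commute)
	have hi: "(%s. norm (h s)) integrable_on {a..t}"
	 by (rule L1D(2)[OF hx]) (use t in auto)
	let ?f = "%s. sin (z * of_real (t - s)) / z * (((R s - z\<^sup>2) * y s + h s) + z\<^sup>2 * y s)"
	let ?B = "%s. exp (?k * (t - a)) * (norm (R s) / norm z * ?u s) + exp (?k * x) / norm z * norm (h s)"
	have hx0: "a <= t" using t by auto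
	have "norm (integral {a..t} ?f) <= integral {a..t} ?B"
	proof (rule integral_norm_bound_integral)
	 have "(%s. sin (z * of_real (t - s)) / z * (R s * y s + h s)) absolutely_integrable_on {a..t}"
	 proof (rule absolutely_integrable_mult_continuous, rule set_integral_add(1))
		show "(%s. R s * y s) absolutely_integrable_on {a..t}"
		 using L1D(3)[OF absolutely_integrable_mult_continuous[OF Rx cy], of a t] t by (simp add: mult.commute)
		show "h absolutely_integrable_on {a..t}" by (rule L1D(3)[OF hx]) (use t in auto)
	 qed (use z in \<open>auto intro!: continuous_intros\<close>)
	 from L1D(1)[OF this order_refl order_refl]
	 show "?f integrable_on {a..t}" by (simp add: algebra_simps)
	 show "?B integrable_on {a..t}" by (intro integrable_add integrable_on_mult_right Ryi hi)
	 fix s assume s: "s \<in> {a..t}"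
	 have "norm (?f s) = norm (sin (z * of_real (t - s))) / norm z * norm (R s * y s + h s)"
	 proof -
		have "(R s - z\<^sup>2) * y s + h s + z\<^sup>2 * y s = R s * y s + h s" by (simp add: algebra_simps)
		then show ?thesis by (simp only: norm_mult norm_divide)
	 qed
	 also have "... <= exp (?k * (t - s)) / norm z * (norm (R s) * norm (y s) + norm (h s))"
		using norm_sin_cos_real_le(1)[of "t - s" z] s norm_triangle_ineq[of "R s * y s" "h s"]
		by (intro mult_mono divide_right_mono) (auto simp: norm_mult)
	 also have "... = exp (?k * (t - a)) * (norm (R s) / norm z * ?u s) + exp (?k * (t - s)) / norm z * norm (h s)"
	 proof -
		have "exp (?k * (t - s)) = exp (?k * (t - a)) * exp (- ?k * (s - a))"
		 by (simp flip: exp_add add: algebra_simps)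
		then show ?thesis by (simp add: algebra_simps add_divide_distrib)
	 qed
	 also have "exp (?k * (t - s)) / norm z * norm (h s) <= exp (?k * x) / norm z * norm (h s)"
		using s t a0 by (intro mult_right_mono divide_right_mono) (auto intro!: mult_left_mono)
	 finally show "norm (?f s) <= ?B s" by simp
	qed
	also have "... = exp (?k * (t - a)) * integral {a..t} (%s. norm (R s) / norm z * ?u s) + exp (?k * x) / norm z * integral {a..t} (%s. norm (h s))"
	 by (subst hk_add[OF integrable_on_mult_right[OF Ryi] integrable_on_mult_right[OF hi]])
		 (simp only: integral_mult_right)
	finally have 1: "norm (integral {a..t} ?f) <= ..." .
	have hle: "integral {a..t} (%s. norm (h s)) <= integral {a..x} (%s. norm (h s))"
	 by (rule integral_subset_le) (use t hi L1D(2)[OF hx] in auto)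
	have "norm (y t) <= norm (y a) * exp (?k * (t - a)) + norm (y' a) * (exp (?k * (t - a)) / norm z) + norm (integral {a..t} ?f)"
	proof -
	 have "norm (y t) <= norm (y a * cos (z * of_real (t - a))) + norm (y' a * (sin (z * of_real (t - a)) / z)) + norm (integral {a..t} ?f)"
		unfolding variation_of_constants[OF y y' z tb]
		by (intro order_trans[OF norm_triangle_ineq] add_right_mono norm_triangle_ineq)
	 also have "... <= norm (y a) * exp (?k * (t - a)) + norm (y' a) * (exp (?k * (t - a)) / norm z) + norm (integral {a..t} ?f)"
		using norm_sin_cos_real_le[of "t - a" z] hx0 unfolding norm_mult norm_divide
		by (intro add_mono mult_left_mono divide_right_mono) auto
	 finally show ?thesis .
	qed
	also have "... <= norm (y a) * exp (?k * (t - a)) + norm (y' a) * (exp (?k * (t - a)) / norm z) +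
	  (exp (?k * (t - a)) * integral {a..t} (%s. norm (R s) / norm z * ?u s) + exp (?k * x) / norm z * integral {a..x} (%s. norm (h s)))"
	 using 1 hle by (intro add_left_mono) (smt (verit) divide_nonneg_nonneg exp_ge_zero mult_left_mono norm_ge_zero)
	finally have 2: "norm (y t) <= ..." .
	have e: "exp (- ?k * (t - a)) * exp (?k * (t - a)) = 1" by (simp flip: exp_add)
	have e1: "exp (- ?k * (t - a)) <= 1" using hx0 by simp
	have "?u t <= exp (- ?k * (t - a)) * (norm (y a) * exp (?k * (t - a)) + norm (y' a) * (exp (?k * (t - a)) / norm z) +
	  (exp (?k * (t - a)) * integral {a..t} (%s. norm (R s) / norm z * ?u s) + exp (?k * x) / norm z * integral {a..x} (%s. norm (h s))))"
	 by (rule mult_left_mono[OF 2]) simp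
	also have "... = (exp (- ?k * (t - a)) * exp (?k * (t - a))) * (norm (y a) + norm (y' a) / norm z + integral {a..t} (%s. norm (R s) / norm z * ?u s))
	  + exp (- ?k * (t - a)) * (integral {a..x} (%s. norm (h s)) * exp (?k * x) / norm z)"
	 by (simp add: algebra_simps add_divide_distrib)
	also have "... <= (norm (y a) + norm (y' a) / norm z + integral {a..t} (%s. norm (R s) / norm z * ?u s))
	  + 1 * (integral {a..x} (%s. norm (h s)) * exp (?k * x) / norm z)"
	 unfolding e using e1 hk_nonneg[OF L1D(2)[OF hx order_refl order_refl]]
	 by (intro add_mono mult_right_mono) auto
	also have "... <= A + integral {a..t} (%s. norm (R s) / norm z * ?u s)"
	proof -
	 have "1 <= exp (?k * a)" using a0 by simp
	 then have "norm (y a) <= exp (?k * a) * norm (y a)" "norm (y' a) / norm z <= exp (?k * a) * norm (y' a) / norm z"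
		by (auto intro!: divide_right_mono simp: mult_le_cancel_right1)
	 then show ?thesis using A by simp
	qed
	finally show ?thesis .
 qed
 have "?u x <= A * exp (integral {a..x} (%s. norm (R s) / norm z))"
	by (rule gronwall[OF w _ cu step A0]) (use x in auto)
 also have "... <= A * exp M"
 proof (intro mult_left_mono A0)
	have "integral {a..x} (%s. norm (R s)) <= integral {a..b} (%s. norm (R s))"
	 by (rule integral_subset_le) (use x L1D(2)[OF R] in auto)
	then have "integral {a..x} (%s. norm (R s)) / norm z <= M" using M z by (simp add: divide_le_eq)
	then show "exp (integral {a..x} (%s. norm (R s) / norm z)) <= exp M" by simp
 qed
 finally have u: "?u x <= A * exp M" .
 have "norm (y x) = ?u x * exp (?k * (x - a))" by (simp flip: exp_add)
 also have "... <= A * exp M * exp (?k * (x - a))" by (rule mult_right_mono[OF u]) simp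
 finally show ?thesis .
qed

lemma integral_norm_sl_coeff_le:
 assumes q: "unit_L1 q" and X: "X \<in> {0..1}"
 shows "integral {0..X} (%y. norm (sl_coeff q lam y)) <= integral {0..X} (%y. \<bar>q y\<bar>) + norm lam * X"
proof -
 have iq: "(%y. \<bar>q y\<bar>) integrable_on {0..X}" using L1D(2)[OF q, of 0 X] X by simp
 have "integral {0..X} (%y. norm (sl_coeff q lam y)) <= integral {0..X} (%y. \<bar>q y\<bar> + norm lam)"
 proof (rule integral_le)
	fix y show "norm (sl_coeff q lam y) <= \<bar>q y\<bar> + norm lam" unfolding sl_coeff_def
	 using norm_triangle_ineq4[of "of_real (q y)" lam] by simp
 qed (use L1D(2)[OF sl_coeff_integrable[OF q]] iq X in \<open>auto intro!: integrable_add\<close>)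
 also have "... = integral {0..X} (%y. \<bar>q y\<bar>) + norm lam * X"
	using X by (subst hk_add[OF iq]) auto
 finally show ?thesis .
qed

text \<open>On \<open>[0,X]\<close> with \<open>|\<lambda>| X\<^sup>2 \<le> 1\<close> also the spectral parameter is a bounded perturbation.\<close>
lemma reg_sol_small:
 assumes q: "unit_L1 q" and X: "0 <= X" "X <= 1" and small: "norm lam * X\<^sup>2 <= 1"
	and x: "x \<in> {0..X}"
 shows "norm (reg_sol l (sl_coeff q lam) x) <= exp (integral {0..1} (%y. \<bar>q y\<bar>) + 1)"
proof -
 let ?r = "sl_coeff q lam" let ?v = "reg_sol l ?r"
 note r = sl_coeff_integrable[OF q, of lam]
 have iq: "(%y. \<bar>q y\<bar>) integrable_on {0..1}" using L1D(2)[OF q, of 0 1] by simp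
 have "norm (?v x) <= 1 * exp (integral {0..x} (%y. X * norm (?r y)))"
 proof (rule gronwall[where a = 0 and b = X])
	show "(%y. X * norm (?r y)) absolutely_integrable_on {0..X}"
	 using L1D(4)[OF r, of 0 X] X by simp
	show "continuous_on {0..X} (%x. norm (?v x))"
	 using continuous_on_subset[OF continuous_reg_sol[OF r]] X by (intro continuous_on_norm) auto
	fix y assume y: "y \<in> {0..X}"
	then have y1: "y \<in> {0..1}" using X by auto
	have "norm (?v y) <= norm (1::complex) + norm (reg_op l ?r ?v y)"
	 using reg_sol_eq[OF r y1, of l] norm_triangle_ineq by metis
	also have "norm (reg_op l ?r ?v y) <= y * integral {0..y} (%y. norm (?r y) * norm (?v y))"
	 by (rule norm_reg_op_le[OF r continuous_reg_sol[OF r] y1])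
	also have "... <= X * integral {0..y} (%y. norm (?r y) * norm (?v y))"
	 using y y1 by (intro mult_right_mono hk_nonneg
		L1D(1)[OF norm_mult_integrable[OF r continuous_reg_sol[OF r]]]) auto
	finally show "norm (?v y) <= 1 + integral {0..y} (%y. X * norm (?r y) * norm (?v y))"
	 by (simp add: mult.assoc)
 qed (use x X in auto)
 also have "... <= exp (integral {0..1} (%y. \<bar>q y\<bar>) + 1)"
 proof -
	have "integral {0..x} (%y. norm (?r y)) <= integral {0..X} (%y. norm (?r y))"
	 by (rule integral_subset_le) (use x X L1D(2)[OF r] in auto)
	also have "... <= integral {0..X} (%y. \<bar>q y\<bar>) + norm lam * X"
	 by (rule integral_norm_sl_coeff_le[OF q]) (use X in auto)
	also have "integral {0..X} (%y. \<bar>q y\<bar>) <= integral {0..1} (%y. \<bar>q y\<bar>)"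
	 by (rule integral_subset_le) (use X iq L1D(2)[OF q, of 0 X] in auto)
	finally have "X * integral {0..x} (%y. norm (?r y)) <= X * (integral {0..1} (%y. \<bar>q y\<bar>) + norm lam * X)"
	 using X by (intro mult_left_mono) auto
	also have "... = X * integral {0..1} (%y. \<bar>q y\<bar>) + norm lam * X\<^sup>2" by (simp add: algebra_simps power2_eq_square)
	also have "... <= 1 * integral {0..1} (%y. \<bar>q y\<bar>) + 1"
	 using X small by (intro add_mono mult_right_mono hk_nonneg iq) auto
	finally show ?thesis by simp
 qed
 finally show ?thesis .
qed

lemma integral_inverse_square_le:
 fixes a c :: real
 assumes "0 < a" "a <= 1"
 shows "(%s. c / s\<^sup>2) integrable_on {a..1}" "0 <= c ==> integral {a..1} (%s. c / s\<^sup>2) <= c / a"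
proof -
 have "((%s. c / s\<^sup>2) has_integral ((- c / 1) - (- c / a))) {a..1}"
 proof (rule fundamental_theorem_of_calculus[OF assms(2)])
	fix s assume "s \<in> {a..1}"
	then have "s ~= 0" using assms by auto
	then have "((%s. - c / s) has_real_derivative c / s\<^sup>2) (at s within {a..1})"
	 by (auto intro!: derivative_eq_intros simp: field_simps power2_eq_square)
	then show "((%s. - c / s) has_vector_derivative c / s\<^sup>2) (at s within {a..1})"
	 by (simp add: has_real_derivative_iff_has_vector_derivative)
 qed
 then show "(%s. c / s\<^sup>2) integrable_on {a..1}" "0 <= c ==> integral {a..1} (%s. c / s\<^sup>2) <= c / a"
	by (auto simp: has_integral_iff)
qed

lemma wronskian_reg_sol:
 assumes r: "unit_L1 r" and s: "unit_L1 s"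
 shows "reg_sol l r 1 * reg_flux l s (reg_sol l s) 1 - reg_flux l r (reg_sol l r) 1 * reg_sol l s 1 =
	integral {0..1} (%x. of_real (x ^ (2*l+2)) * (s x - r x) * (reg_sol l r x * reg_sol l s x))"
proof -
 let ?v = "reg_sol l r" and ?w = "reg_sol l s"
 let ?m = "reg_flux l r ?v" and ?n = "reg_flux l s ?w"
 have ac: "ac_on 0 1 (reg_sol l r) (%x. reg_flux l r (reg_sol l r) x / of_real (x ^ (2*l+2)))"
	if "unit_L1 r" for r
	by (rule ac_onI_C1[OF _ continuous_reg_density[OF that continuous_reg_sol[OF that]]
		reg_sol_has_vector_derivative[OF that]]) auto
 have "ac_on 0 1 (%x. ?v x * ?n x - ?m x * ?w x)
	 (%x. (?m x / of_real (x ^ (2*l+2)) * ?n x + ?v x * (of_real (x ^ (2*l+2)) * s x * ?w x)) -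
		(of_real (x ^ (2*l+2)) * r x * ?v x * ?w x + ?m x * (?n x / of_real (x ^ (2*l+2)))))"
	by (intro ac_on_diff ac_on_mult ac r s ac_reg_flux continuous_reg_sol)
 then have "ac_on 0 1 (%x. ?v x * ?n x - ?m x * ?w x)
	 (%x. of_real (x ^ (2*l+2)) * (s x - r x) * (?v x * ?w x))"
	by (rule ac_on_cong) (auto simp: algebra_simps)
 from ac_onD(3)[OF this, of 1] show ?thesis by (simp add: reg_flux_def)
qed

lemma reg_flux_coeff_diff:
 assumes s: "unit_L1 s" and r: "unit_L1 r"
	and v: "continuous_on {0..1} v" "continuous_on {0..1} w" and x: "x \<in> {0..1}"
 shows "reg_flux l s v x - reg_flux l r w x =
	reg_flux l s (%y. v y - w y) x + reg_flux l (%y. s y - r y) w x"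
proof -
 note i = L1D(1)[OF reg_integrand, of _ _ 0 x]
 have sr: "(%y. s y - r y) absolutely_integrable_on {0..1}" by (rule set_integral_diff(1)[OF s r])
 have c: "continuous_on {0..1} (%y. v y - w y)" using v by (intro continuous_intros)
 have "reg_flux l s v x - reg_flux l r w x = integral {0..x} (%y. of_real (y ^ (2*l+2)) * s y * v y - of_real (y ^ (2*l+2)) * r y * w y)"
	unfolding reg_flux_def using x
	by (intro hk_diff[symmetric] i s r v) auto
 also have "... = integral {0..x} (%y. of_real (y ^ (2*l+2)) * s y * (v y - w y) + of_real (y ^ (2*l+2)) * (s y - r y) * w y)"
	by (simp add: algebra_simps)
 also have "... = reg_flux l s (%y. v y - w y) x + reg_flux l (%y. s y - r y) w x"
	unfolding reg_flux_def using x
	by (intro hk_add i s sr v c) auto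
 finally show ?thesis .
qed

lemma reg_sol_diff:
 fixes l :: nat and r s :: "real => complex"
 assumes s: "unit_L1 s" and r: "unit_L1 r" and x: "x \<in> {0..1}"
 defines "d \<equiv> %y. reg_sol l s y - reg_sol l r y"
 shows "d x = reg_op l s d x + reg_op l (%y. s y - r y) (reg_sol l r) x"
proof -
 let ?v = "reg_sol l s" and ?w = "reg_sol l r" and ?e = "%y. s y - r y"
 note c = continuous_reg_sol[OF s, of l] continuous_reg_sol[OF r, of l]
 have e: "unit_L1 ?e" by (rule set_integral_diff(1)[OF s r])
 have cd: "continuous_on {0..1} d" unfolding d_def by (intro continuous_intros c)
 have i: "(%s. reg_flux l r v s / of_real (s ^ (2*l+2))) integrable_on {0..x}"
	if "unit_L1 r" "continuous_on {0..1} v" for r v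
	by (rule integrable_continuous_interval[OF continuous_on_subset[OF continuous_reg_density[OF that]]])
	  (use x in auto)
 have "d x = reg_op l s ?v x - reg_op l r ?w x"
	unfolding d_def using reg_sol_eq[OF s x, of l] reg_sol_eq[OF r x, of l] by simp
 also have "... = integral {0..x} (%y. reg_flux l s ?v y / of_real (y ^ (2*l+2)) - reg_flux l r ?w y / of_real (y ^ (2*l+2)))"
	unfolding reg_op_def by (intro hk_diff[symmetric] i s r c)
 also have "... = integral {0..x} (%y. reg_flux l s d y / of_real (y ^ (2*l+2)) + reg_flux l ?e ?w y / of_real (y ^ (2*l+2)))"
	by (rule hk_cong)
	  (use reg_flux_coeff_diff[OF s r c, of _ l] x in
		 \<open>auto simp: d_def simp del: of_real_power power_Suc simp flip: diff_divide_distrib add_divide_distrib\<close>)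
 also have "... = reg_op l s d x + reg_op l ?e ?w x"
	unfolding reg_op_def by (intro hk_add i s e cd c)
 finally show ?thesis .
qed

text \<open>Continuity in the spectral parameter with a uniform rate: the difference of two solutions solves the integral
equation with a source of size \<open>\<bar>mu - lam\<bar>\<close>, and Gronwall's inequality bounds it.\<close>

lemma reg_sol_lipschitz:
 assumes q: "unit_L1 q"
 obtains C where "C \<ge> 0"
	"!!mu x. norm (mu - lam) <= 1 ==> x \<in> {0..1} ==>
	 norm (reg_sol l (sl_coeff q mu) x - reg_sol l (sl_coeff q lam) x) <= C * norm (mu - lam)"
	"!!mu. norm (mu - lam) <= 1 ==>
	 norm (reg_flux l (sl_coeff q mu) (reg_sol l (sl_coeff q mu)) 1 -
			reg_flux l (sl_coeff q lam) (reg_sol l (sl_coeff q lam)) 1) <= C * norm (mu - lam)"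
proof -
 let ?r = "%mu. sl_coeff q mu" and ?v = "%mu. reg_sol l (sl_coeff q mu)"
 note r = sl_coeff_integrable[OF q]
 define M where "M = integral {0..1} (%y. \<bar>q y\<bar>) + norm lam + 1"
 have iq: "(%y. \<bar>q y\<bar>) integrable_on {0..1}" using L1D(2)[OF q, of 0 1] by simp
 have M: "integral {0..1} (%y. norm (?r mu y)) <= M" if "norm (mu - lam) <= 1" for mu
 proof -
	have "integral {0..1} (%y. norm (?r mu y)) <= integral {0..1} (%y. \<bar>q y\<bar> + (norm lam + 1))"
	proof (rule integral_le)
	 fix y
	 have "norm (?r mu y) <= \<bar>q y\<bar> + norm mu" unfolding sl_coeff_def
		using norm_triangle_ineq4[of "of_real (q y)" mu] by simp
	 also have "norm mu <= norm lam + 1" using that norm_triangle_ineq2[of mu lam] by linarith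
	 finally show "norm (?r mu y) <= \<bar>q y\<bar> + (norm lam + 1)" by simp
	qed (use L1D(2)[OF r] iq in \<open>auto intro!: integrable_add\<close>)
	also have "... = M" unfolding M_def
	 by (subst hk_add[OF iq]) auto
	finally show ?thesis .
 qed
 have M0: "0 <= M" unfolding M_def
	by (intro add_nonneg_nonneg hk_nonneg iq) auto
 have main: "norm (?v mu x - ?v lam x) <= (exp M * exp M) * norm (mu - lam)"
	"norm (reg_flux l (?r mu) (?v mu) 1 - reg_flux l (?r lam) (?v lam) 1) <= (M * (exp M * exp M) + exp M) * norm (mu - lam)"
	if mu: "norm (mu - lam) <= 1" and x: "x \<in> {0..1}" for mu x
 proof -
	let ?d = "%y. ?v mu y - ?v lam y" and ?e = "%y. ?r mu y - ?r lam y"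
	have cd: "continuous_on {0..1} ?d" by (intro continuous_intros continuous_reg_sol r)
	have e: "unit_L1 ?e" by (rule set_integral_diff(1)[OF r r])
	have ev: "integral {0..y} (%y. norm (?e y) * norm (?v lam y)) <= exp M * norm (mu - lam)" if y: "y \<in> {0..1}" for y
	proof -
	 have "integral {0..y} (%y. norm (?e y) * norm (?v lam y)) <= integral {0..y} (%y. exp M * norm (mu - lam))"
	 proof (rule integral_le)
		show "(%y. norm (?e y) * norm (?v lam y)) integrable_on {0..y}"
		 by (rule L1D(1)[OF norm_mult_integrable[OF e continuous_reg_sol[OF r]]]) (use y in auto)
		fix z assume "z \<in> {0..y}"
		then have "norm (?v lam z) <= exp M" using y by (intro norm_reg_sol_le r M) auto
		moreover have "norm (?e z) = norm (mu - lam)" by (simp add: sl_coeff_def norm_minus_commute)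
		ultimately show "norm (?e z) * norm (?v lam z) <= exp M * norm (mu - lam)"
		 by (metis mult.commute mult_left_mono norm_ge_zero)
	 qed auto
	 also have "... = y * (exp M * norm (mu - lam))" using y by simp
	 also have "... <= 1 * (exp M * norm (mu - lam))" using y by (intro mult_right_mono) auto
	 finally show ?thesis by simp
	qed
	have d: "norm (?d y) <= (exp M * norm (mu - lam)) * exp M" if y: "y \<in> {0..1}" for y
	proof -
	 have "norm (?d y) <= (exp M * norm (mu - lam)) * exp (integral {0..y} (%y. norm (?r mu y)))"
	 proof (rule gronwall[where a = 0 and b = 1])
		show "(%y. norm (?r mu y)) absolutely_integrable_on {0..1}"
		 using L1D(4)[OF r order_refl order_refl] .
		show "continuous_on {0..1} (%y. norm (?d y))" using cd by (intro continuous_on_norm)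
		fix z :: real assume z: "z \<in> {0..1}"
		have "norm (?d z) <= norm (reg_op l (?r mu) ?d z) + norm (reg_op l ?e (?v lam) z)"
		 using reg_sol_diff[OF r[of mu] r[of lam] z, of l] norm_triangle_ineq by metis
		then show "norm (?d z) <= exp M * norm (mu - lam) + integral {0..z} (%y. norm (?r mu y) * norm (?d y))"
		 using norm_reg_op_le'[OF r[of mu] cd z, of l] norm_reg_op_le'[OF e continuous_reg_sol[OF r[of lam], of l] z, of l] ev[OF z]
		 by linarith
	 qed (use y in auto)
	 also have "... <= (exp M * norm (mu - lam)) * exp M"
	 proof (intro mult_left_mono)
		have "integral {0..y} (%y. norm (?r mu y)) <= integral {0..1} (%y. norm (?r mu y))"
		 by (rule integral_subset_le) (use y L1D(2)[OF r] in auto)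
		then show "exp (integral {0..y} (%y. norm (?r mu y))) <= exp M" using M[OF mu] by simp
	 qed auto
	 finally show ?thesis .
	qed
	show "norm (?v mu x - ?v lam x) <= (exp M * exp M) * norm (mu - lam)"
	 using d[OF x] by (simp add: mult_ac)
	have "norm (reg_flux l (?r mu) (?v mu) 1 - reg_flux l (?r lam) (?v lam) 1) <=
		norm (reg_flux l (?r mu) ?d 1) + norm (reg_flux l ?e (?v lam) 1)"
	 using reg_flux_coeff_diff[OF r[of mu] r[of lam] continuous_reg_sol[OF r[of mu], of l] continuous_reg_sol[OF r[of lam], of l], of 1 l]
		norm_triangle_ineq by simp
	also have "... <= integral {0..1} (%y. norm (?r mu y) * norm (?d y)) + exp M * norm (mu - lam)"
	 using norm_reg_flux_le[OF r[of mu] cd, of 1 l] norm_reg_flux_le[OF e continuous_reg_sol[OF r[of lam], of l], of 1 l] ev[of 1] by simp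
	also have "integral {0..1} (%y. norm (?r mu y) * norm (?d y)) <=
		integral {0..1} (%y. norm (?r mu y) * ((exp M * norm (mu - lam)) * exp M))"
	proof (rule integral_le)
	 show "(%y. norm (?r mu y) * norm (?d y)) integrable_on {0..1}"
		by (rule L1D(1)[OF norm_mult_integrable[OF r cd]]) auto
	 show "(%y. norm (?r mu y) * ((exp M * norm (mu - lam)) * exp M)) integrable_on {0..1}"
		by (intro integrable_on_mult_left L1D(2)[OF r]) auto
	qed (use d in \<open>auto intro!: mult_left_mono\<close>)
	also have "... = integral {0..1} (%y. norm (?r mu y)) * ((exp M * norm (mu - lam)) * exp M)" by simp
	also have "... <= M * ((exp M * norm (mu - lam)) * exp M)" by (intro mult_right_mono M mu) auto
	finally show "norm (reg_flux l (?r mu) (?v mu) 1 - reg_flux l (?r lam) (?v lam) 1) <= (M * (exp M * exp M) + exp M) * norm (mu - lam)"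
	 by (simp add: algebra_simps)
 qed
 show thesis
 proof (rule that[of "max (exp M * exp M) (M * (exp M * exp M) + exp M)"])
	show "0 <= max (exp M * exp M) (M * (exp M * exp M) + exp M)" by (simp add: le_max_iff_disj)
	show "norm (?v mu x - ?v lam x) <= max (exp M * exp M) (M * (exp M * exp M) + exp M) * norm (mu - lam)"
	 if "norm (mu - lam) <= 1" "x \<in> {0..1}" for mu x
	 by (rule order_trans[OF main(1)[OF that]]) (intro mult_right_mono, auto)
	show "norm (reg_flux l (?r mu) (?v mu) 1 - reg_flux l (?r lam) (?v lam) 1)
		<= max (exp M * exp M) (M * (exp M * exp M) + exp M) * norm (mu - lam)" if "norm (mu - lam) <= 1" for mu
	 by (rule order_trans[OF main(2)[OF that, of 1]]) (auto intro!: mult_right_mono)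
 qed
qed

text \<open>The integral \<open>\<integral> (qh - q) \<phi> \<phi>h\<close>, whose zeros encode the common spectral data.\<close>
definition prod_fun :: "nat => (real => real) => (real => real) => complex => complex"
 where "prod_fun l q qh mu = integral {0..1} (%x. of_real (x ^ (2*l+2)) * of_real (qh x - q x) *
	 (reg_sol l (sl_coeff q mu) x * reg_sol l (sl_coeff qh mu) x))"

lemma prod_fun_wronskian:
 assumes "unit_L1 q" "unit_L1 qh"
 shows "prod_fun l q qh mu =
	reg_sol l (sl_coeff q mu) 1 * reg_flux l (sl_coeff qh mu) (reg_sol l (sl_coeff qh mu)) 1 -
	reg_flux l (sl_coeff q mu) (reg_sol l (sl_coeff q mu)) 1 * reg_sol l (sl_coeff qh mu) 1"
 unfolding wronskian_reg_sol[OF sl_coeff_integrable[OF assms(1)] sl_coeff_integrable[OF assms(2)]] prod_fun_def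
 by (simp add: sl_coeff_def)

lemma prod_fun_eq_0:
 assumes "unit_L1 q" "unit_L1 qh"
	and "cplx lam \<in> sl_spectrum (real l) q \<beta>" "cplx lam \<in> sl_spectrum (real l) qh \<beta>"
 shows "prod_fun l q qh (of_real lam) = 0"
 using spectrum_reg_bc(1)[OF assms(1,3)] spectrum_reg_bc(1)[OF assms(2,4)]
 unfolding prod_fun_wronskian[OF assms(1,2)] reg_bc_def by (auto split: if_splits)

text \<open>To first order in \<open>mu - lam\<close>, the Wronskian at a common eigenvalue is the difference of the two integrals
\<open>\<integral> \<phi>^2\<close>, each divided by the square of the factor between \<open>\<phi>\<close> and the normalised \<open>\<psi>\<close>; these quotients are the
norming constants.\<close>

lemma prod_fun_double_zero:
 fixes lam :: real
 assumes q: "unit_L1 q" and qh: "unit_L1 qh"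
	and spec: "cplx lam \<in> sl_spectrum (real l) q \<beta>"
	and spech: "cplx lam \<in> sl_spectrum (real l) qh \<beta>"
	and norm_eq: "norming_const (real l) qh \<beta> (of_real lam) = norming_const (real l) q \<beta> (of_real lam)"
 shows "((%mu. prod_fun l q qh mu / (mu - of_real lam)) \<longlongrightarrow> 0) (at (of_real lam))"
proof -
 define L where "L = cplx lam"
 define v m where "v = (%q mu. reg_sol l (sl_coeff q mu) 1)"
	and "m = (%q mu. reg_flux l (sl_coeff q mu) (reg_sol l (sl_coeff q mu)) 1)"
 define k where "k = (%q. bc_scale \<beta> (v q L) (m q L))"
 define I where "I = (%q mu. integral {0..1} (%x. of_real (x ^ (2*l+2)) * (reg_sol l (sl_coeff q L) x * reg_sol l (sl_coeff q mu) x)))"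
 define z where "z = cplx (norming_const (real l) q \<beta> L)"
 have kq: "k q ~= 0" "k qh ~= 0"
	using spectrum_reg_bc(2)[OF q spec] spectrum_reg_bc(2)[OF qh spech] by (simp_all add: k_def v_def m_def L_def)
 have IL: "I q L = z * (k q)\<^sup>2" "I qh L = z * (k qh)\<^sup>2"
	using spectrum_reg_bc(3)[OF q spec] spectrum_reg_bc(3)[OF qh spech] norm_eq
	by (simp_all add: I_def z_def k_def v_def m_def L_def)
 have wr: "v q L * m q mu - m q L * v q mu = (L - mu) * I q mu" if "unit_L1 q" for q mu
 proof -
	have "v q L * m q mu - m q L * v q mu = integral {0..1} (%x. (L - mu) * (of_real (x ^ (2*l+2)) * (reg_sol l (sl_coeff q L) x * reg_sol l (sl_coeff q mu) x)))"
	 unfolding v_def m_def wronskian_reg_sol[OF sl_coeff_integrable[OF that] sl_coeff_integrable[OF that]]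
	 by (simp add: sl_coeff_def mult_ac)
	then show ?thesis by (simp add: I_def)
 qed
 have tI: "(I q \<longlongrightarrow> I q L) (at L)" if q: "unit_L1 q" for q
 proof -
	obtain C where C: "C \<ge> 0" "!!mu x. norm (mu - L) <= 1 ==> x \<in> {0..1} ==>
	 norm (reg_sol l (sl_coeff q mu) x - reg_sol l (sl_coeff q L) x) <= C * norm (mu - L)"
	 using reg_sol_lipschitz[OF q, of L l] by metis
	note c = continuous_reg_sol[OF sl_coeff_integrable[OF q]]
	obtain B where B: "!!x. x \<in> {0..1} ==> norm (reg_sol l (sl_coeff q L) x) <= B"
	 using norm_reg_sol_le[OF sl_coeff_integrable[OF q] _ order_refl] by blast
	have B0: "0 <= B" using order_trans[OF norm_ge_zero B[of 0]] by simp
	have "norm (I q mu - I q L) <= B * C * norm (mu - L)" if mu: "norm (mu - L) <= 1" for mu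
	proof -
	 let ?g = "%mu x. of_real (x ^ (2*l+2)) * (reg_sol l (sl_coeff q L) x * reg_sol l (sl_coeff q mu) x)"
	 have i: "?g mu integrable_on {0..1}" for mu
		by (intro integrable_continuous_interval continuous_intros c)
	 have "norm (I q mu - I q L) = norm (integral {0..1} (%x. ?g mu x - ?g L x))"
		unfolding I_def by (subst hk_diff[OF i i]) simp
	 also have "... <= integral {0..1} (%x::real. B * C * norm (mu - L))"
	 proof (rule integral_norm_bound_integral)
		fix x :: real assume x: "x \<in> {0..1}"
		have "?g mu x - ?g L x = of_real (x ^ (2*l+2)) * reg_sol l (sl_coeff q L) x * (reg_sol l (sl_coeff q mu) x - reg_sol l (sl_coeff q L) x)"
		 by (simp add: algebra_simps)
		also have "norm ... = \<bar>x ^ (2*l+2)\<bar> * norm (reg_sol l (sl_coeff q L) x) * norm (reg_sol l (sl_coeff q mu) x - reg_sol l (sl_coeff q L) x)"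
		 by (simp only: norm_mult norm_of_real)
		also have "... <= 1 * B * (C * norm (mu - L))"
		proof (intro mult_mono B[OF x] C(2)[OF mu x])
		 have "0 <= x ^ (2*l+2)" "x ^ (2*l+2) <= 1" using x by (auto intro: zero_le_power power_le_one simp del: power_Suc)
		 then show "\<bar>x ^ (2*l+2)\<bar> <= 1" by linarith
		qed (use B0 in auto)
		finally show "norm (?g mu x - ?g L x) <= B * C * norm (mu - L)" by simp
	 qed (intro integrable_diff i, auto)
	 finally show ?thesis by simp
	qed
	then have "\<forall>\<^sub>F mu in at L. norm (I q mu - I q L) <= B * C * norm (mu - L)"
	 unfolding eventually_at by (intro exI[of _ 1]) (auto simp: dist_norm)
	moreover have "((%mu. B * C * norm (mu - L)) \<longlongrightarrow> B * C * norm (L - L)) (at L)" by (intro tendsto_intros)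
	then have "((%mu. B * C * norm (mu - L)) \<longlongrightarrow> 0) (at L)" by simp
	ultimately have "((%mu. I q mu - I q L) \<longlongrightarrow> 0) (at L)"
	 by (rule Lim_null_comparison)
	then show ?thesis by (simp add: LIM_zero_iff)
 qed
 have prp: "v qh L = (k qh / k q) * v q L" "m qh L = (k qh / k q) * m q L"
	"v q L = (k q / k qh) * v qh L" "m q L = (k q / k qh) * m qh L"
	using spectrum_reg_bc(1)[OF q spec] spectrum_reg_bc(1)[OF qh spech] kq
	by (auto simp: reg_bc_def k_def bc_scale_def v_def m_def L_def split: if_splits)
 let ?W = "%mu. (v q mu - v q L) * (m qh mu - m qh L) - (m q mu - m q L) * (v qh mu - v qh L)"
 have F: "prod_fun l q qh mu = ?W mu + (k q / k qh) * ((L - mu) * I qh mu) - (k qh / k q) * ((L - mu) * I q mu)" for mu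
 proof -
	have 1: "(k q / k qh) * ((L - mu) * I qh mu) = v q L * m qh mu - m q L * v qh mu"
	 unfolding wr[OF qh, symmetric] using prp(3,4) by (simp add: algebra_simps)
	have 2: "(k qh / k q) * ((L - mu) * I q mu) = v qh L * m q mu - m qh L * v q mu"
	 unfolding wr[OF q, symmetric] using prp(1,2) by (simp add: algebra_simps)
	have 3: "v q L * m qh L - m q L * v qh L = 0" using prp(1,2) by simp
	have 4: "prod_fun l q qh mu = v q mu * m qh mu - m q mu * v qh mu"
	 unfolding prod_fun_wronskian[OF q qh] v_def m_def ..
	show ?thesis unfolding 1 2 4 using 3 by (simp add: algebra_simps)
 qed
 obtain C1 where C1: "C1 \<ge> 0" "!!mu. norm (mu - L) <= 1 ==> norm (v q mu - v q L) <= C1 * norm (mu - L)"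
	 "!!mu. norm (mu - L) <= 1 ==> norm (m q mu - m q L) <= C1 * norm (mu - L)"
	using reg_sol_lipschitz[OF q, of L l] unfolding v_def m_def by (metis atLeastAtMost_iff order_refl zero_le_one)
 obtain C2 where C2: "C2 \<ge> 0" "!!mu. norm (mu - L) <= 1 ==> norm (v qh mu - v qh L) <= C2 * norm (mu - L)"
	 "!!mu. norm (mu - L) <= 1 ==> norm (m qh mu - m qh L) <= C2 * norm (mu - L)"
	using reg_sol_lipschitz[OF qh, of L l] unfolding v_def m_def by (metis atLeastAtMost_iff order_refl zero_le_one)
 have "((%mu. ?W mu / (mu - L)) \<longlongrightarrow> 0) (at L)"
 proof (rule Lim_null_comparison)
	show "\<forall>\<^sub>F mu in at L. norm (?W mu / (mu - L)) <= 2 * C1 * C2 * norm (mu - L)"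
	 unfolding eventually_at
	proof (intro exI[of _ 1] conjI ballI impI)
	 fix mu assume "mu ~= L & dist mu L < 1"
	 then have mu: "mu ~= L" "norm (mu - L) <= 1" by (auto simp: dist_norm)
	 let ?n = "norm (mu - L)"
	 have "norm (?W mu) <= norm (v q mu - v q L) * norm (m qh mu - m qh L) + norm (m q mu - m q L) * norm (v qh mu - v qh L)"
		by (metis norm_mult norm_triangle_ineq4)
	 also have "... <= (C1 * ?n) * (C2 * ?n) + (C1 * ?n) * (C2 * ?n)"
		using C1 C2 mu by (intro add_mono mult_mono) auto
	 finally have "norm (?W mu) <= (2 * C1 * C2 * ?n) * ?n" by (simp add: algebra_simps)
	 then show "norm (?W mu / (mu - L)) <= 2 * C1 * C2 * ?n"
		using mu by (simp add: norm_divide divide_le_eq)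
	qed auto
	have "((%mu. 2 * C1 * C2 * norm (mu - L)) \<longlongrightarrow> 2 * C1 * C2 * norm (L - L)) (at L)" by (intro tendsto_intros)
	then show "((%mu. 2 * C1 * C2 * norm (mu - L)) \<longlongrightarrow> 0) (at L)" by simp
 qed
 then have T1: "((%mu. ?W mu / (mu - L) - (k q / k qh) * I qh mu + (k qh / k q) * I q mu) \<longlongrightarrow>
	 0 - (k q / k qh) * I qh L + (k qh / k q) * I q L) (at L)"
	by (intro tendsto_intros tI q qh)
 have T2: "0 - (k q / k qh) * I qh L + (k qh / k q) * I q L = 0"
	using kq by (simp add: IL power2_eq_square)
 have T3: "\<forall>\<^sub>F mu in at L. ?W mu / (mu - L) - (k q / k qh) * I qh mu + (k qh / k q) * I q mu = prod_fun l q qh mu / (mu - L)"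
	unfolding eventually_at
 proof (intro exI[of _ 1] conjI ballI impI)
	fix mu assume "mu ~= L & dist mu L < 1"
	then have n: "mu - L ~= 0" "L - mu = - (mu - L)" by auto
	show "?W mu / (mu - L) - (k q / k qh) * I qh mu + (k qh / k q) * I q mu = prod_fun l q qh mu / (mu - L)"
	 unfolding F n(2) using n(1) kq by (simp add: field_simps)
 qed auto
 show ?thesis using Lim_transform_eventually[OF T1[unfolded T2] T3] unfolding L_def .
qed

lemma phi_small:
 assumes q: "unit_L1 q" and X: "0 < X" "X <= 1" and small: "norm lam * X\<^sup>2 <= 1"
 defines "N0 \<equiv> integral {0..1} (%y. \<bar>q y\<bar>)"
 shows "norm (phi l q lam X) <= X ^ (l+1) * exp (N0 + 1)"
	and "norm (phi' l q lam X) <= X ^ l * ((real l + 2 + N0) * exp (N0 + 1))"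
proof -
 let ?r = "sl_coeff q lam" let ?v = "reg_sol l ?r" let ?m = "reg_flux l ?r ?v" let ?K = "exp (N0 + 1)"
 note r = sl_coeff_integrable[OF q, of lam]
 have v: "norm (?v x) <= ?K" if "x \<in> {0..X}" for x
	unfolding N0_def by (rule reg_sol_small[OF q _ X(2) small that]) (use X in auto)
 then show "norm (phi l q lam X) <= X ^ (l+1) * ?K"
	unfolding phi_def norm_mult norm_of_real using X by (intro mult_mono) auto
 have iq: "(%y. \<bar>q y\<bar>) integrable_on {0..1}" using L1D(2)[OF q, of 0 1] by simp
 have "norm (?m X) <= X ^ (2*l+2) * integral {0..X} (%y. norm (?r y) * norm (?v y))"
	by (rule norm_reg_flux_le[OF r continuous_reg_sol[OF r]]) (use X in auto)
 also have "... <= X ^ (2*l+2) * integral {0..X} (%y. norm (?r y) * ?K)"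
 proof (intro mult_left_mono integral_le)
	show "(%y. norm (?r y) * norm (?v y)) integrable_on {0..X}"
	 by (rule L1D(1)[OF norm_mult_integrable[OF r continuous_reg_sol[OF r]]]) (use X in auto)
	show "(%y. norm (?r y) * ?K) integrable_on {0..X}"
	 using X by (intro integrable_on_mult_left L1D(2)[OF r]) auto
 qed (use v X in auto)
 also have "integral {0..X} (%y. norm (?r y) * ?K) = integral {0..X} (%y. norm (?r y)) * ?K" by simp
 also have "X ^ (2*l+2) * ... <= X ^ (2*l+2) * ((N0 + norm lam * X) * ?K)"
 proof (intro mult_left_mono mult_right_mono)
	have "integral {0..X} (%y. norm (?r y)) <= integral {0..X} (%y. \<bar>q y\<bar>) + norm lam * X"
	 by (rule integral_norm_sl_coeff_le[OF q]) (use X in auto)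
	also have "integral {0..X} (%y. \<bar>q y\<bar>) <= N0" unfolding N0_def
	 by (rule integral_subset_le) (use X iq L1D(2)[OF q, of 0 X] in auto)
	finally show "integral {0..X} (%y. norm (?r y)) <= N0 + norm lam * X" by simp
 qed (use X in auto)
 finally have m: "norm (?m X) <= X ^ (2*l+2) * ((N0 + norm lam * X) * ?K)" .
 have N0: "0 <= N0" unfolding N0_def by (intro hk_nonneg iq) auto
 have "norm (phi' l q lam X) <= \<bar>(real l + 1) * X ^ l\<bar> * norm (?v X) + \<bar>inverse (X ^ (l+1))\<bar> * norm (?m X)"
	unfolding phi'_def by (intro order_trans[OF norm_triangle_ineq]) (simp only: norm_mult norm_of_real order_refl)
 also have "\<bar>(real l + 1) * X ^ l\<bar> = (real l + 1) * X ^ l" using X by (intro abs_of_nonneg) auto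
 also have "\<bar>inverse (X ^ (l+1))\<bar> = inverse (X ^ (l+1))" using X by (intro abs_of_nonneg) auto
 also have "(real l + 1) * X ^ l * norm (?v X) + inverse (X ^ (l+1)) * norm (?m X) <= (real l + 1) * X ^ l * ?K + inverse (X ^ (l+1)) * (X ^ (2*l+2) * ((N0 + norm lam * X) * ?K))"
	using v[of X] m X by (intro add_mono mult_left_mono) auto
 also have "inverse (X ^ (l+1)) * (X ^ (2*l+2) * ((N0 + norm lam * X) * ?K)) = X ^ l * ((X * N0 + norm lam * X\<^sup>2) * ?K)"
 proof -
	have "X ^ (2*l+2) = X ^ (l+1) * (X ^ l * X)" by (simp add: mult_2 power_add)
	moreover have "inverse P * (P * Q * Y) = Q * Y" if "P ~= 0" for P Q Y :: real using that by simp
	moreover have "X ^ (l+1) ~= 0" using X by simp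
	ultimately have "inverse (X ^ (l+1)) * (X ^ (2*l+2) * Y) = X ^ l * (X * Y)" for Y by (metis mult.assoc)
	note this[of "(N0 + norm lam * X) * ?K"]
	also have "X ^ l * (X * ((N0 + norm lam * X) * ?K)) = X ^ l * ((X * N0 + norm lam * X\<^sup>2) * ?K)"
	 by (simp add: power2_eq_square algebra_simps)
	finally show ?thesis .
 qed
 also have "(real l + 1) * X ^ l * ?K + ... <= (real l + 1) * X ^ l * ?K + X ^ l * ((1 * N0 + 1) * ?K)"
	using X small N0 by (intro add_left_mono mult_left_mono mult_right_mono add_mono) auto
 also have "... = X ^ l * ((real l + 2 + N0) * ?K)" by (simp add: algebra_simps)
 finally show "norm (phi' l q lam X) <= X ^ l * ((real l + 2 + N0) * exp (N0 + 1))" .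
qed

lemma ac_on_scaled_phi:
 assumes q: "unit_L1 q" and a: "0 < a" "a <= 1"
 shows "ac_on a 1 (%x. c * phi l q (z\<^sup>2) x) (%x. c * phi' l q (z\<^sup>2) x)"
	and "ac_on a 1 (%x. c * phi' l q (z\<^sup>2) x)
	 (%x. ((of_real (real l * (real l + 1) / x\<^sup>2) + of_real (q x)) - z\<^sup>2) * (c * phi l q (z\<^sup>2) x) + 0)"
proof -
 show "ac_on a 1 (%x. c * phi l q (z\<^sup>2) x) (%x. c * phi' l q (z\<^sup>2) x)"
	by (intro ac_on_cmult ac_on_phi assms)
 show "ac_on a 1 (%x. c * phi' l q (z\<^sup>2) x)
	 (%x. ((of_real (real l * (real l + 1) / x\<^sup>2) + of_real (q x)) - z\<^sup>2) * (c * phi l q (z\<^sup>2) x) + 0)"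
	by (rule ac_on_cong[OF ac_on_cmult[OF ac_on_phi(2)[OF assms], of c l "z\<^sup>2"]])
	  (auto simp: sl_coeff_def algebra_simps)
qed

lemma of_real_integrable:
 assumes "f absolutely_integrable_on {a..b}"
 shows "(%x. cplx (f x)) absolutely_integrable_on {a..b}"
 using absolutely_integrable_linear[OF assms, of cplx] bounded_linear_of_real
 by (simp add: o_def)

lemma integral_centrifugal_le:
 assumes q: "unit_L1 q" and a: "0 < a" "a <= 1"
 shows "(%x. cplx (c / x\<^sup>2) + of_real (q x)) absolutely_integrable_on {a..1}"
	and "0 <= c ==> integral {a..1} (%s. norm (cplx (c / s\<^sup>2) + of_real (q s)))
	  <= c / a + integral {0..1} (%y. \<bar>q y\<bar>)"
proof -
 show ai: "(%x. cplx (c / x\<^sup>2) + of_real (q x)) absolutely_integrable_on {a..1}"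
	using sl_potential_integrable[OF q a(1), of c 0] by (simp add: sl_coeff_def)
 have iq: "(%y. \<bar>q y\<bar>) integrable_on {a..1}" "(%y. \<bar>q y\<bar>) integrable_on {0..1}"
	using L1D(2)[OF q] a by auto
 assume c: "0 <= c"
 have "integral {a..1} (%s. norm (cplx (c / s\<^sup>2) + of_real (q s))) <= integral {a..1} (%s. c / s\<^sup>2 + \<bar>q s\<bar>)"
 proof (rule integral_le)
	fix s
	have "norm (cplx (c / s\<^sup>2) + of_real (q s)) = \<bar>c / s\<^sup>2 + q s\<bar>" by (metis norm_of_real of_real_add)
	also have "... <= c / s\<^sup>2 + \<bar>q s\<bar>" using c by (simp add: abs_le_iff) (smt (verit) c divide_nonneg_nonneg zero_le_power2)
	finally show "norm (cplx (c / s\<^sup>2) + of_real (q s)) <= c / s\<^sup>2 + \<bar>q s\<bar>" .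
 qed (use L1D(2)[OF ai order_refl order_refl] iq integral_inverse_square_le(1)[OF a] in \<open>auto intro!: integrable_add\<close>)
 also have "... = integral {a..1} (%s. c / s\<^sup>2) + integral {a..1} (%s. \<bar>q s\<bar>)"
	by (rule hk_add[OF integral_inverse_square_le(1)[OF a] iq(1)])
 also have "... <= c / a + integral {0..1} (%y. \<bar>q y\<bar>)"
	using a by (intro add_mono integral_inverse_square_le(2)[OF a c] integral_subset_le iq) auto
 finally show "integral {a..1} (%s. norm (cplx (c / s\<^sup>2) + of_real (q s)))
	  <= c / a + integral {0..1} (%y. \<bar>q y\<bar>)" .
qed

theorem phi_growth:
 assumes q: "unit_L1 q"
 obtains C where "C \<ge> 0"
	"!!z x. x \<in> {0..1} ==> norm (z ^ (l+1) * phi l q (z\<^sup>2) x) <= C * exp (\<bar>Im z\<bar> * x)"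
proof -
 define N0 where "N0 = integral {0..1} (%y. \<bar>q y\<bar>)"
 define K where "K = exp (N0 + 1)"
 define M where "M = real l * (real l + 1) + N0"
 have iq: "(%y. \<bar>q y\<bar>) integrable_on {0..1}" using L1D(2)[OF q, of 0 1] by simp
 have N0: "0 <= N0" unfolding N0_def by (intro hk_nonneg iq) auto
 define A where "A = K + (real l + 2 + N0) * K"
 have K0: "0 < K" by (simp add: K_def)
 have A0: "0 <= A" using K0 N0 by (simp add: A_def)
 define C where "C = max K (exp 1 * A * exp M)"
 have C0: "0 <= C" using K0 by (simp add: C_def le_max_iff_disj less_imp_le)
 have "norm (z ^ (l+1) * phi l q (z\<^sup>2) x) <= C * exp (\<bar>Im z\<bar> * x)" if x: "x \<in> {0..1}" for z x
 proof (cases "norm z * x <= 1")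
	case True
	show ?thesis
	proof (cases "x = 0")
	 case False
	 then have x0: "0 < x" using x by auto
	 have "(norm z * x)\<^sup>2 <= 1" using True x by (simp add: power_le_one)
	 then have "norm (z\<^sup>2) * x\<^sup>2 <= 1" by (simp add: norm_power power_mult_distrib)
	 from phi_small(1)[OF q x0 _ this, of l] have "norm (phi l q (z\<^sup>2) x) <= x ^ (l+1) * K" using x by (simp add: K_def N0_def)
	 then have "norm (z ^ (l+1) * phi l q (z\<^sup>2) x) <= norm z ^ (l+1) * (x ^ (l+1) * K)"
		unfolding norm_mult norm_power by (intro mult_left_mono) auto
	 also have "... = (norm z * x) ^ (l+1) * K" by (simp add: power_mult_distrib)
	 also have "... <= 1 * K" using True x K0 by (intro mult_right_mono power_le_one) auto
	 also have "... <= C * exp (\<bar>Im z\<bar> * x)"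
		using mult_mono[of K C 1 "exp (\<bar>Im z\<bar> * x)"] C0 x by (simp add: C_def)
	 finally show ?thesis .
	qed (use C0 in \<open>simp add: phi_def\<close>)
 next
	case False
	define X where "X = 1 / norm z"
	have x0: "0 < x" using False x by (cases "x = 0") auto
	have z: "z ~= 0" "norm z > 0" using False by auto
	have "norm z * x <= norm z * 1" using x by (intro mult_left_mono) auto
	then have z1: "1 <= norm z" using False by linarith
	have X: "0 < X" "X <= x" "X <= 1" using False z z1 by (auto simp: X_def field_simps)
	have small: "norm (z\<^sup>2) * X\<^sup>2 <= 1" using z by (simp add: X_def norm_power power_divide)
	have "norm z * X = 1" using z by (simp add: X_def)
	then have zX: "norm z ^ n * X ^ n = 1" for n by (metis power_mult_distrib power_one)
	have y: "norm (z ^ (l+1) * phi l q (z\<^sup>2) X) <= K"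
	proof -
	 have "norm (z ^ (l+1) * phi l q (z\<^sup>2) X) <= norm z ^ (l+1) * (X ^ (l+1) * K)"
		unfolding norm_mult norm_power K_def N0_def by (intro mult_left_mono phi_small(1)[OF q X(1,3) small]) auto
	 also have "... = (norm z ^ (l+1) * X ^ (l+1)) * K" by (simp only: mult.assoc)
	 finally show ?thesis unfolding zX by simp
	qed
	have y': "norm (z ^ (l+1) * phi' l q (z\<^sup>2) X) / norm z <= (real l + 2 + N0) * K"
	proof -
	 have "norm (z ^ (l+1) * phi' l q (z\<^sup>2) X) <= norm z ^ (l+1) * (X ^ l * ((real l + 2 + N0) * K))"
		unfolding norm_mult norm_power K_def N0_def by (intro mult_left_mono phi_small(2)[OF q X(1,3) small]) auto
	 also have "... = norm z * (norm z ^ l * X ^ l) * ((real l + 2 + N0) * K)" by simp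
	 finally show ?thesis unfolding zX using z by (simp add: field_simps)
	qed
	have kX: "\<bar>Im z\<bar> * X <= 1" using abs_Im_le_cmod[of z] z by (simp add: X_def field_simps)
	have "norm (z ^ (l+1) * phi l q (z\<^sup>2) x) <= (exp 1 * A) * exp M * exp (\<bar>Im z\<bar> * (x - X))"
	proof (rule oscillator_growth[OF ac_on_scaled_phi[OF q X(1,3)] z(1)])
	 show "(%x. cplx (real l * (real l + 1) / x\<^sup>2) + of_real (q x)) absolutely_integrable_on {X..1}"
		by (rule integral_centrifugal_le(1)[OF q X(1,3)])
	 have "integral {X..1} (%s. norm (cplx (real l * (real l + 1) / s\<^sup>2) + of_real (q s)))
		 <= real l * (real l + 1) / X + N0" unfolding N0_def
		by (rule integral_centrifugal_le(2)[OF q X(1,3)]) simp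
	 also have "... <= real l * (real l + 1) * norm z + N0 * norm z"
	 proof (intro add_mono)
		show "real l * (real l + 1) / X <= real l * (real l + 1) * norm z" by (simp add: X_def)
		show "N0 <= N0 * norm z" using N0 z1 by (simp add: mult_le_cancel_left1)
	 qed
	 finally show "integral {X..1} (%s. norm (cplx (real l * (real l + 1) / s\<^sup>2) + of_real (q s))) <= M * norm z"
		by (simp add: M_def algebra_simps)
	 have "exp (\<bar>Im z\<bar> * X) * norm (z ^ (l+1) * phi l q (z\<^sup>2) X) + exp (\<bar>Im z\<bar> * X) * norm (z ^ (l+1) * phi' l q (z\<^sup>2) X) / norm z
		 = exp (\<bar>Im z\<bar> * X) * (norm (z ^ (l+1) * phi l q (z\<^sup>2) X) + norm (z ^ (l+1) * phi' l q (z\<^sup>2) X) / norm z)"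
		by (simp add: algebra_simps)
	 also have "... <= exp 1 * A"
		unfolding A_def using kX y y' by (intro mult_mono add_mono) auto
	 finally show "exp (\<bar>Im z\<bar> * X) * norm (z ^ (l+1) * phi l q (z\<^sup>2) X) + exp (\<bar>Im z\<bar> * X) * norm (z ^ (l+1) * phi' l q (z\<^sup>2) X) / norm z +
		 integral {X..x} (%s. norm (0::complex)) * exp (\<bar>Im z\<bar> * x) / norm z <= exp 1 * A" by simp
	qed (use X x in auto)
	also have "... <= C * exp (\<bar>Im z\<bar> * x)"
	 using X A0 C0 by (intro mult_mono) (auto simp: C_def intro!: mult_left_mono)
	finally show ?thesis .
 qed
 then show thesis using that[OF C0] by blast
qed

section \<open>The free solution\<close>

lemma zero_integrable: "(%x::real. 0::real) absolutely_integrable_on {a..b}"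
 by simp

lemma free_flux_identity:
 fixes l :: nat and lam :: complex
 defines "r \<equiv> sl_coeff (%_. 0) lam"
 assumes x: "x \<in> {0..1}"
 shows "lam * of_real (x ^ (2*l+3)) * reg_sol l r x + of_nat (2*l+3) * reg_flux l r (reg_sol l r) x =
	lam * integral {0..x} (%y. of_real y * reg_flux l r (reg_sol l r) y)"
proof -
 have r: "unit_L1 r" unfolding r_def by (rule sl_coeff_integrable[OF zero_integrable])
 let ?v = "reg_sol l r" let ?m = "reg_flux l r ?v"
 have "ac_on 0 1 (%x. (lam * of_real (x ^ (2*l+3))) * ?v x + of_nat (2*l+3) * ?m x)
	(%x. ((lam * of_real (real (2*l+3) * x ^ (2*l+3-1))) * ?v x + (lam * of_real (x ^ (2*l+3))) * (?m x / of_real (x ^ (2*l+2)))) +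
	  of_nat (2*l+3) * (of_real (x ^ (2*l+2)) * r x * ?v x))"
	by (intro ac_on_add ac_on_mult ac_on_cmult ac_on_power ac_on_reg_sol ac_reg_flux r continuous_reg_sol) auto
 then have "ac_on 0 1 (%x. (lam * of_real (x ^ (2*l+3))) * ?v x + of_nat (2*l+3) * ?m x) (%x. lam * (of_real x * ?m x))"
 proof (rule ac_on_cong)
	fix x :: real
	have p: "cplx (x ^ (2*l+3)) = of_real x * of_real (x ^ (2*l+2))" "2*l+3-1 = 2*l+2"
	 by (simp_all add: eval_nat_numeral)
	have f0: "?m 0 = 0" by (simp add: reg_flux_def)
	have "(lam * (X * P)) * (m / P) = lam * (X * m)" if "P = 0 ==> X = 0" for X P m :: complex using that by (cases "P = 0") auto
	then have c: "lam * (of_real x * of_real (x ^ (2*l+2))) * (?m x / of_real (x ^ (2*l+2))) = lam * (of_real x * ?m x)"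
	 by (metis of_real_eq_0_iff power_eq_0_iff)
	show "lam * of_real (real (2*l+3) * x ^ (2*l+3-1)) * ?v x + lam * of_real (x ^ (2*l+3)) * (?m x / of_real (x ^ (2*l+2))) +
	  of_nat (2*l+3) * (of_real (x ^ (2*l+2)) * r x * ?v x) = lam * (of_real x * ?m x)"
	 unfolding p c unfolding r_def sl_coeff_def of_real_mult of_real_of_nat_eq
	 by (simp add: algebra_simps del: of_real_power of_nat_add of_nat_mult)
 qed auto
 from ac_onD(3)[OF this x] show ?thesis by (simp add: reg_flux_def)
qed

lemma free_ladder:
 fixes l :: nat and lam :: complex
 defines "r \<equiv> sl_coeff (%_. 0) lam"
 assumes x: "0 < x" "x <= 1"
 shows "lam * of_real (x ^ (2*l+3)) * reg_sol (Suc l) r x = - of_nat (2*l+3) * reg_flux l r (reg_sol l r) x"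
	and "reg_flux (Suc l) r (reg_sol (Suc l) r) x = of_nat (2*l+3) * of_real (x ^ (2*l+3)) * (reg_sol l r x - reg_sol (Suc l) r x)"
proof -
 have r: "unit_L1 r" unfolding r_def by (rule sl_coeff_integrable[OF zero_integrable])
 let ?v = "reg_sol l r" let ?m = "reg_flux l r ?v"
 have cm: "continuous_on {0..1} ?m" by (rule ac_on_continuous[OF ac_reg_flux[OF r continuous_reg_sol[OF r]]])
 have cym: "continuous_on {0..1} (%y. of_real y * ?m y)" by (intro continuous_intros cm)
 define J where "J = (%x. integral {0..x} (%y. of_real y * ?m y))"
 define w where "w = (%x. ?v x - J x / of_real (x ^ (2*l+3)))"
 have B: "lam * of_real (x ^ (2*l+3)) * ?v x + of_nat (2*l+3) * ?m x = lam * J x" if "x \<in> {0..1}" for x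
	using free_flux_identity[OF that, of lam l] by (simp add: J_def r_def)
 have dJ: "(J has_vector_derivative (of_real x * ?m x)) (at x within {0..1})" if "x \<in> {0..1}" for x
	unfolding J_def by (rule integral_has_vector_derivative[OF cym that])
 obtain D where D: "!!x. x \<in> {0..1} ==> norm (?m x / of_real (x ^ (2*l+2))) <= D"
	using compact_imp_bounded[OF compact_continuous_image[OF continuous_reg_density[OF r continuous_reg_sol[OF r, of l], of l]]]
	unfolding bounded_iff by force
 have Jle: "norm (J x / of_real (x ^ (2*l+3))) <= D * x" if x: "x \<in> {0..1}" for x
 proof (cases "x = 0")
	case False
	then have x0: "0 < x" using x by auto
	have "norm (J x) <= integral {0..x} (%y. x ^ (2*l+3) * D)" unfolding J_def
	proof (rule integral_norm_bound_integral)
	 show "(%y. of_real y * ?m y) integrable_on {0..x}"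
		by (rule integrable_continuous_interval[OF continuous_on_subset[OF cym]]) (use x in auto)
	 fix y assume y: "y \<in> {0..x}"
	 have "norm (of_real y * ?m y) = y ^ (2*l+3) * norm (?m y / of_real (y ^ (2*l+2)))"
		using y by (cases "y = 0") (auto simp: norm_mult norm_divide norm_power eval_nat_numeral)
	 also have "... <= x ^ (2*l+3) * D" using D[of y] y x by (intro mult_mono power_mono) auto
	 finally show "norm (of_real y * ?m y) <= x ^ (2*l+3) * D" .
	qed auto
	also have "... = x ^ (2*l+3) * (D * x)" using x by simp
	finally have "norm (J x) <= x ^ (2*l+3) * (D * x)" .
	moreover have "0 < x ^ (2*l+3)" using x0 by simp
	ultimately show ?thesis unfolding norm_divide norm_of_real by (simp add: pos_divide_le_eq mult.commute)
 qed simp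
 have cw: "continuous_on {0..1} w"
	unfolding continuous_on_eq_continuous_within
 proof
	fix x :: real assume x: "x \<in> {0..1}"
	have cv: "continuous (at x within {0..1}) ?v"
	 using continuous_reg_sol[OF r] x continuous_on_eq_continuous_within by blast
	have "continuous (at x within {0..1}) (%x. J x / of_real (x ^ (2*l+3)))"
	proof (cases "x = 0")
	 case False
	 then show ?thesis using has_vector_derivative_continuous[OF dJ[OF x]] by (intro continuous_intros) auto
	next
	 case True
	 have "((%x. J x / of_real (x ^ (2*l+3))) \<longlongrightarrow> 0) (at 0 within {0..1})"
	 proof (rule Lim_null_comparison)
		show "\<forall>\<^sub>F x in at 0 within {0..1}. norm (J x / of_real (x ^ (2*l+3))) <= D * x"
		 using Jle by (auto simp: eventually_at_filter)
		have "((%x. D * x) \<longlongrightarrow> D * 0) (at 0 within {0..1})" by (intro tendsto_intros)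
		then show "((%x. D * x) \<longlongrightarrow> 0) (at 0 within {0..1})" by simp
	 qed
	 then show ?thesis using True by (simp add: continuous_within J_def)
	qed
	then show "continuous (at x within {0..1}) w" unfolding w_def by (rule continuous_diff[OF cv])
 qed
 have fluxw: "reg_flux (Suc l) r w x = of_nat (2*l+3) * J x" if x: "x \<in> {0..1}" for x
 proof -
	have "reg_flux (Suc l) r w x = integral {0..x} (%y. of_nat (2*l+3) * (of_real y * ?m y))"
	 unfolding reg_flux_def[of "Suc l"]
	proof (rule hk_cong)
	 fix y assume "y \<in> {0..x}"
	 then have y: "y \<in> {0..1}" using x by auto
	 have p: "cplx (y ^ (2 * Suc l + 2)) = of_real y * of_real (y ^ (2*l+3))" by (simp add: eval_nat_numeral)
	 have "of_real (y ^ (2*l+3)) * w y = of_real (y ^ (2*l+3)) * ?v y - J y"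
		by (cases "y = 0") (simp_all add: w_def J_def algebra_simps)
	 note * = this
	 have "of_real (y ^ (2 * Suc l + 2)) * r y * w y = - of_real y * (lam * of_real (y ^ (2*l+3)) * ?v y - lam * J y)"
	 proof -
		have "(Y * P) * (of_real 0 - lam) * W = - Y * (lam * P * V - lam * K)" if "P * W = P * V - K" for Y P W V K :: complex
		proof -
		 have "(Y * P) * (of_real 0 - lam) * W = - Y * (lam * (P * W))" by (simp add: algebra_simps)
		 then show ?thesis unfolding that by (simp add: algebra_simps)
		qed
		note gen = this
		have ry: "r y = of_real 0 - lam" by (simp add: r_def sl_coeff_def)
		show ?thesis unfolding p ry by (rule gen[OF *])
	 qed
	 also have "... = of_nat (2*l+3) * (of_real y * ?m y)"
		unfolding B[OF y, symmetric] by (simp add: algebra_simps del: of_real_power of_nat_add of_nat_mult)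
	 finally show "of_real (y ^ (2 * Suc l + 2)) * r y * w y = of_nat (2*l+3) * (of_real y * ?m y)" .
	qed
	then show ?thesis by (simp add: J_def)
 qed
 have w_eq: "w x = reg_sol (Suc l) r x" if x: "x \<in> {0..1}" for x
 proof -
	have "w x = w 0 * reg_sol (Suc l) r x"
	proof (rule reg_sol_eqI[OF r cw _ x])
	 fix x :: real assume x: "x \<in> {0<..<1}"
	 define P where "P = cplx (x ^ (2*l+2))"
	 define X where "X = cplx x"
	 have nz: "X ~= 0" "P ~= 0" using x by (auto simp: P_def X_def)
	 have at: "at x within {0..1} = at x" using x by (intro at_within_interior) auto
	 have d1: "(?v has_vector_derivative ?m x / P) (at x)"
		using reg_sol_has_vector_derivative[OF r, of x l] x unfolding at P_def by simp
	 have d2: "(J has_vector_derivative X * ?m x) (at x)"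
		using dJ[of x] x unfolding at X_def by simp
	 have d3: "((%x. cplx (inverse (x ^ (2*l+3)))) has_vector_derivative - of_nat (2*l+3) / (P * X * X)) (at x)"
	 proof -
		have "((%x. inverse (x ^ (2*l+3))) has_real_derivative - (inverse (x ^ (2*l+3)) * (real (2*l+3) * x ^ (2*l+3-1)) * inverse (x ^ (2*l+3)))) (at x)"
		 using x DERIV_pow[of "2*l+3" x UNIV] by (intro DERIV_inverse') auto
		from has_vector_derivative_of_real[OF this, where 'a = complex]
		have *: "((%x. cplx (inverse (x ^ (2*l+3)))) has_vector_derivative of_real (- (inverse (x ^ (2*l+3)) * (real (2*l+3) * x ^ (2*l+3-1)) * inverse (x ^ (2*l+3))))) (at x)" .
		have e: "cplx (x ^ (2*l+3)) = X * P" "cplx (x ^ (2*l+3-1)) = P"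
		 by (simp_all add: X_def P_def eval_nat_numeral)
		have "cplx (- (inverse (x ^ (2*l+3)) * (real (2*l+3) * x ^ (2*l+3-1)) * inverse (x ^ (2*l+3))))
		  = - (inverse (X * P) * (of_nat (2*l+3) * P) * inverse (X * P))"
		 unfolding of_real_minus of_real_mult of_real_inverse e of_real_of_nat_eq ..
		also have "... = - of_nat (2*l+3) / (P * X * X)" using nz by (simp add: field_simps)
		finally show ?thesis using * by simp
	 qed
	 have "((%x. ?v x - J x * cplx (inverse (x ^ (2*l+3)))) has_vector_derivative
		 ?m x / P - (J x * (- of_nat (2*l+3) / (P * X * X)) + X * ?m x * cplx (inverse (x ^ (2*l+3))))) (at x)"
		by (intro has_vector_derivative_diff has_vector_derivative_mult d1 d2 d3)
	 moreover have "?m x / P - (J x * (- of_nat (2*l+3) / (P * X * X)) + X * ?m x * cplx (inverse (x ^ (2*l+3)))) =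
		 reg_flux (Suc l) r w x / of_real (x ^ (2 * Suc l + 2))"
	 proof -
		have e: "cplx (inverse (x ^ (2*l+3))) = inverse (X * P)" "cplx (x ^ (2 * Suc l + 2)) = P * X * X"
		 by (simp_all add: X_def P_def eval_nat_numeral)
		have x1: "x \<in> {0..1}" using x by auto
		show ?thesis unfolding e fluxw[OF x1] using nz by (simp add: field_simps)
	 qed
	 ultimately show "(w has_vector_derivative reg_flux (Suc l) r w x / of_real (x ^ (2 * Suc l + 2))) (at x)"
		by (simp add: w_def[abs_def] divide_inverse)
	qed
	moreover have "w 0 = 1" by (simp add: w_def J_def reg_sol_0[OF r])
	ultimately show ?thesis by simp
 qed
 have x1: "x \<in> {0..1}" using x by auto
 define P where "P = cplx (x ^ (2*l+3))"
 have P: "P ~= 0" using x by (simp add: P_def)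
 have Pw: "P * reg_sol (Suc l) r x = P * ?v x - J x"
	unfolding w_eq[OF x1, symmetric] w_def P_def[symmetric] using P by (simp add: algebra_simps)
 have "lam * P * reg_sol (Suc l) r x = lam * P * ?v x - lam * J x"
	using Pw by (metis mult.assoc right_diff_distrib)
 also have "... = - of_nat (2*l+3) * ?m x"
 proof -
	have "A - K = - k * m" if "A + k * m = K" for A k m K :: complex
	 unfolding that[symmetric] by simp
	from this[OF B[OF x1]] show ?thesis by (simp only: P_def)
 qed
 finally show "lam * of_real (x ^ (2*l+3)) * reg_sol (Suc l) r x = - of_nat (2*l+3) * ?m x" by (simp only: P_def)
 have "reg_flux (Suc l) r (reg_sol (Suc l) r) x = reg_flux (Suc l) r w x"
	unfolding reg_flux_def by (rule hk_cong) (use w_eq x in auto)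
 also have "... = of_nat (2*l+3) * J x" by (rule fluxw[OF x1])
 also have "J x = P * (?v x - reg_sol (Suc l) r x)" using Pw by (simp add: algebra_simps)
 finally show "reg_flux (Suc l) r (reg_sol (Suc l) r) x = of_nat (2*l+3) * of_real (x ^ (2*l+3)) * (?v x - reg_sol (Suc l) r x)"
	by (simp only: P_def mult.assoc)
qed

fun odd_fact :: "nat => real" where
 "odd_fact 0 = 1" | "odd_fact (Suc l) = real (2*l+3) * odd_fact l"

lemma odd_fact_pos: "odd_fact l > 0"
 by (induction l) auto

lemma phi_free_0:
 assumes z: "0 < z" and x: "0 < x" "x <= 1"
 shows "of_real z * phi 0 (%_. 0) (of_real (z\<^sup>2)) x = of_real (sin (z * x))"
	and "phi' 0 (%_. 0) (of_real (z\<^sup>2)) x = of_real (cos (z * x))"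
proof -
 define r where "r = sl_coeff (%_. 0) (of_real (z\<^sup>2))"
 have r: "unit_L1 r" unfolding r_def by (rule sl_coeff_integrable[OF zero_integrable])
 define vr where "vr = (%x. if x = 0 then 1 else sin (z * x) / (z * x))"
 define M where "M = (%x. x * cos (z * x) - sin (z * x) / z)"
 define v where "v = (%x. cplx (vr x))"
 have dvr: "(vr has_real_derivative M x / x\<^sup>2) (at x)" if "0 < x" for x
 proof -
	have "((%x. sin (z * x) / (z * x)) has_real_derivative M x / x\<^sup>2) (at x)"
	 using that z unfolding M_def by (auto intro!: derivative_eq_intros simp: field_simps power2_eq_square)
	then show ?thesis
	 by (rule has_field_derivative_transform_within_open[of _ _ _ "{0<..}"]) (use that in \<open>auto simp: vr_def\<close>)
 qed
 have cvr: "continuous_on {0..1} vr"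
	unfolding continuous_on_eq_continuous_within
 proof
	fix x :: real assume x: "x \<in> {0..1}"
	show "continuous (at x within {0..1}) vr"
	proof (cases "x = 0")
	 case True
	 have "((%x. sin (z * x) / (z * x)) \<longlongrightarrow> 1) (at_right 0)"
		using z by real_asymp
	 then have "(vr \<longlongrightarrow> 1) (at_right 0)"
		by (rule Lim_transform_eventually) (auto simp: vr_def eventually_at_filter)
	 then show ?thesis using True by (simp add: continuous_within vr_def at_within_Icc_at_right)
	next
	 case False
	 then show ?thesis using DERIV_isCont[OF dvr] x by (auto intro: continuous_at_imp_continuous_at_within)
	qed
 qed
 then have cv: "continuous_on {0..1} v" unfolding v_def by (intro continuous_intros)
 have flux: "reg_flux 0 r v x = of_real (M x)" if x: "x \<in> {0..1}" for x
 proof -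
	have hi: "((%y. cplx (- z * y * sin (z * y))) has_integral (of_real (M x) - of_real (M 0))) {0..x}"
	proof (rule fundamental_theorem_of_calculus)
	 fix y assume "y \<in> {0..x}"
	 have "(M has_real_derivative - z * y * sin (z * y)) (at y within {0..x})"
		unfolding M_def using z by (auto intro!: derivative_eq_intros)
	 then show "((%x. cplx (M x)) has_vector_derivative cplx (- z * y * sin (z * y))) (at y within {0..x})"
		by (rule has_vector_derivative_of_real)
	qed (use x in auto)
	have eq: "reg_flux 0 r v x = integral {0..x} (%y. cplx (- z * y * sin (z * y)))"
	 unfolding reg_flux_def
	proof (rule hk_cong)
	 fix y :: real
	 have "y ^ 2 * - z\<^sup>2 * vr y = - z * y * sin (z * y)"
		using z by (cases "y = 0") (auto simp: vr_def power2_eq_square)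
	 then have "cplx (y ^ 2 * - z\<^sup>2 * vr y) = cplx (- z * y * sin (z * y))" by simp
	 moreover have "cplx (y ^ (2 * 0 + 2)) * r y * v y = cplx (y ^ 2 * - z\<^sup>2 * vr y)"
		by (simp add: r_def sl_coeff_def v_def power2_eq_square)
	 ultimately show "cplx (y ^ (2 * 0 + 2)) * r y * v y = cplx (- z * y * sin (z * y))" by simp
	qed
	have "M 0 = 0" by (simp add: M_def)
	then show ?thesis using eq integral_unique[OF hi] by (metis diff_zero of_real_0)
 qed
 have v_eq: "v x = reg_sol 0 r x" if x: "x \<in> {0..1}" for x
 proof -
	have "v x = v 0 * reg_sol 0 r x"
	proof (rule reg_sol_eqI[OF r cv _ x])
	 fix x :: real assume x: "x \<in> {0<..<1}"
	 have "(v has_vector_derivative of_real (M x / x\<^sup>2)) (at x)"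
		unfolding v_def by (rule has_vector_derivative_of_real[OF dvr]) (use x in auto)
	 then show "(v has_vector_derivative reg_flux 0 r v x / cplx (x ^ (2 * 0 + 2))) (at x)"
		using flux[of x] x by (simp add: power2_eq_square)
	qed
	then show ?thesis by (simp add: v_def vr_def)
 qed
 have m: "reg_flux 0 r (reg_sol 0 r) x = of_real (M x)"
 proof -
	have "reg_flux 0 r (reg_sol 0 r) x = reg_flux 0 r v x"
	 unfolding reg_flux_def by (rule hk_cong) (use v_eq x in auto)
	then show ?thesis using flux[of x] x by simp
 qed
 have v: "reg_sol 0 r x = of_real (sin (z * x) / (z * x))" using v_eq[of x] x by (simp add: v_def vr_def)
 show "of_real z * phi 0 (%_. 0) (of_real (z\<^sup>2)) x = of_real (sin (z * x))"
	unfolding phi_def r_def[symmetric] v using x z by simp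
 show "phi' 0 (%_. 0) (of_real (z\<^sup>2)) x = of_real (cos (z * x))"
	unfolding phi'_def r_def[symmetric] v m using x z by (simp add: M_def field_simps)
qed

lemma phi_free_ladder:
 fixes l :: nat and lam :: complex
 assumes x: "0 < x" "x <= 1"
 defines "f \<equiv> %l. phi l (%_. 0) lam x" and "f' \<equiv> %l. phi' l (%_. 0) lam x" and "X \<equiv> cplx x"
 shows "lam * f (Suc l) = of_nat (2*l+3) * (of_nat (l+1) / X * f l - f' l)"
	and "f' (Suc l) = of_nat (2*l+3) * f l - of_nat (l+1) / X * f (Suc l)"
proof -
 define r where "r = sl_coeff (%_. 0) lam"
 define v w m where "v = reg_sol l r x" and "w = reg_sol (Suc l) r x" and "m = reg_flux l r (reg_sol l r) x"
 define P where "P = X ^ l"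
 have nz: "X ~= 0" "P ~= 0" using x by (auto simp: X_def P_def)
 have p: "cplx (x ^ (2*l+3)) = P * P * X * X * X" "cplx (x ^ (l+1)) = P * X"
	"cplx (x ^ (Suc l+1)) = P * X * X" "cplx (x ^ l) = P" "cplx (x ^ Suc l) = P * X"
	by (simp_all add: X_def P_def eval_nat_numeral power_add mult_2)
 have 1: "lam * (P * P * X * X * X) * w = - of_nat (2*l+3) * m"
	using free_ladder(1)[OF x, of lam l] by (simp only: p v_def w_def m_def r_def)
 have 2: "reg_flux (Suc l) r (reg_sol (Suc l) r) x = of_nat (2*l+3) * (P * P * X * X * X) * (v - w)"
	using free_ladder(2)[OF x, of l lam] by (simp only: p v_def w_def m_def r_def)
 have fl: "f l = P * X * v" "f (Suc l) = P * X * X * w" unfolding f_def phi_def p by (simp_all add: v_def w_def r_def)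
 have f'l: "f' l = of_nat (l+1) * P * v + m / (P * X)"
	unfolding f'_def phi'_def of_real_mult of_real_inverse p by (simp add: v_def m_def r_def divide_inverse mult_ac)
 have f'Sl: "f' (Suc l) = of_nat (l+2) * (P * X) * w + of_nat (2*l+3) * (P * P * X * X * X) * (v - w) / (P * X * X)"
	unfolding f'_def phi'_def of_real_mult of_real_inverse p r_def[symmetric] 2 by (simp add: w_def divide_inverse mult_ac)
 have "lam * f (Suc l) = lam * (P * P * X * X * X) * w / (P * X)" unfolding fl using nz by (simp add: field_simps)
 also have "... = of_nat (2*l+3) * (of_nat (l+1) / X * f l - f' l)"
	unfolding 1 fl f'l using nz by (simp add: field_simps del: of_nat_Suc of_nat_add of_nat_mult)
 finally show "lam * f (Suc l) = of_nat (2*l+3) * (of_nat (l+1) / X * f l - f' l)" .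
 have k: "of_nat (2*l+3) = (of_nat (l+1) + of_nat (l+2) :: complex)" by simp
 have "b * (P * X) * w + (a + b) * (P * P * X * X * X) * (v - w) / (P * X * X) = (a + b) * (P * X * v) - a / X * (P * X * X * w)" for a b
	using nz by (simp add: field_simps)
 then show "f' (Suc l) = of_nat (2*l+3) * f l - of_nat (l+1) / X * f (Suc l)"
	unfolding f'Sl fl k by blast
qed

text \<open>The free regular solution is a spherical Bessel function; induction on \<open>l\<close> through the raising operator
keeps track of the first two terms.\<close>

lemma phi_free_asymptotics:
 "\<exists>\<beta> C. 0 <= C & (\<forall>z x. 0 < z --> 0 < x --> x <= 1 --> 1 <= z * x -->
	norm (of_real (z ^ (l+1)) * phi l (%_. 0) (of_real (z\<^sup>2)) x -
	 of_real (odd_fact l * (sin (z * x - real l * pi / 2) + \<beta> * cos (z * x - real l * pi / 2) / (z * x)))) <= C / (z * x)\<^sup>2 &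
	norm (of_real (z ^ l) * phi' l (%_. 0) (of_real (z\<^sup>2)) x -
	 of_real (odd_fact l * (cos (z * x - real l * pi / 2) - \<beta> * sin (z * x - real l * pi / 2) / (z * x)))) <= C / (z * x)\<^sup>2)"
proof (induction l)
 case 0
 show ?case
	by (intro exI[of _ 0] exI[of _ 0]) (use phi_free_0 in auto)
next
 case (Suc l)
 then obtain \<beta> C where C: "0 <= C" and IH: "!!z x. 0 < z ==> 0 < x ==> x <= 1 ==> 1 <= z * x ==>
	norm (of_real (z ^ (l+1)) * phi l (%_. 0) (of_real (z\<^sup>2)) x -
	 of_real (odd_fact l * (sin (z * x - real l * pi / 2) + \<beta> * cos (z * x - real l * pi / 2) / (z * x)))) <= C / (z * x)\<^sup>2"
	"!!z x. 0 < z ==> 0 < x ==> x <= 1 ==> 1 <= z * x ==>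
	norm (of_real (z ^ l) * phi' l (%_. 0) (of_real (z\<^sup>2)) x -
	 of_real (odd_fact l * (cos (z * x - real l * pi / 2) - \<beta> * sin (z * x - real l * pi / 2) / (z * x)))) <= C / (z * x)\<^sup>2"
	by blast
 define k where "k = real (2*l+3)"
 define L where "L = real (l+1)"
 define \<alpha> where "\<alpha> = odd_fact l"
 define C1 where "C1 = k * (L * \<alpha> * \<bar>\<beta>\<bar> + L * C + C)"
 define C2 where "C2 = k * C + L * (k * \<alpha> * (L + \<bar>\<beta>\<bar>) + C1)"
 have pos: "0 <= k" "0 <= L" "0 <= \<alpha>" using odd_fact_pos[of l] by (auto simp: k_def L_def \<alpha>_def)
 have C1: "0 <= C1" and C2: "0 <= C2" using pos C by (auto simp: C1_def C2_def intro!: add_nonneg_nonneg mult_nonneg_nonneg)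
 have main: "norm (of_real (z ^ (Suc l+1)) * phi (Suc l) (%_. 0) (of_real (z\<^sup>2)) x -
	 of_real (odd_fact (Suc l) * (sin (z * x - real (Suc l) * pi / 2) + (L + \<beta>) * cos (z * x - real (Suc l) * pi / 2) / (z * x)))) <= C1 / (z * x)\<^sup>2 &
	norm (of_real (z ^ Suc l) * phi' (Suc l) (%_. 0) (of_real (z\<^sup>2)) x -
	 of_real (odd_fact (Suc l) * (cos (z * x - real (Suc l) * pi / 2) - (L + \<beta>) * sin (z * x - real (Suc l) * pi / 2) / (z * x)))) <= C2 / (z * x)\<^sup>2"
	if zx: "0 < z" "0 < x" "x <= 1" "1 <= z * x" for z x
 proof -
	define u where "u = z * x"
	define s c where "s = sin (u - real l * pi / 2)" and "c = cos (u - real l * pi / 2)"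
	have sc: "\<bar>s\<bar> <= 1" "\<bar>c\<bar> <= 1" by (auto simp: s_def c_def)
	have shift: "u - real (Suc l) * pi / 2 = (u - real l * pi / 2) - pi / 2" by (simp add: field_simps)
	have sc': "sin (u - real (Suc l) * pi / 2) = - c" "cos (u - real (Suc l) * pi / 2) = s"
	 unfolding shift by (simp_all add: sin_diff cos_diff s_def c_def)
	have u1: "1 <= u" using zx by (simp add: u_def)
	let ?U = "cplx u"
	define Z Z' Y Y' where "Z = of_real (z ^ (l+1)) * phi l (%_. 0) (of_real (z\<^sup>2)) x"
	 and "Z' = of_real (z ^ l) * phi' l (%_. 0) (of_real (z\<^sup>2)) x"
	 and "Y = of_real (z ^ (Suc l+1)) * phi (Suc l) (%_. 0) (of_real (z\<^sup>2)) x"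
	 and "Y' = of_real (z ^ Suc l) * phi' (Suc l) (%_. 0) (of_real (z\<^sup>2)) x"
	define e1 e2 where "e1 = Z - of_real (\<alpha> * (s + \<beta> * c / u))" and "e2 = Z' - of_real (\<alpha> * (c - \<beta> * s / u))"
	have e: "norm e1 <= C / u\<^sup>2" "norm e2 <= C / u\<^sup>2"
	 using IH[OF zx] by (simp_all add: e1_def e2_def Z_def Z'_def \<alpha>_def s_def c_def u_def)
	have zn: "cplx z ~= 0" "cplx x ~= 0" using zx by auto
	have Y: "Y = of_real k * (of_real L / ?U * Z - Z')"
	proof -
	 have "Y = of_real (z ^ l) * (of_real (z\<^sup>2) * phi (Suc l) (%_. 0) (of_real (z\<^sup>2)) x)"
		by (simp add: Y_def power2_eq_square mult_ac)
	 also have "... = of_real k * (of_real L / ?U * Z - Z')"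
		unfolding phi_free_ladder(1)[OF zx(2,3)] using zn
		by (simp add: k_def L_def u_def Z_def Z'_def field_simps)
	 finally show ?thesis .
	qed
	have Y': "Y' = of_real k * Z - of_real L / ?U * Y"
	 unfolding Y'_def Y_def Z_def phi_free_ladder(2)[OF zx(2,3)] using zn
	 by (simp add: k_def L_def u_def field_simps)
	have Zeq: "Z = of_real (\<alpha> * (s + \<beta> * c / u)) + e1" "Z' = of_real (\<alpha> * (c - \<beta> * s / u)) + e2" by (simp_all add: e1_def e2_def)
	have Un: "?U ~= 0" using u1 by auto
	define E where "E = Y - of_real (k * \<alpha> * (- c + (L + \<beta>) * s / u))"
	have Eeq: "E = of_real k * (of_real (L * \<alpha> * \<beta> * c / u\<^sup>2) + of_real (L / u) * e1 - e2)"
	 unfolding E_def Y Zeq using Un by (simp add: field_simps power2_eq_square)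
	have Lu: "L / u <= L" using u1 pos(2) by (simp add: divide_le_eq mult_le_cancel_left1)
	have nE: "norm E <= C1 / u\<^sup>2"
	proof -
	 have "norm E = k * norm (of_real (L * \<alpha> * \<beta> * c / u\<^sup>2) + of_real (L / u) * e1 - e2)"
		unfolding Eeq norm_mult using pos by simp
	 also have "norm (of_real (L * \<alpha> * \<beta> * c / u\<^sup>2) + of_real (L / u) * e1 - e2) <=
		 norm (cplx (L * \<alpha> * \<beta> * c / u\<^sup>2)) + norm (of_real (L / u) * e1) + norm e2"
		by (intro order_trans[OF norm_triangle_ineq4] add_right_mono norm_triangle_ineq)
	 also have "norm (cplx (L * \<alpha> * \<beta> * c / u\<^sup>2)) = L * \<alpha> * \<bar>\<beta>\<bar> * \<bar>c\<bar> / u\<^sup>2"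
		unfolding norm_of_real using pos by (simp add: abs_mult)
	 also have "... <= L * \<alpha> * \<bar>\<beta>\<bar> * 1 / u\<^sup>2"
		using pos sc by (intro divide_right_mono mult_left_mono) auto
	 also have "norm (of_real (L / u) * e1) <= L * (C / u\<^sup>2)"
		unfolding norm_mult norm_of_real using Lu e(1) pos u1 by (intro mult_mono) auto
	 also note e(2)
	 finally have "norm E <= k * (L * \<alpha> * \<bar>\<beta>\<bar> * 1 / u\<^sup>2 + L * (C / u\<^sup>2) + C / u\<^sup>2)"
		using pos(1) by (simp add: mult_left_mono)
	 then show ?thesis by (simp add: C1_def add_divide_distrib algebra_simps)
	qed
	have Yeq: "Y = of_real (k * \<alpha> * (- c + (L + \<beta>) * s / u)) + E" by (simp add: E_def)
	define F where "F = Y' - of_real (k * \<alpha> * (s + (L + \<beta>) * c / u))"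
	have Feq: "F = of_real k * e1 - of_real L * (of_real (k * \<alpha> * (L + \<beta>) * s / u\<^sup>2) + of_real (1 / u) * E)"
	 unfolding F_def Y' Yeq unfolding Zeq using Un by (simp add: field_simps power2_eq_square)
	have nF: "norm F <= C2 / u\<^sup>2"
	proof -
	 have "norm F <= norm (of_real k * e1) + norm (cplx L * (of_real (k * \<alpha> * (L + \<beta>) * s / u\<^sup>2) + of_real (1 / u) * E))"
		unfolding Feq by (rule norm_triangle_ineq4)
	 also have "norm (of_real k * e1) <= k * (C / u\<^sup>2)"
		unfolding norm_mult norm_of_real using pos e(1) by (intro mult_mono) auto
	 also have "norm (cplx L * (of_real (k * \<alpha> * (L + \<beta>) * s / u\<^sup>2) + of_real (1 / u) * E))
		 <= L * (k * \<alpha> * (L + \<bar>\<beta>\<bar>) / u\<^sup>2 + C1 / u\<^sup>2)"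
	 proof -
		have "norm (cplx (k * \<alpha> * (L + \<beta>) * s / u\<^sup>2)) = k * \<alpha> * \<bar>L + \<beta>\<bar> * \<bar>s\<bar> / u\<^sup>2"
		 unfolding norm_of_real using pos by (simp add: abs_mult)
		also have "... <= k * \<alpha> * (L + \<bar>\<beta>\<bar>) * 1 / u\<^sup>2"
		 using pos sc by (intro divide_right_mono mult_mono mult_left_mono) auto
		finally have 1: "norm (cplx (k * \<alpha> * (L + \<beta>) * s / u\<^sup>2)) <= k * \<alpha> * (L + \<bar>\<beta>\<bar>) / u\<^sup>2" by simp
		have "1 / u <= 1" using u1 by simp
		then have "norm (of_real (1 / u) * E) <= 1 * (C1 / u\<^sup>2)"
		 unfolding norm_mult norm_of_real using u1 nE by (intro mult_mono) auto
		then have "norm (of_real (k * \<alpha> * (L + \<beta>) * s / u\<^sup>2) + of_real (1 / u) * E) <= k * \<alpha> * (L + \<bar>\<beta>\<bar>) / u\<^sup>2 + C1 / u\<^sup>2"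
		 using 1 norm_triangle_ineq[of "of_real (k * \<alpha> * (L + \<beta>) * s / u\<^sup>2)" "of_real (1 / u) * E"] by linarith
		then show ?thesis unfolding norm_mult norm_of_real using pos(2) by (intro mult_mono) auto
	 qed
	 finally show ?thesis by (simp add: C2_def add_divide_distrib algebra_simps)
	qed
	have "norm (Y - of_real (odd_fact (Suc l) * (- c + (L + \<beta>) * s / u))) <= C1 / u\<^sup>2"
	 "norm (Y' - of_real (odd_fact (Suc l) * (s - (L + \<beta>) * - c / u))) <= C2 / u\<^sup>2"
	 using nE nF by (simp_all add: E_def F_def k_def \<alpha>_def)
	then show ?thesis unfolding Y_def Y'_def u_def[symmetric] sc' by simp
 qed
 show ?case
 proof (rule exI[of _ "L + \<beta>"], rule exI[of _ "max C1 C2"], intro conjI allI impI)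
	fix z x :: real assume zx: "0 < z" "0 < x" "x <= 1" "1 <= z * x"
	have "C1 / (z * x)\<^sup>2 <= max C1 C2 / (z * x)\<^sup>2" "C2 / (z * x)\<^sup>2 <= max C1 C2 / (z * x)\<^sup>2"
	 by (intro divide_right_mono; simp)+
	with main[OF zx] show "norm (of_real (z ^ (Suc l+1)) * phi (Suc l) (%_. 0) (of_real (z\<^sup>2)) x -
	 of_real (odd_fact (Suc l) * (sin (z * x - real (Suc l) * pi / 2) + (L + \<beta>) * cos (z * x - real (Suc l) * pi / 2) / (z * x)))) <= max C1 C2 / (z * x)\<^sup>2"
	 "norm (of_real (z ^ Suc l) * phi' (Suc l) (%_. 0) (of_real (z\<^sup>2)) x -
	 of_real (odd_fact (Suc l) * (cos (z * x - real (Suc l) * pi / 2) - (L + \<beta>) * sin (z * x - real (Suc l) * pi / 2) / (z * x)))) <= max C1 C2 / (z * x)\<^sup>2"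
	 by linarith+
 qed (use C1 in auto)
qed

section \<open>Asymptotics of the regular solution for real frequencies\<close>

text \<open>The weight expresses that \<open>q\<close> is slightly better than integrable at 0, which is what makes the node values
of the remainder summable.\<close>

definition wpot :: "real => real => (real => real) => bool"
 where "wpot \<delta> N q \<longleftrightarrow> q absolutely_integrable_on {0..1} & q 0 = 0 & 0 < \<delta> & \<delta> < 1 &
	(%y. \<bar>q y\<bar> * y powr (- \<delta>)) integrable_on {0..1} & integral {0..1} (%y. \<bar>q y\<bar> * y powr (- \<delta>)) <= N"

lemma wpotD:
 assumes "wpot \<delta> N q"
 shows "unit_L1 q" "q 0 = 0" "0 < \<delta>" "\<delta> < 1"
	"(%y. \<bar>q y\<bar> * y powr (- \<delta>)) integrable_on {0..1}"
	"integral {0..1} (%y. \<bar>q y\<bar> * y powr (- \<delta>)) <= N" "0 <= N"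
proof -
 show a: "unit_L1 q" "q 0 = 0" "0 < \<delta>" "\<delta> < 1"
	"(%y. \<bar>q y\<bar> * y powr (- \<delta>)) integrable_on {0..1}"
	and b: "integral {0..1} (%y. \<bar>q y\<bar> * y powr (- \<delta>)) <= N"
	using assms by (auto simp: wpot_def)
 have "0 <= integral {0..1} (%y. \<bar>q y\<bar> * y powr (- \<delta>))"
	by (intro hk_nonneg a) auto
 with b show "0 <= N" by simp
qed

lemma wpot_integral_le:
 assumes w: "wpot \<delta> N q" and x: "x \<in> {0..1}"
 shows "integral {0..x} (%y. \<bar>q y\<bar>) <= N * x powr \<delta>"
proof -
 note D = wpotD[OF w]
 have i: "(%y. \<bar>q y\<bar> * y powr (- \<delta>)) integrable_on {0..x}"
	by (rule integrable_subinterval_real[OF D(5)]) (use x in auto)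
 have "integral {0..x} (%y. \<bar>q y\<bar>) <= integral {0..x} (%y. x powr \<delta> * (\<bar>q y\<bar> * y powr (- \<delta>)))"
 proof (rule integral_le)
	show "(%y. \<bar>q y\<bar>) integrable_on {0..x}" using L1D(2)[OF D(1), of 0 x] x by simp
	show "(%y. x powr \<delta> * (\<bar>q y\<bar> * y powr (- \<delta>))) integrable_on {0..x}" by (intro integrable_on_mult_right i)
	fix y assume y: "y \<in> {0..x}"
	show "\<bar>q y\<bar> <= x powr \<delta> * (\<bar>q y\<bar> * y powr (- \<delta>))"
	proof (cases "y = 0")
	 case False
	 then have y0: "0 < y" using y by auto
	 then have "1 = y powr \<delta> * y powr (- \<delta>)" by (simp flip: powr_add)
	 also have "... <= x powr \<delta> * y powr (- \<delta>)" using y y0 D(3) by (intro mult_right_mono powr_mono2) auto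
	 finally have "\<bar>q y\<bar> * 1 <= \<bar>q y\<bar> * (x powr \<delta> * y powr (- \<delta>))" by (intro mult_left_mono) auto
	 then show ?thesis by (simp add: mult_ac)
	qed (use D in auto)
 qed
 also have "... = x powr \<delta> * integral {0..x} (%y. \<bar>q y\<bar> * y powr (- \<delta>))" by simp
 also have "... <= x powr \<delta> * N"
 proof (intro mult_left_mono)
	have "integral {0..x} (%y. \<bar>q y\<bar> * y powr (- \<delta>)) <= integral {0..1} (%y. \<bar>q y\<bar> * y powr (- \<delta>))"
	 by (rule integral_subset_le) (use x i D in auto)
	then show "integral {0..x} (%y. \<bar>q y\<bar> * y powr (- \<delta>)) <= N" using D(6) by simp
 qed auto
 finally show ?thesis by (simp add: mult.commute)
qed

lemma wpot_tail_le:
 assumes w: "wpot \<delta> N q" and x: "0 < X" "X <= x" "x <= 1"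
 shows "(%y. \<bar>q y\<bar> / y) integrable_on {X..x}" "integral {X..x} (%y. \<bar>q y\<bar> / y) <= N * X powr (\<delta> - 1)"
proof -
 note D = wpotD[OF w]
 have i: "(%y. \<bar>q y\<bar> * y powr (- \<delta>)) integrable_on {X..x}"
	by (rule integrable_subinterval_real[OF D(5)]) (use x in auto)
 have qa: "(%y. \<bar>q y\<bar>) absolutely_integrable_on {X..x}" using L1D(4)[OF D(1), of X x] x by simp
 have "continuous_on {X..x} (%y. inverse y)" using x by (intro continuous_intros) auto
 from L1D(1)[OF absolutely_integrable_mult_continuous[OF qa this] order_refl order_refl]
 show i2: "(%y. \<bar>q y\<bar> / y) integrable_on {X..x}" by (simp add: divide_inverse mult.commute)
 have "integral {X..x} (%y. \<bar>q y\<bar> / y) <= integral {X..x} (%y. X powr (\<delta> - 1) * (\<bar>q y\<bar> * y powr (- \<delta>)))"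
 proof (rule integral_le[OF i2])
	show "(%y. X powr (\<delta> - 1) * (\<bar>q y\<bar> * y powr (- \<delta>))) integrable_on {X..x}" by (intro integrable_on_mult_right i)
	fix y assume y: "y \<in> {X..x}"
	then have y0: "0 < y" using x by auto
	have "y powr (\<delta> - 1) * y powr (- \<delta>) = y powr (- 1)" unfolding powr_add[symmetric] by simp
	then have "1 / y = y powr (\<delta> - 1) * y powr (- \<delta>)" using y0 by (simp only:) (simp add: powr_minus_divide)
	also have "... <= X powr (\<delta> - 1) * y powr (- \<delta>)" using y x D(4) by (intro mult_right_mono powr_mono2') auto
	finally have "\<bar>q y\<bar> * (1 / y) <= \<bar>q y\<bar> * (X powr (\<delta> - 1) * y powr (- \<delta>))" by (intro mult_left_mono) auto
	then show "\<bar>q y\<bar> / y <= X powr (\<delta> - 1) * (\<bar>q y\<bar> * y powr (- \<delta>))" by (simp add: mult_ac)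
 qed
 also have "... = X powr (\<delta> - 1) * integral {X..x} (%y. \<bar>q y\<bar> * y powr (- \<delta>))" by simp
 also have "... <= X powr (\<delta> - 1) * N"
 proof (intro mult_left_mono)
	have "integral {X..x} (%y. \<bar>q y\<bar> * y powr (- \<delta>)) <= integral {0..1} (%y. \<bar>q y\<bar> * y powr (- \<delta>))"
	 by (rule integral_subset_le) (use x i D in auto)
	then show "integral {X..x} (%y. \<bar>q y\<bar> * y powr (- \<delta>)) <= N" using D(6) by simp
 qed auto
 finally show "integral {X..x} (%y. \<bar>q y\<bar> / y) <= N * X powr (\<delta> - 1)" by (simp add: mult.commute)
qed

definition Dphi :: "nat => (real => real) => real => real => complex"
 where "Dphi l q z x = of_real (z ^ (l+1)) * (phi l q (of_real (z\<^sup>2)) x - phi l (%_. 0) (of_real (z\<^sup>2)) x)"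
definition Dphi' :: "nat => (real => real) => real => real => complex"
 where "Dphi' l q z x = of_real (z ^ (l+1)) * (phi' l q (of_real (z\<^sup>2)) x - phi' l (%_. 0) (of_real (z\<^sup>2)) x)"

lemma ac_on_Dphi:
 assumes q: "unit_L1 q" and a: "0 < a" "a <= 1"
 shows "ac_on a 1 (Dphi l q z) (Dphi' l q z)"
	and "ac_on a 1 (Dphi' l q z) (%x. (of_real (real l * (real l + 1) / x\<^sup>2) - (of_real z)\<^sup>2) * Dphi l q z x
	  + of_real (q x) * (of_real (z ^ (l+1)) * phi l q (of_real (z\<^sup>2)) x))"
proof -
 show "ac_on a 1 (Dphi l q z) (Dphi' l q z)"
	unfolding Dphi_def[abs_def] Dphi'_def[abs_def]
	by (intro ac_on_cmult ac_on_diff ac_on_phi[OF q a] ac_on_phi[OF zero_integrable a])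
 have "ac_on a 1 (Dphi' l q z) (%x. of_real (z ^ (l+1)) * ((of_real (real l * (real l + 1) / x\<^sup>2) + sl_coeff q (of_real (z\<^sup>2)) x) * phi l q (of_real (z\<^sup>2)) x
	 - (of_real (real l * (real l + 1) / x\<^sup>2) + sl_coeff (%_. 0) (of_real (z\<^sup>2)) x) * phi l (%_. 0) (of_real (z\<^sup>2)) x))"
	unfolding Dphi'_def[abs_def]
	by (intro ac_on_cmult ac_on_diff ac_on_phi[OF q a] ac_on_phi[OF zero_integrable a])
 then show "ac_on a 1 (Dphi' l q z) (%x. (of_real (real l * (real l + 1) / x\<^sup>2) - (of_real z)\<^sup>2) * Dphi l q z x
	  + of_real (q x) * (of_real (z ^ (l+1)) * phi l q (of_real (z\<^sup>2)) x))"
 proof (rule ac_on_cong)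
	fix x
	have "Z * ((L + (Q - w)) * f - (L + (0 - w)) * g) = (L - w) * (Z * (f - g)) + Q * (Z * f)" for Z L Q w f g :: complex
	 by (simp add: algebra_simps)
	then show "of_real (z ^ (l+1)) * ((of_real (real l * (real l + 1) / x\<^sup>2) + sl_coeff q (of_real (z\<^sup>2)) x) * phi l q (of_real (z\<^sup>2)) x
	 - (of_real (real l * (real l + 1) / x\<^sup>2) + sl_coeff (%_. 0) (of_real (z\<^sup>2)) x) * phi l (%_. 0) (of_real (z\<^sup>2)) x) =
	 (of_real (real l * (real l + 1) / x\<^sup>2) - (of_real z)\<^sup>2) * Dphi l q z x
	  + of_real (q x) * (of_real (z ^ (l+1)) * phi l q (of_real (z\<^sup>2)) x)"
	 unfolding Dphi_def sl_coeff_def of_real_power[symmetric] of_real_0 by blast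
 qed simp
qed

lemma Dphi_small:
 assumes w: "wpot \<delta> N q" and z: "1 <= z"
 defines "X \<equiv> 1 / z"
 shows "norm (Dphi l q z X) <= (exp 1 * exp (N + 1) * N) * X powr (1 + \<delta>)"
	and "norm (Dphi' l q z X) / z <= ((real l + 1) * exp 1 + exp 1 + 1) * exp (N + 1) * N * X powr (1 + \<delta>)"
proof -
 note D = wpotD[OF w]
 note q = D(1)
 define lam where "lam = cplx (z\<^sup>2)"
 define r0 r where "r0 = sl_coeff (%_. 0) lam" and "r = sl_coeff q lam"
 have r0: "unit_L1 r0" and r: "unit_L1 r"
	unfolding r0_def r_def by (intro sl_coeff_integrable zero_integrable q)+
 define K where "K = exp (N + 1)"
 have X: "0 < X" "X <= 1" using z by (auto simp: X_def)
 have zX: "z * X = 1" using z by (simp add: X_def)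
 have nlam: "norm lam = z\<^sup>2" by (simp add: lam_def norm_power)
 have lamX: "z\<^sup>2 * X * X = 1" using z by (simp add: X_def power2_eq_square)
 have small: "norm lam * X\<^sup>2 <= 1" using lamX nlam by (simp add: power2_eq_square)
 have iq: "(%y. \<bar>q y\<bar>) integrable_on {0..X}" using L1D(2)[OF q, of 0 X] X by simp
 define Q where "Q = integral {0..X} (%y. \<bar>q y\<bar>)"
 have Q0: "0 <= Q" unfolding Q_def by (intro hk_nonneg iq) auto
 have Q: "Q <= N * X powr \<delta>" unfolding Q_def by (rule wpot_integral_le[OF w]) (use X in auto)
 have K: "norm (reg_sol l r x) <= K" if x: "x \<in> {0..X}" for x
 proof -
	have "norm (reg_sol l r x) <= exp (integral {0..1} (%y. \<bar>q y\<bar>) + 1)"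
	 unfolding r_def by (rule reg_sol_small[OF q _ X(2) small x]) (use X in auto)
	also have "... <= K" using wpot_integral_le[OF w, of 1] by (simp add: K_def)
	finally show ?thesis .
 qed
 have K0: "0 < K" by (simp add: K_def)
 let ?u = "reg_sol l r0" and ?v = "reg_sol l r"
 let ?d = "%y. ?u y - ?v y" and ?e = "%y. r0 y - r y"
 have e: "unit_L1 ?e" by (rule set_integral_diff(1)[OF r0 r])
 have ne: "norm (?e y) = \<bar>q y\<bar>" "norm (r0 y) = z\<^sup>2" for y
	using nlam by (simp_all add: r0_def r_def sl_coeff_def)
 have cd: "continuous_on {0..1} ?d" by (intro continuous_intros continuous_reg_sol r0 r)
 have ev: "integral {0..x} (%y. norm (?e y) * norm (?v y)) <= K * Q" if x: "x \<in> {0..X}" for x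
 proof -
	have "integral {0..x} (%y. norm (?e y) * norm (?v y)) <= integral {0..x} (%y. \<bar>q y\<bar> * K)"
	proof (rule integral_le)
	 show "(%y. norm (?e y) * norm (?v y)) integrable_on {0..x}"
		by (rule L1D(1)[OF norm_mult_integrable[OF e continuous_reg_sol[OF r]]]) (use x X in auto)
	 show "(%y. \<bar>q y\<bar> * K) integrable_on {0..x}"
		by (intro integrable_on_mult_left integrable_subinterval_real[OF iq]) (use x in auto)
	 fix y assume "y \<in> {0..x}"
	 then show "norm (?e y) * norm (?v y) <= \<bar>q y\<bar> * K" unfolding ne using K[of y] x by (intro mult_left_mono) auto
	qed
	also have "... = integral {0..x} (%y. \<bar>q y\<bar>) * K" by simp
	also have "... <= Q * K" unfolding Q_def
	 using K0 by (intro mult_right_mono integral_subset_le integrable_subinterval_real[OF iq] iq) (use x in auto)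
	finally show ?thesis by (simp add: mult.commute)
 qed
 have d: "norm (?d x) <= X * (K * Q) * exp 1" if x: "x \<in> {0..X}" for x
 proof -
	have "norm (?d x) <= X * (K * Q) * exp (integral {0..x} (%y. X * z\<^sup>2))"
	proof (rule gronwall[where a = 0 and b = X])
	 show "continuous_on {0..X} (%x. norm (?d x))"
		using continuous_on_subset[OF cd] X by (intro continuous_on_norm) auto
	 fix y assume y: "y \<in> {0..X}"
	 then have y1: "y \<in> {0..1}" using X by auto
	 have "norm (?d y) <= norm (reg_op l r0 ?d y) + norm (reg_op l ?e ?v y)"
		using reg_sol_diff[OF r0 r y1, of l] norm_triangle_ineq by metis
	 also have "... <= y * integral {0..y} (%y. norm (r0 y) * norm (?d y)) + y * integral {0..y} (%y. norm (?e y) * norm (?v y))"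
		by (intro add_mono norm_reg_op_le r0 e cd continuous_reg_sol r y1)
	 also have "... <= X * integral {0..y} (%y. norm (r0 y) * norm (?d y)) + X * (K * Q)"
		using y y1 X K0 Q0 ev[OF y] L1D(1)[OF norm_mult_integrable[OF r0 cd], of 0 y]
		by (intro add_mono mult_mono mult_nonneg_nonneg hk_nonneg)
		  (auto intro: L1D(1)[OF norm_mult_integrable[OF e continuous_reg_sol[OF r]]])
	 finally show "norm (?d y) <= X * (K * Q) + integral {0..y} (%y. X * z\<^sup>2 * norm (?d y))"
		unfolding ne by (simp add: mult.assoc)
	qed (use X K0 Q0 x in auto)
	also have "... <= X * (K * Q) * exp 1"
	proof (intro mult_left_mono)
	 have "integral {0..x} (%y. X * z\<^sup>2) = z\<^sup>2 * X * x" using x by simp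
	 also have "... <= z\<^sup>2 * X * X" using x X by (intro mult_left_mono) auto
	 finally show "exp (integral {0..x} (%y. X * z\<^sup>2)) <= exp 1" using lamX by simp
	qed (use X K0 Q0 in auto)
	finally show ?thesis .
 qed
 have X1: "X \<in> {0..1}" "X \<in> {0..X}" using X by auto
 have "norm (reg_flux l r0 ?u X - reg_flux l r ?v X) <= norm (reg_flux l r0 ?d X) + norm (reg_flux l ?e ?v X)"
	unfolding reg_flux_coeff_diff[OF r0 r continuous_reg_sol[OF r0] continuous_reg_sol[OF r] X1(1)] by (rule norm_triangle_ineq)
 also have "... <= X ^ (2*l+2) * integral {0..X} (%y. norm (r0 y) * norm (?d y)) + X ^ (2*l+2) * integral {0..X} (%y. norm (?e y) * norm (?v y))"
	by (intro add_mono norm_reg_flux_le r0 e cd continuous_reg_sol r X1)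
 also have "... <= X ^ (2*l+2) * (K * Q * exp 1) + X ^ (2*l+2) * (K * Q)"
 proof (intro add_mono mult_left_mono ev X1)
	have "integral {0..X} (%y. norm (r0 y) * norm (?d y)) <= integral {0..X} (%y. z\<^sup>2 * (X * (K * Q) * exp 1))"
	proof (rule integral_le)
	 show "(%y. norm (r0 y) * norm (?d y)) integrable_on {0..X}"
		by (rule L1D(1)[OF norm_mult_integrable[OF r0 cd]]) (use X in auto)
	qed (use d in \<open>auto simp: ne intro!: mult_left_mono\<close>)
	also have "... = (z\<^sup>2 * X * X) * (K * Q * exp 1)" using X by simp
	finally show "integral {0..X} (%y. norm (r0 y) * norm (?d y)) <= K * Q * exp 1" unfolding lamX by simp
 qed (use X in auto)
 finally have m: "norm (reg_flux l r0 ?u X - reg_flux l r ?v X) <= X ^ (2*l+2) * ((exp 1 + 1) * (K * Q))"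
	by (simp add: algebra_simps)
 have zXn: "z ^ n * X ^ n = 1" for n using zX by (metis power_mult_distrib power_one)
 have XQ: "X * Q <= N * X powr (1 + \<delta>)"
 proof -
	have "X * Q <= X * (N * X powr \<delta>)" using Q X by (intro mult_left_mono) auto
	also have "... = N * X powr (1 + \<delta>)" using X by (simp add: powr_add)
	finally show ?thesis .
 qed
 have "Dphi l q z X = of_real (z ^ (l+1) * X ^ (l+1)) * (?v X - ?u X)"
	unfolding Dphi_def phi_def lam_def[symmetric] r_def[symmetric] r0_def[symmetric] by (simp add: algebra_simps)
 then have "norm (Dphi l q z X) = norm (?d X)" unfolding zXn by (simp add: norm_minus_commute)
 also have "... <= X * (K * Q) * exp 1" by (rule d[OF X1(2)])
 also have "... = exp 1 * K * (X * Q)" by simp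
 also have "... <= exp 1 * K * (N * X powr (1 + \<delta>))" using XQ K0 by (intro mult_left_mono) auto
 finally show "norm (Dphi l q z X) <= (exp 1 * exp (N + 1) * N) * X powr (1 + \<delta>)" by (simp add: K_def mult_ac)
 have "Dphi' l q z X = of_real (z ^ (l+1)) * (of_real ((real l + 1) * X ^ l) * (?v X - ?u X) +
	 of_real (inverse (X ^ (l+1))) * (reg_flux l r ?v X - reg_flux l r0 ?u X))"
	unfolding Dphi'_def phi'_def lam_def[symmetric] r_def[symmetric] r0_def[symmetric] by (simp add: algebra_simps)
 then have "norm (Dphi' l q z X) = z ^ (l+1) * norm (of_real ((real l + 1) * X ^ l) * (?v X - ?u X) +
	 of_real (inverse (X ^ (l+1))) * (reg_flux l r ?v X - reg_flux l r0 ?u X))"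
	using z by (simp only: norm_mult norm_of_real) simp
 also have "norm (of_real ((real l + 1) * X ^ l) * (?v X - ?u X) +
	 of_real (inverse (X ^ (l+1))) * (reg_flux l r ?v X - reg_flux l r0 ?u X)) <=
	 \<bar>(real l + 1) * X ^ l\<bar> * norm (?d X) + \<bar>inverse (X ^ (l+1))\<bar> * norm (reg_flux l r0 ?u X - reg_flux l r ?v X)"
	by (rule order_trans[OF norm_triangle_ineq]) (simp only: norm_mult norm_of_real norm_minus_commute order_refl)
 also have "\<bar>(real l + 1) * X ^ l\<bar> = (real l + 1) * X ^ l" using X by (intro abs_of_nonneg) auto
 also have "\<bar>inverse (X ^ (l+1))\<bar> = inverse (X ^ (l+1))" using X by (intro abs_of_nonneg) auto
 also have "(real l + 1) * X ^ l * norm (?d X) + inverse (X ^ (l+1)) * norm (reg_flux l r0 ?u X - reg_flux l r ?v X)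
	 <= (real l + 1) * X ^ l * (X * (K * Q) * exp 1) + inverse (X ^ (l+1)) * (X ^ (2*l+2) * ((exp 1 + 1) * (K * Q)))"
	using X m d[OF X1(2)] by (intro add_mono mult_left_mono) auto
 also have "inverse (X ^ (l+1)) * (X ^ (2*l+2) * ((exp 1 + 1) * (K * Q))) = X ^ (l+1) * ((exp 1 + 1) * (K * Q))"
 proof -
	have "X ^ (2*l+2) = X ^ (l+1) * X ^ (l+1)" by (simp add: mult_2 power_add)
	moreover have "inverse P * (P * P * Y) = P * Y" if "P ~= 0" for P Y :: real using that by simp
	moreover have "X ^ (l+1) ~= 0" using X by simp
	ultimately show ?thesis by metis
 qed
 also have "z ^ (l+1) * ((real l + 1) * X ^ l * (X * (K * Q) * exp 1) + X ^ (l+1) * ((exp 1 + 1) * (K * Q)))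
	 = (z ^ (l+1) * X ^ (l+1)) * (((real l + 1) * exp 1 + exp 1 + 1) * (K * Q))"
	by (simp add: algebra_simps)
 finally have "norm (Dphi' l q z X) <= ((real l + 1) * exp 1 + exp 1 + 1) * (K * Q)"
	unfolding zXn using z by (simp add: mult_left_mono)
 then have "norm (Dphi' l q z X) / z <= ((real l + 1) * exp 1 + exp 1 + 1) * (K * Q) / z"
	using z by (intro divide_right_mono) auto
 also have "... = ((real l + 1) * exp 1 + exp 1 + 1) * K * (X * Q)" by (simp add: X_def)
 also have "... <= ((real l + 1) * exp 1 + exp 1 + 1) * K * (N * X powr (1 + \<delta>))"
	using XQ K0 by (intro mult_left_mono) (auto intro!: mult_nonneg_nonneg add_nonneg_nonneg)
 finally show "norm (Dphi' l q z X) / z <= ((real l + 1) * exp 1 + exp 1 + 1) * exp (N + 1) * N * X powr (1 + \<delta>)"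
	by (simp add: K_def mult_ac)
qed

lemma Dphi_bound:
 assumes w: "wpot \<delta> N q"
 shows "\<exists>C\<ge>0. \<forall>z x. 0 < z --> 0 < x --> x <= 1 --> 1 <= z * x --> norm (Dphi l q z x) <= C * x powr \<delta> / z"
proof -
 note D = wpotD[OF w]
 note q = D(1)
 obtain B where B: "0 <= B" "!!z x. x \<in> {0..1} ==> norm (z ^ (l+1) * phi l q (z\<^sup>2) x) <= B * exp (\<bar>Im z\<bar> * x)"
	using phi_growth[OF q, of l] by blast
 define C1 where "C1 = exp 1 * exp (N + 1) * N + ((real l + 1) * exp 1 + exp 1 + 1) * exp (N + 1) * N"
 define M where "M = real l * (real l + 1)"
 define C where "C = (C1 + B * N) * exp M"
 have C1: "0 <= C1" using D(7) by (auto simp: C1_def intro!: add_nonneg_nonneg mult_nonneg_nonneg)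
 have C: "0 <= C" using C1 B(1) D(7) by (auto simp: C_def)
 have "norm (Dphi l q z x) <= C * x powr \<delta> / z" if zx: "0 < z" "0 < x" "x <= 1" "1 <= z * x" for z x
 proof -
	define X where "X = 1 / z"
	have "z * x <= z * 1" using zx by (intro mult_left_mono) auto
	then have z1: "1 <= z" using zx by linarith
	have X: "0 < X" "X <= x" "X <= 1" using zx z1 by (auto simp: X_def field_simps)
	let ?y = "Dphi l q z" and ?y' = "Dphi' l q z"
	let ?h = "%s. of_real (q s) * (of_real (z ^ (l+1)) * phi l q (of_real (z\<^sup>2)) s)"
	note ac = ac_on_Dphi[OF q X(1,3), of l z]
	have Phi: "norm (cplx (z ^ (l+1)) * phi l q (of_real (z\<^sup>2)) s) <= B" if "s \<in> {0..1}" for s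
	 using B(2)[OF that, of "of_real z"] by simp
	have cphi: "continuous_on {X..1} (%s. cplx (z ^ (l+1)) * phi l q (of_real (z\<^sup>2)) s)"
	 by (intro continuous_intros ac_on_continuous[OF ac_on_phi(1)[OF q X(1,3)]])
	have qX: "(%s. cplx (q s)) absolutely_integrable_on {X..1}"
	 by (intro of_real_integrable L1D(3)[OF q]) (use X in auto)
	have h: "?h absolutely_integrable_on {X..1}"
	 using absolutely_integrable_mult_continuous[OF qX cphi] by (simp add: mult.commute)
	have iq: "(%y. \<bar>q y\<bar>) integrable_on {0..x}" using L1D(2)[OF q, of 0 x] zx by simp
	have hle: "integral {X..x} (%s. norm (?h s)) <= B * (N * x powr \<delta>)"
	proof -
	 have "integral {X..x} (%s. norm (?h s)) <= integral {X..x} (%s. \<bar>q s\<bar> * B)"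
	 proof (rule integral_le)
		show "(%s. norm (?h s)) integrable_on {X..x}" by (rule L1D(2)[OF h]) (use zx in auto)
		show "(%s. \<bar>q s\<bar> * B) integrable_on {X..x}"
		 by (intro integrable_on_mult_left integrable_subinterval_real[OF iq]) (use X in auto)
		fix s assume "s \<in> {X..x}"
		then show "norm (?h s) <= \<bar>q s\<bar> * B" unfolding norm_mult[of "cplx (q s)"] norm_of_real
		 using Phi[of s] X zx by (intro mult_left_mono) auto
	 qed
	 also have "... = integral {X..x} (%s. \<bar>q s\<bar>) * B" by simp
	 also have "... <= integral {0..x} (%s. \<bar>q s\<bar>) * B"
		using B(1) X by (intro mult_right_mono integral_subset_le integrable_subinterval_real[OF iq] iq) auto
	 also have "... <= (N * x powr \<delta>) * B"
		using B(1) zx by (intro mult_right_mono wpot_integral_le[OF w]) auto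
	 finally show ?thesis by (simp add: mult.commute)
	qed
	have Xx: "X powr (1 + \<delta>) <= x powr \<delta> / z"
	proof -
	 have "X powr (1 + \<delta>) = X powr \<delta> / z" using X by (simp add: powr_add X_def)
	 also have "... <= x powr \<delta> / z" using X D(3) zx by (intro divide_right_mono powr_mono2) auto
	 finally show ?thesis .
	qed
	have "norm (?y x) <= ((C1 + B * N) * x powr \<delta> / z) * exp M * exp (\<bar>Im (cplx z)\<bar> * (x - X))"
	proof (rule oscillator_growth[OF ac])
	 show "(%x. cplx (real l * (real l + 1) / x\<^sup>2)) absolutely_integrable_on {X..1}"
		using X by (intro absolutely_integrable_continuous_real continuous_intros) auto
	 show "?h absolutely_integrable_on {X..1}" by (rule h)
	 have "integral {X..1} (%s. norm (cplx (real l * (real l + 1) / s\<^sup>2))) = integral {X..1} (%s. real l * (real l + 1) / s\<^sup>2)"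
		unfolding norm_of_real by (simp add: abs_mult)
	 also have "... <= real l * (real l + 1) / X" by (rule integral_inverse_square_le(2)[OF X(1,3)]) simp
	 finally show "integral {X..1} (%s. norm (cplx (real l * (real l + 1) / s\<^sup>2))) <= M * norm (cplx z)"
		using zx by (simp add: M_def X_def)
	 have "norm (?y X) + norm (?y' X) / z <= C1 * X powr (1 + \<delta>)"
		using Dphi_small[OF w z1, of l] unfolding X_def C1_def distrib_right by (rule add_mono)
	 also have "... <= C1 * (x powr \<delta> / z)" by (rule mult_left_mono[OF Xx C1])
	 finally have "norm (?y X) + norm (?y' X) / z + integral {X..x} (%s. norm (?h s)) / z <= C1 * (x powr \<delta> / z) + B * (N * x powr \<delta>) / z"
		using hle zx by (intro add_mono divide_right_mono) auto
	 then show "exp (\<bar>Im (cplx z)\<bar> * X) * norm (?y X) + exp (\<bar>Im (cplx z)\<bar> * X) * norm (?y' X) / norm (cplx z) +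
		 integral {X..x} (%s. norm (?h s)) * exp (\<bar>Im (cplx z)\<bar> * x) / norm (cplx z) <= (C1 + B * N) * x powr \<delta> / z"
		using zx by (simp add: distrib_right add_divide_distrib mult.assoc)
	qed (use zx X in auto)
	then show ?thesis by (simp add: C_def mult_ac)
 qed
 with C show ?thesis by blast
qed

lemma integral_powr_tail_le:
 fixes \<delta> X x :: real
 assumes "0 < \<delta>" "\<delta> < 1" "0 < X" "X <= x"
 shows "(%s. s powr (\<delta> - 2)) integrable_on {X..x}"
	and "integral {X..x} (%s. s powr (\<delta> - 2)) <= X powr (\<delta> - 1) / (1 - \<delta>)"
proof -
 have "((%s. s powr (\<delta> - 2)) has_integral (x powr (\<delta> - 1) / (\<delta> - 1) - X powr (\<delta> - 1) / (\<delta> - 1))) {X..x}"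
 proof (rule fundamental_theorem_of_calculus[OF assms(4)])
	fix s assume "s \<in> {X..x}"
	then have s: "0 < s" using assms by auto
	have "((%s. s powr (\<delta> - 1) / (\<delta> - 1)) has_real_derivative s powr (\<delta> - 2)) (at s within {X..x})"
	proof -
	 have "((%s. s powr (\<delta> - 1) / (\<delta> - 1)) has_real_derivative (\<delta> - 1) * s powr (\<delta> - 1 - 1) / (\<delta> - 1)) (at s)"
		by (intro DERIV_cdivide has_real_derivative_powr s)
	 moreover have "(\<delta> - 1) * s powr (\<delta> - 1 - 1) / (\<delta> - 1) = s powr (\<delta> - 2)" using assms by simp
	 ultimately show ?thesis by (metis has_field_derivative_at_within)
	qed
	then show "((%s. s powr (\<delta> - 1) / (\<delta> - 1)) has_vector_derivative s powr (\<delta> - 2)) (at s within {X..x})"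
	 by (simp add: has_real_derivative_iff_has_vector_derivative)
 qed
 moreover have "x powr (\<delta> - 1) / (\<delta> - 1) - X powr (\<delta> - 1) / (\<delta> - 1) <= X powr (\<delta> - 1) / (1 - \<delta>)"
 proof -
	have "x powr (\<delta> - 1) / (\<delta> - 1) <= 0" using assms by (intro divide_nonneg_neg) auto
	moreover have "- (X powr (\<delta> - 1) / (\<delta> - 1)) = X powr (\<delta> - 1) / (1 - \<delta>)" by (metis minus_diff_eq minus_divide_right)
	ultimately show ?thesis by linarith
 qed
 ultimately show "(%s. s powr (\<delta> - 2)) integrable_on {X..x}"
	and "integral {X..x} (%s. s powr (\<delta> - 2)) <= X powr (\<delta> - 1) / (1 - \<delta>)"
	by (auto simp: has_integral_iff)
qed

definition born :: "nat => (real => real) => real => real => real"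
 where "born l q z x = integral {0..x} (%s. sin (z * (x - s)) * sin (z * s - real l * pi / 2) * q s)"

lemma Dphi_asymptotics:
 assumes w: "wpot \<delta> N q"
 shows "\<exists>C\<ge>0. \<forall>z x. 0 < z --> 0 < x --> x <= 1 --> 1 <= z * x -->
	norm (Dphi l q z x - of_real (odd_fact l / z * born l q z x)) <= C * (1 / z) powr (1 + \<delta>)"
proof -
 note D = wpotD[OF w]
 note q = D(1)
 define \<theta> where "\<theta> = real l * pi / 2"
 define \<alpha> where "\<alpha> = odd_fact l"
 have \<alpha>: "0 < \<alpha>" by (simp add: \<alpha>_def odd_fact_pos)
 obtain CD where CD: "0 <= CD" "!!z x. 0 < z ==> 0 < x ==> x <= 1 ==> 1 <= z * x ==> norm (Dphi l q z x) <= CD * x powr \<delta> / z"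
	using Dphi_bound[OF w, of l] by blast
 obtain \<beta> CF where CF: "0 <= CF" "!!z x. 0 < z ==> 0 < x ==> x <= 1 ==> 1 <= z * x ==>
	 norm (of_real (z ^ (l+1)) * phi l (%_. 0) (of_real (z\<^sup>2)) x -
	 of_real (\<alpha> * (sin (z * x - \<theta>) + \<beta> * cos (z * x - \<theta>) / (z * x)))) <= CF / (z * x)\<^sup>2"
	using phi_free_asymptotics[of l] unfolding \<theta>_def \<alpha>_def by blast
 define C1 where "C1 = exp 1 * exp (N + 1) * N + ((real l + 1) * exp 1 + exp 1 + 1) * exp (N + 1) * N"
 define C4 where "C4 = \<alpha> * \<bar>\<beta>\<bar> + CF + CD"
 define C where "C = C1 + CD * (real l * (real l + 1)) / (1 - \<delta>) + C4 * N + \<alpha> * N"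
 have C1: "0 <= C1" using D(7) by (auto simp: C1_def intro!: add_nonneg_nonneg mult_nonneg_nonneg)
 have C4: "0 <= C4" using \<alpha> CF CD by (auto simp: C4_def)
 have C: "0 <= C" using C1 C4 CD \<alpha> D by (auto simp: C_def intro!: add_nonneg_nonneg)
 have "norm (Dphi l q z x - of_real (\<alpha> / z * born l q z x)) <= C * (1 / z) powr (1 + \<delta>)"
	if zx: "0 < z" "0 < x" "x <= 1" "1 <= z * x" for z x
 proof -
	define X where "X = 1 / z"
	have "z * x <= z * 1" using zx by (intro mult_left_mono) auto
	then have z1: "1 <= z" using zx by linarith
	have X: "0 < X" "X <= x" "X <= 1" using zx z1 by (auto simp: X_def field_simps)
	let ?z = "cplx z"
	let ?y = "Dphi l q z" and ?y' = "Dphi' l q z"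
	let ?P = "%s. cplx (z ^ (l+1)) * phi l q (of_real (z\<^sup>2)) s"
	let ?L = "%s::real. real l * (real l + 1) / s\<^sup>2"
	let ?w = "%s. (of_real (?L s) - ?z\<^sup>2) * ?y s + of_real (q s) * ?P s"
	let ?k = "%s. sin (?z * of_real (x - s)) / ?z"
	let ?g = "%s. cplx (\<alpha> / z * (sin (z * (x - s)) * sin (z * s - \<theta>) * q s))"
	note ac = ac_on_Dphi[OF q X(1,3), of l z]
	have x1: "x \<in> {X..1}" using X zx by auto
	have voc: "?y x = ?y X * cos (?z * of_real (x - X)) + ?y' X * (sin (?z * of_real (x - X)) / ?z) +
	  integral {X..x} (%s. ?k s * (?w s + ?z\<^sup>2 * ?y s))"
	 by (rule variation_of_constants[OF ac _ x1]) (use zx in auto)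
	have kr: "?k s = cplx (sin (z * (x - s)) / z)" for s
	 by (simp only: of_real_mult[symmetric] sin_of_real of_real_divide)
	have nk: "norm (?k s) <= 1 / z" for s unfolding kr norm_of_real using zx by (simp add: abs_mult divide_right_mono)
	have cy: "continuous_on {X..x} ?y"
	 using continuous_on_subset[OF ac_on_continuous[OF ac(1)]] zx by auto
	have cP: "continuous_on {X..x} ?P"
	 using continuous_on_subset[OF ac_on_continuous[OF ac_on_phi(1)[OF q X(1,3)]], of "{X..x}"] zx by (intro continuous_intros) auto
	have ck: "continuous_on A ?k" for A using zx by (intro continuous_intros) auto
	have qx: "(%s. cplx (q s)) absolutely_integrable_on {0..x}"
	 by (intro of_real_integrable L1D(3)[OF q]) (use zx in auto)
	have qX: "(%s. cplx (q s)) absolutely_integrable_on {X..x}"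
	 by (rule L1D(3)[OF qx]) (use X in auto)
	have int1: "(%s. ?k s * (?w s + ?z\<^sup>2 * ?y s)) absolutely_integrable_on {X..x}"
	proof (rule absolutely_integrable_mult_continuous[OF _ ck])
	 have "(%s. of_real (?L s) * ?y s) absolutely_integrable_on {X..x}"
		using X by (intro absolutely_integrable_continuous_real continuous_intros cy) auto
	 from set_integral_add(1)[OF this absolutely_integrable_mult_continuous[OF qX cP]]
	 show "(%s. ?w s + ?z\<^sup>2 * ?y s) absolutely_integrable_on {X..x}" by (simp add: algebra_simps)
	qed
	have int2: "?g absolutely_integrable_on {0..x}"
	proof -
	 have "(%s. cplx (\<alpha> / z * (sin (z * (x - s)) * sin (z * s - \<theta>))) * of_real (q s)) absolutely_integrable_on {0..x}"
		by (intro absolutely_integrable_mult_continuous qx continuous_intros)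
	 then show ?thesis by (simp add: mult_ac)
	qed
	have iq: "(%y. \<bar>q y\<bar>) integrable_on {0..X}" using L1D(2)[OF q, of 0 X] X by simp
	note i1 = L1D(1)[OF int1 order_refl order_refl]
	have i2: "?g integrable_on {X..x}" "?g integrable_on {0..X}" "?g integrable_on {0..x}"
	 using L1D(1)[OF int2] X by auto
	note ip = integral_powr_tail_le[OF D(3,4) X(1,2)]
	note it = wpot_tail_le[OF w X(1,2) zx(3)]
	have i3: "(%s. 1 / z * (CD * (real l * (real l + 1)) / z * s powr (\<delta> - 2) + C4 / z * (\<bar>q s\<bar> / s))) integrable_on {X..x}"
	 by (intro integrable_on_mult_right integrable_add ip it)
	have E1: "norm (integral {X..x} (%s. ?k s * (?w s + ?z\<^sup>2 * ?y s)) - integral {X..x} ?g) <=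
		(CD * (real l * (real l + 1)) / (1 - \<delta>) + C4 * N) * X powr (1 + \<delta>)"
	proof -
	 have "norm (integral {X..x} (%s. ?k s * (?w s + ?z\<^sup>2 * ?y s) - ?g s)) <=
		integral {X..x} (%s. 1 / z * (CD * (real l * (real l + 1)) / z * s powr (\<delta> - 2) + C4 / z * (\<bar>q s\<bar> / s)))"
	 proof (rule integral_norm_bound_integral[OF integrable_diff[OF i1 i2(1)] i3])
		fix s assume s: "s \<in> {X..x}"
		then have s0: "0 < s" "s <= 1" using X zx by auto
		have zs: "1 <= z * s" using s zx by (simp add: X_def field_simps)
		have Deq: "?P s = of_real (z ^ (l+1)) * phi l (%_. 0) (of_real (z\<^sup>2)) s + ?y s"
		 by (simp add: Dphi_def algebra_simps)
		have yb: "norm (?y s) <= CD * s powr \<delta> / z" by (rule CD(2)[OF zx(1) s0 zs])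
		have sd: "s powr \<delta> <= 1 / s"
		proof -
		 have "s powr \<delta> <= 1" using s0 D(3) by (intro powr_le1) auto
		 also have "1 <= 1 / s" using s0 by simp
		 finally show ?thesis .
		qed
		have "norm (?P s - of_real (\<alpha> * sin (z * s - \<theta>))) <= C4 / (z * s)"
		proof -
		 have "?P s - of_real (\<alpha> * sin (z * s - \<theta>)) =
			 (of_real (z ^ (l+1)) * phi l (%_. 0) (of_real (z\<^sup>2)) s - of_real (\<alpha> * (sin (z * s - \<theta>) + \<beta> * cos (z * s - \<theta>) / (z * s))))
			 + of_real (\<alpha> * \<beta> * cos (z * s - \<theta>) / (z * s)) + ?y s"
			unfolding Deq by (simp add: algebra_simps)
		 also have "norm ... <= CF / (z * s)\<^sup>2 + \<alpha> * \<bar>\<beta>\<bar> / (z * s) + CD * s powr \<delta> / z"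
		 proof (intro order_trans[OF norm_triangle_ineq] add_mono CF(2)[OF zx(1) s0 zs] yb)
			have "norm (cplx (\<alpha> * \<beta> * cos (z * s - \<theta>) / (z * s))) = \<alpha> * \<bar>\<beta>\<bar> * \<bar>cos (z * s - \<theta>)\<bar> / (z * s)"
			 unfolding norm_of_real using \<alpha> zx s0 by (simp add: abs_mult)
			also have "... <= \<alpha> * \<bar>\<beta>\<bar> * 1 / (z * s)" using \<alpha> zx s0 by (intro divide_right_mono mult_left_mono) auto
			finally show "norm (cplx (\<alpha> * \<beta> * cos (z * s - \<theta>) / (z * s))) <= \<alpha> * \<bar>\<beta>\<bar> / (z * s)" by simp
		 qed
		 also have "... <= CF / (z * s) + \<alpha> * \<bar>\<beta>\<bar> / (z * s) + CD * (1 / s) / z"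
		 proof (intro add_mono divide_right_mono mult_left_mono sd)
			have "(z * s) * 1 <= (z * s) * (z * s)" using zs by (intro mult_left_mono) auto
			then show "CF / (z * s)\<^sup>2 <= CF / (z * s)" using CF(1) zs by (intro divide_left_mono) (auto simp: power2_eq_square)
		 qed (use CD zx \<alpha> s0 in auto)
		 also have "... = C4 / (z * s)" using zx s0 by (simp add: C4_def add_divide_distrib)
		 finally show ?thesis .
		qed
		note Pb = this
		have "?k s * (?w s + ?z\<^sup>2 * ?y s) - ?g s = ?k s * (of_real (?L s) * ?y s + of_real (q s) * (?P s - of_real (\<alpha> * sin (z * s - \<theta>))))"
		proof -
		 have g: "?g s = ?k s * (of_real (q s) * of_real (\<alpha> * sin (z * s - \<theta>)))" unfolding kr by simp
		 show ?thesis unfolding g by (simp add: algebra_simps)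
		qed
		also have "norm ... <= 1 / z * (?L s * (CD * s powr \<delta> / z) + \<bar>q s\<bar> * (C4 / (z * s)))"
		proof -
		 have "norm (of_real (?L s) * ?y s) <= ?L s * (CD * s powr \<delta> / z)"
		 proof -
			have "\<bar>?L s\<bar> = ?L s" by (intro abs_of_nonneg) auto
			then show ?thesis unfolding norm_mult norm_of_real by (simp only:) (intro mult_left_mono yb, auto)
		 qed
		 moreover have "norm (of_real (q s) * (?P s - of_real (\<alpha> * sin (z * s - \<theta>)))) <= \<bar>q s\<bar> * (C4 / (z * s))"
			unfolding norm_mult[of "cplx (q s)"] norm_of_real by (intro mult_left_mono Pb) auto
		 ultimately have "norm (of_real (?L s) * ?y s + of_real (q s) * (?P s - of_real (\<alpha> * sin (z * s - \<theta>)))) <=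
			 ?L s * (CD * s powr \<delta> / z) + \<bar>q s\<bar> * (C4 / (z * s))"
			by (rule order_trans[OF norm_triangle_ineq add_mono])
		 then show ?thesis unfolding norm_mult[of "?k s"] using nk[of s] zx by (intro mult_mono) auto
		qed
		also have "?L s * (CD * s powr \<delta> / z) = CD * (real l * (real l + 1)) / z * s powr (\<delta> - 2)"
		 using s0 by (simp add: powr_diff mult_ac)
		also have "\<bar>q s\<bar> * (C4 / (z * s)) = C4 / z * (\<bar>q s\<bar> / s)" by simp
		finally show "norm (?k s * (?w s + ?z\<^sup>2 * ?y s) - ?g s) <=
		 1 / z * (CD * (real l * (real l + 1)) / z * s powr (\<delta> - 2) + C4 / z * (\<bar>q s\<bar> / s))" .
	 qed
	 also have "... = 1 / z * (CD * (real l * (real l + 1)) / z * integral {X..x} (%s. s powr (\<delta> - 2)) + C4 / z * integral {X..x} (%s. \<bar>q s\<bar> / s))"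
		by (subst integral_mult_right, subst hk_add[OF
			 integrable_on_mult_right[OF ip(1)] integrable_on_mult_right[OF it(1)]]) (simp only: integral_mult_right)
	 also have "... <= 1 / z * (CD * (real l * (real l + 1)) / z * (X powr (\<delta> - 1) / (1 - \<delta>)) + C4 / z * (N * X powr (\<delta> - 1)))"
		using ip(2) it(2) zx CD(1) C4 by (intro mult_left_mono add_mono) auto
	 also have "... = (CD * (real l * (real l + 1)) / (1 - \<delta>) + C4 * N) * (X * X * X powr (\<delta> - 1))"
	 proof -
		have "1 / z * (A / z * (Y / d) + C4 / z * (N * Y)) = (A / d + C4 * N) * (1 / z * (1 / z) * Y)" for A Y d :: real
		 by (simp add: distrib_left distrib_right mult_ac)
		then show ?thesis unfolding X_def by blast
	 qed
	 also have "X * X * X powr (\<delta> - 1) = X powr (1 + \<delta>)" using X by (simp add: powr_add powr_diff)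
	 finally show ?thesis unfolding hk_diff[OF i1 i2(1)] .
	qed
	have E2: "norm (integral {0..X} ?g) <= \<alpha> * N * X powr (1 + \<delta>)"
	proof -
	 have "norm (integral {0..X} ?g) <= integral {0..X} (%s. \<alpha> / z * \<bar>q s\<bar>)"
	 proof (rule integral_norm_bound_integral[OF i2(2)])
		show "(%s. \<alpha> / z * \<bar>q s\<bar>) integrable_on {0..X}" by (intro integrable_on_mult_right iq)
		fix s
		have "\<bar>sin (z * (x - s)) * sin (z * s - \<theta>)\<bar> <= 1" unfolding abs_mult by (intro mult_le_one) auto
		then have "\<alpha> / z * (\<bar>sin (z * (x - s)) * sin (z * s - \<theta>)\<bar> * \<bar>q s\<bar>) <= \<alpha> / z * (1 * \<bar>q s\<bar>)"
		 using \<alpha> zx by (intro mult_left_mono mult_right_mono) auto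
		then show "norm (?g s) <= \<alpha> / z * \<bar>q s\<bar>" unfolding norm_of_real using \<alpha> zx by (simp add: abs_mult)
	 qed
	 also have "... = \<alpha> / z * integral {0..X} (%s. \<bar>q s\<bar>)" by simp
	 also have "... <= \<alpha> / z * (N * X powr \<delta>)"
		using \<alpha> zx X by (intro mult_left_mono wpot_integral_le[OF w]) auto
	 also have "... = \<alpha> * N * X powr (1 + \<delta>)" using X by (simp add: powr_add X_def)
	 finally show ?thesis .
	qed
	have Bg: "of_real (\<alpha> / z * born l q z x) = integral {0..X} ?g + integral {X..x} ?g"
	proof -
	 have "integral {0..X} ?g + integral {X..x} ?g = integral {0..x} ?g"
		by (rule hk_combine[OF _ X(2) i2(3)]) (use X in auto)
	 also have "... = of_real (\<alpha> / z * born l q z x)"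
	 proof -
		have "(%s. sin (z * (x - s)) * sin (z * s - \<theta>) * q s) integrable_on {0..x}"
		proof -
		 have "q absolutely_integrable_on {0..x}" by (rule L1D(3)[OF q]) (use zx in auto)
		 then have "(%s. (sin (z * (x - s)) * sin (z * s - \<theta>)) * q s) absolutely_integrable_on {0..x}"
			by (intro absolutely_integrable_mult_continuous continuous_intros)
		 from L1D(1)[OF this order_refl order_refl] show ?thesis .
		qed
		then have "((%s. \<alpha> / z * (sin (z * (x - s)) * sin (z * s - \<theta>) * q s)) has_integral (\<alpha> / z * born l q z x)) {0..x}"
		 unfolding born_def \<theta>_def by (intro has_integral_mult_right integrable_integral)
		from has_integral_linear[OF this bounded_linear_of_real[where 'a = complex]]
		show ?thesis by (simp only: o_def integral_unique)
	 qed
	 finally show ?thesis by simp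
	qed
	have E3: "norm (?y X * cos (?z * of_real (x - X)) + ?y' X * (sin (?z * of_real (x - X)) / ?z)) <= C1 * X powr (1 + \<delta>)"
	proof -
	 have t: "cos (?z * of_real (x - X)) = of_real (cos (z * (x - X)))" "sin (?z * of_real (x - X)) / ?z = of_real (sin (z * (x - X)) / z)"
		by (simp_all only: of_real_mult[symmetric] sin_of_real cos_of_real of_real_divide)
	 have "norm (?y X * cos (?z * of_real (x - X)) + ?y' X * (sin (?z * of_real (x - X)) / ?z)) <= norm (?y X) * 1 + norm (?y' X) * (1 / z)"
		unfolding t
	 proof (intro order_trans[OF norm_triangle_ineq] add_mono)
		show "norm (?y X * of_real (cos (z * (x - X)))) <= norm (?y X) * 1"
		 unfolding norm_mult norm_of_real by (intro mult_left_mono) auto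
		show "norm (?y' X * of_real (sin (z * (x - X)) / z)) <= norm (?y' X) * (1 / z)"
		 unfolding norm_mult norm_of_real using zx by (intro mult_left_mono) (auto simp: divide_right_mono)
	 qed
	 also have "... = norm (?y X) + norm (?y' X) / z" by simp
	 also have "... <= C1 * X powr (1 + \<delta>)"
		using Dphi_small[OF w z1, of l] unfolding X_def C1_def distrib_right by (rule add_mono)
	 finally show ?thesis .
	qed
	have "?y x - of_real (\<alpha> / z * born l q z x) = (?y X * cos (?z * of_real (x - X)) + ?y' X * (sin (?z * of_real (x - X)) / ?z))
	  + (integral {X..x} (%s. ?k s * (?w s + ?z\<^sup>2 * ?y s)) - integral {X..x} ?g) + (- integral {0..X} ?g)"
	 unfolding Bg by (subst voc) simp
	also have "norm ... <= C1 * X powr (1 + \<delta>) + (CD * (real l * (real l + 1)) / (1 - \<delta>) + C4 * N) * X powr (1 + \<delta>) + \<alpha> * N * X powr (1 + \<delta>)"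
	 using E2 by (intro order_trans[OF norm_triangle_ineq] add_mono E1 E3) simp
	also have "... = C * X powr (1 + \<delta>)" by (simp add: C_def algebra_simps)
	finally show ?thesis by (simp only: X_def)
 qed
 with C show ?thesis unfolding \<alpha>_def by blast
qed

section \<open>Cosine sampling\<close>

lemma norm_sin_pi_ge:
 fixes w :: complex
 assumes "1 <= \<bar>Im w\<bar> \<or> (\<exists>n::int. Re w = of_int n + 1/2)"
 shows "exp (pi * \<bar>Im w\<bar>) / 4 <= norm (sin (of_real pi * w))"
proof -
 define y where "y = pi * \<bar>Im w\<bar>"
 have e: "norm (exp (\<i> * (of_real pi * w))) = exp (- pi * Im w)" "norm (exp (- (\<i> * (of_real pi * w)))) = exp (pi * Im w)"
	by (simp_all add: norm_exp_eq_Re)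
 have ns: "norm (sin (of_real pi * w)) = norm (exp (\<i> * (of_real pi * w)) - exp (- (\<i> * (of_real pi * w)))) / 2"
	by (simp add: sin_exp_eq norm_divide norm_mult)
 from assms show ?thesis
 proof
	assume 1: "1 <= \<bar>Im w\<bar>"
	then have "pi * 1 <= y" unfolding y_def by (intro mult_left_mono) auto
	then have "1 <= y" using pi_gt3 by simp
	then have "2 <= exp y" using exp_ge_add_one_self[of y] by linarith
	then have "2 * exp (- y) <= exp y * exp (- y)" by (intro mult_right_mono) auto
	then have ey: "2 * exp (- y) <= 1" by (simp flip: exp_add)
	have "exp y / 2 <= exp y - exp (- y)" using ey \<open>2 <= exp y\<close> by linarith
	also have "... <= norm (exp (\<i> * (of_real pi * w)) - exp (- (\<i> * (of_real pi * w))))"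
	proof (cases "0 <= Im w")
	 case True
	 then show ?thesis using norm_triangle_ineq2[of "exp (- (\<i> * (of_real pi * w)))" "exp (\<i> * (of_real pi * w))"]
		unfolding e by (simp add: y_def norm_minus_commute)
	next
	 case False
	 then show ?thesis using norm_triangle_ineq2[of "exp (\<i> * (of_real pi * w))" "exp (- (\<i> * (of_real pi * w)))"]
		unfolding e by (simp add: y_def)
	qed
	finally show ?thesis unfolding ns y_def by simp
 next
	assume "\<exists>n::int. Re w = of_int n + 1/2"
	then obtain n :: int where n: "Re w = of_int n + 1/2" by blast
	have c: "cos (pi * Re w) = 0" "(sin (pi * Re w))\<^sup>2 = 1"
	proof -
	 have "pi * Re w = of_int n * pi + pi / 2" by (simp add: n algebra_simps)
	 then show "cos (pi * Re w) = 0" using sin_zero_iff_int2[of "of_int n * pi"] by (auto simp: cos_add)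
	 then show "(sin (pi * Re w))\<^sup>2 = 1" using sin_cos_squared_add[of "pi * Re w"] by simp
	qed
	have "(norm (sin (of_real pi * w)))\<^sup>2 = (exp (2 * (pi * Im w)) + inverse (exp (2 * (pi * Im w))) - 2 * cos (2 * (pi * Re w))) / 4"
	 using norm_sin_squared[of "of_real pi * w"] by simp
	also have "... = ((exp (pi * Im w) + exp (- (pi * Im w))) / 2)\<^sup>2"
	proof -
	 have "cos (2 * (pi * Re w)) = -1" using cos_double_sin[of "pi * Re w"] c by simp
	 moreover have "exp (2 * (pi * Im w)) = (exp (pi * Im w))\<^sup>2" "inverse (exp (2 * (pi * Im w))) = (exp (- (pi * Im w)))\<^sup>2"
		by (simp_all add: power2_eq_square flip: exp_minus exp_add)
	 moreover have "exp (pi * Im w) * exp (- (pi * Im w)) = 1" by (simp flip: exp_add)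
	 ultimately show ?thesis by (simp add: power2_sum power_divide)
	qed
	finally have "norm (sin (of_real pi * w)) = (exp (pi * Im w) + exp (- (pi * Im w))) / 2"
	 by (simp add: power2_eq_iff_nonneg)
	moreover have "exp (pi * \<bar>Im w\<bar>) <= exp (pi * Im w) + exp (- (pi * Im w))" by (cases "0 <= Im w") auto
	moreover have "exp (pi * \<bar>Im w\<bar>) / 4 <= exp (pi * \<bar>Im w\<bar>) / 2" by simp
	ultimately show ?thesis by (metis divide_right_mono order_trans zero_le_numeral)
 qed
qed

lemma sin_pi_eq_0_Ints: "sin (cplx pi * w) = 0 \<longleftrightarrow> w \<in> \<int>"
proof
 assume "sin (cplx pi * w) = 0"
 then obtain n :: int where "of_real pi * w = of_real (real_of_int n * pi)" by (auto simp: sin_eq_0)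
 then have "of_real pi * w = of_real pi * of_int n" by simp
 then have "w = of_int n" by simp
 then show "w \<in> \<int>" by simp
next
 assume "w \<in> \<int>"
 then obtain n where "w = of_int n" by (auto elim: Ints_cases)
 then have "cplx pi * w = of_real (of_int n * pi)" by simp
 then show "sin (cplx pi * w) = 0" by (auto simp: sin_eq_0)
qed

text \<open>Dividing by \<open>sin (\<pi> w)\<close> gives an entire function, bounded by the maximum principle on unit
  squares; it is constant by Liouville, and it is odd.\<close>
lemma even_entire_zero_at_Ints:
 fixes G :: "complex => complex"
 assumes G: "G holomorphic_on UNIV" and Z: "!!w. w \<in> \<int> ==> G w = 0"
	and le: "!!w. norm (G w) <= C * exp (pi * \<bar>Im w\<bar>)" and even: "!!w. G (- w) = G w"
 shows "G w = 0"
proof -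
 let ?s = "%w. sin (cplx pi * w)"
 define Q where "Q = (%w. if w \<in> \<int> then deriv G w / (of_real pi * cos (of_real pi * w)) else G w / ?s w)"
 have C0: "0 <= C" using order_trans[OF norm_ge_zero le[of 0]] by simp
 have holo1: "Q holomorphic_on (UNIV - \<int>)"
 proof (rule holomorphic_transform[of "%w. G w / ?s w"])
	show "(%w. G w / ?s w) holomorphic_on (UNIV - \<int>)"
	 using sin_pi_eq_0_Ints by (intro holomorphic_intros holomorphic_on_subset[OF G]) auto
 qed (auto simp: Q_def)
 have opn: "open (UNIV - \<int> :: complex set)" using closed_Ints by (auto simp: open_Diff)
 have cont: "isCont Q w" for w
 proof (cases "w \<in> \<int>")
	case False
	then show ?thesis using holomorphic_on_imp_continuous_on[OF holo1] opn
	 by (simp add: continuous_on_eq_continuous_at)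
 next
	case True
	have cw: "of_real pi * cos (of_real pi * w) ~= 0"
	 using True sin_pi_eq_0_Ints[of w] sin_cos_squared_add[of "cplx pi * w"] by auto
	have d1: "((%y. (G y - G w) / (y - w)) \<longlongrightarrow> deriv G w) (at w)"
	 using holomorphic_derivI[OF G open_UNIV, of w] by (simp add: has_field_derivative_iff)
	have "(?s has_field_derivative of_real pi * cos (of_real pi * w)) (at w)" by (auto intro!: derivative_eq_intros)
	then have d2: "((%y. (?s y - ?s w) / (y - w)) \<longlongrightarrow> of_real pi * cos (of_real pi * w)) (at w)" by (simp add: has_field_derivative_iff)
	have "((%y. ((G y - G w) / (y - w)) / ((?s y - ?s w) / (y - w))) \<longlongrightarrow> deriv G w / (of_real pi * cos (of_real pi * w))) (at w)"
	 by (intro tendsto_intros d1 d2 cw)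
	moreover have "\<forall>\<^sub>F y in at w. ((G y - G w) / (y - w)) / ((?s y - ?s w) / (y - w)) = Q y"
	proof -
	 obtain e where e: "e > 0" "!!y. y \<in> \<int> ==> y ~= w ==> e <= dist w y"
	 proof
		show "(1::real) > 0" by simp
		show "1 <= dist w y" if y: "y \<in> \<int>" "y ~= w" for y
		proof -
		 have "w - y \<in> \<int>" using True y by auto
		 then obtain k where k: "w - y = of_int k" by (auto elim: Ints_cases)
		 then have "k ~= 0" using y by auto
		 then show ?thesis using k by (simp add: dist_norm)
		qed
	 qed
	 have "\<forall>\<^sub>F y in at w. y ~= w & dist y w < e"
		unfolding eventually_at using e(1) by (intro exI[of _ e]) auto
	 then show ?thesis
	 proof (rule eventually_mono)
		fix y assume y: "y ~= w & dist y w < e"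
		then have "y \<notin> \<int>" using e(2)[of y] by (auto simp: dist_commute)
		then show "((G y - G w) / (y - w)) / ((?s y - ?s w) / (y - w)) = Q y"
		 using y Z[OF True] sin_pi_eq_0_Ints[of w] True by (simp add: Q_def)
	 qed
	qed
	ultimately have "(Q \<longlongrightarrow> deriv G w / (of_real pi * cos (of_real pi * w))) (at w)"
	 by (rule Lim_transform_eventually)
	then show ?thesis using True by (simp add: isCont_def Q_def)
 qed
 have holo: "Q holomorphic_on UNIV"
 proof -
	have "Q holomorphic_on ball w 1" for w
	proof (rule no_isolated_singularity[where K = "ball w 1 \<inter> \<int>"])
	 show "continuous_on (ball w 1) Q" using cont by (intro continuous_at_imp_continuous_on) auto
	 show "Q holomorphic_on ball w 1 - (ball w 1 \<inter> \<int>)" by (rule holomorphic_on_subset[OF holo1]) auto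
	 have "ball w 1 \<inter> \<int> \<subseteq> of_int ` {\<lfloor>Re w - 1\<rfloor>..\<lceil>Re w + 1\<rceil>}"
	 proof
		fix z assume "z \<in> ball w 1 \<inter> \<int>"
		then obtain k where k: "z = of_int k" "dist w z < 1" by (auto elim: Ints_cases)
		have "\<bar>Re w - of_int k\<bar> <= norm (w - z)" using abs_Re_le_cmod[of "w - z"] k(1) by simp
		then have "\<bar>Re w - of_int k\<bar> < 1" using k(2) by (simp add: dist_norm)
		then have "k \<in> {\<lfloor>Re w - 1\<rfloor>..\<lceil>Re w + 1\<rceil>}" by (auto; linarith)
		then show "z \<in> of_int ` {\<lfloor>Re w - 1\<rfloor>..\<lceil>Re w + 1\<rceil>}" using k(1) by auto
	 qed
	 then show "finite (ball w 1 \<inter> \<int>)" by (rule finite_subset) simp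
	qed auto
	then have "Q field_differentiable at w" for w
	 by (meson centre_in_ball holomorphic_on_imp_differentiable_at open_ball zero_less_one)
	then show ?thesis by (simp add: holomorphic_on_def field_differentiable_at_within)
 qed
 have big: "norm (Q w) <= 4 * C" if "1 <= \<bar>Im w\<bar> \<or> (\<exists>n::int. Re w = of_int n + 1/2)" for w
 proof -
	have s: "exp (pi * \<bar>Im w\<bar>) / 4 <= norm (?s w)" by (rule norm_sin_pi_ge[OF that])
	then have "0 < norm (?s w)" using exp_gt_zero[of "pi * \<bar>Im w\<bar>"] by linarith
	then have "w \<notin> \<int>" using sin_pi_eq_0_Ints[of w] by auto
	then have "norm (Q w) = norm (G w) / norm (?s w)" by (simp add: Q_def norm_divide)
	also have "... <= (C * exp (pi * \<bar>Im w\<bar>)) / (exp (pi * \<bar>Im w\<bar>) / 4)"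
	 by (rule frac_le) (use le[of w] s C0 in auto)
	finally show ?thesis by simp
 qed
 have bound: "norm (Q w) <= 4 * C" for w
 proof (cases "1 <= \<bar>Im w\<bar>")
	case False
	define n where "n = \<lfloor>Re w + 1/2\<rfloor>"
	define S where "S = cbox (Complex (of_int n - 1/2) (-1)) (Complex (of_int n + 1/2) 1)"
	have wS: "w \<in> S" using False unfolding S_def n_def in_cbox_complex_iff by simp linarith
	show ?thesis
	proof (rule maximum_modulus_frontier[of Q S])
	 show "Q holomorphic_on interior S" by (rule holomorphic_on_subset[OF holo]) auto
	 show "continuous_on (closure S) Q"
		by (rule continuous_on_subset[OF holomorphic_on_imp_continuous_on[OF holo]]) auto
	 show "bounded S" by (simp add: S_def bounded_cbox)
	 fix z assume "z \<in> frontier S"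
	 then have z: "z \<in> S" "z \<notin> box (Complex (of_int n - 1/2) (-1)) (Complex (of_int n + 1/2) 1)"
		by (auto simp: S_def frontier_cbox)
	 have "1 <= \<bar>Im z\<bar> \<or> Re z = of_int n + 1/2 \<or> Re z = of_int (n - 1) + 1/2"
		using z unfolding S_def in_cbox_complex_iff in_box_complex_iff by auto
	 then show "norm (Q z) <= 4 * C" by (intro big) blast
	qed (rule wS)
 qed (simp add: big)
 have "\<exists>c. \<forall>w. Q w = c"
 proof (rule Liouville_theorem[OF holo, unfolded constant_on_def, simplified])
	show "bounded (range Q)" using bound by (auto simp: bounded_iff)
 qed
 then obtain c where c: "!!w. Q w = c" by blast
 have h: "(1/2 :: complex) \<notin> \<int>" "(-1/2 :: complex) \<notin> \<int>"
 proof -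
	have "?s (1/2) = 1" by (simp add: sin_of_real[symmetric, of "pi/2", simplified])
	then show "(1/2 :: complex) \<notin> \<int>" using sin_pi_eq_0_Ints[of "1/2"] by auto
	then show "(-1/2 :: complex) \<notin> \<int>" using minus_in_Ints_iff[of "1/2 :: complex"] by auto
 qed
 have "Q (-1/2) = - Q (1/2)" using even[of "1/2"] h by (simp add: Q_def)
 then have "c = - c" using c by metis
 then have c0: "c = 0" by simp
 have G0: "G w = 0" if "w \<notin> \<int>" for w
 proof -
	have "Q w = 0" using c c0 by simp
	then show ?thesis using that sin_pi_eq_0_Ints[of w] by (simp add: Q_def)
 qed
 then show ?thesis using Z by blast
qed

lemma integral_cos_cos:
 assumes x: "0 < x"
 shows "((%t. cos (real n * pi * t / x) * cos (real m * pi * t / x)) has_integral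
	(if n = m then if n = 0 then x else x / 2 else 0)) {0..x}"
proof -
 have I: "((%t. cos (of_int k * pi * t / x)) has_integral (if k = 0 then x else 0)) {0..x}" for k :: int
 proof (cases "k = 0")
	case True
	then show ?thesis using has_integral_const_real[of "1::real" 0 x] x by simp
 next
	case False
	have "((%t. cos (of_int k * pi * t / x)) has_integral (sin (of_int k * pi * x / x) * x / (of_int k * pi) - sin (of_int k * pi * 0 / x) * x / (of_int k * pi))) {0..x}"
	proof (rule fundamental_theorem_of_calculus)
	 fix t
	 have "((%t. sin (of_int k * pi * t / x) * x / (of_int k * pi)) has_real_derivative cos (of_int k * pi * t / x)) (at t within {0..x})"
		using False x by (auto intro!: derivative_eq_intros)
	 then show "((%t. sin (of_int k * pi * t / x) * x / (of_int k * pi)) has_vector_derivative cos (of_int k * pi * t / x)) (at t within {0..x})"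
		by (simp add: has_real_derivative_iff_has_vector_derivative)
	qed (use x in auto)
	then show ?thesis using False x using sin_zero_iff_int2[of "of_int k * pi"] by auto
 qed
 have "((%t. (cos (of_int (int n - int m) * pi * t / x) + cos (of_int (int n + int m) * pi * t / x)) / 2) has_integral
	 ((if int n - int m = 0 then x else 0) + (if int n + int m = 0 then x else 0)) / 2) {0..x}"
	by (intro has_integral_divide has_integral_add I)
 moreover have "(%t. (cos (of_int (int n - int m) * pi * t / x) + cos (of_int (int n + int m) * pi * t / x)) / 2) =
	 (%t. cos (real n * pi * t / x) * cos (real m * pi * t / x))"
 proof
	fix t
	have "of_int (int n - int m) * pi * t / x = real n * pi * t / x - real m * pi * t / x"
	 "of_int (int n + int m) * pi * t / x = real n * pi * t / x + real m * pi * t / x"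
	 by (simp_all add: diff_divide_distrib add_divide_distrib algebra_simps)
	then show "(cos (of_int (int n - int m) * pi * t / x) + cos (of_int (int n + int m) * pi * t / x)) / 2 =
	 cos (real n * pi * t / x) * cos (real m * pi * t / x)" by (simp add: cos_times_cos)
 qed
 moreover have "((if int n - int m = 0 then x else 0) + (if int n + int m = 0 then x else 0)) / 2 =
	 (if n = m then if n = 0 then x else x / 2 else 0)" by auto
 ultimately show ?thesis by simp
qed

definition cos_kernel :: "(complex => complex) => real => real => complex"
 where "cos_kernel E x t = (\<Sum>n. (if n = 0 then 1 else 2) * E (of_real (real n * pi / (2 * x))) *
	 of_real (cos (real n * pi * t / x))) / of_real x"

theorem cosine_sampling:
 fixes E :: "complex => complex"
 assumes x: "0 < x" and E: "E holomorphic_on UNIV" and even: "!!z. E (- z) = E z"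
	and growth: "!!z. norm (E z) <= C * exp (2 * x * \<bar>Im z\<bar>)"
	and summ: "summable (%n. norm (E (of_real (real n * pi / (2 * x)))))"
 shows "continuous_on UNIV (cos_kernel E x)"
	and "norm (cos_kernel E x t) <= 2 * (\<Sum>n. norm (E (of_real (real n * pi / (2 * x))))) / x"
	and "((%t. cos_kernel E x t * cos (2 * z * of_real t)) has_integral E z) {0..x}"
proof -
 let ?c = "%n. E (of_real (real n * pi / (2 * x)))"
 let ?d = "%n. (if n = 0 then 1 else 2) * ?c n"
 let ?f = "%n t. ?d n * cplx (cos (real n * pi * t / x))"
 have fb: "norm (?f n t) <= 2 * norm (?c n)" for n t
 proof -
	have "norm (?f n t) = norm (?d n) * \<bar>cos (real n * pi * t / x)\<bar>" by (simp only: norm_mult norm_of_real)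
	also have "... <= norm (?d n) * 1" by (intro mult_left_mono) auto
	also have "... <= 2 * norm (?c n)" by (simp add: norm_mult)
	finally show ?thesis .
 qed
 have s2: "summable (%n. 2 * norm (?c n))" using summ by (rule summable_mult)
 have ul: "uniform_limit UNIV (%N t. \<Sum>n<N. ?f n t) (%t. \<Sum>n. ?f n t) sequentially"
	by (rule Weierstrass_m_test[OF fb s2])
 have cS: "continuous_on A (%t. \<Sum>n<N. ?f n t)" for N A by (intro continuous_intros) (use x in auto)
 have cK: "continuous_on UNIV (%t. \<Sum>n. ?f n t)"
	by (rule uniform_limit_theorem[OF _ ul]) (intro always_eventually allI cS, simp)
 show contK: "continuous_on UNIV (cos_kernel E x)"
	unfolding cos_kernel_def[abs_def] using x by (intro continuous_intros cK) auto
 show Kb: "norm (cos_kernel E x t) <= 2 * (\<Sum>n. norm (?c n)) / x" for t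
 proof -
	have "norm (\<Sum>n. ?f n t) <= (\<Sum>n. 2 * norm (?c n))" by (rule norm_suminf_le[OF fb s2])
	also have "... = 2 * (\<Sum>n. norm (?c n))" by (rule suminf_mult[OF summ])
	finally show ?thesis unfolding cos_kernel_def using x by (simp add: norm_divide divide_right_mono)
 qed
 define B where "B = 2 * (\<Sum>n. norm (?c n)) / x"
 have B0: "0 <= B" using order_trans[OF norm_ge_zero Kb[of 0]] by (simp add: B_def)
 let ?K = "cos_kernel E x"
 define T where "T = (%z. integral {0..x} (%t. ?K t * cos (2 * z * of_real t)))"
 have ci: "(%t. ?K t * cos (2 * z * of_real t)) integrable_on {0..x}" for z
	by (intro integrable_continuous_interval continuous_intros continuous_on_subset[OF contK]) auto
 have Th: "T holomorphic_on UNIV"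
 proof -
	have "(%z. integral (cbox 0 x) (%t. ?K t * cos (2 * z * of_real t))) holomorphic_on UNIV"
	proof (rule leibniz_rule_holomorphic[where fx = "%z t. ?K t * (- sin (2 * z * of_real t) * (2 * of_real t))"])
	 show "((%z. ?K t * cos (2 * z * of_real t)) has_field_derivative ?K t * (- sin (2 * z * of_real t) * (2 * of_real t))) (at z within UNIV)" for z t
		by (auto intro!: derivative_eq_intros)
	 show "(%t. ?K t * cos (2 * z * of_real t)) integrable_on cbox 0 x" for z using ci[of z] by (simp add: cbox_interval)
	 have "continuous_on (UNIV \<times> cbox 0 x) (%p. ?K (snd p) * (- sin (2 * fst p * of_real (snd p)) * (2 * of_real (snd p))))"
		by (intro continuous_intros continuous_on_compose2[OF contK]) auto
	 then show "continuous_on (UNIV \<times> cbox 0 x) (%(z, t). ?K t * (- sin (2 * z * of_real t) * (2 * of_real t)))"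
		by (simp add: case_prod_unfold)
	qed auto
	then show ?thesis by (simp add: T_def[abs_def] cbox_interval)
 qed
 have Teven: "T (- z) = T z" for z by (simp add: T_def)
 have Tb: "norm (T z) <= B * x * exp (2 * x * \<bar>Im z\<bar>)" for z
 proof -
	have "norm (T z) <= integral {0..x} (%t. B * exp (2 * x * \<bar>Im z\<bar>))" unfolding T_def
	proof (rule integral_norm_bound_integral[OF ci])
	 fix t assume t: "t \<in> {0..x}"
	 have "norm (cos (2 * z * of_real t)) <= exp \<bar>Im (2 * z * of_real t)\<bar>"
	 proof -
		let ?u = "2 * z * of_real t"
		have e: "norm (exp (\<i> * ?u)) <= exp \<bar>Im ?u\<bar>" "norm (exp (- (\<i> * ?u))) <= exp \<bar>Im ?u\<bar>" by (simp_all add: norm_exp_eq_Re)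
		have "norm (cos ?u) = norm (exp (\<i> * ?u) + exp (- (\<i> * ?u))) / 2" by (simp add: cos_exp_eq norm_divide)
		also have "... <= (exp \<bar>Im ?u\<bar> + exp \<bar>Im ?u\<bar>) / 2"
		 using norm_triangle_ineq[of "exp (\<i> * ?u)" "exp (- (\<i> * ?u))"] e by (intro divide_right_mono) linarith+
		finally show ?thesis by simp
	 qed
	 also have "... <= exp (2 * x * \<bar>Im z\<bar>)" using t by (simp add: abs_mult mult.commute[of _ "\<bar>Im z\<bar>"] mult_left_mono mult.assoc)
	 finally show "norm (?K t * cos (2 * z * of_real t)) <= B * exp (2 * x * \<bar>Im z\<bar>)"
		unfolding norm_mult using Kb[of t] B0 by (intro mult_mono) (auto simp: B_def)
	qed auto
	then show ?thesis using x by (simp add: mult_ac)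
 qed
 have node: "T (of_real (real m * pi / (2 * x))) = ?c m" for m :: nat
 proof -
	let ?g = "%t. cplx (cos (real m * pi * t / x))"
	have ulg: "uniform_limit (cbox 0 x) (%N t. (\<Sum>n<N. ?f n t) * ?g t) (%t. (\<Sum>n. ?f n t) * ?g t) sequentially"
	proof (rule uniform_limitI)
	 fix e :: real assume "e > 0"
	 from uniform_limitD[OF ul this] show "\<forall>\<^sub>F N in sequentially. \<forall>t\<in>cbox 0 x. dist ((\<Sum>n<N. ?f n t) * ?g t) ((\<Sum>n. ?f n t) * ?g t) < e"
	 proof (rule eventually_mono, intro ballI)
		fix N t assume h: "\<forall>t\<in>UNIV. dist (\<Sum>n<N. ?f n t) (\<Sum>n. ?f n t) < e"
		have "dist ((\<Sum>n<N. ?f n t) * ?g t) ((\<Sum>n. ?f n t) * ?g t) = dist (\<Sum>n<N. ?f n t) (\<Sum>n. ?f n t) * \<bar>cos (real m * pi * t / x)\<bar>"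
		 by (simp only: dist_norm left_diff_distrib[symmetric] norm_mult norm_of_real)
		also have "... <= dist (\<Sum>n<N. ?f n t) (\<Sum>n. ?f n t) * 1" by (intro mult_left_mono) auto
		also have "... < e" using h by auto
		finally show "dist ((\<Sum>n<N. ?f n t) * ?g t) ((\<Sum>n. ?f n t) * ?g t) < e" .
	 qed
	qed
	have cg: "continuous_on (cbox 0 x) (%t. (\<Sum>n<N. ?f n t) * ?g t)" for N
	 using x by (intro continuous_intros cS) auto
	obtain I J where IJ: "!!N. ((%t. (\<Sum>n<N. ?f n t) * ?g t) has_integral I N) (cbox 0 x)"
	 "((%t. (\<Sum>n. ?f n t) * ?g t) has_integral J) (cbox 0 x)" "(I \<longlongrightarrow> J) sequentially"
	 by (rule uniform_limit_integral_cbox[OF ulg cg]) auto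
	have "I N = of_real x * ?c m" if N: "m < N" for N
	proof -
	 have "((%t. cplx (cos (real n * pi * t / x) * cos (real m * pi * t / x))) has_integral
		of_real (if n = m then if n = 0 then x else x / 2 else 0)) {0..x}" for n
		using has_integral_linear[OF integral_cos_cos[OF x, of n m] bounded_linear_of_real[where 'a = complex]] by (simp add: o_def)
	 then have "((%t. \<Sum>n<N. ?d n * cplx (cos (real n * pi * t / x) * cos (real m * pi * t / x))) has_integral
		(\<Sum>n<N. ?d n * of_real (if n = m then if n = 0 then x else x / 2 else 0))) {0..x}"
		by (intro has_integral_sum has_integral_mult_right) auto
	 moreover have "(%t. \<Sum>n<N. ?d n * cplx (cos (real n * pi * t / x) * cos (real m * pi * t / x))) = (%t. (\<Sum>n<N. ?f n t) * ?g t)"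
		by (simp add: sum_distrib_right mult.assoc)
	 moreover have "(\<Sum>n<N. ?d n * of_real (if n = m then if n = 0 then x else x / 2 else 0)) = of_real x * ?c m"
	 proof -
		have "(\<Sum>n<N. ?d n * of_real (if n = m then if n = 0 then x else x / 2 else 0)) = (\<Sum>n<N. if n = m then of_real x * ?c m else 0)"
		 by (intro sum.cong) auto
		then show ?thesis using N by simp
	 qed
	 ultimately have "((%t. (\<Sum>n<N. ?f n t) * ?g t) has_integral of_real x * ?c m) (cbox 0 x)" by (simp add: cbox_interval)
	 then show ?thesis using IJ(1)[of N] has_integral_unique by blast
	qed
	then have "\<forall>\<^sub>F N in sequentially. I N = of_real x * ?c m"
	 unfolding eventually_sequentially by (intro exI[of _ "Suc m"]) auto
	then have "(I \<longlongrightarrow> of_real x * ?c m) sequentially" by (rule tendsto_eventually)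
	then have J: "J = of_real x * ?c m" using IJ(3) LIMSEQ_unique by blast
	have "((%t. (\<Sum>n. ?f n t) * ?g t / of_real x) has_integral J / of_real x) {0..x}"
	 using has_integral_divide[OF IJ(2), of "of_real x"] by (simp add: cbox_interval)
	moreover have "(%t. (\<Sum>n. ?f n t) * ?g t / of_real x) = (%t. ?K t * cos (2 * of_real (real m * pi / (2 * x)) * of_real t))"
	proof
	 fix t
	 have "2 * cplx (real m * pi / (2 * x)) * of_real t = of_real (real m * pi * t / x)" using x by (simp add: field_simps)
	 then have "cos (2 * cplx (real m * pi / (2 * x)) * of_real t) = ?g t" by (metis cos_of_real)
	 then show "(\<Sum>n. ?f n t) * ?g t / of_real x = ?K t * cos (2 * of_real (real m * pi / (2 * x)) * of_real t)"
		by (simp only: cos_kernel_def times_divide_eq_left)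
	qed
	ultimately show ?thesis using J x by (simp add: T_def integral_unique)
 qed
 define G where "G = (%w. E (of_real (pi / (2 * x)) * w) - T (of_real (pi / (2 * x)) * w))"
 have G0: "G w = 0" for w
 proof (rule even_entire_zero_at_Ints[of G "C + B * x"])
	show "G holomorphic_on UNIV"
	 unfolding G_def
	 by (intro holomorphic_intros holomorphic_on_compose_gen[OF _ E, unfolded o_def] holomorphic_on_compose_gen[OF _ Th, unfolded o_def]) auto
	show "G (- w) = G w" for w using even[of "of_real (pi / (2 * x)) * w"] Teven[of "of_real (pi / (2 * x)) * w"] by (simp add: G_def)
	show "norm (G w) <= (C + B * x) * exp (pi * \<bar>Im w\<bar>)" for w
	proof -
	 let ?z = "of_real (pi / (2 * x)) * w"
	 have im: "2 * x * \<bar>Im ?z\<bar> = pi * \<bar>Im w\<bar>" using x by (simp add: abs_mult)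
	 have "norm (G w) <= norm (E ?z) + norm (T ?z)" unfolding G_def by (rule norm_triangle_ineq4)
	 also have "... <= C * exp (2 * x * \<bar>Im ?z\<bar>) + B * x * exp (2 * x * \<bar>Im ?z\<bar>)" by (intro add_mono growth Tb)
	 finally show ?thesis unfolding im by (simp add: algebra_simps)
	qed
	fix w :: complex assume "w \<in> \<int>"
	then obtain k where k: "w = of_int k" by (auto elim: Ints_cases)
	show "G w = 0"
	proof (cases "0 <= k")
	 case True
	 then have w: "w = of_nat (nat k)" using k by (metis of_int_of_nat_eq nat_0_le)
	 have "of_real (pi / (2 * x)) * w = of_real (real (nat k) * pi / (2 * x))" unfolding w by simp
	 then show ?thesis by (simp only: G_def node diff_self)
	next
	 case False
	 then have "int (nat (- k)) = - k" by simp
	 then have w: "w = - of_nat (nat (- k))" using k by (metis of_int_of_nat_eq of_int_minus minus_minus)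
	 have "of_real (pi / (2 * x)) * w = - of_real (real (nat (- k)) * pi / (2 * x))" unfolding w by simp
	 then show ?thesis by (simp only: G_def even Teven node diff_self)
	qed
 qed
 have "E z = T z"
	using G0[of "of_real (2 * x / pi) * z"] x by (simp add: G_def flip: mult.assoc of_real_mult)
 then show "((%t. ?K t * cos (2 * z * of_real t)) has_integral E z) {0..x}"
	using ci[of z] by (simp add: T_def has_integral_iff)
qed

section \<open>Analytic dependence on the spectral parameter\<close>

lemma reg_op_cong:
 assumes "!!y. y \<in> {0..1} ==> v y = w y" "x \<in> {0..1}"
 shows "reg_op l r v x = reg_op l r w x"
proof -
 have "reg_flux l r v s = reg_flux l r w s" if "s \<in> {0..x}" for s
	unfolding reg_flux_def
	by (rule hk_cong) (use assms that in auto)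
 then show ?thesis unfolding reg_op_def
	by (intro hk_cong) auto
qed

lemma reg_op_sum:
 fixes n :: nat
 assumes r: "unit_L1 r" and c: "!!j. continuous_on {0..1} (c j)" and x: "x \<in> {0..1}"
 shows "reg_op l r (%y. \<Sum>j<n. a j * c j y) x = (\<Sum>j<n. a j * reg_op l r (c j) x)"
proof (induction n)
 case 0
 show ?case by (simp add: reg_op_def reg_flux_def)
next
 case (Suc n)
 have cs: "continuous_on {0..1} (%y. \<Sum>j<n. a j * c j y)" by (intro continuous_intros c)
 have "reg_op l r (%y. \<Sum>j<Suc n. a j * c j y) x = reg_op l r (%y. 1 * (\<Sum>j<n. a j * c j y) + a n * c n y) x" by simp
 also have "... = 1 * reg_op l r (%y. \<Sum>j<n. a j * c j y) x + a n * reg_op l r (c n) x"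
	by (rule reg_op_lincomb[OF r cs c x])
 finally show ?case using Suc by simp
qed

lemma reg_op_coeff:
 assumes q: "unit_L1 q" and v: "continuous_on {0..1} v" and x: "x \<in> {0..1}"
 shows "reg_op l (sl_coeff q lam) v x = reg_op l (sl_coeff q 0) v x - lam * reg_op l (%_. 1) v x"
proof -
 have u: "(%_. 1 :: complex) absolutely_integrable_on {0..1::real}" by (rule absolutely_integrable_on_const) auto
 note q0 = sl_coeff_integrable[OF q, of 0]
 have fl: "reg_flux l (sl_coeff q lam) v s = reg_flux l (sl_coeff q 0) v s - lam * reg_flux l (%_. 1) v s" if s: "s \<in> {0..1}" for s
 proof -
	have i: "(%y. of_real (y ^ (2*l+2)) * r y * v y) integrable_on {0..s}" if "unit_L1 r" for r
	 using L1D(1)[OF reg_integrand[OF that v], of 0 s] s by auto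
	have "reg_flux l (sl_coeff q lam) v s = integral {0..s} (%y. of_real (y ^ (2*l+2)) * sl_coeff q 0 y * v y - lam * (of_real (y ^ (2*l+2)) * 1 * v y))"
	 unfolding reg_flux_def by (simp add: sl_coeff_def algebra_simps)
	also have "... = reg_flux l (sl_coeff q 0) v s - lam * reg_flux l (%_. 1) v s"
	 unfolding reg_flux_def
	 by (subst hk_diff[OF i[OF q0] integrable_on_mult_right[OF i[OF u]]]) (simp only: integral_mult_right)
	finally show ?thesis .
 qed
 have i: "(%s. reg_flux l r v s / of_real (s ^ (2*l+2))) integrable_on {0..x}" if "unit_L1 r" for r
	by (rule integrable_continuous_interval[OF continuous_on_subset[OF continuous_reg_density[OF that v]]]) (use x in auto)
 have "reg_op l (sl_coeff q lam) v x = integral {0..x} (%s. reg_flux l (sl_coeff q 0) v s / of_real (s ^ (2*l+2)) - lam * (reg_flux l (%_. 1) v s / of_real (s ^ (2*l+2))))"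
	unfolding reg_op_def
	by (rule hk_cong) (use fl x in \<open>auto simp: diff_divide_distrib simp del: of_real_power power_Suc\<close>)
 also have "... = reg_op l (sl_coeff q 0) v x - lam * reg_op l (%_. 1) v x"
	unfolding reg_op_def
	by (subst hk_diff[OF i[OF q0] integrable_on_mult_right[OF i[OF u]]]) (simp only: integral_mult_right)
 finally show ?thesis .
qed

lemma picard_polynomial:
 assumes q: "unit_L1 q"
 shows "\<exists>c. (\<forall>j. continuous_on {0..1} (c j)) &
	(\<forall>lam. \<forall>x\<in>{0..1}. picard l (sl_coeff q lam) n x = (\<Sum>j<Suc n. lam ^ j * c j x))"
proof (induction n)
 case 0
 show ?case by (rule exI[of _ "%_ _. 1"]) auto
next
 case (Suc n)
 then obtain c where c: "!!j. continuous_on {0..1} (c j)"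
	"!!lam x. x \<in> {0..1} ==> picard l (sl_coeff q lam) n x = (\<Sum>j<Suc n. lam ^ j * c j x)" by metis
 have u: "(%_. 1 :: complex) absolutely_integrable_on {0..1::real}" by (rule absolutely_integrable_on_const) auto
 note q0 = sl_coeff_integrable[OF q, of 0]
 define d where "d = (%j x. (if j < Suc n then reg_op l (sl_coeff q 0) (c j) x else 0) -
	 (if 0 < j then reg_op l (%_. 1) (c (j - 1)) x else 0))"
 have "continuous_on {0..1} (d j)" for j
	unfolding d_def
	by (cases "j < Suc n"; cases "0 < j") (auto intro!: continuous_intros continuous_reg_op q0 u c)
 moreover have "picard l (sl_coeff q lam) (Suc n) x = (\<Sum>j<Suc (Suc n). lam ^ j * d j x)" if x: "x \<in> {0..1}" for lam x
 proof -
	have cs: "continuous_on {0..1} (%y. \<Sum>j<Suc n. lam ^ j * c j y)" by (intro continuous_intros c)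
	have "picard l (sl_coeff q lam) (Suc n) x = reg_op l (sl_coeff q lam) (%y. \<Sum>j<Suc n. lam ^ j * c j y) x"
	 using reg_op_cong[of "picard l (sl_coeff q lam) n", OF c(2) x] by simp
	also have "... = (\<Sum>j<Suc n. lam ^ j * reg_op l (sl_coeff q 0) (c j) x) - lam * (\<Sum>j<Suc n. lam ^ j * reg_op l (%_. 1) (c j) x)"
	proof -
	 have "reg_op l (sl_coeff q 0) (%y. \<Sum>j<Suc n. lam ^ j * c j y) x = (\<Sum>j<Suc n. lam ^ j * reg_op l (sl_coeff q 0) (c j) x)"
		by (rule reg_op_sum[OF q0 _ x]) (rule c(1))
	 moreover have "reg_op l (%_. 1) (%y. \<Sum>j<Suc n. lam ^ j * c j y) x = (\<Sum>j<Suc n. lam ^ j * reg_op l (%_. 1) (c j) x)"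
		by (rule reg_op_sum[OF u _ x]) (rule c(1))
	 ultimately show ?thesis using reg_op_coeff[OF q cs x, of l lam] by (simp only:)
	qed
	also have "... = (\<Sum>j<Suc (Suc n). lam ^ j * (if j < Suc n then reg_op l (sl_coeff q 0) (c j) x else 0)) -
	  (\<Sum>j<Suc (Suc n). lam ^ j * (if 0 < j then reg_op l (%_. 1) (c (j - 1)) x else 0))"
	proof -
	 have "(\<Sum>j<Suc (Suc n). lam ^ j * (if j < Suc n then reg_op l (sl_coeff q 0) (c j) x else 0)) = (\<Sum>j<Suc n. lam ^ j * reg_op l (sl_coeff q 0) (c j) x)"
		by simp
	 moreover have "(\<Sum>j<Suc (Suc n). lam ^ j * (if 0 < j then reg_op l (%_. 1) (c (j - 1)) x else 0)) = lam * (\<Sum>j<Suc n. lam ^ j * reg_op l (%_. 1) (c j) x)"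
		unfolding sum.lessThan_Suc_shift[of _ "Suc n"] by (simp add: sum_distrib_left mult.assoc distrib_left)
	 ultimately show ?thesis by simp
	qed
	also have "... = (\<Sum>j<Suc (Suc n). lam ^ j * d j x)"
	 unfolding d_def right_diff_distrib sum_subtractf ..
	finally show ?thesis .
 qed
 ultimately show ?case by blast
qed

lemma reg_sol_holomorphic:
 assumes q: "unit_L1 q" and x: "x \<in> {0..1}"
 shows "(%lam. reg_sol l (sl_coeff q lam) x) holomorphic_on UNIV"
proof (rule holomorphic_uniform_sequence[OF open_UNIV])
 fix N
 have "(%lam. picard l (sl_coeff q lam) n x) holomorphic_on UNIV" for n
 proof -
	obtain c where "!!lam. picard l (sl_coeff q lam) n x = (\<Sum>j<Suc n. lam ^ j * c j x)"
	 using picard_polynomial[OF q, of l n] x by blast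
	then show ?thesis by (auto intro!: holomorphic_intros)
 qed
 then show "(%lam. \<Sum>n<N. picard l (sl_coeff q lam) n x) holomorphic_on UNIV" by (intro holomorphic_intros)
next
 fix lam :: complex
 define M where "M = integral {0..1} (%y. \<bar>q y\<bar>) + (norm lam + 1)"
 have "uniform_limit (cball lam 1) (%N lam. \<Sum>n<N. picard l (sl_coeff q lam) n x) (%lam. \<Sum>n. picard l (sl_coeff q lam) n x) sequentially"
 proof (rule Weierstrass_m_test[OF _ summable_exp_real[of M]])
	fix n mu assume "mu \<in> cball lam 1"
	then have "norm mu <= norm lam + 1" using norm_triangle_ineq2[of mu lam] by (simp add: dist_norm norm_minus_commute)
	then have "integral {0..1} (%y. norm (sl_coeff q mu y)) <= M"
	 using integral_norm_sl_coeff_le[OF q, of 1 mu] by (simp add: M_def)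
	then show "norm (picard l (sl_coeff q mu) n x) <= M ^ n / fact n"
	 by (rule picard_uniform_bound[OF sl_coeff_integrable[OF q] x])
 qed
 then show "\<exists>d>0. cball lam d \<subseteq> UNIV & uniform_limit (cball lam d) (%N lam. \<Sum>n<N. picard l (sl_coeff q lam) n x) (%lam. reg_sol l (sl_coeff q lam) x) sequentially"
	unfolding reg_sol_def by (intro exI[of _ 1]) auto
qed

lemma reg_sol_continuous_joint:
 assumes q: "unit_L1 q" and A: "A \<subseteq> {0..1}" and f: "continuous_on A f"
 shows "continuous_on A (%x. reg_sol l (sl_coeff q (f x)) x)"
 unfolding continuous_on_def
proof
 fix x assume x: "x \<in> A"
 obtain C where C: "C \<ge> 0" "!!mu y. norm (mu - f x) <= 1 ==> y \<in> {0..1} ==>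
	 norm (reg_sol l (sl_coeff q mu) y - reg_sol l (sl_coeff q (f x)) y) <= C * norm (mu - f x)"
	using reg_sol_lipschitz[OF q, of "f x" l] by metis
 have fl: "(f \<longlongrightarrow> f x) (at x within A)" using f x by (simp add: continuous_on_def)
 have vl: "((%y. reg_sol l (sl_coeff q (f x)) y) \<longlongrightarrow> reg_sol l (sl_coeff q (f x)) x) (at x within A)"
	using continuous_on_subset[OF continuous_reg_sol[OF sl_coeff_integrable[OF q]] A] x by (simp add: continuous_on_def)
 have "((%y. reg_sol l (sl_coeff q (f y)) y - reg_sol l (sl_coeff q (f x)) y) \<longlongrightarrow> 0) (at x within A)"
 proof (rule Lim_null_comparison)
	have "((%y. C * norm (f y - f x)) \<longlongrightarrow> C * norm (f x - f x)) (at x within A)" by (intro tendsto_intros fl)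
	then show "((%y. C * norm (f y - f x)) \<longlongrightarrow> 0) (at x within A)" by simp
	have e1: "\<forall>\<^sub>F y in at x within A. dist (f y) (f x) < 1" using fl by (rule tendstoD) simp
	have e2: "\<forall>\<^sub>F y in at x within A. y \<in> A" by (simp add: eventually_at_filter)
	show "\<forall>\<^sub>F y in at x within A. norm (reg_sol l (sl_coeff q (f y)) y - reg_sol l (sl_coeff q (f x)) y) <= C * norm (f y - f x)"
	 using e1 e2 by eventually_elim (use C(2) A in \<open>auto simp: dist_norm\<close>)
 qed
 from tendsto_add[OF this vl] show "((%y. reg_sol l (sl_coeff q (f y)) y) \<longlongrightarrow> reg_sol l (sl_coeff q (f x)) x) (at x within A)" by simp
qed

theorem phi_asymptotics:
 assumes w: "wpot \<delta> N q"
 shows "\<exists>\<beta> C. 0 <= C & (\<forall>z x. 0 < z --> 0 < x --> x <= 1 --> 1 <= z * x -->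
	norm (of_real (z ^ (l+1)) * phi l q (of_real (z\<^sup>2)) x -
	 of_real (odd_fact l * (sin (z * x - real l * pi / 2) + \<beta> * cos (z * x - real l * pi / 2) / (z * x)) + odd_fact l / z * born l q z x))
	<= C * (z * x) powr (- 1 - \<delta>))"
proof -
 note D = wpotD[OF w]
 obtain \<beta> CF where CF: "0 <= CF" "!!z x. 0 < z ==> 0 < x ==> x <= 1 ==> 1 <= z * x ==>
	 norm (of_real (z ^ (l+1)) * phi l (%_. 0) (of_real (z\<^sup>2)) x -
	 of_real (odd_fact l * (sin (z * x - real l * pi / 2) + \<beta> * cos (z * x - real l * pi / 2) / (z * x)))) <= CF / (z * x)\<^sup>2"
	using phi_free_asymptotics[of l] by blast
 obtain CD where CD: "0 <= CD" "!!z x. 0 < z ==> 0 < x ==> x <= 1 ==> 1 <= z * x ==>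
	norm (Dphi l q z x - of_real (odd_fact l / z * born l q z x)) <= CD * (1 / z) powr (1 + \<delta>)"
	using Dphi_asymptotics[OF w, of l] by blast
 show ?thesis
 proof (rule exI[of _ \<beta>], rule exI[of _ "CF + CD"], intro conjI allI impI)
	fix z x :: real assume zx: "0 < z" "0 < x" "x <= 1" "1 <= z * x"
	let ?a = "odd_fact l * (sin (z * x - real l * pi / 2) + \<beta> * cos (z * x - real l * pi / 2) / (z * x))"
	let ?b = "odd_fact l / z * born l q z x"
	have eq: "of_real (z ^ (l+1)) * phi l q (of_real (z\<^sup>2)) x - of_real (?a + ?b) =
	 (of_real (z ^ (l+1)) * phi l (%_. 0) (of_real (z\<^sup>2)) x - of_real ?a) + (Dphi l q z x - of_real ?b)"
	 unfolding Dphi_def of_real_add by (simp add: right_diff_distrib)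
	have "CF / (z * x)\<^sup>2 <= CF * (z * x) powr (- 1 - \<delta>)"
	proof -
	 have "1 / (z * x)\<^sup>2 = (z * x) powr (- 2)" using zx powr_realpow[of "z * x" 2] by (simp add: powr_minus_divide)
	 also have "... <= (z * x) powr (- 1 - \<delta>)" using zx D(4) by (intro powr_mono) auto
	 finally show ?thesis using mult_left_mono[OF _ CF(1)] by fastforce
	qed
	moreover have "CD * (1 / z) powr (1 + \<delta>) <= CD * (z * x) powr (- 1 - \<delta>)"
	proof (intro mult_left_mono CD(1))
	 have "z * x <= z * 1" using zx by (intro mult_left_mono) auto
	 then have "z powr (- 1 - \<delta>) <= (z * x) powr (- 1 - \<delta>)" using zx D(3) by (intro powr_mono2') auto
	 moreover have "(1 / z) powr (1 + \<delta>) = z powr (- 1 - \<delta>)"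
	 proof -
		have "(1 / z) powr (1 + \<delta>) = 1 / z powr (1 + \<delta>)" using zx by (simp add: powr_divide)
		also have "... = z powr (- (1 + \<delta>))" by (simp only: powr_minus_divide)
		finally show ?thesis by (simp add: algebra_simps)
	 qed
	 ultimately show "(1 / z) powr (1 + \<delta>) <= (z * x) powr (- 1 - \<delta>)" by simp
	qed
	ultimately show "norm (of_real (z ^ (l+1)) * phi l q (of_real (z\<^sup>2)) x - of_real (?a + ?b)) <= (CF + CD) * (z * x) powr (- 1 - \<delta>)"
	 unfolding eq distrib_right using norm_triangle_ineq CF(2)[OF zx] CD(2)[OF zx] by (meson add_mono order_trans)
 qed (use CF CD in auto)
qed

lemma abs_born_le:
 assumes w: "wpot \<delta> N q" and x: "0 < x" "x <= 1"
 shows "\<bar>born l q z x\<bar> <= N"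
proof -
 note D = wpotD[OF w]
 have qx: "q absolutely_integrable_on {0..x}" by (rule L1D(3)[OF D(1)]) (use x in auto)
 have "(%s. (sin (z * (x - s)) * sin (z * s - real l * pi / 2)) * q s) absolutely_integrable_on {0..x}"
	by (intro absolutely_integrable_mult_continuous qx continuous_intros)
 from L1D(1)[OF this order_refl order_refl]
 have "norm (born l q z x) <= integral {0..x} (%s. \<bar>q s\<bar>)" unfolding born_def
 proof (rule integral_norm_bound_integral)
	show "(%s. \<bar>q s\<bar>) integrable_on {0..x}" using L1D(2)[OF qx order_refl order_refl] by simp
	fix s
	have "\<bar>sin (z * (x - s)) * sin (z * s - real l * pi / 2)\<bar> <= 1" unfolding abs_mult by (intro mult_le_one) auto
	then show "norm (sin (z * (x - s)) * sin (z * s - real l * pi / 2) * q s) <= \<bar>q s\<bar>"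
	 using mult_right_mono[of _ 1 "\<bar>q s\<bar>"] by (simp add: abs_mult)
 qed
 also have "... <= N * x powr \<delta>" by (rule wpot_integral_le[OF w]) (use x in auto)
 also have "... <= N * 1" using D x by (intro mult_left_mono powr_le1) auto
 finally show ?thesis by simp
qed

section \<open>The product of two regular solutions as a cosine transform\<close>

lemma integral_reflect_interval:
 fixes f :: "real => 'a::banach"
 assumes "(f has_integral i) {0..x}" "0 <= x"
 shows "((%s. f (x - s)) has_integral i) {0..x}"
proof -
 have "((%s. f ((-1) * s + x)) has_integral (1 / \<bar>-1::real\<bar>) *\<^sub>R i) ((%t. (1 / -1) * t + - ((1 / -1) * x)) ` {0..x})"
	using has_integral_affinity[of f i 0 x "-1" x] assms by (simp add: cbox_interval)
 moreover have "(%t::real. (1 / -1) * t + - ((1 / -1) * x)) ` {0..x} = {0..x}"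
 proof -
	have "(%t::real. (1 / -1) * t + - ((1 / -1) * x)) = (%t. x - t)" by auto
	then show ?thesis by (simp only: image_diff_atLeastAtMost) simp
 qed
 ultimately show ?thesis by (simp add: algebra_simps)
qed

text \<open>The part of the kernel that comes from the first order in the potential; \<open>s\<close> is the sum of the
  two potentials.\<close>
definition born_kernel :: "nat => (real => real) => real => real => real"
 where "born_kernel l s x t = integral {0..x - t} s + (- 1) ^ l * (integral {0..x} s - integral {0..t} s)"

lemma sin_cos_int_shift:
 "sin (a - real l * pi) = (- 1) ^ l * sin a" "cos (a - real l * pi) = (- 1) ^ l * cos a"
proof -
 have "real l * pi = pi * real l" by simp
 then show "sin (a - real l * pi) = (- 1) ^ l * sin a" "cos (a - real l * pi) = (- 1) ^ l * cos a"
	by (simp_all add: sin_diff cos_diff cos_npi sin_npi mult.commute)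
qed

lemma born_kernel_continuous:
 assumes s: "unit_L1 s" and x: "x \<in> {0..1}"
 shows "continuous_on {0..x} (born_kernel l s x)"
proof -
 have c: "continuous_on {0..1} (%t. integral {0..t} s)"
	by (intro indefinite_integral_continuous_1 L1D(1)[OF s]) auto
 have "continuous_on {0..x} (%t. integral {0..t} s)" by (rule continuous_on_subset[OF c]) (use x in auto)
 moreover have "continuous_on {0..x} (%t. integral {0..x - t} s)"
	by (rule continuous_on_compose2[OF c]) (use x in \<open>auto intro!: continuous_intros\<close>)
 ultimately show ?thesis unfolding born_kernel_def[abs_def] by (intro continuous_intros)
qed

lemma abs_indefinite_le:
 fixes s :: "real => real"
 assumes s: "unit_L1 s" and t: "t \<in> {0..1}" and N: "integral {0..1} (%y. \<bar>s y\<bar>) <= N"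
 shows "\<bar>integral {0..t} s\<bar> <= N"
proof -
 have i: "(%y. \<bar>s y\<bar>) integrable_on {0..t}" "(%y. \<bar>s y\<bar>) integrable_on {0..1}"
	using L1D(2)[OF s, of 0 t] L1D(2)[OF s, of 0 1] t by auto
 have "norm (integral {0..t} s) <= integral {0..t} (%y. \<bar>s y\<bar>)"
	by (rule integral_norm_bound_integral[OF L1D(1)[OF s] i(1)]) (use t in auto)
 also have "... <= integral {0..1} (%y. \<bar>s y\<bar>)" by (rule integral_subset_le) (use t i in auto)
 finally show ?thesis using N by simp
qed

lemma abs_born_kernel_le:
 assumes s: "unit_L1 s" and x: "x \<in> {0..1}" and t: "t \<in> {0..x}"
	and N: "integral {0..1} (%y. \<bar>s y\<bar>) <= N"
 shows "\<bar>born_kernel l s x t\<bar> <= 3 * N"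
proof -
 have "\<bar>born_kernel l s x t\<bar> <= \<bar>integral {0..x - t} s\<bar> + \<bar>(- 1) ^ l * (integral {0..x} s - integral {0..t} s)\<bar>"
	unfolding born_kernel_def by (rule abs_triangle_ineq)
 also have "... = \<bar>integral {0..x - t} s\<bar> + \<bar>integral {0..x} s - integral {0..t} s\<bar>" by (simp add: abs_mult power_abs)
 also have "... <= N + (N + N)"
	using abs_indefinite_le[OF s _ N, of "x - t"] abs_indefinite_le[OF s _ N, of x] abs_indefinite_le[OF s _ N, of t] x t
	by auto
 finally show ?thesis by simp
qed

lemma born_kernel_cos_transform:
 assumes s: "unit_L1 s" and x: "x \<in> {0..1}" and z: "z ~= 0"
 shows "((%t. born_kernel l s x t * cos (2 * z * t)) has_integral
	(integral {0..x} (%y. s y * (sin (2 * z * (x - y)) + (- 1) ^ l * sin (2 * z * y))) / (2 * z))) {0..x}"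
proof -
 define S where "S = (%t. integral {0..t} s)"
 have x0: "0 <= x" using x by auto
 have sx: "s absolutely_integrable_on {0..x}" by (rule L1D(3)[OF s]) (use x in auto)
 have acS: "ac_on 0 x S s" unfolding S_def by (rule ac_on_indefinite[OF sx])
 have cS: "continuous_on {0..x} S" by (rule ac_on_continuous[OF acS])
 have isg: "(%y. g y * s y) integrable_on {0..x}" if "continuous_on {0..x} g" for g
	by (rule L1D(1)[OF absolutely_integrable_mult_continuous[OF sx that] order_refl order_refl])
 have A1: "ac_on 0 x (%t. sin (2 * z * t) / (2 * z)) (%t. cos (2 * z * t))"
	by (rule ac_onI_C1[OF x0])
	  (use z in \<open>auto intro!: derivative_eq_intros continuous_intros simp flip: has_real_derivative_iff_has_vector_derivative\<close>)
 have A2: "ac_on 0 x (%t. - sin (2 * z * (x - t)) / (2 * z)) (%t. cos (2 * z * (x - t)))"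
	by (rule ac_onI_C1[OF x0])
	  (use z in \<open>auto intro!: derivative_eq_intros continuous_intros simp flip: has_real_derivative_iff_has_vector_derivative\<close>)
 have 1: "((%t. S t * cos (2 * z * (x - t))) has_integral (integral {0..x} (%y. sin (2 * z * (x - y)) * s y) / (2 * z))) {0..x}"
 proof -
	have ac: "ac_on 0 x (%t. S t * (- sin (2 * z * (x - t)) / (2 * z))) (%t. s t * (- sin (2 * z * (x - t)) / (2 * z)) + S t * cos (2 * z * (x - t)))"
	 by (rule ac_on_mult[OF acS A2])
	have "((%t. s t * (- sin (2 * z * (x - t)) / (2 * z)) + S t * cos (2 * z * (x - t))) has_integral 0) {0..x}"
	 using ac_onD(2)[OF ac] ac_onD(3)[OF ac, of x] x0 by (simp add: has_integral_iff S_def)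
	moreover have "((%t. (- 1 / (2 * z)) * (sin (2 * z * (x - t)) * s t)) has_integral (- 1 / (2 * z)) * integral {0..x} (%y. sin (2 * z * (x - y)) * s y)) {0..x}"
	 by (intro has_integral_mult_right integrable_integral isg continuous_intros)
	ultimately have "((%t. (s t * (- sin (2 * z * (x - t)) / (2 * z)) + S t * cos (2 * z * (x - t))) - (- 1 / (2 * z)) * (sin (2 * z * (x - t)) * s t)) has_integral
	  0 - (- 1 / (2 * z)) * integral {0..x} (%y. sin (2 * z * (x - y)) * s y)) {0..x}" by (rule has_integral_diff)
	then show ?thesis by (simp add: algebra_simps)
 qed
 have 2: "((%t. S (x - t) * cos (2 * z * t)) has_integral (integral {0..x} (%y. sin (2 * z * (x - y)) * s y) / (2 * z))) {0..x}"
	using integral_reflect_interval[OF 1 x0] by simp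
 have 3: "((%t. (S x - S t) * cos (2 * z * t)) has_integral (integral {0..x} (%y. sin (2 * z * y) * s y) / (2 * z))) {0..x}"
 proof -
	have ac: "ac_on 0 x (%t. (S x - S t) * (sin (2 * z * t) / (2 * z))) (%t. (0 - s t) * (sin (2 * z * t) / (2 * z)) + (S x - S t) * cos (2 * z * t))"
	 by (intro ac_on_mult ac_on_diff ac_on_const acS A1 x0)
	have "((%t. (0 - s t) * (sin (2 * z * t) / (2 * z)) + (S x - S t) * cos (2 * z * t)) has_integral 0) {0..x}"
	 using ac_onD(2)[OF ac] ac_onD(3)[OF ac, of x] x0 by (simp add: has_integral_iff)
	moreover have "((%t. (- 1 / (2 * z)) * (sin (2 * z * t) * s t)) has_integral (- 1 / (2 * z)) * integral {0..x} (%y. sin (2 * z * y) * s y)) {0..x}"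
	 by (intro has_integral_mult_right integrable_integral isg continuous_intros)
	ultimately have "((%t. ((0 - s t) * (sin (2 * z * t) / (2 * z)) + (S x - S t) * cos (2 * z * t)) - (- 1 / (2 * z)) * (sin (2 * z * t) * s t)) has_integral
	  0 - (- 1 / (2 * z)) * integral {0..x} (%y. sin (2 * z * y) * s y)) {0..x}" by (rule has_integral_diff)
	then show ?thesis by (simp add: algebra_simps)
 qed
 have "((%t. S (x - t) * cos (2 * z * t) + (- 1) ^ l * ((S x - S t) * cos (2 * z * t))) has_integral
	(integral {0..x} (%y. sin (2 * z * (x - y)) * s y) / (2 * z) + (- 1) ^ l * (integral {0..x} (%y. sin (2 * z * y) * s y) / (2 * z)))) {0..x}"
	by (intro has_integral_add has_integral_mult_right 2 3)
 moreover have "integral {0..x} (%y. sin (2 * z * (x - y)) * s y) / (2 * z) + (- 1) ^ l * (integral {0..x} (%y. sin (2 * z * y) * s y) / (2 * z))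
	= integral {0..x} (%y. s y * (sin (2 * z * (x - y)) + (- 1) ^ l * sin (2 * z * y))) / (2 * z)"
 proof -
	have "integral {0..x} (%y. s y * (sin (2 * z * (x - y)) + (- 1) ^ l * sin (2 * z * y))) =
	 integral {0..x} (%y. sin (2 * z * (x - y)) * s y + (- 1) ^ l * (sin (2 * z * y) * s y))" by (simp add: algebra_simps)
	also have "... = integral {0..x} (%y. sin (2 * z * (x - y)) * s y) + integral {0..x} (%y. (- 1) ^ l * (sin (2 * z * y) * s y))"
	 by (intro hk_add integrable_on_mult_right isg continuous_intros)
	finally show ?thesis by (simp add: add_divide_distrib)
 qed
 ultimately show ?thesis by (simp add: born_kernel_def S_def algebra_simps)
qed

text \<open>At the nodes \<open>2 z x = n \<pi>\<close> the first-order term is exactly the transform of the kernel.\<close>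
lemma born_at_node:
 assumes q: "unit_L1 q" "unit_L1 qh"
	and x: "0 < x" "x <= 1" and n: "2 * z * x = real n * pi" and z: "z ~= 0"
 shows "sin (z * x - real l * pi / 2) * (born l q z x + born l qh z x) / z =
	 integral {0..x} (%t. born_kernel l (%y. q y + qh y) x t * cos (2 * z * t)) / 2"
proof -
 let ?s = "%y. q y + qh y"
 have s: "unit_L1 ?s" by (rule set_integral_add(1)[OF q])
 let ?\<theta> = "real l * pi / 2"
 have ii: "(%y. sin (z * (x - y)) * sin (z * y - ?\<theta>) * q y) integrable_on {0..x}" if q: "unit_L1 q" for q
 proof -
	have "q absolutely_integrable_on {0..x}" by (rule L1D(3)[OF q]) (use x in auto)
	then have "(%s. (sin (z * (x - s)) * sin (z * s - ?\<theta>)) * q s) absolutely_integrable_on {0..x}"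
	 by (intro absolutely_integrable_mult_continuous continuous_intros)
	from L1D(1)[OF this order_refl order_refl] show ?thesis .
 qed
 have sin0: "sin (2 * (z * x - ?\<theta>)) = 0"
 proof -
	have "2 * (z * x - ?\<theta>) = real n * pi - real l * pi" using n by (simp add: algebra_simps)
	then have "sin (2 * (z * x - ?\<theta>)) = (- 1) ^ l * sin (real n * pi)" by (simp only: sin_cos_int_shift)
	then show ?thesis by simp
 qed
 have trig: "4 * (sin (z * x - ?\<theta>) * (sin (z * (x - y)) * sin (z * y - ?\<theta>))) = sin (2 * z * (x - y)) + (- 1) ^ l * sin (2 * z * y)" for y
 proof -
	define A B where "A = z * (x - y)" and "B = z * y - ?\<theta>"
	have AB: "z * x - ?\<theta> = A + B" by (simp add: A_def B_def algebra_simps)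
	have "4 * (sin (A + B) * (sin A * sin B)) = sin (2 * A) + sin (2 * B) - sin (2 * (A + B))"
	proof -
	 have s2: "2 * sin A * sin B = cos (A - B) - cos (A + B)" by (simp add: cos_diff cos_add)
	 have "4 * (sin (A + B) * (sin A * sin B)) = 2 * sin (A + B) * (2 * sin A * sin B)" by simp
	 also have "... = 2 * sin (A + B) * (cos (A - B) - cos (A + B))" by (simp only: s2)
	 also have "2 * sin (A + B) * (cos (A - B) - cos (A + B)) = 2 * sin (A + B) * cos (A - B) - sin (2 * (A + B))" by (simp only: sin_double right_diff_distrib mult.assoc)
	 also have "2 * sin (A + B) * cos (A - B) = sin (2 * A) + sin (2 * B)"
		using sin_add[of "A + B" "A - B"] sin_diff[of "A + B" "A - B"] by (simp add: algebra_simps)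
	 finally show ?thesis by simp
	qed
	also have "sin (2 * (A + B)) = 0" using sin0 by (simp only: AB)
	also have "sin (2 * B) = (- 1) ^ l * sin (2 * z * y)"
	proof -
	 have "2 * B = 2 * z * y - real l * pi" by (simp add: B_def algebra_simps)
	 then show ?thesis by (simp only: sin_cos_int_shift)
	qed
	finally show ?thesis unfolding AB by (simp add: A_def B_def mult.assoc)
 qed
 have "born l q z x + born l qh z x = integral {0..x} (%y. sin (z * (x - y)) * sin (z * y - ?\<theta>) * q y + sin (z * (x - y)) * sin (z * y - ?\<theta>) * qh y)"
	unfolding born_def by (rule hk_add[symmetric]) (intro ii q)+
 then have "4 * (sin (z * x - ?\<theta>) * (born l q z x + born l qh z x)) =
	integral {0..x} (%y. 4 * (sin (z * x - ?\<theta>) * (sin (z * (x - y)) * sin (z * y - ?\<theta>) * q y + sin (z * (x - y)) * sin (z * y - ?\<theta>) * qh y)))"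
	by simp
 also have "... = integral {0..x} (%y. ?s y * (sin (2 * z * (x - y)) + (- 1) ^ l * sin (2 * z * y)))"
	unfolding trig[symmetric] by (simp add: algebra_simps)
 also have "... = 2 * z * integral {0..x} (%t. born_kernel l ?s x t * cos (2 * z * t))"
	using integral_unique[OF born_kernel_cos_transform[OF s _ z, of x l]] x z by simp
 finally show ?thesis using z by (simp add: field_simps)
qed

definition prod_rem :: "nat => (real => real) => (real => real) => real => complex => complex"
 where "prod_rem l q qh x z =
	(z ^ (l+1) * phi l q (z\<^sup>2) x) * (z ^ (l+1) * phi l qh (z\<^sup>2) x)
	- of_real ((odd_fact l)\<^sup>2 / 2) * (1 - (- 1) ^ l * cos (2 * z * of_real x))
	- of_real ((odd_fact l)\<^sup>2 / 2) * integral {0..x} (%t. of_real (born_kernel l (%y. q y + qh y) x t) * cos (2 * z * of_real t))"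

lemma norm_cos_real_mult_le:
 assumes "0 <= t" "t <= x"
 shows "norm (cos (2 * z * cplx t)) <= exp (2 * x * \<bar>Im z\<bar>)"
proof -
 have "norm (cos (2 * z * cplx t)) <= exp (\<bar>Im (2 * z)\<bar> * t)"
	by (rule norm_sin_cos_real_le(2)[OF assms(1)])
 also have "\<bar>Im (2 * z)\<bar> * t <= 2 * x * \<bar>Im z\<bar>"
	using mult_right_mono[OF assms(2), of "\<bar>Im z\<bar>"] by (simp add: abs_mult mult_ac)
 finally show ?thesis by simp
qed

lemma phi_holomorphic:
 assumes "unit_L1 q" "x \<in> {0..1}"
 shows "(%z. phi l q (z\<^sup>2) x) holomorphic_on UNIV"
proof -
 have "((%lam. reg_sol l (sl_coeff q lam) x) \<circ> (%z. z\<^sup>2)) holomorphic_on UNIV"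
	by (rule holomorphic_on_compose_gen[OF _ reg_sol_holomorphic[OF assms]]) (auto intro!: holomorphic_intros)
 then show ?thesis unfolding phi_def by (auto simp: o_def intro!: holomorphic_intros)
qed

lemma cos_transform_holomorphic:
 fixes g :: "real => complex"
 assumes g: "continuous_on {0..x} g"
 shows "(%z. integral {0..x} (%t. g t * cos (2 * z * of_real t))) holomorphic_on UNIV"
proof -
 have "(%z. integral (cbox 0 x) (%t. g t * cos (2 * z * of_real t))) holomorphic_on UNIV"
 proof (rule leibniz_rule_holomorphic[where fx = "%z t. g t * (- sin (2 * z * of_real t) * (2 * of_real t))"])
	show "((%z. g t * cos (2 * z * of_real t)) has_field_derivative g t * (- sin (2 * z * of_real t) * (2 * of_real t))) (at z within UNIV)" for z t
	 by (auto intro!: derivative_eq_intros)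
	show "(%t. g t * cos (2 * z * of_real t)) integrable_on cbox 0 x" for z
	 unfolding cbox_interval by (intro integrable_continuous_interval continuous_intros g)
	have "continuous_on (UNIV \<times> cbox 0 x) (%p. g (snd p) * (- sin (2 * fst p * of_real (snd p)) * (2 * of_real (snd p))))"
	 by (intro continuous_intros continuous_on_compose2[OF g]) auto
	then show "continuous_on (UNIV \<times> cbox 0 x) (%(z, t). g t * (- sin (2 * z * of_real t) * (2 * of_real t)))"
	 by (simp add: case_prod_unfold)
 qed auto
 then show ?thesis by (simp add: cbox_interval)
qed

lemma prod_rem_holomorphic:
 assumes q: "unit_L1 q" and qh: "unit_L1 qh" and x: "x \<in> {0..1}"
 shows "prod_rem l q qh x holomorphic_on UNIV"
proof -
 have "continuous_on {0..x} (%t. cplx (born_kernel l (%y. q y + qh y) x t))"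
	by (intro continuous_intros born_kernel_continuous set_integral_add(1)[OF q qh] x)
 from cos_transform_holomorphic[OF this] show ?thesis
	unfolding prod_rem_def[abs_def] by (intro holomorphic_intros phi_holomorphic q qh x)
qed

lemma prod_rem_even: "prod_rem l q qh x (- z) = prod_rem l q qh x z"
proof -
 have "(- z) ^ (l+1) * a * ((- z) ^ (l+1) * b) = z ^ (l+1) * a * (z ^ (l+1) * b)" for a b :: complex
 proof -
	have p: "p * a * (p * b) = p * p * (a * b)" for p :: complex by simp
	have "(- z) ^ (l+1) * (- z) ^ (l+1) = z ^ (l+1) * z ^ (l+1)" by (simp only: power_mult_distrib[symmetric] minus_mult_minus)
	then show ?thesis by (simp only: p)
 qed
 then show ?thesis by (simp add: prod_rem_def)
qed

lemma integral_abs_sum_le: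
 assumes w: "wpot \<delta> N q" and wh: "wpot \<delta> N qh"
 shows "(%y. q y + qh y) absolutely_integrable_on {0..1}" "integral {0..1} (%y. \<bar>q y + qh y\<bar>) <= 2 * N"
proof -
 note q = wpotD(1)[OF w] and qh = wpotD(1)[OF wh]
 have i: "(%y. \<bar>q y\<bar>) integrable_on {0..1}" "(%y. \<bar>qh y\<bar>) integrable_on {0..1}"
	using L1D(2)[OF q, of 0 1] L1D(2)[OF qh, of 0 1] by auto
 show s: "(%y. q y + qh y) absolutely_integrable_on {0..1}" by (rule set_integral_add(1)[OF q qh])
 have "integral {0..1} (%y. \<bar>q y + qh y\<bar>) <= integral {0..1} (%y. \<bar>q y\<bar> + \<bar>qh y\<bar>)"
	by (rule integral_le) (use L1D(2)[OF s, of 0 1] i in \<open>auto intro: integrable_add abs_triangle_ineq\<close>)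
 also have "... = integral {0..1} (%y. \<bar>q y\<bar>) + integral {0..1} (%y. \<bar>qh y\<bar>)"
	by (rule hk_add[OF i])
 also have "... <= N * 1 powr \<delta> + N * 1 powr \<delta>"
	by (intro add_mono wpot_integral_le[OF w] wpot_integral_le[OF wh]) auto
 finally show "integral {0..1} (%y. \<bar>q y + qh y\<bar>) <= 2 * N" by simp
qed

text \<open>Each regular solution has exponential type \<open>x\<close>, so that the product has type \<open>2x\<close>, just the bandwidth that sampling at
distance \<open>\<pi>/(2x)\<close> resolves.\<close>

lemma prod_rem_growth:
 assumes w: "wpot \<delta> N q" and wh: "wpot \<delta> N qh"
 shows "\<exists>C\<ge>0. \<forall>x\<in>{0..1}. \<forall>z. norm (prod_rem l q qh x z) <= C * exp (2 * x * \<bar>Im z\<bar>)"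
proof -
 note q = wpotD(1)[OF w] and qh = wpotD(1)[OF wh] and N0 = wpotD(7)[OF w]
 note s = integral_abs_sum_le[OF w wh]
 obtain B where B: "0 <= B" "!!z x. x \<in> {0..1} ==> norm (z ^ (l+1) * phi l q (z\<^sup>2) x) <= B * exp (\<bar>Im z\<bar> * x)"
	using phi_growth[OF q, of l] by blast
 obtain Bh where Bh: "0 <= Bh" "!!z x. x \<in> {0..1} ==> norm (z ^ (l+1) * phi l qh (z\<^sup>2) x) <= Bh * exp (\<bar>Im z\<bar> * x)"
	using phi_growth[OF qh, of l] by blast
 define a where "a = (odd_fact l)\<^sup>2 / 2"
 have a: "0 <= a" by (simp add: a_def)
 define C where "C = B * Bh + a * 2 + a * (6 * N)"
 have C: "0 <= C" using B Bh a N0 by (auto simp: C_def)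
 have "norm (prod_rem l q qh x z) <= C * exp (2 * x * \<bar>Im z\<bar>)" if x: "x \<in> {0..1}" for x z
 proof -
	let ?e = "exp (2 * x * \<bar>Im z\<bar>)"
	have e1: "1 <= ?e" using x by simp
	have "norm ((z ^ (l+1) * phi l q (z\<^sup>2) x) * (z ^ (l+1) * phi l qh (z\<^sup>2) x)) <= (B * exp (\<bar>Im z\<bar> * x)) * (Bh * exp (\<bar>Im z\<bar> * x))"
	 unfolding norm_mult[of "z ^ (l+1) * phi l q (z\<^sup>2) x"] using B Bh x by (intro mult_mono) auto
	also have "... = B * Bh * ?e"
	proof -
	 have "exp (\<bar>Im z\<bar> * x) * exp (\<bar>Im z\<bar> * x) = ?e" by (simp flip: exp_add)
	 then show ?thesis by (metis (no_types, opaque_lifting) mult.assoc mult.left_commute)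
	qed
	finally have 1: "norm ((z ^ (l+1) * phi l q (z\<^sup>2) x) * (z ^ (l+1) * phi l qh (z\<^sup>2) x)) <= B * Bh * ?e" .
	have "norm (1 - (- 1) ^ l * cos (2 * z * of_real x)) <= norm (1::complex) + norm ((- 1) ^ l * cos (2 * z * of_real x))"
	 by (rule norm_triangle_ineq4)
	also have "... <= ?e + ?e"
	 using norm_cos_real_mult_le[of x x z] e1 x by (intro add_mono) (auto simp: norm_mult norm_power)
	finally have 2: "norm (of_real a * (1 - (- 1) ^ l * cos (2 * z * of_real x))) <= a * 2 * ?e"
	 unfolding norm_mult norm_of_real using a by (simp add: mult_left_mono mult.assoc)
	let ?f = "%t. cplx (born_kernel l (%y. q y + qh y) x t) * cos (2 * z * of_real t)"
	have ci: "?f integrable_on {0..x}"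
	 by (intro integrable_continuous_interval continuous_intros born_kernel_continuous s x)
	have "norm (integral {0..x} ?f) <= integral {0..x} (%t. 3 * (2 * N) * ?e)"
	proof (rule integral_norm_bound_integral[OF ci])
	 fix t assume t: "t \<in> {0..x}"
	 show "norm (?f t) <= 3 * (2 * N) * ?e"
		unfolding norm_mult norm_of_real
		using abs_born_kernel_le[OF s(1) x t s(2), of l] norm_cos_real_mult_le[of t x z] t N0 by (intro mult_mono) auto
	qed auto
	also have "... = x * (6 * N * ?e)" using x by simp
	also have "... <= 1 * (6 * N * ?e)" using x N0 by (intro mult_right_mono) auto
	finally have "norm (integral {0..x} ?f) <= 6 * N * ?e" by simp
	then have 3: "norm (of_real a * integral {0..x} ?f) <= a * (6 * N) * ?e"
	 unfolding norm_mult norm_of_real using a by (simp add: mult_left_mono mult.assoc)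
	have "norm (prod_rem l q qh x z) <= norm ((z ^ (l+1) * phi l q (z\<^sup>2) x) * (z ^ (l+1) * phi l qh (z\<^sup>2) x)) +
	  norm (of_real a * (1 - (- 1) ^ l * cos (2 * z * of_real x))) + norm (of_real a * integral {0..x} ?f)"
	 unfolding prod_rem_def a_def[symmetric]
	 by (intro order_trans[OF norm_triangle_ineq4] add_right_mono norm_triangle_ineq4)
	also have "... <= B * Bh * ?e + a * 2 * ?e + a * (6 * N) * ?e" by (intro add_mono 1 2 3)
	also have "... = C * ?e" by (simp add: C_def algebra_simps)
	finally show ?thesis .
 qed
 with C show ?thesis by blast
qed

lemma prod_rem_at_nodes:
 assumes w: "wpot \<delta> N q" and wh: "wpot \<delta> N qh"
 shows "\<exists>C\<ge>0. \<forall>x\<in>{0<..1}. \<forall>n\<ge>1. norm (prod_rem l q qh x (of_real (real n * pi / (2 * x)))) <= C * real n powr (- 1 - \<delta>)"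
proof -
 note q = wpotD(1)[OF w] and qh = wpotD(1)[OF wh] and N0 = wpotD(7)[OF w] and \<delta> = wpotD(3,4)[OF w]
 note s = integral_abs_sum_le[OF w wh]
 obtain \<beta> C where C: "0 <= C" "!!z x. 0 < z ==> 0 < x ==> x <= 1 ==> 1 <= z * x ==>
	norm (of_real (z ^ (l+1)) * phi l q (of_real (z\<^sup>2)) x -
	 of_real (odd_fact l * (sin (z * x - real l * pi / 2) + \<beta> * cos (z * x - real l * pi / 2) / (z * x)) + odd_fact l / z * born l q z x))
	<= C * (z * x) powr (- 1 - \<delta>)" using phi_asymptotics[OF w, of l] by blast
 obtain \<beta>h Ch where Ch: "0 <= Ch" "!!z x. 0 < z ==> 0 < x ==> x <= 1 ==> 1 <= z * x ==>
	norm (of_real (z ^ (l+1)) * phi l qh (of_real (z\<^sup>2)) x -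
	 of_real (odd_fact l * (sin (z * x - real l * pi / 2) + \<beta>h * cos (z * x - real l * pi / 2) / (z * x)) + odd_fact l / z * born l qh z x))
	<= Ch * (z * x) powr (- 1 - \<delta>)" using phi_asymptotics[OF wh, of l] by blast
 define \<alpha> where "\<alpha> = odd_fact l"
 have \<alpha>: "0 < \<alpha>" by (simp add: \<alpha>_def odd_fact_pos)
 define b bh where "b = \<alpha> * (\<bar>\<beta>\<bar> + N)" and "bh = \<alpha> * (\<bar>\<beta>h\<bar> + N)"
 have b0: "0 <= b" "0 <= bh" using \<alpha> N0 by (auto simp: b_def bh_def)
 define D where "D = b * bh + (\<alpha> + b) * Ch + C * (\<alpha> + bh) + C * Ch"
 have D: "0 <= D" using \<alpha> b0 C Ch by (auto simp: D_def)
 have "norm (prod_rem l q qh x (of_real (real n * pi / (2 * x)))) <= D * real n powr (- 1 - \<delta>)"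
	if x: "x \<in> {0<..1}" and n: "1 <= n" for x n
 proof -
	define z where "z = real n * pi / (2 * x)"
	define u where "u = z * x"
	have x0: "0 < x" "x <= 1" using x by auto
	have z0: "0 < z" using x0 n by (simp add: z_def)
	have u: "u = real n * pi / 2" using x0 by (simp add: u_def z_def)
	have un: "real n <= u"
	proof -
	 have "real n * 2 <= real n * pi" using pi_gt3 by (intro mult_left_mono) auto
	 then show ?thesis by (simp add: u)
	qed
	have u1: "1 <= u" using un n by simp
	have zx: "1 <= z * x" using u1 by (simp add: u_def)
	have node: "2 * z * x = real n * pi" using x0 by (simp add: z_def)
	let ?\<theta> = "real l * pi / 2"
	define sn cs where "sn = sin (u - ?\<theta>)" and "cs = cos (u - ?\<theta>)"
	define r where "r = u powr (- 1 - \<delta>)"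
	have r: "0 <= r" "r <= 1" "1 / u <= 1" "1 / u * (1 / u) <= r"
	proof -
	 show "0 <= r" by (simp add: r_def)
	 have "u powr (- 1 - \<delta>) <= u powr 0" using u1 \<delta> by (intro powr_mono) auto
	 then show "r <= 1" using u1 by (simp add: r_def)
	 show "1 / u <= 1" using u1 by simp
	 have "1 / u * (1 / u) = u powr (- 2)" using u1 powr_realpow[of u 2] by (simp add: powr_minus_divide power2_eq_square)
	 also have "... <= r" unfolding r_def using u1 \<delta> by (intro powr_mono) auto
	 finally show "1 / u * (1 / u) <= r" .
	qed
	define A P Ph where "A = \<alpha> * sn" and "P = \<alpha> * \<beta> * cs / u + \<alpha> / z * born l q z x"
	 and "Ph = \<alpha> * \<beta>h * cs / u + \<alpha> / z * born l qh z x"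
	define e eh where "e = of_real (z ^ (l+1)) * phi l q (of_real (z\<^sup>2)) x - of_real (A + P)"
	 and "eh = of_real (z ^ (l+1)) * phi l qh (of_real (z\<^sup>2)) x - of_real (A + Ph)"
	have ne: "norm e <= C * r" "norm eh <= Ch * r"
	 using C(2)[OF z0 x0 zx] Ch(2)[OF z0 x0 zx]
	 by (simp_all add: e_def eh_def A_def P_def Ph_def \<alpha>_def sn_def cs_def u_def r_def algebra_simps)
	have zu: "1 / z <= 1 / u"
	proof -
	 have "u <= z * 1" unfolding u_def using x0 z0 by (intro mult_left_mono) auto
	 then show ?thesis using u1 by (intro divide_left_mono) auto
	qed
	have Pb: "\<bar>\<alpha> * \<beta> * cs / u + \<alpha> / z * born l q z x\<bar> <= \<alpha> * (\<bar>\<beta>\<bar> + N) * (1 / u)" if w: "wpot \<delta> N q" for \<beta> q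
	proof -
	 have "\<bar>\<alpha> * \<beta> * cs / u\<bar> = \<alpha> * \<bar>\<beta>\<bar> * \<bar>cs\<bar> * (1 / u)" using \<alpha> u1 by (simp add: abs_mult)
	 also have "... <= \<alpha> * \<bar>\<beta>\<bar> * 1 * (1 / u)" using \<alpha> u1 by (intro mult_right_mono mult_left_mono) (auto simp: cs_def)
	 finally have 1: "\<bar>\<alpha> * \<beta> * cs / u\<bar> <= \<alpha> * \<bar>\<beta>\<bar> * (1 / u)" by simp
	 have "\<bar>\<alpha> / z * born l q z x\<bar> = \<alpha> * (1 / z) * \<bar>born l q z x\<bar>" using \<alpha> z0 by (simp add: abs_mult)
	 also have "... <= \<alpha> * (1 / u) * N" using \<alpha> z0 u1 zu abs_born_le[OF w x0] by (intro mult_mono) auto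
	 finally have 2: "\<bar>\<alpha> / z * born l q z x\<bar> <= \<alpha> * N * (1 / u)" by simp
	 show ?thesis using order_trans[OF abs_triangle_ineq add_mono[OF 1 2]] by (simp add: algebra_simps)
	qed
	have P: "\<bar>P\<bar> <= b * (1 / u)" and Ph: "\<bar>Ph\<bar> <= bh * (1 / u)"
	 unfolding P_def Ph_def b_def bh_def by (rule Pb[OF w], rule Pb[OF wh])
	have Ab: "\<bar>A\<bar> <= \<alpha>" using \<alpha> by (simp add: A_def abs_mult sn_def mult_le_cancel_left1)
	have b1: "b * (1 / u) <= b" "bh * (1 / u) <= bh" using mult_left_mono[OF r(3) b0(1)] mult_left_mono[OF r(3) b0(2)] by simp_all
	have AP: "\<bar>A + P\<bar> <= \<alpha> + b" "\<bar>A + Ph\<bar> <= \<alpha> + bh" using Ab P Ph b1 by linarith+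
	have Phi: "of_real z ^ (l+1) * phi l q ((of_real z)\<^sup>2) x = of_real (A + P) + e"
	 "of_real z ^ (l+1) * phi l qh ((of_real z)\<^sup>2) x = of_real (A + Ph) + eh" by (simp_all add: e_def eh_def)
	have cos2: "cos (2 * z * x - real l * pi) = (- 1) ^ l * cos (2 * z * x)" by (rule sin_cos_int_shift(2))
	have AA: "A * A = \<alpha>\<^sup>2 / 2 * (1 - (- 1) ^ l * cos (2 * z * x))"
	proof -
	 have z2: "2 * z * x = 2 * u" by (simp add: u_def)
	 have "2 * u - real l * pi = 2 * (u - ?\<theta>)" by (simp add: algebra_simps)
	 then have "(- 1) ^ l * cos (2 * u) = 1 - 2 * sn\<^sup>2"
		using cos2[unfolded z2] cos_double_sin[of "u - ?\<theta>"] unfolding sn_def by metis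
	 then have "(- 1) ^ l * cos (2 * z * x) = 1 - 2 * sn\<^sup>2" unfolding z2 .
	 then show ?thesis by (simp add: A_def power2_eq_square)
	qed
	have sc: "sn * cs = 0"
	proof -
	 have "2 * (u - ?\<theta>) = real n * pi - real l * pi" using u by (simp add: algebra_simps)
	 then have "sin (2 * (u - ?\<theta>)) = (- 1) ^ l * sin (real n * pi)" by (simp only: sin_cos_int_shift)
	 then have "2 * (sn * cs) = 0" using sin_double[of "u - ?\<theta>"] by (simp add: sn_def cs_def)
	 then show ?thesis by simp
	qed
	let ?I = "integral {0..x} (%t. born_kernel l (%y. q y + qh y) x t * cos (2 * z * t))"
	have AB: "A * (P + Ph) = \<alpha>\<^sup>2 / 2 * ?I"
	proof -
	 have "A * (P + Ph) = \<alpha>\<^sup>2 * (\<beta> + \<beta>h) * (sn * cs) / u + \<alpha>\<^sup>2 * (sn * (born l q z x + born l qh z x) / z)"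
		by (simp add: A_def P_def Ph_def power2_eq_square algebra_simps add_divide_distrib)
	 also have "... = \<alpha>\<^sup>2 * (?I / 2)"
	 proof -
		have m: "sn * (born l q z x + born l qh z x) / z = ?I / 2"
		 using born_at_node[OF q qh x0 node, of l] z0 by (simp add: sn_def u_def)
		show ?thesis by (simp only: sc m)
	 qed
	 finally show ?thesis by simp
	qed
	have cI: "integral {0..x} (%t. of_real (born_kernel l (%y. q y + qh y) x t) * cos (2 * cplx z * of_real t)) = of_real ?I"
	proof -
	 have "(%t. born_kernel l (%y. q y + qh y) x t * cos (2 * z * t)) integrable_on {0..x}"
		using x by (intro integrable_continuous_interval continuous_intros born_kernel_continuous s) auto
	 from has_integral_linear[OF integrable_integral[OF this] bounded_linear_of_real[where 'a = complex]]
	 have "((%t. cplx (born_kernel l (%y. q y + qh y) x t * cos (2 * z * t))) has_integral of_real ?I) {0..x}" by (simp only: o_def)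
	 moreover have "(%t. cplx (born_kernel l (%y. q y + qh y) x t * cos (2 * z * t))) =
		 (%t. of_real (born_kernel l (%y. q y + qh y) x t) * cos (2 * cplx z * of_real t))"
	 proof
		fix t
		have "2 * cplx z * of_real t = of_real (2 * z * t)" by simp
		then show "cplx (born_kernel l (%y. q y + qh y) x t * cos (2 * z * t)) =
		 of_real (born_kernel l (%y. q y + qh y) x t) * cos (2 * cplx z * of_real t)"
		 by (metis cos_of_real of_real_mult)
	 qed
	 ultimately show ?thesis by (simp add: integral_unique)
	qed
	have cM: "of_real (\<alpha>\<^sup>2 / 2) * (1 - (- 1) ^ l * cos (2 * cplx z * of_real x)) = cplx (A * A)"
	proof -
	 have "2 * cplx z * of_real x = of_real (2 * z * x)" by simp
	 then have "cos (2 * cplx z * of_real x) = of_real (cos (2 * z * x))" by (metis cos_of_real)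
	 then show ?thesis unfolding AA by simp
	qed
	have "prod_rem l q qh x (of_real z) = (of_real (A + P) + e) * (of_real (A + Ph) + eh) - of_real (A * A) - of_real (A * (P + Ph))"
	 unfolding prod_rem_def Phi cI \<alpha>_def[symmetric] cM AB by simp
	also have "... = of_real (P * Ph) + of_real (A + P) * eh + e * of_real (A + Ph) + e * eh"
	 by (simp add: algebra_simps)
	also have "norm ... <= norm (cplx (P * Ph)) + norm (of_real (A + P) * eh) + norm (e * of_real (A + Ph)) + norm (e * eh)"
	 by (intro order_trans[OF norm_triangle_ineq] add_right_mono norm_triangle_ineq)
	also have "... <= b * bh * r + (\<alpha> + b) * (Ch * r) + (C * r) * (\<alpha> + bh) + C * Ch * r"
	proof (intro add_mono)
	 have "norm (cplx (P * Ph)) = \<bar>P\<bar> * \<bar>Ph\<bar>" by (simp add: norm_mult)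
	 also have "... <= (b * (1 / u)) * (bh * (1 / u))" using P Ph b0 u1 by (intro mult_mono) auto
	 also have "... = b * bh * (1 / u * (1 / u))" by simp
	 also have "... <= b * bh * r" using b0 r by (intro mult_left_mono) auto
	 finally show "norm (cplx (P * Ph)) <= b * bh * r" .
	 show "norm (of_real (A + P) * eh) <= (\<alpha> + b) * (Ch * r)"
		unfolding norm_mult norm_of_real using AP ne \<alpha> b0 by (intro mult_mono) auto
	 show "norm (e * of_real (A + Ph)) <= (C * r) * (\<alpha> + bh)"
		unfolding norm_mult norm_of_real using AP ne C r by (intro mult_mono) auto
	 have "norm (e * eh) <= (C * r) * (Ch * r)"
		unfolding norm_mult using ne C r by (intro mult_mono) auto
	 also have "... = C * Ch * r * r" by simp
	 also have "... <= C * Ch * r * 1" using C Ch r by (intro mult_left_mono) auto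
	 finally show "norm (e * eh) <= C * Ch * r" by simp
	qed
	also have "... = D * r" by (simp add: D_def algebra_simps)
	also have "... <= D * real n powr (- 1 - \<delta>)"
	 unfolding r_def using n un \<delta> by (intro mult_left_mono D powr_mono2') auto
	finally show ?thesis by (simp only: z_def)
 qed
 with D show ?thesis by blast
qed

lemma scaled_integral:
 fixes h :: "real => 'a::banach"
 assumes x: "0 < x" and h: "h integrable_on {0..x}"
 shows "integral {0..x} h = x *\<^sub>R integral {0..1} (%u. h (x * u))"
proof -
 have "(%u. (1 / x) *\<^sub>R u + - ((1 / x) *\<^sub>R 0)) ` cbox 0 x = {0..1}"
	using x image_affinity_cbox[of "1 / x" 0 0 x] by (simp add: cbox_interval)
 with has_integral_affinity[of h "integral {0..x} h" 0 x x 0] x integrable_integral[OF h]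
 have "((%u. h (x * u)) has_integral (1 / x) *\<^sub>R integral {0..x} h) {0..1}" by (simp add: cbox_interval)
 then show ?thesis using x by (simp add: integral_unique)
qed

text \<open>Only needed to see that the kernel is a measurable function of both variables.\<close>

lemma prod_rem_node_continuous:
 assumes q: "unit_L1 q" and qh: "unit_L1 qh"
 shows "continuous_on {0<..1} (%x. prod_rem l q qh x (of_real (real n * pi / (2 * x))))"
proof -
 let ?s = "%y. q y + qh y"
 define S where "S = (%t. integral {0..t} ?s)"
 have Sf: "integral {0..t} ?s = S t" for t by (simp add: S_def)
 have s: "unit_L1 ?s" by (rule set_integral_add(1)[OF q qh])
 have S: "continuous_on {0..1} S" unfolding S_def
	by (intro indefinite_integral_continuous_1 L1D(1)[OF s]) auto
 let ?z = "%x. cplx (real n * pi / (2 * x))"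
 have zc: "continuous_on {0<..1} ?z" by (intro continuous_intros) auto
 have ph: "continuous_on {0<..1} (%x. phi l q ((?z x)\<^sup>2) x)" if q: "unit_L1 q" for q
	unfolding phi_def by (intro continuous_intros reg_sol_continuous_joint[OF q] zc) auto
 have c3: "integral {0..x} (%t. of_real (born_kernel l ?s x t) * cos (2 * ?z x * of_real t)) =
	 x *\<^sub>R integral {0..1} (%u. of_real (born_kernel l ?s x (x * u)) * cos (of_real (real n * pi * u)))" if x: "x \<in> {0<..1}" for x
 proof -
	have x': "x \<in> {0..1}" "x > 0" using x by auto
	have "integral {0..x} (%t. of_real (born_kernel l ?s x t) * cos (2 * ?z x * of_real t)) =
	 x *\<^sub>R integral {0..1} (%u. of_real (born_kernel l ?s x (x * u)) * cos (2 * ?z x * of_real (x * u)))"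
	 by (intro scaled_integral x' integrable_continuous_interval continuous_intros born_kernel_continuous s)
	moreover have "2 * ?z x * of_real (x * u) = of_real (real n * pi * u)" for u using x' by simp
	ultimately show ?thesis by simp
 qed
 have m1: "x * u <= x" and m2: "x * u <= 1" and m3: "x - x * u <= 1" if "0 < x" "x <= 1" "0 <= u" "u <= 1" for x u :: real
 proof -
	show "x * u <= x" using that mult_left_mono[of u 1 x] by simp
	then show "x * u <= 1" using that by linarith
	have "0 <= x * u" using that by simp
	then show "x - x * u <= 1" using that by linarith
 qed
 have bc: "continuous_on ({0<..1} \<times> cbox 0 1) (%p. cplx (born_kernel l ?s (fst p) (fst p * snd p)) * cos (of_real (real n * pi * snd p)))"
	unfolding born_kernel_def Sf
	by (intro continuous_intros continuous_on_compose2[OF S]) (auto simp: m1 m2 m3)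
 have "continuous_on {0<..1} (%x. integral (cbox 0 1) (%u. cplx (born_kernel l ?s x (x * u)) * cos (of_real (real n * pi * u))))"
	by (rule integral_continuous_on_param) (use bc in \<open>simp add: case_prod_unfold\<close>)
 then have c3c: "continuous_on {0<..1} (%x. integral {0..x} (%t. of_real (born_kernel l ?s x t) * cos (2 * ?z x * of_real t)))"
	by (subst continuous_on_cong[OF refl c3]) (auto intro!: continuous_intros simp: cbox_interval)
 show ?thesis unfolding prod_rem_def
	by (intro continuous_on_diff continuous_on_mult continuous_on_power continuous_on_const zc ph q qh c3c continuous_on_cos continuous_on_of_real continuous_on_id)
qed

text \<open>The kernel is the sampled remainder plus the explicit kernel of the Born term. The bound \<open>C/x\<close> is the
length of the sampling step times a sum over the nodes that is bounded uniformly in \<open>x\<close>.\<close>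

theorem prod_phi_transform:
 assumes w: "wpot \<delta> N q" and wh: "wpot \<delta> N qh"
 shows "\<exists>(K :: real \<times> real => complex) C. K \<in> borel_measurable borel & 0 <= C &
	(\<forall>x t. \<not> (0 < x & x <= 1 & 0 <= t & t <= x) --> K (x, t) = 0) &
	(\<forall>x t. 0 < x --> norm (K (x, t)) <= C / x) &
	(\<forall>x\<in>{0<..1}. \<forall>z. ((%t. K (x, t) * cos (2 * z * of_real t)) has_integral
	  (z ^ (l+1) * phi l q (z\<^sup>2) x) * (z ^ (l+1) * phi l qh (z\<^sup>2) x)
		- of_real ((odd_fact l)\<^sup>2 / 2) * (1 - (- 1) ^ l * cos (2 * z * of_real x))) {0..x})"
proof -
 note q = wpotD(1)[OF w] and qh = wpotD(1)[OF wh] and N0 = wpotD(7)[OF w]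
 note s = integral_abs_sum_le[OF w wh]
 let ?s = "%y. q y + qh y"
 let ?E = "prod_rem l q qh"
 define a where "a = (odd_fact l)\<^sup>2 / 2"
 have a: "0 <= a" by (simp add: a_def)
 have \<delta>: "0 < \<delta>" using w by (simp add: wpot_def)
 obtain A where A: "0 <= A" "!!x z. x \<in> {0..1} ==> norm (?E x z) <= A * exp (2 * x * \<bar>Im z\<bar>)"
	using prod_rem_growth[OF w wh, of l] by blast
 obtain B where B: "0 <= B" "!!x n. x \<in> {0<..1} ==> 1 <= n ==>
	 norm (?E x (of_real (real n * pi / (2 * x)))) <= B * real n powr (-1 - \<delta>)"
	using prod_rem_at_nodes[OF w wh, of l] by blast
 have sb: "summable (%n. A * 0 ^ n + B * real n powr (-1 - \<delta>))"
	using \<delta> by (intro summable_add summable_mult) (auto simp: summable_real_powr_iff summable_geometric)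
 have nb: "norm (?E x (of_real (real n * pi / (2 * x)))) <= A * 0 ^ n + B * real n powr (-1 - \<delta>)" if "x \<in> {0<..1}" for x n
	using B(2)[OF that, of n] A(2)[of x 0] that by (cases n) auto
 define M where "M = (\<Sum>n. A * 0 ^ n + B * real n powr (-1 - \<delta>))"
 have ns: "summable (%n. norm (?E x (of_real (real n * pi / (2 * x)))))" if "x \<in> {0<..1}" for x
	by (rule summable_comparison_test[OF _ sb]) (use nb[OF that] in auto)
 have nM: "(\<Sum>n. norm (?E x (of_real (real n * pi / (2 * x))))) <= M" if "x \<in> {0<..1}" for x
	unfolding M_def by (rule suminf_le[OF nb[OF that] ns[OF that] sb])
 define k where "k = (%x t. cos_kernel (?E x) x t + of_real (a * born_kernel l ?s x t))"
 define T where "T = {p :: real \<times> real. 0 < fst p & fst p <= 1 & 0 <= snd p & snd p <= fst p}"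
 define K where "K = (%p. indicator T p *\<^sub>R k (fst p) (snd p))"
 define C where "C = 2 * M + a * (3 * (2 * N))"
 have M0: "0 <= M" using nM[of 1] suminf_nonneg[OF ns[of 1]] by force
 have C0: "0 <= C" using M0 a N0 by (simp add: C_def)
 have samp: "(\<forall>t. norm (cos_kernel (?E x) x t) <= 2 * M / x) &
	 ((%t. cos_kernel (?E x) x t * cos (2 * z * of_real t)) has_integral ?E x z) {0..x}" if x: "x \<in> {0<..1}" for x z
 proof -
	have x': "0 < x" "x \<in> {0..1}" using x by auto
	note cs = cosine_sampling[OF x'(1) prod_rem_holomorphic[OF q qh x'(2)] prod_rem_even A(2)[OF x'(2)] ns[OF x]]
	have "2 * (\<Sum>n. norm (?E x (of_real (real n * pi / (2 * x))))) / x <= 2 * M / x"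
	 using nM[OF x] x' by (intro divide_right_mono mult_left_mono) auto
	then show ?thesis using order_trans[OF cs(2)] cs(3) by blast
 qed
 have Kb: "norm (K (x, t)) <= C / x" if x: "0 < x" for x t
 proof (cases "(x, t) \<in> T")
	case True
	then have x': "x \<in> {0<..1}" "x \<in> {0..1}" "t \<in> {0..x}" by (auto simp: T_def)
	have "norm (K (x, t)) <= norm (cos_kernel (?E x) x t) + norm (cplx (a * born_kernel l ?s x t))"
	 using True by (simp add: K_def k_def norm_triangle_ineq del: of_real_mult norm_of_real)
	also have "... <= 2 * M / x + a * (3 * (2 * N))"
	 using samp[OF x'(1)] abs_born_kernel_le[OF s(1) x'(2,3) s(2), of l] a
	 by (intro add_mono) (auto simp: norm_mult abs_mult mult_left_mono)
	also have "... <= 2 * M / x + a * (3 * (2 * N)) / x"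
	 using x' a N0 divide_left_mono[of x 1 "a * (3 * (2 * N))"] by auto
	finally show ?thesis by (simp add: C_def add_divide_distrib)
 qed (use C0 x in \<open>simp add: K_def\<close>)
 have Tb: "T \<in> sets borel"
 proof -
	have "T = {p. 0 < fst p} \<inter> {p. fst p <= 1 & 0 <= snd p & snd p <= fst p}" by (auto simp: T_def)
	also have "... \<in> sets borel"
	 by (intro sets.Int borel_open borel_closed open_Collect_less closed_Collect_conj closed_Collect_le continuous_intros)
	finally show ?thesis .
 qed
 have Km: "K \<in> borel_measurable borel"
 proof -
	let ?g = "%n p. (if n = 0 then 1 else 2) * ?E (fst p) (of_real (real n * pi / (2 * fst p))) * of_real (cos (real n * pi * snd p / fst p))"
	have gc: "continuous_on T (?g n)" for n
	proof -
	 have "continuous_on T (%p. ?E (fst p) (of_real (real n * pi / (2 * fst p))))"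
		by (rule continuous_on_compose2[OF prod_rem_node_continuous[OF q qh]])
		  (auto simp: T_def intro!: continuous_intros)
	 then show ?thesis by (intro continuous_intros) (auto simp: T_def)
	qed
	define S where "S = (%t. integral {0..t} ?s)"
 have Sf: "integral {0..t} ?s = S t" for t by (simp add: S_def)
	have S: "continuous_on {0..1} S" unfolding S_def
	 by (intro indefinite_integral_continuous_1 L1D(1)[OF s(1)]) auto
	have bc: "continuous_on T (%p. cplx (a * born_kernel l ?s (fst p) (snd p)))"
	 unfolding born_kernel_def Sf
	 by (intro continuous_intros continuous_on_compose2[OF S]) (auto simp: T_def)
	have "(%p. (\<Sum>n. indicator T p *\<^sub>R ?g n p) / of_real (fst p) + indicator T p *\<^sub>R cplx (a * born_kernel l ?s (fst p) (snd p))) \<in> borel_measurable borel"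
	 by (intro borel_measurable_add borel_measurable_divide borel_measurable_suminf borel_measurable_continuous_on_indicator[OF Tb gc]
		borel_measurable_continuous_on_indicator[OF Tb bc] borel_measurable_continuous_onI continuous_intros)
	moreover have "(%p. (\<Sum>n. indicator T p *\<^sub>R ?g n p) / of_real (fst p) + indicator T p *\<^sub>R cplx (a * born_kernel l ?s (fst p) (snd p))) = K"
	 by (auto simp: K_def k_def cos_kernel_def fun_eq_iff indicator_def)
	ultimately show ?thesis by simp
 qed
 have Ki: "((%t. K (x, t) * cos (2 * z * of_real t)) has_integral
	  (z ^ (l+1) * phi l q (z\<^sup>2) x) * (z ^ (l+1) * phi l qh (z\<^sup>2) x)
		- of_real a * (1 - (- 1) ^ l * cos (2 * z * of_real x))) {0..x}" if x: "x \<in> {0<..1}" for x z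
 proof -
	have x': "x \<in> {0..1}" using x by auto
	let ?b = "%t. of_real (born_kernel l ?s x t) * cos (2 * z * of_real t)"
	have "?b integrable_on {0..x}"
	 by (intro integrable_continuous_interval continuous_intros born_kernel_continuous s x')
	note h = has_integral_add[OF conjunct2[OF samp[OF x, of z]] has_integral_mult_right[OF integrable_integral[OF this], of "of_real a"]]
	have "?E x z + of_real a * integral {0..x} ?b =
	 (z ^ (l+1) * phi l q (z\<^sup>2) x) * (z ^ (l+1) * phi l qh (z\<^sup>2) x) - of_real a * (1 - (- 1) ^ l * cos (2 * z * of_real x))"
	 unfolding prod_rem_def a_def[symmetric] by simp
	from h[unfolded this] show ?thesis
	 by (rule has_integral_eq[rotated]) (use x in \<open>auto simp: K_def k_def T_def algebra_simps\<close>)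
 qed
 have K0: "K (x, t) = 0" if "\<not> (0 < x & x <= 1 & 0 <= t & t <= x)" for x t
	using that by (auto simp: K_def T_def)
 show ?thesis
	by (rule exI[of _ K], rule exI[of _ C]) (use Km C0 K0 Kb Ki in \<open>auto simp: a_def\<close>)
qed

section \<open>An inequality of Hardy type\<close>

lemma Lp_integrable:
 fixes f :: "real => 'a::euclidean_space"
 assumes p: "1 < p" and f: "f \<in> borel_measurable borel" and f0: "!!x. x \<notin> {0<..<1} ==> f x = 0"
	and fp: "integrable lborel (%x. norm (f x) powr p)"
 shows "integrable lborel f"
proof (rule bi_integrable_bound)
 show "integrable lborel (%x. indicator {0<..<1} x + norm (f x) powr p)"
	by (intro bi_integrable_add fp) simp
 have "norm (f x) <= indicator {0<..<1} x + norm (f x) powr p" for x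
 proof (cases "norm (f x) <= 1")
	case False
	then have "norm (f x) powr 1 <= norm (f x) powr p" using p by (intro powr_mono) auto
	then show ?thesis using False by (auto intro: add_increasing)
 qed (use f0[of x] in \<open>auto simp: indicator_def intro: add_increasing2\<close>)
 then show "AE x in lborel. norm (f x) <= norm (indicator {0<..<1} x + norm (f x) powr p)"
	by (intro AE_I2) (simp add: indicator_def)
qed (use f in simp)

text \<open>A substitute for Young's inequality: below \<open>c\<close> the first term suffices, above it the second.\<close>

lemma le_scale_powr:
 fixes u c p :: real
 assumes "0 <= u" "0 < c" "1 < p"
 shows "u <= c + c powr (1 - p) * u powr p"
proof (cases "u <= c")
 case False
 then have u: "c < u" "0 < u" using assms by auto
 have "u powr (1 - p) <= c powr (1 - p)" using u assms by (intro powr_mono2') auto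
 then have "u powr (1 - p) * u powr p <= c powr (1 - p) * u powr p" by (intro mult_right_mono) auto
 then show ?thesis using u assms by (simp flip: powr_add)
qed (use assms in \<open>auto intro: add_increasing2\<close>)

text \<open>Hoelder's inequality for the splitting \<open>\<bar>f\<bar>/x = (\<bar>f\<bar> x^e) x^(-1-e)\<close>, obtained from the previous inequality by
optimising \<open>c\<close>. The choice \<open>e = 1/(2(p-1))\<close> makes both weights equal to the integrable power \<open>-1/2\<close>; the
summand 1 keeps \<open>c\<close> positive.\<close>

lemma tail_avg_bound:
 fixes f :: "real => real"
 assumes p: "1 < p" and f[measurable]: "f \<in> borel_measurable borel" and f0: "!!x. x \<notin> {0<..<1} ==> f x = 0"
	and fp: "integrable lborel (%x. \<bar>f x\<bar> powr p)" and t: "0 < t"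
 shows "integrable lborel (%x. indicator {t..} x * (\<bar>f x\<bar> / x))"
	"integrable lborel (%x. indicator {t..} x * (\<bar>f x\<bar> powr p * x powr (-1/2)))"
	"(LBINT x. indicator {t..} x * (\<bar>f x\<bar> / x)) powr p <=
	 2 powr p * (2 * (p - 1)) powr (p - 1) *
	 ((1 + (LBINT x. indicator {t..} x * (\<bar>f x\<bar> powr p * x powr (-1/2)))) * t powr (-1/2))"
proof -
 have fi: "integrable lborel f" by (rule Lp_integrable[OF p f f0]) (use fp in auto)
 show i1: "integrable lborel (%x. indicator {t..} x * (\<bar>f x\<bar> / x))"
 proof (rule bi_integrable_bound)
	show "integrable lborel (%x. \<bar>f x\<bar> / t)" using fi by (intro integrable_divide) auto
	show "AE x in lborel. norm (indicator {t..} x * (\<bar>f x\<bar> / x)) <= norm (\<bar>f x\<bar> / t)"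
	 using t by (intro AE_I2) (auto simp: indicator_def intro!: divide_left_mono)
 qed simp
 show i2: "integrable lborel (%x. indicator {t..} x * (\<bar>f x\<bar> powr p * x powr (-1/2)))"
 proof (rule bi_integrable_bound)
	show "integrable lborel (%x. \<bar>f x\<bar> powr p * t powr (-1/2))" using fp by (intro integrable_mult_left) auto
	show "AE x in lborel. norm (indicator {t..} x * (\<bar>f x\<bar> powr p * x powr (-1/2))) <= norm (\<bar>f x\<bar> powr p * t powr (-1/2))"
	 using t by (intro AE_I2) (auto simp: indicator_def intro!: mult_left_mono powr_mono2')
 qed simp
 define A where "A = (LBINT x. indicator {t..} x * (\<bar>f x\<bar> powr p * x powr (-1/2)))"
 define T where "T = (LBINT x. indicator {t..} x * (\<bar>f x\<bar> / x))"
 have A0: "0 <= A" unfolding A_def by (intro bi_integral_nonneg) auto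
 have T0: "0 <= T" unfolding T_def using t by (intro bi_integral_nonneg) (auto simp: indicator_def)
 define e where "e = 1 / (2 * (p - 1))"
 have e: "0 < e" "e * (p - 1) = 1 / 2" using p by (auto simp: e_def)
 define B where "B = t powr (- e) / e"
 have B: "0 < B" using e t by (simp add: B_def)
 define c where "c = ((1 + A) / B) powr (1 / p)"
 have c: "0 < c" using A0 B by (simp add: c_def)
 have Tle: "T <= c * B + c powr (1 - p) * A"
 proof (cases "t <= 1")
	case True
	have em: "- 1 - e = - e - 1" by simp
	have hb: "has_bochner_integral lborel (%x. x powr (-1 - e) * indicator {t..1} x) (- (1 powr (- e) / e) - - (t powr (- e) / e))"
	proof (rule has_bochner_integral_FTC_Icc_nonneg[OF _ _ _ True])
	 fix x assume x: "x \<in> {t..1}"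
	 show "((%x. - (x powr (- e) / e)) has_real_derivative x powr (- 1 - e)) (at x)"
		unfolding em using x t e by (auto intro!: derivative_eq_intros simp: algebra_simps)
	qed auto
	have "T <= (LBINT x. c * (x powr (-1 - e) * indicator {t..1} x) + c powr (1 - p) * (indicator {t..} x * (\<bar>f x\<bar> powr p * x powr (-1/2))))"
	 unfolding T_def
	proof (rule integral_mono[OF i1])
	 show "integrable lborel (%x. c * (x powr (-1 - e) * indicator {t..1} x) + c powr (1 - p) * (indicator {t..} x * (\<bar>f x\<bar> powr p * x powr (-1/2))))"
		by (intro bi_integrable_add integrable_mult_right i2 integrable.intros[OF hb])
	 fix x :: real
	 show "indicator {t..} x * (\<bar>f x\<bar> / x) <= c * (x powr (-1 - e) * indicator {t..1} x) + c powr (1 - p) * (indicator {t..} x * (\<bar>f x\<bar> powr p * x powr (-1/2)))"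
	 proof (cases "x \<in> {t..1}")
		case True
		then have x: "0 < x" "t <= x" "x <= 1" using t by auto
		have 1: "(\<bar>f x\<bar> * x powr e) powr p * x powr (-1 - e) = \<bar>f x\<bar> powr p * x powr (-1/2)"
		proof -
		 have "e * p + (-1 - e) = -1/2" using e by (simp add: algebra_simps)
		 then show ?thesis using x by (simp add: powr_mult powr_powr powr_add[symmetric] mult.assoc)
		qed
		have 2: "\<bar>f x\<bar> * x powr e * x powr (-1 - e) = \<bar>f x\<bar> / x"
		 using x by (simp add: mult.assoc powr_add[symmetric] powr_minus_divide)
		have "\<bar>f x\<bar> * x powr e * x powr (-1 - e) <= (c + c powr (1 - p) * (\<bar>f x\<bar> * x powr e) powr p) * x powr (-1 - e)"
		 by (intro mult_right_mono le_scale_powr c p) auto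
		also have "... = c * x powr (-1 - e) + c powr (1 - p) * (\<bar>f x\<bar> powr p * x powr (-1/2))"
		 unfolding 1[symmetric] by (simp add: algebra_simps)
		finally show ?thesis unfolding 2 using x by simp
	 next
		case False
		then consider "x < t" | "1 < x" "t <= x" by fastforce
		then show ?thesis using f0[of x] by cases auto
	 qed
	qed
	also have "... = c * ((t powr (- e) / e) - 1 / e) + c powr (1 - p) * A"
	 using has_bochner_integral_integral_eq[OF hb] i2 integrable.intros[OF hb]
	 by (subst bi_integral_add) (auto simp: A_def)
	also have "... <= c * B + c powr (1 - p) * A"
	 unfolding B_def using c e by (intro add_right_mono mult_left_mono) auto
	finally show ?thesis .
 next
	case False
	then have "(%x. indicator {t..} x * (\<bar>f x\<bar> / x)) = (%x. 0)" using f0 by (auto simp: fun_eq_iff indicator_def)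
	then have "T = 0" unfolding T_def by (simp only:) simp
	then show ?thesis using c B A0 by simp
 qed
 have "c powr (1 - p) * A <= c powr (1 - p) * (c powr p * B)"
 proof (intro mult_left_mono)
	have "c powr p = (1 + A) / B" using p A0 B by (simp add: c_def powr_powr)
	then show "A <= c powr p * B" using B by simp
 qed simp
 also have "... = c * B" using c by (simp add: mult.assoc[symmetric] powr_add[symmetric])
 finally have "T <= 2 * (c * B)" using Tle by simp
 then have "T powr p <= (2 * (c * B)) powr p" using T0 p by (intro powr_mono2) auto
 also have "... = 2 powr p * (c powr p * B powr p)" using c B by (simp add: powr_mult)
 also have "c powr p * B powr p = (1 + A) * B powr (p - 1)"
 proof -
	have "c powr p = (1 + A) / B" using p A0 B by (simp add: c_def powr_powr)
	then show ?thesis using B by (simp add: powr_diff)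
 qed
 also have "B powr (p - 1) = (2 * (p - 1)) powr (p - 1) * t powr (-1/2)"
 proof -
	have "B = (2 * (p - 1)) * t powr (- e)" using p by (simp add: B_def e_def)
	then show ?thesis using p t by (simp add: powr_mult powr_powr e(2))
 qed
 finally show "T powr p <= 2 powr p * (2 * (p - 1)) powr (p - 1) * ((1 + A) * t powr (-1/2))"
	by (simp add: mult_ac)
qed

lemma triangle_integrable:
 fixes h w :: "real => real"
 assumes [measurable]: "h \<in> borel_measurable borel" "w \<in> borel_measurable borel"
	and W: "!!x. 0 < x ==> x < 1 ==> integrable lborel (%t. indicator {0..x} t * w t)"
	and hW: "integrable lborel (%x. indicator {0<..<1} x * \<bar>h x\<bar> * (LBINT t. indicator {0..x} t * \<bar>w t\<bar>))"
 shows "integrable (lborel \<Otimes>\<^sub>M lborel) (%(x, t). indicator {0<..<1} x * h x * (indicator {0..x} t * w t))"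
proof (rule lborel_pair.Fubini_integrable)
 have "(%(x, t). (if 0 < x & x < 1 & 0 <= t & t <= x then 1 else 0) * (h x * w t)) \<in> borel_measurable (borel \<Otimes>\<^sub>M borel)"
	by measurable
 moreover have "(%(x, t). (if 0 < x & x < 1 & 0 <= t & t <= x then 1 else 0) * (h x * w t)) =
	(%(x, t). indicator {0<..<1} x * h x * (indicator {0..x} t * w t))" by (auto simp: fun_eq_iff indicator_def)
 ultimately show "(%(x, t). indicator {0<..<1} x * h x * (indicator {0..x} t * w t)) \<in> borel_measurable (lborel \<Otimes>\<^sub>M lborel)"
	by (simp cong: measurable_cong_sets)
 have "(LBINT t. norm (case (x, t) of (x, t) => indicator {0<..<1} x * h x * (indicator {0..x} t * w t))) =
	 indicator {0<..<1} x * \<bar>h x\<bar> * (LBINT t. indicator {0..x} t * \<bar>w t\<bar>)" for x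
	by (simp add: abs_mult)
 then show "integrable lborel (%x. LBINT t. norm (case (x, t) of (x, t) => indicator {0<..<1} x * h x * (indicator {0..x} t * w t)))"
	using hW by simp
 show "AE x in lborel. integrable lborel (%t. case (x, t) of (x, t) => indicator {0<..<1} x * h x * (indicator {0..x} t * w t))"
	using W by (intro AE_I2) (auto simp: indicator_def)
qed

lemma tail_avg_Lp:
 fixes f :: "real => real"
 assumes p: "1 < p" and f[measurable]: "f \<in> borel_measurable borel" and f0: "!!x. x \<notin> {0<..<1} ==> f x = 0"
	and fp: "integrable lborel (%x. \<bar>f x\<bar> powr p)"
 shows "integrable lborel (%t. indicator {0<..<1} t * (LBINT x. indicator {t..} x * (\<bar>f x\<bar> / x)) powr p)"
proof -
 let ?A = "%t. LBINT x. indicator {t..} x * (\<bar>f x\<bar> powr p * x powr (-1/2))"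
 have pw: "has_bochner_integral lborel (%t. indicator {0..x} t * t powr (-1/2)) (2 * x powr (1/2))" if "0 < x" for x :: real
 proof -
	have "((%t. t powr (-1/2)) has_integral (x powr (-1/2 + 1) / (-1/2 + 1))) {0..x}"
	 by (rule has_integral_powr_from_0) (use that in auto)
	then have "((%t. t powr (-1/2)) has_integral (2 * x powr (1/2))) {0..x}" by (simp add: mult.commute)
	then have "((%t. indicator {0..x} t * t powr (-1/2)) has_integral (2 * x powr (1/2))) UNIV"
	 unfolding has_integral_restrict_UNIV[of "{0..x}", symmetric]
	 by (rule has_integral_eq[rotated]) (auto simp: indicator_def)
	then show ?thesis by (intro has_bochner_integral_nn_integral nn_integral_has_integral_lborel) auto
 qed
 have pi: "(LBINT t. indicator {0..x} t * \<bar>t powr (-1/2)\<bar>) = 2 * x powr (1/2)" if "0 < x" for x :: real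
	using has_bochner_integral_integral_eq[OF pw[OF that]] by simp
 have "integrable (lborel \<Otimes>\<^sub>M lborel) (%(x, t). indicator {0<..<1} x * (\<bar>f x\<bar> powr p * x powr (-1/2)) * (indicator {0..x} t * t powr (-1/2)))"
 proof (rule triangle_integrable)
	show "integrable lborel (%t. indicator {0..x} t * t powr (-1/2))" if "0 < x" for x :: real
	 by (rule integrable.intros[OF pw[OF that]])
	have "indicator {0<..<1} x * \<bar>\<bar>f x\<bar> powr p * x powr (-1/2)\<bar> * (LBINT t. indicator {0..x} t * \<bar>t powr (-1/2)\<bar>) = 2 * \<bar>f x\<bar> powr p" for x
	proof (cases "x \<in> {0<..<1}")
	 case True
	 then have "x powr (-1/2) * x powr (1/2) = 1" by (simp flip: powr_add)
	 then show ?thesis using pi[of x] True by simp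
	qed (use f0[of x] p in simp)
	then show "integrable lborel (%x. indicator {0<..<1} x * \<bar>\<bar>f x\<bar> powr p * x powr (-1/2)\<bar> * (LBINT t. indicator {0..x} t * \<bar>t powr (-1/2)\<bar>))"
	 using fp by (simp only:) simp
 qed simp_all
 from lborel_pair.integrable_snd[OF this]
 have "integrable lborel (%t. LBINT x. indicator {0<..<1} x * (\<bar>f x\<bar> powr p * x powr (-1/2)) * (indicator {0..x} t * t powr (-1/2)))" by simp
 moreover have "(LBINT x. indicator {0<..<1} x * (\<bar>f x\<bar> powr p * x powr (-1/2)) * (indicator {0..x} t * t powr (-1/2))) =
	 indicator {0<..<1} t * (?A t * t powr (-1/2))" for t
 proof -
	have "indicator {0<..<1} x * (\<bar>f x\<bar> powr p * x powr (-1/2)) * (indicator {0..x} t * t powr (-1/2)) =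
	  (indicator {t..} x * (\<bar>f x\<bar> powr p * x powr (-1/2))) * (indicator {0<..<1} t * t powr (-1/2))" for x
	 using f0[of x] p by (auto simp: indicator_def)
	then show ?thesis by (simp only:) simp
 qed
 ultimately have A: "integrable lborel (%t. indicator {0<..<1} t * (?A t * t powr (-1/2)))" by simp
 have "integrable lborel (%t::real. indicator {0<..<1} t * t powr (-1/2) :: real)"
	by (rule bi_integrable_bound[OF integrable.intros[OF pw[of 1]]]) (auto simp: indicator_def)
 from bi_integrable_add[OF this A]
 have i: "integrable lborel (%t. 2 powr p * (2 * (p - 1)) powr (p - 1) * (indicator {0<..<1} t * ((1 + ?A t) * t powr (-1/2))))"
	by (intro integrable_mult_right) (simp add: algebra_simps)
 show ?thesis
 proof (rule bi_integrable_bound[OF i])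
	have [measurable]: "(%(t, x). (if t <= x then 1 else 0) * (\<bar>f x\<bar> / x)) \<in> borel_measurable (borel \<Otimes>\<^sub>M borel)"
	 by measurable
	have "(%t. LBINT x. (if t <= x then 1 else 0) * (\<bar>f x\<bar> / x)) \<in> borel_measurable borel"
	 by measurable
	moreover have "(%t. LBINT x. (if t <= x then 1 else 0) * (\<bar>f x\<bar> / x)) = (%t. LBINT x. indicator {t..} x * (\<bar>f x\<bar> / x))"
	 by (intro ext bi_integral_cong) auto
	ultimately have [measurable]: "(%t. LBINT x. indicator {t..} x * (\<bar>f x\<bar> / x)) \<in> borel_measurable borel" by (simp only:)
	show "(%t. indicator {0<..<1} t * (LBINT x. indicator {t..} x * (\<bar>f x\<bar> / x)) powr p) \<in> borel_measurable lborel"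
	 by measurable
	show "AE t in lborel. norm (indicator {0<..<1} t * (LBINT x. indicator {t..} x * (\<bar>f x\<bar> / x)) powr p)
	  <= norm (2 powr p * (2 * (p - 1)) powr (p - 1) * (indicator {0<..<1} t * ((1 + ?A t) * t powr (-1/2))))"
	proof (rule AE_I2)
	 fix t :: real
	 show "norm (indicator {0<..<1} t * (LBINT x. indicator {t..} x * (\<bar>f x\<bar> / x)) powr p)
	  <= norm (2 powr p * (2 * (p - 1)) powr (p - 1) * (indicator {0<..<1} t * ((1 + ?A t) * t powr (-1/2))))"
	 proof (cases "t \<in> {0<..<1}")
		case True
		then have t: "0 < t" by auto
		show ?thesis using True order_trans[OF tail_avg_bound(3)[OF p f f0 fp t] abs_ge_self] by simp
	 qed simp
	qed
 qed
qed

lemma norm_add_powr_le: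
 fixes u v :: "'a::real_normed_vector"
 assumes "1 < p"
 shows "norm (u - v) powr p <= 2 powr p * (norm u powr p + norm v powr p)"
proof -
 have "norm (u - v) <= 2 * max (norm u) (norm v)" using norm_triangle_ineq4[of u v] by linarith
 then have "norm (u - v) powr p <= (2 * max (norm u) (norm v)) powr p" using assms by (intro powr_mono2) auto
 also have "... = 2 powr p * max (norm u) (norm v) powr p" by (simp add: powr_mult)
 also have "... <= 2 powr p * (norm u powr p + norm v powr p)"
	by (intro mult_left_mono) (auto simp: max_def)
 finally show ?thesis .
qed

text \<open>A Gronwall argument from the right end: away from 0 the factor \<open>1/x\<close> is bounded, so vanishing of \<open>f\<close> beyond
\<open>s + \<eta>\<close> propagates to \<open>s\<close> for a fixed step \<open>\<eta>\<close>.\<close>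

lemma tail_avg_vanishing:
 fixes f :: "real => real"
 assumes f: "integrable lborel f" and f0: "!!x. x \<notin> {0<..<1} ==> f x = 0" and D: "0 <= D"
	and le: "AE t in lborel. 0 < t --> \<bar>f t\<bar> <= D * (LBINT x. indicator {t..} x * (\<bar>f x\<bar> / x))"
 shows "AE t in lborel. f t = 0"
proof -
 have fm[measurable]: "f \<in> borel_measurable borel" using f by simp
 define h where "h = (%s. LBINT x. indicator {s..} x * \<bar>f x\<bar>)"
 have hi: "integrable lborel (%x. indicator {s..} x * \<bar>f x\<bar>)" for s
	by (rule bi_integrable_bound[OF f]) (auto simp: indicator_def)
 have h0: "0 <= h s" for s unfolding h_def by (intro bi_integral_nonneg) auto
 have h_eps: "h e = 0" if e: "0 < e" for e
 proof -
	define \<eta> where "\<eta> = e / (2 * (D + 1))"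
	have \<eta>: "0 < \<eta>" "\<eta> * (D / e) <= 1 / 2" using e D by (auto simp: \<eta>_def field_simps)
	have step: "h s = 0" if s: "e <= s" and s': "h (s + \<eta>) = 0" for s
	proof -
	 have Tle: "(LBINT x. indicator {t..} x * (\<bar>f x\<bar> / x)) <= h s / e" if t: "s <= t" for t
	 proof -
		have "(LBINT x. indicator {t..} x * (\<bar>f x\<bar> / x)) <= (LBINT x. indicator {s..} x * \<bar>f x\<bar> / e)"
		 using s t e by (intro integral_mono' integrable_divide hi) (auto simp: indicator_def intro!: divide_left_mono)
		then show ?thesis by (simp add: h_def)
	 qed
	 have z: "AE x in lborel. indicator {s + \<eta>..} x * \<bar>f x\<bar> = 0"
		using s' unfolding h_def by (subst (asm) integral_nonneg_eq_0_iff_AE[OF hi]) auto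
	 have bi: "integrable lborel (%x. indicator {s..s + \<eta>} x * (D * (h s / e)))"
		by (intro integrable_mult_left integrable_real_indicator) (auto simp: emeasure_lborel_Icc_eq)
	 have hs: "(LBINT x. indicator {s..} x * \<bar>f x\<bar>) = h s" by (simp add: h_def)
	 have "h s <= (LBINT x. indicator {s..s + \<eta>} x * (D * (h s / e)))"
		unfolding h_def
	 proof (rule integral_mono_AE[OF hi])
		show "integrable lborel (%x. indicator {s..s + \<eta>} x * (D * ((LBINT x. indicator {s..} x * \<bar>f x\<bar>) / e)))"
		 using bi by (simp only: h_def)
		show "AE x in lborel. indicator {s..} x * \<bar>f x\<bar> <= indicator {s..s + \<eta>} x * (D * ((LBINT x. indicator {s..} x * \<bar>f x\<bar>) / e))"
		 using z le
		proof eventually_elim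
		 case (elim x)
		 have "\<bar>f x\<bar> <= D * (h s / e)" if "s <= x"
			using elim(2) that s e mult_left_mono[OF Tle[OF that] D] by linarith
		 then show ?case using elim(1) \<eta>(1) h0[of s] D e unfolding hs by (auto simp: indicator_def split: if_splits)
		qed
	 qed
	 also have "... = \<eta> * (D / e) * h s" using \<eta> by simp
	 also have "... <= 1 / 2 * h s" using \<eta> h0 by (intro mult_right_mono) auto
	 finally show ?thesis using h0[of s] by simp
	qed
	have A: "\<forall>s. e <= s --> 1 - real n * \<eta> <= s --> h s = 0" for n
	proof (induction n)
	 case 0
	 have "(%x. indicator {s..} x * \<bar>f x\<bar>) = (%x. 0)" if "1 <= s" for s :: real
		using that f0 by (auto simp: fun_eq_iff indicator_def)
	 then show ?case by (simp add: h_def)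
	next
	 case (Suc n)
	 then show ?case using step \<eta> by (auto simp: algebra_simps)
	qed
	obtain n where "1 / \<eta> <= real n" using real_arch_simple by blast
	then have "1 <= real n * \<eta>" using \<eta>(1) by (simp add: field_simps)
	then have "1 - real n * \<eta> <= e" using e by linarith
	then show ?thesis using A[of n] by blast
 qed
 have "AE t in lborel. \<forall>n. indicator {1 / real (Suc n)..} t * \<bar>f t\<bar> = 0"
 proof (subst AE_all_countable, intro allI)
	fix n
	have "h (1 / real (Suc n)) = 0" by (rule h_eps) simp
	then show "AE t in lborel. indicator {1 / real (Suc n)..} t * \<bar>f t\<bar> = 0"
	 unfolding h_def by (subst (asm) integral_nonneg_eq_0_iff_AE[OF hi]) auto
 qed
 then show ?thesis
 proof eventually_elim
	case (elim t)
	show ?case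
	proof (cases "0 < t")
	 case True
	 then obtain n where "inverse (real (Suc n)) < t" using reals_Archimedean by blast
	 then show ?thesis using elim[THEN spec, of n] by (auto simp: indicator_def divide_inverse)
	qed (use f0 in auto)
 qed
qed

section \<open>The product function as a cosine transform\<close>

theorem prod_fun_transform:
 fixes f :: "real => real"
 assumes p: "1 < p" and w: "wpot \<delta> N q" and wh: "wpot \<delta> N qh" and a: "0 < a" "a <= 1"
	and fm[measurable]: "f \<in> borel_measurable borel" and f0: "!!x. x \<notin> {0<..<a} ==> f x = 0"
	and fp: "integrable lborel (%x. \<bar>f x\<bar> powr p)"
	and feq: "AE x in lborel. x \<in> {0<..<1} --> qh x - q x = f x"
 shows "\<exists>(g :: real => complex) c. g \<in> borel_measurable borel & (\<forall>t. t \<notin> {0<..<a} --> g t = 0) &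
	integrable lborel (%t. norm (g t) powr p) &
	(\<forall>z. (z\<^sup>2) ^ (l+1) * prod_fun l q qh (z\<^sup>2) = c + (LBINT t. g t * cos (2 * z * of_real t))) &
	((AE t in lborel. g t = 0) --> (AE t in lborel. f t = 0))"
proof -
 have f0': "!!x. x \<notin> {0<..<1} ==> f x = 0" using f0 a by auto
 have fi: "integrable lborel f" by (rule Lp_integrable[OF p fm f0']) (use fp in auto)
 obtain K :: "real \<times> real => complex" and C where Km: "K \<in> borel_measurable borel" and C: "0 <= C"
	and K0: "!!x t. \<not> (0 < x & x <= 1 & 0 <= t & t <= x) ==> K (x, t) = 0"
	and Kb: "!!x t. 0 < x ==> norm (K (x, t)) <= C / x"
	and Ki: "!!x z. x \<in> {0<..1} ==> ((%t. K (x, t) * cos (2 * z * of_real t)) has_integral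
	  (z ^ (l+1) * phi l q (z\<^sup>2) x) * (z ^ (l+1) * phi l qh (z\<^sup>2) x)
		- of_real ((odd_fact l)\<^sup>2 / 2) * (1 - (- 1) ^ l * cos (2 * z * of_real x))) {0..x}"
	using prod_phi_transform[OF w wh, of l] by blast
 have [measurable]: "K \<in> borel_measurable (borel \<Otimes>\<^sub>M borel)" using Km by (simp add: borel_prod)
 define b where "b = (odd_fact l)\<^sup>2 / 2"
 have b: "0 < b" using odd_fact_pos[of l] by (simp add: b_def)
 let ?T = "%t. LBINT x. indicator {t..} x * (\<bar>f x\<bar> / x)"
 define G where "G = (%t. LBINT x. of_real (f x) * K (x, t))"
 define g where "g = (%t. indicator {0<..<a} t *\<^sub>R (G t - (- 1) ^ l * of_real (b * f t)))"
 define c where "c = (LBINT x. cplx (b * f x))"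
 have Gm[measurable]: "G \<in> borel_measurable borel" unfolding G_def by measurable
 have gm: "g \<in> borel_measurable borel" unfolding g_def by measurable
 have Gb: "norm (G t) <= C * ?T t" if t: "0 < t" for t
 proof -
	have "norm (G t) <= (LBINT x. norm (of_real (f x) * K (x, t)))"
	 unfolding G_def by (rule integral_norm_bound)
	also have "... <= (LBINT x. C * (indicator {t..} x * (\<bar>f x\<bar> / x)))"
	proof (rule integral_mono')
	 show "integrable lborel (%x. C * (indicator {t..} x * (\<bar>f x\<bar> / x)))"
		by (intro integrable_mult_right tail_avg_bound(1)[OF p fm f0' fp t])
	 fix x :: real
	 show "0 <= C * (indicator {t..} x * (\<bar>f x\<bar> / x))" using t C by (auto simp: indicator_def)
	 show "norm (of_real (f x) * K (x, t)) <= C * (indicator {t..} x * (\<bar>f x\<bar> / x))"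
	 proof (cases "t <= x")
		case True
		then have "\<bar>f x\<bar> * norm (K (x, t)) <= \<bar>f x\<bar> * (C / x)" using t by (intro mult_left_mono Kb) auto
		then show ?thesis using True by (simp add: norm_mult mult.commute)
	 qed (use K0[of x t] in simp)
	qed
	finally show ?thesis by (simp only: integral_mult_right_zero)
 qed
 have gp: "integrable lborel (%t. norm (g t) powr p)"
 proof (rule bi_integrable_bound)
	show "integrable lborel (%t. 2 powr p * (C powr p * (indicator {0<..<1} t * ?T t powr p) + b powr p * \<bar>f t\<bar> powr p))"
	 by (intro integrable_mult_right bi_integrable_add tail_avg_Lp[OF p fm f0' fp] fp)
	have "norm (g t) powr p <= 2 powr p * (C powr p * (indicator {0<..<1} t * ?T t powr p) + b powr p * \<bar>f t\<bar> powr p)" for t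
	proof (cases "t \<in> {0<..<a}")
	 case True
	 then have t: "0 < t" "t \<in> {0<..<1}" using a by auto
	 have T0: "0 <= ?T t" using t by (intro bi_integral_nonneg) (auto simp: indicator_def)
	 have "norm (g t) powr p <= 2 powr p * (norm (G t) powr p + norm ((- 1) ^ l * cplx (b * f t)) powr p)"
		using True norm_add_powr_le[OF p, of "G t"] by (simp add: g_def del: of_real_mult)
	 also have "... <= 2 powr p * ((C * ?T t) powr p + (b * \<bar>f t\<bar>) powr p)"
		using Gb[OF t(1)] p b by (intro mult_left_mono add_mono powr_mono2) (auto simp: norm_mult norm_power abs_mult)
	 also have "... = 2 powr p * (C powr p * (indicator {0<..<1} t * ?T t powr p) + b powr p * \<bar>f t\<bar> powr p)"
		using t b C T0 by (simp add: powr_mult)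
	 finally show ?thesis .
	qed (auto simp: g_def)
	then show "AE t in lborel. norm (norm (g t) powr p) <= norm (2 powr p * (C powr p * (indicator {0<..<1} t * ?T t powr p) + b powr p * \<bar>f t\<bar> powr p))"
	 by (intro AE_I2) (auto intro: order_trans[OF _ abs_ge_self])
 qed (use gm in measurable)
 have tr: "(z\<^sup>2) ^ (l+1) * prod_fun l q qh (z\<^sup>2) = c + (LBINT t. g t * cos (2 * z * of_real t))" for z
 proof -
	define F where "F = (%x t. of_real (f x) * K (x, t) * cos (2 * z * of_real t))"
	have Fb: "norm (F x t) <= norm (indicator {0<..<1} x * (f x / x) * (indicator {0..x} t * 1) * (C * exp (2 * \<bar>Im z\<bar>)))" for x t
	proof (cases "0 < x & x < 1 & 0 <= t & t <= x")
	 case True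
	 have "norm (cos (2 * z * cplx t)) <= exp (2 * x * \<bar>Im z\<bar>)" using True by (intro norm_cos_real_mult_le) auto
	 also have "... <= exp (2 * \<bar>Im z\<bar>)" using True by (auto intro!: mult_left_le_one_le)
	 finally have "norm (F x t) <= \<bar>f x\<bar> * (C / x) * exp (2 * \<bar>Im z\<bar>)"
		unfolding F_def norm_mult norm_of_real using True C by (intro mult_mono Kb) auto
	 then show ?thesis using True C by (simp add: abs_mult mult_ac)
	next
	 case False
	 then show ?thesis using K0[of x t] f0'[of x] by (cases "x \<in> {0<..<1}") (auto simp: F_def)
	qed
	have Fi: "integrable (lborel \<Otimes>\<^sub>M lborel) (case_prod F)"
	proof (rule bi_integrable_bound)
	 have "integrable (lborel \<Otimes>\<^sub>M lborel) (%(x, t). indicator {0<..<1} x * (f x / x) * (indicator {0..x} t * (1::real)))"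
	 proof (rule triangle_integrable)
		show "integrable lborel (%t. indicator {0..x} t * (1::real))" if "0 < x" for x :: real
		 using that by (simp add: emeasure_lborel_Icc_eq)
		have "indicator {0<..<1} x * \<bar>f x / x\<bar> * (LBINT t. indicator {0..x} t * \<bar>1::real\<bar>) = \<bar>f x\<bar>" for x
		 using f0'[of x] by (cases "x \<in> {0<..<1}") auto
		then show "integrable lborel (%x. indicator {0<..<1} x * \<bar>f x / x\<bar> * (LBINT t. indicator {0..x} t * \<bar>1::real\<bar>))"
		 using fi by (simp only:) simp
	 qed simp_all
	 then show "integrable (lborel \<Otimes>\<^sub>M lborel) (%p. (case p of (x, t) => indicator {0<..<1} x * (f x / x) * (indicator {0..x} t * (1::real))) * (C * exp (2 * \<bar>Im z\<bar>)))"
		by (rule integrable_mult_left)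
	 show "case_prod F \<in> borel_measurable (lborel \<Otimes>\<^sub>M lborel)" unfolding F_def by measurable
	 show "AE p in lborel \<Otimes>\<^sub>M lborel. norm (case_prod F p) <= norm ((case p of (x, t) => indicator {0<..<1} x * (f x / x) * (indicator {0..x} t * (1::real))) * (C * exp (2 * \<bar>Im z\<bar>)))"
		using Fb by (intro AE_I2) (auto simp: case_prod_unfold)
	qed
	define P where "P = (%x. (z ^ (l+1) * phi l q (z\<^sup>2) x) * (z ^ (l+1) * phi l qh (z\<^sup>2) x))"
	have inner: "(LBINT t. F x t) = of_real (f x) * (P x - of_real b * (1 - (- 1) ^ l * cos (2 * z * of_real x)))" for x
	proof (cases "x \<in> {0<..<1}")
	 case True
	 then have x: "0 < x" "x \<in> {0<..1}" by auto
	 let ?k = "%t. K (x, t) * cos (2 * z * of_real t)"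
	 have "integrable lborel ?k"
	 proof (rule bi_integrable_bound)
		show "integrable lborel (%t. indicator {0..x} t * (C / x * exp (2 * x * \<bar>Im z\<bar>)))"
		 by (intro integrable_mult_left integrable_real_indicator) (auto simp: emeasure_lborel_Icc_eq)
		have "norm (?k t) <= norm (indicator {0..x} t * (C / x * exp (2 * x * \<bar>Im z\<bar>)))" for t
		proof (cases "t \<in> {0..x}")
		 case True
		 have "norm (?k t) <= C / x * exp (2 * x * \<bar>Im z\<bar>)"
			unfolding norm_mult using True x C by (intro mult_mono Kb norm_cos_real_mult_le) auto
		 then show ?thesis using True C x by (simp add: abs_mult)
		qed (use K0[of x t] in auto)
		then show "AE t in lborel. norm (?k t) <= norm (indicator {0..x} t * (C / x * exp (2 * x * \<bar>Im z\<bar>)))" by (rule AE_I2)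
	 qed measurable
	 from has_integral_integral_lborel[OF this]
	 have "(?k has_integral (LBINT t. ?k t)) UNIV" .
	 moreover have "(?k has_integral P x - of_real b * (1 - (- 1) ^ l * cos (2 * z * of_real x))) UNIV"
		using Ki[OF x(2), of z] unfolding P_def b_def
		by (rule has_integral_on_superset) (use K0 in auto)
	 ultimately have "(LBINT t. ?k t) = P x - of_real b * (1 - (- 1) ^ l * cos (2 * z * of_real x))"
		by (rule has_integral_unique)
	 then show ?thesis unfolding F_def by (simp add: mult.assoc)
	qed (use f0'[of x] in \<open>simp add: F_def\<close>)
	have Li: "integrable lborel (%x. LBINT t. F x t)" using lborel_pair.integrable_fst[OF Fi] by simp
	have Gi: "integrable lborel (%t. G t * cos (2 * z * of_real t))"
	 using lborel_pair.integrable_snd[OF Fi] by (simp add: F_def G_def)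
	have fc: "integrable lborel (%x. cplx (b * f x) * cos (2 * z * of_real x))"
	proof (rule bi_integrable_bound)
	 show "integrable lborel (%x. b * exp (2 * 1 * \<bar>Im z\<bar>) * f x)" using fi by (rule integrable_mult_right)
	 have "norm (cplx (b * f x) * cos (2 * z * of_real x)) <= norm (b * exp (2 * 1 * \<bar>Im z\<bar>) * f x)" for x
	 proof (cases "x \<in> {0<..<1}")
		case True
		then have "b * \<bar>f x\<bar> * norm (cos (2 * z * cplx x)) <= b * \<bar>f x\<bar> * exp (2 * 1 * \<bar>Im z\<bar>)"
		 using b by (intro mult_left_mono norm_cos_real_mult_le) auto
		then show ?thesis using b by (simp add: norm_mult abs_mult mult_ac)
	 qed (use f0'[of x] in simp)
	 then show "AE x in lborel. norm (cplx (b * f x) * cos (2 * z * of_real x)) <= norm (b * exp (2 * 1 * \<bar>Im z\<bar>) * f x)" by (rule AE_I2)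
	qed measurable
	have f1: "integrable lborel (%x. cplx (b * f x))" using fi by (intro integrable_of_real integrable_mult_right)
	have fP: "(%x. of_real (f x) * P x) = (%x. (LBINT t. F x t) + (cplx (b * f x) - (- 1) ^ l * (cplx (b * f x) * cos (2 * z * of_real x))))"
	 by (rule ext) (simp add: inner algebra_simps)
	have Pi: "integrable lborel (%x. of_real (f x) * P x)"
	 unfolding fP by (intro bi_integrable_add bi_integrable_diff Li f1 fc integrable_mult_right)
	have "(z\<^sup>2) ^ (l+1) * prod_fun l q qh (z\<^sup>2) = (LBINT x. of_real (f x) * P x)"
	proof -
	 have "((%x. of_real (f x) * P x) has_integral (LBINT x. of_real (f x) * P x)) UNIV"
		by (rule has_integral_integral_lborel[OF Pi])
	 then have "((%x. if x \<in> {0..1} then of_real (f x) * P x else 0) has_integral (LBINT x. of_real (f x) * P x)) UNIV"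
		by (rule has_integral_eq[rotated]) (use f0' in auto)
	 then have "((%x. of_real (f x) * P x) has_integral (LBINT x. of_real (f x) * P x)) {0..1}"
		by (simp only: has_integral_restrict_UNIV)
	 moreover have "AE x in lborel. x \<in> {0..1} --> of_real (f x) * P x = of_real (qh x - q x) * P x"
		using feq AE_lborel_singleton[of 0] AE_lborel_singleton[of 1] by eventually_elim auto
	 ultimately have "((%x. of_real (qh x - q x) * P x) has_integral (LBINT x. of_real (f x) * P x)) {0..1}"
		by (subst (asm) has_integral_AE) auto
	 then have "(LBINT x. of_real (f x) * P x) = integral {0..1} (%x. of_real (qh x - q x) * P x)" by (simp add: integral_unique)
	 also have "... = integral {0..1} (%x. (z\<^sup>2) ^ (l+1) * (of_real (x ^ (2*l+2)) * of_real (qh x - q x) *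
		 (reg_sol l (sl_coeff q (z\<^sup>2)) x * reg_sol l (sl_coeff qh (z\<^sup>2)) x)))"
	 proof -
		have "(z\<^sup>2) ^ (l+1) = z ^ (l+1) * z ^ (l+1)" by (metis power2_eq_square power_mult_distrib)
		moreover have "cplx (x ^ (2*l+2)) = of_real (x ^ (l+1)) * of_real (x ^ (l+1))" for x
		proof -
		 have "x ^ (2*l+2) = x ^ (l+1) * x ^ (l+1)" by (simp add: power_add[symmetric] mult_2)
		 then show ?thesis by (metis of_real_mult)
		qed
		ultimately show ?thesis unfolding P_def phi_def by (intro arg_cong[where f = "integral {0..1}"] ext) (simp only: mult_ac)
	 qed
	 also have "... = (z\<^sup>2) ^ (l+1) * prod_fun l q qh (z\<^sup>2)" unfolding prod_fun_def by (rule integral_mult_right)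
	 finally show ?thesis by simp
	qed
	also have "... = (LBINT x. LBINT t. F x t) + (c - (- 1) ^ l * (LBINT x. cplx (b * f x) * cos (2 * z * of_real x)))"
	 unfolding fP c_def using Li f1 fc by (simp del: of_real_mult)
	also have "(LBINT x. LBINT t. F x t) = (LBINT t. G t * cos (2 * z * of_real t))"
	 unfolding lborel_pair.Fubini_integral[OF Fi, symmetric] by (simp add: F_def G_def)
	also have "... + (c - (- 1) ^ l * (LBINT x. cplx (b * f x) * cos (2 * z * of_real x))) =
	  c + (LBINT t. G t * cos (2 * z * of_real t) - (- 1) ^ l * (cplx (b * f t) * cos (2 * z * of_real t)))"
	 using Gi fc by (simp del: of_real_mult)
	also have "(LBINT t. G t * cos (2 * z * of_real t) - (- 1) ^ l * (cplx (b * f t) * cos (2 * z * of_real t))) =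
		(LBINT t. g t * cos (2 * z * of_real t))"
	proof (rule integral_cong_AE)
	 have "G t = 0" if t: "t ~= 0" "t \<notin> {0<..<a}" for t
	 proof -
		have "of_real (f x) * K (x, t) = 0" for x
		 using t f0[of x] K0[of x t] by (cases "x \<in> {0<..<a}") auto
		then show ?thesis unfolding G_def by (simp only:) simp
	 qed
	 then have "t ~= 0 ==> G t * cos (2 * z * of_real t) - (- 1) ^ l * (cplx (b * f t) * cos (2 * z * of_real t)) = g t * cos (2 * z * of_real t)" for t
		using f0[of t] by (cases "t \<in> {0<..<a}") (auto simp: g_def algebra_simps)
	 then show "AE t in lborel. G t * cos (2 * z * of_real t) - (- 1) ^ l * (cplx (b * f t) * cos (2 * z * of_real t)) = g t * cos (2 * z * of_real t)"
		by (intro AE_mp[OF AE_lborel_singleton[of 0] AE_I2]) simp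
	qed (use gm in measurable)
	finally show ?thesis .
 qed
 have inj: "AE t in lborel. f t = 0" if g: "AE t in lborel. g t = 0"
 proof (rule tail_avg_vanishing[OF fi f0'])
	show "0 <= C / b" using C b by simp
	show "AE t in lborel. 0 < t --> \<bar>f t\<bar> <= C / b * ?T t"
	 using g
	proof eventually_elim
	 case (elim t)
	 show ?case
	 proof
		assume t: "0 < t"
		show "\<bar>f t\<bar> <= C / b * ?T t"
		proof (cases "t < a")
		 case True
		 then have "G t = (- 1) ^ l * of_real (b * f t)" using elim t by (simp add: g_def)
		 then have "norm (G t) = b * \<bar>f t\<bar>" using b by (simp add: norm_mult norm_power abs_mult)
		 then show ?thesis using Gb[OF t] b by (simp add: field_simps)
		next
		 case False
		 then have "f t = 0" using f0 by auto
		 then show ?thesis using order_trans[OF norm_ge_zero Gb[OF t]] b C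
			by (simp add: divide_nonneg_pos)
		qed
	 qed
	qed
 qed
 have gs: "\<forall>t. t \<notin> {0<..<a} --> g t = 0" by (simp add: g_def)
 show ?thesis
	by (rule exI[of _ g], rule exI[of _ c]) (use gm gs gp tr inj in blast)
qed

section \<open>Zeros of entire functions of order one half\<close>

lemma divide_out_zero:
 fixes h :: "complex => complex"
 assumes h: "h holomorphic_on UNIV" and a: "h a = 0" and u: "u ~= a"
 obtains k where "k holomorphic_on UNIV" "!!z. h z = (z - a) / (u - a) * k z"
proof
 let ?k = "%z. if z = a then (u - a) * deriv h a else (u - a) * (h z / (z - a))"
 have "(%z. if z = a then deriv h a else h z / (z - a)) holomorphic_on UNIV"
	by (rule pole_theorem_0[OF h, of a]) (auto simp: a)
 then have "(%z. (u - a) * (if z = a then deriv h a else h z / (z - a))) holomorphic_on UNIV"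
	by (intro holomorphic_intros)
 then show "?k holomorphic_on UNIV" by (rule holomorphic_transform) auto
 show "h z = (z - a) / (u - a) * ?k z" for z using a u by auto
qed

text \<open>Each factor has modulus at least 2 on the circle of radius \<open>3R\<close> and equals 1 at \<open>u\<close>, so the maximum
principle bounds the number of factors. A maximal choice leaves no zero in the inner disc; multiplicities need
no separate count.\<close>

lemma factor_out_zeros:
 fixes F :: "complex => complex"
 assumes F: "F holomorphic_on UNIV" and u: "F u ~= 0" and R: "0 < R"
	and M': "\<forall>z. norm (z - u) = 3 * R --> norm (F z) <= M"
 shows "\<exists>as h. h holomorphic_on UNIV & (\<forall>z. F z = (\<Prod>a\<leftarrow>as. (z - a) / (u - a)) * h z) &
	(\<forall>a\<in>set as. F a = 0) & (\<forall>z\<in>cball u R. h z ~= 0) & (\<forall>z\<in>cball u (3 * R). norm (h z) <= M) & h u = F u"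
proof -
 note M = M'[rule_format]
 define good where "good = (%as h. h holomorphic_on UNIV & set as \<subseteq> {a \<in> cball u R. F a = 0} &
	(\<forall>z. F z = (\<Prod>a\<leftarrow>as. (z - a) / (u - a)) * h z))"
 have P2: "2 ^ length as <= norm (\<Prod>a\<leftarrow>as. (z - a) / (u - a))"
	if as: "set as \<subseteq> {a \<in> cball u R. F a = 0}" and z: "norm (z - u) = 3 * R" for as z
	using as
 proof (induction as)
	case (Cons a as)
	then have a: "norm (u - a) <= R" "a ~= u" using u by (auto simp: dist_norm)
	have "3 * R <= norm (z - a) + norm (u - a)" using norm_triangle_ineq4[of "z - a" "u - a"] z by simp
	then have "2 * norm (u - a) <= norm (z - a)" using a by linarith
	then have "2 <= norm ((z - a) / (u - a))" using a by (simp add: norm_divide field_simps)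
	then have "2 * 2 ^ length as <= norm ((z - a) / (u - a)) * norm (\<Prod>a\<leftarrow>as. (z - a) / (u - a))"
	 using Cons by (intro mult_mono) auto
	then show ?case by (simp only: list.map prod_list.Cons norm_mult length_Cons power_Suc)
 qed simp
 have hb: "norm (h z) <= M / 2 ^ length as" if g: "good as h" and z: "z \<in> cball u (3 * R)" for as h z
 proof (rule maximum_modulus_frontier[of h "cball u (3 * R)"])
	have h: "h holomorphic_on UNIV" using g by (simp add: good_def)
	show "h holomorphic_on interior (cball u (3 * R))" by (rule holomorphic_on_subset[OF h]) simp
	show "continuous_on (closure (cball u (3 * R))) h"
	 by (rule continuous_on_subset[OF holomorphic_on_imp_continuous_on[OF h]]) simp
	fix y assume "y \<in> frontier (cball u (3 * R))"
	then have y: "norm (y - u) = 3 * R" using R by (simp add: frontier_cball sphere_def dist_norm norm_minus_commute)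
	have "2 ^ length as * norm (h y) <= norm (\<Prod>a\<leftarrow>as. (y - a) / (u - a)) * norm (h y)"
	 using P2[OF _ y, of as] g by (intro mult_right_mono) (auto simp: good_def)
	also have "... = norm (F y)" using g by (simp add: good_def norm_mult)
	also have "... <= M" by (rule M[OF y])
	finally show "norm (h y) <= M / 2 ^ length as" by (simp add: field_simps)
 qed (use z in auto)
 have hu: "h u = F u" if "good as h" for as h
 proof -
	have "set as' \<subseteq> {a. F a = 0} ==> (\<Prod>a\<leftarrow>as'. (u - a) / (u - a)) = 1" for as'
	 using u by (induction as') auto
	moreover have "set as \<subseteq> {a. F a = 0}" using that by (auto simp: good_def)
	ultimately show ?thesis using that unfolding good_def by (metis mult_1)
 qed
 have bnd: "length as <= nat \<lceil>M / norm (F u)\<rceil>" if g: "good as h" for as h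
 proof -
	have "norm (F u) * 2 ^ length as <= M" using hb[OF g, of u] hu[OF g] R by (simp add: field_simps)
	then have "2 ^ length as <= M / norm (F u)" using u by (simp add: field_simps)
	moreover have "real (length as) < 2 ^ length as" by (rule of_nat_less_two_power)
	ultimately show ?thesis by linarith
 qed
 have "good [] F" using F by (simp add: good_def)
 then have "\<exists>p. (case p of (as, h) => good as h) & (\<forall>p'. (case p' of (as, h) => good as h) --> length (fst p') <= length (fst p))"
	by (intro ex_has_greatest_nat[of _ "([], F)" _ "Suc (nat \<lceil>M / norm (F u)\<rceil>)"]) (use bnd in \<open>auto simp: less_Suc_eq_le\<close>)
 then obtain as h where gd: "good as h" and mx: "!!as' h'. good as' h' ==> length as' <= length as" by fastforce
 have nz: "h z ~= 0" if z: "z \<in> cball u R" for z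
 proof
	assume 0: "h z = 0"
	have h: "h holomorphic_on UNIV" using gd by (simp add: good_def)
	have Fz: "F z = 0" using gd 0 by (simp add: good_def)
	have "u ~= z" using Fz u by auto
	from divide_out_zero[OF h 0 this] obtain k where k: "k holomorphic_on UNIV" "!!w. h w = (w - z) / (u - z) * k w" by blast
	have "good (as @ [z]) k" unfolding good_def
	proof (intro conjI allI)
	 fix w
	 have "F w = (\<Prod>a\<leftarrow>as. (w - a) / (u - a)) * ((w - z) / (u - z) * k w)" using gd k(2) by (simp add: good_def)
	 then show "F w = (\<Prod>a\<leftarrow>as @ [z]. (w - a) / (u - a)) * k w" by simp
	qed (use gd z Fz k in \<open>auto simp: good_def\<close>)
	from mx[OF this] show False by simp
 qed
 have "norm (h z) <= M" if "z \<in> cball u (3 * R)" for z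
 proof -
	have M0: "0 <= M" using order_trans[OF norm_ge_zero M[of "u + of_real (3 * R)"]] R by (simp add: norm_mult)
	have "M / 2 ^ length as <= M / 1" using M0 by (intro divide_left_mono) auto
	then show ?thesis using hb[OF gd that] by simp
 qed
 then show ?thesis
	using gd nz hu[OF gd] unfolding good_def by (intro exI[where x = as], intro exI[where x = h]) blast
qed

text \<open>The map \<open>w \<mapsto> w / (2M - w)\<close> sends the half-plane \<open>Re w \<le> M\<close> to the unit disc, and the Schwarz lemma applies.\<close>

lemma borel_caratheodory:
 fixes g :: "complex => complex"
 assumes g: "g holomorphic_on ball u R" and g0: "g u = 0" and R: "0 < R" and M: "0 < M"
	and le: "!!z. z \<in> ball u R ==> Re (g z) <= M" and x: "norm (x - u) < R / 2"
 shows "norm (g x) <= 4 * M * norm (x - u) / R"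
proof -
 define \<phi> where "\<phi> = (%s. g (u + of_real R * s) / (2 * of_real M - g (u + of_real R * s)))"
 have inb: "u + of_real R * s \<in> ball u R" if "s \<in> ball 0 1" for s :: complex
	using that R by (simp add: dist_norm norm_mult)
 have ReM: "Re (g (u + of_real R * s)) <= M" if "s \<in> ball 0 1" for s using le[OF inb[OF that]] .
 have le1: "norm w <= norm (2 * of_real M - w)" if "Re w <= M" for w :: complex
 proof -
	have "M * Re w <= M * M" using that M by (intro mult_left_mono) auto
	then have "(norm w)\<^sup>2 <= (norm (2 * of_real M - w))\<^sup>2"
	 unfolding cmod_power2 by (simp add: power2_eq_square algebra_simps)
	then show ?thesis by (rule power2_le_imp_le) simp
 qed
 have dn: "2 * of_real M - g (u + of_real R * s) ~= 0" if "s \<in> ball 0 1" for s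
	using ReM[OF that] M by (auto simp: complex_eq_iff)
 have ph: "\<phi> holomorphic_on ball 0 1" unfolding \<phi>_def
	by (intro holomorphic_intros holomorphic_on_compose_gen[OF _ g, unfolded o_def] dn) (use inb in auto)
 have p1: "norm (\<phi> s) <= 1" if "s \<in> ball 0 1" for s
	using le1[OF ReM[OF that]] dn[OF that] by (simp add: \<phi>_def norm_divide divide_le_eq)
 define s where "s = (x - u) / of_real R"
 have s: "norm s < 1 / 2" "u + of_real R * s = x" using x R by (auto simp: s_def norm_divide field_simps)
 have ps: "norm (\<phi> s) <= norm s"
 proof (cases "\<exists>c. \<forall>z\<in>ball 0 1. \<phi> z = c")
	case True
	then obtain c where c: "\<forall>z\<in>ball 0 1. \<phi> z = c" by blast
	have "\<phi> 0 = 0" by (simp add: \<phi>_def g0)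
	then have "\<phi> s = 0" using c s by auto
	then show ?thesis by simp
 next
	case False
	have lt: "norm (\<phi> z) < 1" if z: "norm z < 1" for z
	proof (rule ccontr)
	 assume "\<not> norm (\<phi> z) < 1"
	 then have mx: "norm (\<phi> w) <= norm (\<phi> z)" if "w \<in> ball 0 1" for w using p1[OF that] by linarith
	 have "\<phi> constant_on ball 0 1"
		by (rule maximum_modulus_principle[OF ph open_ball _ open_ball subset_refl, of z]) (use z mx in auto)
	 then show False using False by (auto simp: constant_on_def)
	qed
	have "\<phi> 0 = 0" by (simp add: \<phi>_def g0)
	from Schwarz_Lemma(1)[OF ph this lt] show ?thesis using s by auto
 qed
 have sb: "s \<in> ball 0 1" using s by auto
 have "g x = 2 * of_real M * \<phi> s / (1 + \<phi> s)"
 proof -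
	have "2 * of_real M - g x ~= 0" using dn[OF sb] s by simp
	then have "1 + \<phi> s = 2 * of_real M / (2 * of_real M - g x)" "\<phi> s = g x / (2 * of_real M - g x)"
	 using s by (simp_all add: \<phi>_def field_simps)
	then show ?thesis using M \<open>2 * of_real M - g x ~= 0\<close> by (simp only:) (simp add: field_simps)
 qed
 moreover have "1 / 2 <= norm (1 + \<phi> s)"
	using norm_diff_ineq[of 1 "\<phi> s"] ps s by simp
 ultimately have gx: "norm (g x) = 2 * M * norm (\<phi> s) / norm (1 + \<phi> s)" and half: "1 / 2 <= norm (1 + \<phi> s)"
	using M by (simp_all add: norm_divide norm_mult)
 have "0 < norm (1 + \<phi> s)" using half by linarith
 with half have "norm (g x) <= 2 * M * norm (\<phi> s) / (1 / 2)"
	unfolding gx using M by (intro divide_left_mono) auto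
 also have "... <= 2 * M * norm s / (1 / 2)" using ps M by (intro divide_right_mono mult_left_mono) auto
 also have "... = 4 * M * norm (x - u) / R" using R by (simp add: s_def norm_divide)
 finally show ?thesis .
qed

text \<open>Otherwise each factor \<open>(x - a)/(u - a)\<close> of the zeros has modulus at least 1 for large real \<open>x\<close>. The zero-free
cofactor on a disc of radius \<open>R\<close> has logarithm at most \<open>O(sqrt R)\<close>, hence by Borel-Caratheodory it is nearly
constant near \<open>x\<close> as \<open>R\<close> grows. So \<open>F\<close> stays away from 0 along the positive axis.\<close>

theorem order_half_zero_off_negative_axis:
 fixes F :: "complex => complex"
 assumes F: "F holomorphic_on UNIV" and A: "!!z. norm (F z) <= A * exp (B * sqrt (norm z))" and B: "0 <= B"
	and lim: "((%x::real. F (of_real x)) \<longlongrightarrow> 0) at_top"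
	and ne: "F u0 ~= 0" and V: "finite V"
 shows "\<exists>w. F w = 0 & w \<notin> V & \<not> (Im w = 0 & Re w < 0)"
proof (rule ccontr)
 assume "\<not> ?thesis"
 then have zeros: "a \<in> V \<or> (Im a = 0 & Re a < 0)" if "F a = 0" for a using that by blast
 have "\<exists>x>0. F (cplx x) ~= 0"
 proof (rule ccontr)
	assume "\<not> ?thesis"
	then have z: "F (cplx x) = 0" if "0 < x" for x using that by blast
	have "F u0 = 0"
	proof (rule analytic_continuation[OF F, of "of_real ` {0<..}" 1])
	 show "(1::complex) islimpt of_real ` {0<..}"
	 proof (rule islimptI)
		fix T :: "complex set" assume T: "1 \<in> T" "open T"
		then obtain e where e: "0 < e" "ball 1 e \<subseteq> T" by (meson open_contains_ball)
		have "cplx (1 + e / 2) \<in> ball 1 e" using e by (simp add: dist_norm)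
		then show "\<exists>y\<in>of_real ` {0<..}. y \<in> T & y ~= 1" using e
		 by (intro bexI[of _ "of_real (1 + e / 2)"]) (auto simp: complex_eq_iff)
	 qed
	qed (use z in auto)
	then show False using ne by simp
 qed
 then obtain u where u: "0 < u" "F (cplx u) ~= 0" by blast
 let ?u = "cplx u"
 have A0: "0 < A" using A[of ?u] u(2) by (metis exp_gt_zero less_le_trans norm_ge_zero zero_less_mult_pos2 zero_less_norm_iff)
 define m where "m = norm (F ?u)"
 have m: "0 < m" using u by (simp add: m_def)
 have low: "m / 2 <= norm (F (of_real x))" if x: "u <= x" and xV: "!!a. a \<in> V ==> norm (?u - a) <= norm (of_real x - a)" for x
 proof -
	have "((%R. 4 * (\<bar>ln (A / m)\<bar> + 1 + B * sqrt (u + 3 * R)) * (x - u) / R) \<longlongrightarrow> 0) at_top" by real_asymp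
	then have "\<forall>\<^sub>F R in at_top. \<bar>4 * (\<bar>ln (A / m)\<bar> + 1 + B * sqrt (u + 3 * R)) * (x - u) / R\<bar> < 1 / 2"
	 by (auto dest!: tendstoD[where e = "1/2"] simp: dist_real_def)
	with eventually_gt_at_top[of "2 * (x - u)"] eventually_gt_at_top[of 0]
	have "\<forall>\<^sub>F R in at_top. 0 < R & 2 * (x - u) < R & \<bar>4 * (\<bar>ln (A / m)\<bar> + 1 + B * sqrt (u + 3 * R)) * (x - u) / R\<bar> < 1 / 2"
	 by eventually_elim auto
	then obtain R where R: "0 < R" "2 * (x - u) < R" "4 * (\<bar>ln (A / m)\<bar> + 1 + B * sqrt (u + 3 * R)) * (x - u) / R < 1 / 2"
	 using eventually_happens'[OF trivial_limit_at_top_linorder] by (metis (no_types, lifting) abs_less_iff)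
	have Mb: "\<forall>z. norm (z - ?u) = 3 * R --> norm (F z) <= A * exp (B * sqrt (u + 3 * R))"
	proof (intro allI impI)
	 fix z assume that: "norm (z - ?u) = 3 * R"
	 have "norm z <= u + 3 * R" using norm_triangle_ineq[of "z - ?u" ?u] that u by simp
	 then have "B * sqrt (norm z) <= B * sqrt (u + 3 * R)" using B by (intro mult_left_mono) auto
	 then have "A * exp (B * sqrt (norm z)) <= A * exp (B * sqrt (u + 3 * R))" using A0 by (intro mult_left_mono) (simp_all only: exp_le_cancel_iff less_imp_le)
	 then show "norm (F z) <= A * exp (B * sqrt (u + 3 * R))" using A[of z] by linarith
	qed
	obtain as h where h0: "h holomorphic_on UNIV" "\<forall>z. F z = (\<Prod>a\<leftarrow>as. (z - a) / (?u - a)) * h z"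
	 "\<forall>a\<in>set as. F a = 0" "\<forall>z\<in>cball ?u R. h z ~= 0"
	 "\<forall>z\<in>cball ?u (3 * R). norm (h z) <= A * exp (B * sqrt (u + 3 * R))" "h ?u = F ?u"
	 using factor_out_zeros[OF F u(2) R(1) Mb] by (elim exE conjE) (rule that)
	note h = h0(1) h0(2-5)[rule_format] h0(6)
	have hol: "(%z. h z / F ?u) holomorphic_on ball ?u R" by (intro holomorphic_intros holomorphic_on_subset[OF h(1)] u(2)) auto
	have con: "contractible (ball ?u R)" by (intro convex_imp_contractible) simp
	have nz: "h z / F ?u ~= 0" if "z \<in> ball ?u R" for z using h(4)[of z] u(2) that by auto
	from contractible_imp_holomorphic_log[OF hol con nz] obtain L where L: "L holomorphic_on ball ?u R" "!!z. z \<in> ball ?u R ==> h z / F ?u = exp (L z)" by blast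
	define g where "g = (%z. L z - L ?u)"
	have ub: "?u \<in> ball ?u R" using R by simp
	have eL: "exp (L ?u) = 1" using L(2)[OF ub] h(6) u(2) by simp
	have eg: "h z / F ?u = exp (g z)" if "z \<in> ball ?u R" for z
	 using L(2)[OF that] eL by (simp add: g_def exp_diff)
	define M where "M = \<bar>ln (A / m)\<bar> + 1 + B * sqrt (u + 3 * R)"
	have "0 <= B * sqrt (u + 3 * R)" using B u R by simp
	then have M0: "0 < M" unfolding M_def by linarith
	have "norm (g (of_real x)) <= 4 * M * norm (of_real x - ?u) / R"
	proof (rule borel_caratheodory[of g ?u R M])
	 show "g holomorphic_on ball ?u R" unfolding g_def by (intro holomorphic_intros L)
	 show "norm (of_real x - ?u) < R / 2" using R x by (simp flip: of_real_diff)
	 fix z assume z: "z \<in> ball ?u R"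
	 have "exp (Re (g z)) = norm (h z) / m" using eg[OF z] by (metis norm_divide norm_exp_eq_Re m_def)
	 also have "... <= A * exp (B * sqrt (u + 3 * R)) / m" using h(5)[of z] z R m by (intro divide_right_mono) auto
	 also have "... = exp (ln (A / m) + B * sqrt (u + 3 * R))" using A0 m by (simp add: exp_add)
	 finally show "Re (g z) <= M" unfolding M_def exp_le_cancel_iff by linarith
	qed (use R M0 in \<open>auto simp: g_def\<close>)
	also have "norm (of_real x - ?u) = x - u" using x by (simp flip: of_real_diff)
	finally have gx: "norm (g (of_real x)) < 1 / 2" using R(3) unfolding M_def by linarith
	have xb: "of_real x \<in> ball ?u R" using R x by (simp add: dist_norm norm_minus_commute flip: of_real_diff)
	have "1 / 2 <= exp (Re (g (of_real x)))"
	 using exp_ge_add_one_self[of "Re (g (of_real x))"] abs_Re_le_cmod[of "g (of_real x)"] gx by linarith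
	then have "1 / 2 <= norm (h (of_real x)) / m" using eg[OF xb] by (metis norm_divide norm_exp_eq_Re m_def)
	then have hx: "m / 2 <= norm (h (of_real x))" using m by (simp add: field_simps)
	have "1 <= norm (\<Prod>a\<leftarrow>as'. (of_real x - a) / (?u - a))" if "set as' \<subseteq> {a. F a = 0}" for as'
	 using that
	proof (induction as')
	 case (Cons a as')
	 then have Fa: "F a = 0" by simp
	 have "?u ~= a" using Fa u(2) by auto
	 moreover have "norm (?u - a) <= norm (of_real x - a)"
		using zeros[OF Fa]
	 proof
		assume n: "Im a = 0 & Re a < 0"
		then have "a = of_real (Re a)" by (simp add: complex_eq_iff)
		then have "norm (?u - a) = u - Re a" "norm (of_real x - a) = x - Re a"
		 using n u x by (metis abs_of_nonneg diff_ge_0_iff_ge less_imp_le norm_of_real of_real_diff order_trans)+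
		then show ?thesis using x by simp
	 qed (rule xV)
	 ultimately have "1 <= norm ((of_real x - a) / (?u - a))" by (simp add: norm_divide)
	 then have "1 * 1 <= norm ((of_real x - a) / (?u - a)) * norm (\<Prod>a\<leftarrow>as'. (of_real x - a) / (?u - a))"
		using Cons by (intro mult_mono) auto
	 then show ?case by (simp only: list.map prod_list.Cons norm_mult mult_1)
	qed simp
	then have "1 <= norm (\<Prod>a\<leftarrow>as. (of_real x - a) / (?u - a))" using h(3) by auto
	then have "1 * norm (h (of_real x)) <= norm (F (of_real x))" unfolding h(2)[of "of_real x"] norm_mult by (intro mult_right_mono) auto
	then show ?thesis using hx by simp
 qed
 have "\<forall>\<^sub>F x in at_top. u <= x & (\<forall>a\<in>V. norm (?u - a) <= norm (of_real x - a))"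
 proof (intro eventually_conj eventually_ge_at_top eventually_ball_finite V ballI)
	fix a
	have na: "norm (?u - a) <= norm (of_real x - a)" if "norm (?u - a) + norm a <= x" for x
	 using norm_triangle_ineq2[of "cplx x" a] that by (auto simp: abs_le_iff)
	show "\<forall>\<^sub>F x in at_top. norm (?u - a) <= norm (of_real x - a)"
	 by (rule eventually_mono[OF eventually_ge_at_top na])
 qed
 then have "\<forall>\<^sub>F x in at_top. m / 2 <= norm (F (cplx x))" by eventually_elim (use low in blast)
 moreover have "\<forall>\<^sub>F x in at_top. norm (F (cplx x)) < m / 2"
	using tendstoD[OF lim, of "m / 2"] m by (simp add: dist_norm)
 ultimately have "\<forall>\<^sub>F x::real in at_top. False" by eventually_elim auto
 then show False by simp
qed

section \<open>Cosine transforms of integrable functions\<close>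

lemma riemann_lebesgue_limit:
 fixes f :: "real => complex" and s :: "nat => real => complex"
 assumes f: "f \<in> borel_measurable lborel" and s: "!!k. s k \<in> borel_measurable lborel"
	and lim: "!!t. (%k. s k t) \<longlonglongrightarrow> f t" and w: "integrable lborel w" and b: "!!k t. norm (s k t) <= w t"
	and rl: "!!k. ((%z::real. LBINT t. s k t * of_real (cos (z * t))) \<longlongrightarrow> 0) at_top"
 shows "((%z::real. LBINT t. f t * of_real (cos (z * t))) \<longlongrightarrow> 0) at_top"
proof (rule tendstoI)
 fix e :: real assume e: "0 < e"
 have fb: "norm (f t) <= w t" for t
	by (rule tendsto_upperbound[OF tendsto_norm[OF lim]]) (auto simp: b)
 have fi: "integrable lborel f" by (rule bi_integrable_bound[OF w f]) (auto intro!: AE_I2 order_trans[OF fb])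
 have si: "integrable lborel (s k)" for k by (rule bi_integrable_bound[OF w s]) (auto intro!: AE_I2 order_trans[OF b])
 have "(%k. LBINT t. norm (s k t - f t)) \<longlonglongrightarrow> integral\<^sup>L lborel (%t::real. 0::real)"
 proof (rule bi_integral_dominated_convergence[where s = "%k t. norm (s k t - f t)" and f = "%t. 0" and M = lborel and w = "%t. 2 * w t"])
	show "AE t in lborel. (%k. norm (s k t - f t)) \<longlonglongrightarrow> 0"
	 using lim by (intro AE_I2) (simp add: tendsto_norm_zero_iff LIM_zero_iff)
	show "AE t in lborel. norm (norm (s k t - f t)) <= 2 * w t" for k
	proof (rule AE_I2)
	 show "norm (norm (s k t - f t)) <= 2 * w t" for t using norm_triangle_ineq4[of "s k t" "f t"] b[of k t] fb[of t] by simp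
	qed
 qed (use f s w in auto)
 then have "\<forall>\<^sub>F k in sequentially. (LBINT t. norm (s k t - f t)) < e / 2"
	using e by (auto dest!: order_tendstoD(2)[where a = "e / 2"])
 then obtain k where k: "(LBINT t. norm (s k t - f t)) < e / 2" by (auto simp: eventually_sequentially)
 have mi: "integrable lborel (%t. h t * cplx (cos (z * t)))" if "integrable lborel h" for h z
	by (rule bi_integrable_bound[OF that]) (use that in \<open>auto intro!: AE_I2 simp: norm_mult mult_right_le_one_le\<close>)
 have "\<forall>\<^sub>F z in at_top. norm (LBINT t. s k t * of_real (cos (z * t))) < e / 2"
	using tendstoD[OF rl[of k], of "e / 2"] e by (simp add: dist_norm)
 then show "\<forall>\<^sub>F z in at_top. dist (LBINT t. f t * of_real (cos (z * t))) 0 < e"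
 proof eventually_elim
	case (elim z)
	have "(LBINT t. f t * of_real (cos (z * t))) = (LBINT t. s k t * of_real (cos (z * t))) - (LBINT t. (s k t - f t) * of_real (cos (z * t)))"
	 using mi[OF fi, of z] mi[OF si, of k z] by (simp add: left_diff_distrib)
	also have "norm ... <= norm (LBINT t. s k t * of_real (cos (z * t))) + norm (LBINT t. (s k t - f t) * of_real (cos (z * t)))"
	 by (rule norm_triangle_ineq4)
	also have "norm (LBINT t. (s k t - f t) * of_real (cos (z * t))) <= (LBINT t. norm (s k t - f t))"
	 by (intro integral_norm_bound[THEN order_trans] integral_mono' integrable_norm bi_integrable_diff si fi)
		 (auto simp: norm_mult mult_right_le_one_le)
	finally show ?case using elim k by simp
 qed
qed

text \<open>Dynkin's lemma reduces arbitrary Borel sets to half-lines.\<close>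

lemma riemann_lebesgue_set:
 fixes A :: "real set"
 assumes A: "A \<in> sets borel"
 shows "((%z::real. LBINT t. cplx (indicator (A \<inter> {0..1}) t) * of_real (cos (z * t))) \<longlongrightarrow> 0) at_top"
proof -
 let ?P = "%A. ((%z::real. LBINT t. cplx (indicator (A \<inter> {0..1}) t) * of_real (cos (z * t))) \<longlongrightarrow> 0) at_top"
 have atm: "?P {..a}" for a :: real
 proof (cases "0 <= a")
	case True
	define b where "b = min a 1"
	have b: "0 <= b" "{..a} \<inter> {0..1} = {0..b}" using True by (auto simp: b_def)
	have iv: "(LBINT t. cplx (indicator {0..b} t) * of_real (cos (z * t))) = of_real (sin (z * b) / z)" if z: "0 < z" for z
	proof -
	 have "(LBINT t. cos (z * t) * indicator {0..b} t) = sin (z * b) / z - sin (z * 0) / z"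
		by (rule integral_FTC_Icc_real[OF b(1)]) (use z in \<open>auto intro!: derivative_eq_intros continuous_intros\<close>)
	 then have "(LBINT t. indicator {0..b} t * cos (z * t)) = sin (z * b) / z" by (simp add: mult.commute)
	 moreover have "(LBINT t. cplx (indicator {0..b} t * cos (z * t))) = of_real (LBINT t. indicator {0..b} t * cos (z * t))"
	 proof (rule integral_of_real, rule bi_integrable_bound)
		show "integrable lborel (indicator {0..b} :: real => real)" by (simp add: emeasure_lborel_Icc_eq)
		show "AE t in lborel. norm (indicator {0..b} t * cos (z * t)) <= norm (indicator {0..b} t :: real)"
		 by (intro AE_I2) (auto simp: indicator_def)
	 qed measurable
	 ultimately show ?thesis by simp
	qed
	have "\<forall>\<^sub>F z in at_top. cplx (sin (z * b) / z) = (LBINT t. cplx (indicator {0..b} t) * of_real (cos (z * t)))"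
	 by (rule eventually_mono[OF eventually_gt_at_top[of 0]]) (simp only: iv)
	moreover have "((%z::real. cplx (sin (z * b) / z)) \<longlongrightarrow> 0) at_top"
	proof (rule Lim_null_comparison)
	 have n: "norm (cplx (sin (z * b) / z)) <= 1 / z" if "0 < z" for z
		using that by (simp add: norm_divide abs_sin_le_one divide_right_mono flip: of_real_divide)
	 show "\<forall>\<^sub>F z in at_top. norm (cplx (sin (z * b) / z)) <= 1 / z"
		by (rule eventually_mono[OF eventually_gt_at_top n])
	 show "((%z::real. 1 / z) \<longlongrightarrow> 0) at_top" by real_asymp
	qed
	ultimately show ?thesis unfolding b(2) by (rule Lim_transform_eventually[rotated])
 next
	case False
	then have "{..a} \<inter> {0..1} = {}" by auto
	then show ?thesis by simp
 qed
 have ii: "integrable lborel (%t. cplx (indicator (B \<inter> {0..1}) t) * of_real (cos (z * t)))" if "B \<in> sets borel" for B :: "real set" and z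
 proof (rule bi_integrable_bound)
	show "integrable lborel (indicator {0..1::real} :: real => real)" by simp
	show "AE t in lborel. norm (cplx (indicator (B \<inter> {0..1}) t) * of_real (cos (z * t))) <= norm (indicator {0..1::real} t :: real)"
	 by (intro AE_I2) (auto simp: norm_mult indicator_def)
 qed (use that in measurable)
 have "Int_stable (range (%a::real. {..a}))" by (auto simp: Int_stable_def)
 moreover have "range (%a::real. {..a}) \<subseteq> Pow UNIV" by simp
 moreover have "A \<in> sigma_sets UNIV (range (%a::real. {..a}))" using A unfolding borel_eq_atMost by simp
 ultimately show ?thesis
 proof (induction rule: sigma_sets_induct_disjoint)
	case (basic A)
	then show ?case using atm by auto
 next
	case (compl A)
	then have m: "A \<in> sets borel" by (simp add: borel_eq_atMost)
	have "(LBINT t. cplx (indicator ((UNIV - A) \<inter> {0..1}) t) * of_real (cos (z * t))) =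
		(LBINT t. cplx (indicator ({..1} \<inter> {0..1}) t) * of_real (cos (z * t))) - (LBINT t. cplx (indicator (A \<inter> {0..1}) t) * of_real (cos (z * t)))" for z
	 by (subst bi_integral_diff[symmetric, OF ii ii[OF m]]) (auto intro!: bi_integral_cong simp: indicator_def)
	then show ?case using tendsto_diff[OF atm[of 1] compl(2)] by simp
 next
	case (union A)
	have m: "A i \<in> sets borel" for i using union(2) by (auto simp: borel_eq_atMost)
	show ?case
	proof (rule riemann_lebesgue_limit[where s = "%k t. \<Sum>i<k. cplx (indicator (A i \<inter> {0..1}) t)" and w = "indicator {0..1}"])
	 have eq: "(\<Sum>i<k. cplx (indicator (A i \<inter> {0..1}) t)) = of_real (indicator ((\<Union>i<k. A i) \<inter> {0..1}) t)" for k t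
	 proof -
		have d: "disjoint_family_on (%i. A i \<inter> {0..1}) {..<k}" using union(1) by (auto simp: disjoint_family_on_def)
		have "(\<Sum>i<k. indicat_real (A i \<inter> {0..1}) t) = indicator (\<Union>i<k. A i \<inter> {0..1}) t"
		 by (rule indicator_UN_disjoint[OF _ d, symmetric]) simp
		moreover have "(\<Union>i<k. A i \<inter> {0..1}) = (\<Union>i<k. A i) \<inter> {0..1}" by auto
		ultimately show ?thesis by (metis of_real_sum)
	 qed
	 show "norm (\<Sum>i<k. cplx (indicator (A i \<inter> {0..1}) t)) <= indicator {0..1} t" for k t
		unfolding eq by (auto simp: indicator_def)
	 show "(%k. \<Sum>i<k. cplx (indicator (A i \<inter> {0..1}) t)) \<longlonglongrightarrow> of_real (indicator ((\<Union>i. A i) \<inter> {0..1}) t)" for t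
	 proof (rule tendsto_eventually)
		show "\<forall>\<^sub>F k in sequentially. (\<Sum>i<k. cplx (indicator (A i \<inter> {0..1}) t)) = of_real (indicator ((\<Union>i. A i) \<inter> {0..1}) t)"
		proof (cases "\<exists>i. t \<in> A i")
		 case True
		 then obtain i where "t \<in> A i" by blast
		 then show ?thesis unfolding eq eventually_sequentially by (intro exI[of _ "Suc i"]) (auto simp: indicator_def)
		qed (auto simp: eq indicator_def)
	 qed
	 have "(%z::real. LBINT t. (\<Sum>i<k. cplx (indicator (A i \<inter> {0..1}) t)) * of_real (cos (z * t))) =
		 (%z. \<Sum>i<k. LBINT t. cplx (indicator (A i \<inter> {0..1}) t) * of_real (cos (z * t)))" for k
		by (subst bi_integral_sum[symmetric, OF ii[OF m]]) (simp add: sum_distrib_right)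
	 then show "((%z::real. LBINT t. (\<Sum>i<k. cplx (indicator (A i \<inter> {0..1}) t)) * of_real (cos (z * t))) \<longlongrightarrow> 0) at_top" for k
		using union(3) by (auto intro!: tendsto_null_sum)
	 note m[measurable]
	 show "(%t. cplx (indicator ((\<Union>i. A i) \<inter> {0..1}) t)) \<in> borel_measurable lborel" by measurable
	 show "(%t. \<Sum>i<k. cplx (indicator (A i \<inter> {0..1}) t)) \<in> borel_measurable lborel" for k by measurable
	 show "integrable lborel (indicator {0..1} :: real => real)" by simp
	qed
 qed simp
qed

lemma riemann_lebesgue:
 fixes g :: "real => complex"
 assumes g: "integrable lborel g" and g0: "!!t. t \<notin> {0<..<1} ==> g t = 0"
 shows "((%z::real. LBINT t. g t * cos (2 * of_real z * of_real t)) \<longlongrightarrow> 0) at_top"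
proof -
 let ?P = "%f. ((%z::real. LBINT t. (indicator {0..1} t *\<^sub>R f t) * cplx (cos (z * t))) \<longlongrightarrow> 0) at_top"
 have mi: "integrable lborel (%t. indicator {0..1} t *\<^sub>R h t * cplx (cos (z * t)))" if "integrable lborel h" for h z
	by (rule bi_integrable_bound[OF that])
	  (use that in \<open>auto intro!: AE_I2 simp: norm_mult indicator_def mult_right_le_one_le\<close>)
 have "?P g"
	using g
 proof (induction rule: integrable_induct)
	case (base A c)
	have "(%z. LBINT t. (indicator {0..1} t *\<^sub>R (indicator A t *\<^sub>R c)) * cplx (cos (z * t))) =
	 (%z. c * (LBINT t. cplx (indicator (A \<inter> {0..1}) t) * of_real (cos (z * t))))"
	 by (subst integral_mult_right_zero[symmetric], intro ext bi_integral_cong refl) (auto simp: indicator_def)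
	then show ?case using tendsto_mult_right_zero[OF riemann_lebesgue_set[of A], of c] base by simp
 next
	case (add f g)
	have "(LBINT t. (indicator {0..1} t *\<^sub>R (f t + g t)) * cplx (cos (z * t))) =
	  (LBINT t. (indicator {0..1} t *\<^sub>R f t) * cplx (cos (z * t))) + (LBINT t. (indicator {0..1} t *\<^sub>R g t) * cplx (cos (z * t)))" for z
	 by (subst bi_integral_add[symmetric, OF mi[OF add(1)] mi[OF add(2)]]) (simp add: scaleR_add_right distrib_right)
	then show ?case using tendsto_add[OF add(3,4)] by simp
 next
	case (lim f s)
	show ?case
	proof (rule riemann_lebesgue_limit[where s = "%k t. indicator {0..1} t *\<^sub>R s k t" and w = "%t. 2 * norm (f t)"])
	 show "norm (indicator {0..1} t *\<^sub>R s k t) <= 2 * norm (f t)" for k t using lim(3)[of t k] by (auto simp: indicator_def)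
	 show "(%k. indicator {0..1} t *\<^sub>R s k t) \<longlonglongrightarrow> indicator {0..1} t *\<^sub>R f t" for t
		using lim(2)[of t] by (intro tendsto_intros) simp
	qed (use lim in auto)
 qed
 moreover have "(indicator {0..1} t *\<^sub>R g t) = g t" for t using g0[of t] by (cases "t \<in> {0<..<1}") (auto simp: indicator_def)
 ultimately have r: "((%z::real. LBINT t. g t * cplx (cos (z * t))) \<longlongrightarrow> 0) at_top" by (simp only:)
 have "filterlim (%z::real. 2 * z) at_top at_top" by real_asymp
 from filterlim_compose[OF r this]
 have r2: "((%z::real. LBINT t. g t * cplx (cos (2 * z * t))) \<longlongrightarrow> 0) at_top" .
 have e: "cplx (cos (2 * z * t)) = cos (2 * of_real z * of_real t)" for z t
 proof -
	have "2 * cplx z * of_real t = of_real (2 * z * t)" by simp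
	then show ?thesis by (simp only: cos_of_real)
 qed
 show ?thesis using r2 by (simp only: e)
qed

lemma cos_even_series: "(%n. (- 1) ^ n / fact (2 * n) * z ^ (2 * n)) sums cos (z :: complex)"
proof -
 have "(%n. \<Sum>k = n * 2..<n * 2 + 2. cos_coeff k *\<^sub>R z ^ k) sums cos z"
	by (rule sums_group) (use cos_converges[of z] in auto)
 then show ?thesis by (simp add: cos_coeff_def scaleR_conv_of_real mult.commute)
qed

lemma cos_transform_series:
 fixes g :: "real => complex"
 assumes g: "integrable lborel g" and g0: "!!t. t \<notin> {0<..<1} ==> g t = 0"
 shows "integrable lborel (%t. g t * of_real (t ^ (2 * n)))"
	"(%n. (- 4) ^ n / fact (2 * n) * (LBINT t. g t * of_real (t ^ (2 * n))) * (z\<^sup>2) ^ n) sums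
	  (LBINT t. g t * cos (2 * z * of_real t))"
proof -
 have gm: "g \<in> borel_measurable borel" using g by simp
 have b1: "norm (g t * of_real (t ^ (2 * n))) <= norm (g t)" for t n
 proof (cases "t \<in> {0<..<1}")
	case True
	then have "norm (cplx (t ^ (2 * n))) <= 1" unfolding norm_of_real by (simp add: power_le_one)
	then show ?thesis unfolding norm_mult[of "g t"] by (intro mult_right_le_one_le) auto
 qed (use g0[of t] in simp)
 show i: "integrable lborel (%t. g t * of_real (t ^ (2 * n)))" for n
	by (rule bi_integrable_bound[OF g]) (use gm b1 in \<open>auto intro: AE_I2\<close>)
 define b where "b = (%n. (- 4) ^ n / fact (2 * n) * (z\<^sup>2) ^ n)"
 have be: "b n = (- 1) ^ n / fact (2 * n) * (2 * z) ^ (2 * n)" for n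
 proof -
	have e: "- 4 * z\<^sup>2 = - 1 * (2 * z)\<^sup>2" by (simp add: power2_eq_square)
	have "(- 4) ^ n * (z\<^sup>2) ^ n = (- 1) ^ n * (2 * z) ^ (2 * n)"
	 unfolding power_mult[of "2 * z"] by (simp only: power_mult_distrib[symmetric] e)
	then show ?thesis by (simp add: b_def)
 qed
 have sb: "summable (%n. norm (b n))"
 proof (rule summable_comparison_test')
	show "summable (%n. inverse (fact n) *\<^sub>R (4 * (norm z)\<^sup>2) ^ n)" by (rule summable_exp_generic)
	have "norm (b n) <= inverse (fact n) *\<^sub>R (4 * (norm z)\<^sup>2) ^ n" for n
	proof -
	 have "norm (b n) = (4 * (norm z)\<^sup>2) ^ n / fact (2 * n)"
		by (simp add: b_def norm_mult norm_divide norm_power power_mult_distrib)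
	 also have "... <= (4 * (norm z)\<^sup>2) ^ n / fact n" by (intro divide_left_mono) (auto intro: fact_mono)
	 finally show ?thesis by (simp add: divide_inverse mult.commute)
	qed
	then show "!!n. 0 <= n ==> norm (norm (b n)) <= inverse (fact n) *\<^sub>R (4 * (norm z)\<^sup>2) ^ n" by simp
 qed
 let ?f = "%n t. b n * (g t * of_real (t ^ (2 * n)))"
 have fb: "norm (?f n t) <= norm (b n) * norm (g t)" for n t
	using mult_left_mono[OF b1[of t n], of "norm (b n)"] by (simp only: norm_mult) simp
 have A: "(%n. LBINT t. ?f n t) sums (LBINT t. (\<Sum>n. ?f n t))"
 proof (rule sums_integral)
	show "integrable lborel (?f n)" for n by (intro integrable_mult_right i)
	show "AE t in lborel. summable (%n. norm (?f n t))"
	 by (intro AE_I2 summable_comparison_test'[OF summable_mult2[OF sb]]) (use fb in auto)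
	show "summable (%n. LBINT t. norm (?f n t))"
	proof (rule summable_comparison_test'[OF summable_mult2[OF sb, of "LBINT t. norm (g t)"]])
	 fix n
	 have "(LBINT t. norm (?f n t)) <= (LBINT t. norm (b n) * norm (g t))"
		by (intro integral_mono' integrable_mult_right integrable_norm g fb) auto
	 then show "norm (LBINT t. norm (?f n t)) <= norm (b n) * (LBINT t. norm (g t))"
		by (simp add: bi_integral_nonneg)
	qed
 qed
 have S: "(\<Sum>n. ?f n t) = g t * cos (2 * z * of_real t)" for t
 proof -
	have "?f n t = g t * ((- 1) ^ n / fact (2 * n) * (2 * z * of_real t) ^ (2 * n))" for n
	 unfolding be by (simp add: power_mult_distrib)
	then show ?thesis using sums_mult[OF cos_even_series[of "2 * z * of_real t"], of "g t"] by (simp add: sums_iff)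
 qed
 have eq: "b n * m = (- 4) ^ n / fact (2 * n) * m * (z\<^sup>2) ^ n" for n m by (simp add: b_def)
 have "(%n. b n * (LBINT t. g t * of_real (t ^ (2 * n)))) sums (LBINT t. g t * cos (2 * z * of_real t))"
	using A by (simp only: S integral_mult_right_zero)
 then show "(%n. (- 4) ^ n / fact (2 * n) * (LBINT t. g t * of_real (t ^ (2 * n))) * (z\<^sup>2) ^ n) sums
	  (LBINT t. g t * cos (2 * z * of_real t))"
	by (simp only: eq)
qed

text \<open>Orders of vanishing at 0 are read off from the Taylor coefficients, which for a cosine transform in \<open>z^2\<close> are
the even moments of the density.\<close>

lemma power_series_quotient_limit:
 fixes a :: "nat => complex"
 assumes s: "!!\<mu>. (%k. a k * \<mu> ^ k) sums H \<mu>" and a0: "!!k. k < n ==> a k = 0"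
 shows "\<mu> ~= 0 ==> (%k. a (k + n) * \<mu> ^ k) sums (H \<mu> / \<mu> ^ n)" "((%\<mu>. H \<mu> / \<mu> ^ n) \<longlongrightarrow> a n) (at 0)"
proof -
 show t: "(%k. a (k + n) * \<mu> ^ k) sums (H \<mu> / \<mu> ^ n)" if "\<mu> ~= 0" for \<mu>
 proof -
	have "(%k. a (k + n) * \<mu> ^ (k + n)) sums (H \<mu> - (\<Sum>k<n. a k * \<mu> ^ k))"
	 using s[of \<mu>] by (subst sums_iff_shift) simp
	then have "(%k. a (k + n) * \<mu> ^ (k + n)) sums H \<mu>" using a0 by simp
	from sums_divide[OF this, of "\<mu> ^ n"] show ?thesis using that by (simp add: power_add)
 qed
 show "((%\<mu>. H \<mu> / \<mu> ^ n) \<longlongrightarrow> a n) (at 0)"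
	using powser_limit_0_strong[of 1 "%k. a (k + n)" "%\<mu>. H \<mu> / \<mu> ^ n"] t by simp
qed

lemma power_series_vanishing:
 fixes a :: "nat => complex"
 assumes s: "!!\<mu>. (%k. a k * \<mu> ^ k) sums H \<mu>" and HJ: "!!\<mu>. \<mu> ~= 0 ==> H \<mu> = \<mu> ^ m * J \<mu>"
	and J: "(J \<longlongrightarrow> L) (at 0)"
 shows "k < m ==> a k = 0"
proof (induction k rule: less_induct)
 case (less k)
 have 1: "((%\<mu>. H \<mu> / \<mu> ^ k) \<longlongrightarrow> a k) (at 0)"
	by (rule power_series_quotient_limit(2)[OF s]) (use less in auto)
 have 2: "((%\<mu>. \<mu> ^ (m - k) * J \<mu>) \<longlongrightarrow> 0 ^ (m - k) * L) (at 0)" by (intro tendsto_intros J)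
 have "\<forall>\<^sub>F \<mu> in at 0. \<mu> ^ (m - k) * J \<mu> = H \<mu> / \<mu> ^ k"
	using less(2) by (auto simp: eventually_at_filter HJ power_diff)
 from tendsto_unique[OF at_neq_bot 1 Lim_transform_eventually[OF 2 this]] have "a k = 0 ^ (m - k) * L" .
 then show ?case using less(2) by simp
qed

lemma power_series_entire:
 assumes "!!\<mu>::complex. (%k. a k * \<mu> ^ k) sums H \<mu>"
 shows "H holomorphic_on UNIV"
proof -
 have "H holomorphic_on ball 0 r" for r
	by (rule power_series_holomorphic[where a = a]) (use assms in simp)
 then have "H holomorphic_on (\<Union>r. ball 0 r)" by (intro holomorphic_on_UN_open) auto
 moreover have "(\<Union>r. ball (0::complex) r) = UNIV"
 proof (intro equalityI subsetI UNIV_I)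
	fix x :: complex
	show "x \<in> (\<Union>r. ball 0 r)" by (rule UN_I[of "norm x + 1"]) simp_all
 qed
 ultimately show ?thesis by simp
qed

text \<open>The sine integral is minus half the derivative of the cosine transform; a difference quotient along a real
sequence suffices.\<close>

lemma cos_transform_double_zero:
 fixes g :: "real => complex"
 assumes g: "integrable lborel g" and g0: "!!t. t \<notin> {0<..<1} ==> g t = 0"
	and z0: "(LBINT t. g t * cos (2 * z * of_real t)) = 0"
	and lim: "(%n. (LBINT t. g t * cos (2 * (z + of_real (inverse (real (Suc n)))) * of_real t)) / of_real (inverse (real (Suc n)))) \<longlonglongrightarrow> 0"
 shows "(LBINT t. g t * (of_real t * sin (2 * z * of_real t))) = 0"
proof -
 have gm[measurable]: "g \<in> borel_measurable borel" using g by simp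
 define h where "h = (%n. inverse (real (Suc n)))"
 have h: "0 < h n" "h n <= 1" for n by (auto simp: h_def field_simps)
 define s where "s = (%n t. g t * ((cos (2 * (z + of_real (h n)) * of_real t) - cos (2 * z * of_real t)) / of_real (h n)))"
 have cb: "norm (g t * cos (2 * w * of_real t)) <= norm (g t) * exp (2 * \<bar>Im w\<bar>)" for w t
 proof (cases "t \<in> {0<..<1}")
	case True
	then show ?thesis using norm_cos_real_mult_le[of t 1 w] by (simp add: norm_mult mult_left_mono)
 qed (use g0[of t] in simp)
 have ci: "integrable lborel (%t. g t * cos (2 * w * of_real t))" for w
	by (rule bi_integrable_bound[OF integrable_mult_left[OF integrable_norm[OF g], of "exp (2 * \<bar>Im w\<bar>)"]])
	  (use cb[of _ w] in \<open>auto intro!: AE_I2\<close>)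
 have A: "(%n. LBINT t. s n t) \<longlonglongrightarrow> (LBINT t. g t * (- sin (2 * z * of_real t) * (2 * of_real t)))"
 proof (rule integral_dominated_convergence[where w = "%t. norm (g t) * (2 * exp (2 * \<bar>Im z\<bar>))"])
	show "integrable lborel (%t. norm (g t) * (2 * exp (2 * \<bar>Im z\<bar>)))" by (intro integrable_mult_left integrable_norm g)
	have "(%n. s n t) \<longlonglongrightarrow> g t * (- sin (2 * z * of_real t) * (2 * of_real t))" for t
	proof -
	 have "((%w. cos (2 * w * cplx t)) has_field_derivative - sin (2 * z * of_real t) * (2 * of_real t)) (at z)"
		by (auto intro!: derivative_eq_intros)
	 then have D: "((%d. (cos (2 * (z + d) * cplx t) - cos (2 * z * of_real t)) / d) \<longlongrightarrow> - sin (2 * z * of_real t) * (2 * of_real t)) (at 0)"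
		by (rule DERIV_D)
	 have "h \<longlonglongrightarrow> 0" unfolding h_def by (rule LIMSEQ_inverse_real_of_nat)
	 then have "(%n. cplx (h n)) \<longlonglongrightarrow> 0" by (simp add: tendsto_of_real_iff[where c = 0, simplified])
	 then have "filterlim (%n. cplx (h n)) (at 0) sequentially"
		using h(1) by (auto simp: filterlim_at less_imp_neq[symmetric] intro!: always_eventually)
	 from filterlim_compose[OF D this] show ?thesis unfolding s_def by (intro tendsto_mult tendsto_const)
	qed
	then show "AE t in lborel. (%n. s n t) \<longlonglongrightarrow> g t * (- sin (2 * z * of_real t) * (2 * of_real t))" by (rule AE_I2)
	have "norm (s n t) <= norm (g t) * (2 * exp (2 * \<bar>Im z\<bar>))" for n t
	proof (cases "t \<in> {0<..<1}")
	 case True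
	 have "cos (2 * (z + of_real (h n)) * of_real t) - cos (2 * z * of_real t) =
		 2 * sin ((2 * z + of_real (h n)) * of_real t) * sin (- of_real (h n * t))"
	 proof -
		have e1: "(2 * (z + of_real (h n)) * of_real t + 2 * z * of_real t) / 2 = (2 * z + of_real (h n)) * of_real t"
		 and e2: "(2 * z * of_real t - 2 * (z + of_real (h n)) * of_real t) / 2 = - cplx (h n * t)"
		 by (simp_all add: algebra_simps add_divide_distrib)
		show ?thesis unfolding cos_diff_cos e1 e2 ..
	 qed
	 moreover have "norm (sin ((2 * z + of_real (h n)) * cplx t)) <= exp (2 * \<bar>Im z\<bar>)"
	 proof -
		have "norm (sin ((2 * z + of_real (h n)) * cplx t)) <= exp \<bar>Im ((2 * z + of_real (h n)) * cplx t)\<bar>"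
		 by (rule norm_sin_cos_le(1))
		also have "\<bar>Im ((2 * z + of_real (h n)) * cplx t)\<bar> <= 2 * \<bar>Im z\<bar>"
		 using True mult_left_le_one_le[of "\<bar>Im z\<bar>" t] by (simp add: abs_mult mult.commute)
		finally show ?thesis by simp
	 qed
	 moreover have "norm (sin (- cplx (h n * t))) <= h n"
	 proof -
		have "norm (sin (- cplx (h n * t))) = \<bar>sin (h n * t)\<bar>" unfolding sin_minus norm_minus_cancel sin_of_real norm_of_real ..
		also have "... <= \<bar>h n * t\<bar>" by (rule abs_sin_x_le_abs_x)
		also have "... <= h n" using True h[of n] by (simp add: abs_mult mult_right_le_one_le)
		finally show ?thesis .
	 qed
	 ultimately have "norm (cos (2 * (z + of_real (h n)) * of_real t) - cos (2 * z * of_real t)) <= 2 * exp (2 * \<bar>Im z\<bar>) * h n"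
		by (simp only: norm_mult) (intro mult_mono, auto)
	 then have "norm (cos (2 * (z + of_real (h n)) * of_real t) - cos (2 * z * of_real t)) / h n <= 2 * exp (2 * \<bar>Im z\<bar>)"
		using h(1)[of n] by (simp add: divide_le_eq)
	 then show ?thesis unfolding s_def norm_mult[of "g t"] norm_divide norm_of_real using h(1)[of n]
		by (intro mult_left_mono) auto
	qed (use g0[of t] in \<open>simp add: s_def\<close>)
	then show "AE t in lborel. norm (s n t) <= norm (g t) * (2 * exp (2 * \<bar>Im z\<bar>))" for n by (rule AE_I2)
 qed (auto simp: s_def)
 have eq: "(LBINT t. s n t) = (LBINT t. g t * cos (2 * (z + of_real (h n)) * of_real t)) / of_real (h n)" for n
 proof -
	have "(LBINT t. s n t) = (LBINT t. (g t * cos (2 * (z + of_real (h n)) * of_real t) - g t * cos (2 * z * of_real t)) / of_real (h n))"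
	 unfolding s_def by (intro bi_integral_cong refl) (simp add: right_diff_distrib)
	also have "... = ((LBINT t. g t * cos (2 * (z + of_real (h n)) * of_real t)) - (LBINT t. g t * cos (2 * z * of_real t))) / of_real (h n)"
	 by (subst bi_integral_diff[symmetric, OF ci ci]) (rule integral_divide_zero)
	finally show ?thesis using z0 by simp
 qed
 have "(%n. LBINT t. s n t) \<longlonglongrightarrow> 0" using lim unfolding eq h_def .
 from LIMSEQ_unique[OF A this] have "(LBINT t. g t * (- sin (2 * z * of_real t) * (2 * of_real t))) = 0" .
 moreover have "(LBINT t. g t * (- sin (2 * z * of_real t) * (2 * of_real t))) = (LBINT t. (- 2) * (g t * (of_real t * sin (2 * z * of_real t))))"
	by (intro bi_integral_cong refl) simp
 ultimately show ?thesis by (simp only: integral_mult_right_zero) simp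
qed

text \<open>The density is \<open>k(s) = - 2/\<zeta> \<integral> g(t) sin 2\<zeta>(t - s) dt\<close> over \<open>t \<ge> s\<close>, the solution of
\<open>- k''/4 - \<zeta>^2 k = g\<close> that vanishes beyond the support of \<open>g\<close>.\<close>

lemma cos_transform_quotient:
 fixes g :: "real => complex"
 assumes g: "integrable lborel g" and a: "a <= 1" and g0: "!!t. t \<notin> {0<..<a} ==> g t = 0" and \<zeta>: "\<zeta> ~= 0"
 shows "\<exists>k C. k \<in> borel_measurable borel & (\<forall>s. s \<notin> {0<..<a} --> k s = 0) & (\<forall>s. norm (k s) <= C) &
	(\<forall>z. (z\<^sup>2 - \<zeta>\<^sup>2) * (LBINT s. k s * cos (2 * z * of_real s)) =
	  (LBINT t. g t * cos (2 * z * of_real t)) - (LBINT t. g t * cos (2 * \<zeta> * of_real t)))"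
proof -
 have gm[measurable]: "g \<in> borel_measurable borel" using g by simp
 have g0': "g t = 0" if "t \<notin> {0<..<1}" for t using g0[of t] that a by auto
 define u where "u = (%t s. if 0 <= s & s <= t then - 2 / \<zeta> * (g t * sin (2 * \<zeta> * of_real (t - s))) else 0)"
 define c where "c = 2 / norm \<zeta> * exp (2 * \<bar>Im \<zeta>\<bar>)"
 have um[measurable]: "case_prod u \<in> borel_measurable (borel \<Otimes>\<^sub>M borel)" unfolding u_def by measurable
 have sb: "norm (sin (2 * w * cplx t)) <= exp (2 * \<bar>Im w\<bar>)" if "0 <= t" "t <= 1" for w t
 proof -
	have "norm (sin (2 * w * cplx t)) <= exp \<bar>Im (2 * w * cplx t)\<bar>" by (rule norm_sin_cos_le(1))
	also have "... <= exp (2 * \<bar>Im w\<bar>)" using that by (simp add: abs_mult mult_right_le_one_le)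
	finally show ?thesis .
 qed
 have ub: "norm (u t s) <= c * norm (g t)" for t s
 proof (cases "0 <= s & s <= t & t \<in> {0<..<1}")
	case True
	have "norm (u t s) = 2 / norm \<zeta> * (norm (g t) * norm (sin (2 * \<zeta> * of_real (t - s))))"
	 using True by (simp add: u_def norm_mult norm_divide del: of_real_diff)
	also have "... <= 2 / norm \<zeta> * (norm (g t) * exp (2 * \<bar>Im \<zeta>\<bar>))"
	 using True by (intro mult_left_mono sb) auto
	finally show ?thesis by (simp add: c_def mult_ac)
 next
	case False
	then show ?thesis using g0'[of t] by (cases "0 <= s & s <= t") (auto simp: u_def c_def)
 qed
 define k where "k = (%s. indicator {0<..<a} s *\<^sub>R (LBINT t. u t s))"
 have km: "k \<in> borel_measurable borel" unfolding k_def by measurable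
 have ui: "integrable lborel (%t. u t s)" for s
	by (rule bi_integrable_bound[OF integrable_mult_right[OF integrable_norm[OF g], of c]])
	  (auto intro!: AE_I2 order_trans[OF ub])
 have kb: "norm (k s) <= c * (LBINT t. norm (g t))" for s
 proof -
	have c0: "0 <= c" by (simp add: c_def)
	have "norm (k s) <= norm (LBINT t. u t s)" by (auto simp: k_def indicator_def)
	also have "... <= (LBINT t. norm (u t s))" by (rule integral_norm_bound)
	also have "... <= (LBINT t. c * norm (g t))" using c0 by (intro integral_mono' integrable_mult_right integrable_norm g ub) auto
	finally show ?thesis by simp
 qed
 have tr: "(z\<^sup>2 - \<zeta>\<^sup>2) * (LBINT s. k s * cos (2 * z * of_real s)) =
	  (LBINT t. g t * cos (2 * z * of_real t)) - (LBINT t. g t * cos (2 * \<zeta> * of_real t))" for z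
 proof -
	have cb: "norm (g t * cos (2 * w * of_real t)) <= norm (g t) * exp (2 * \<bar>Im w\<bar>)" for w t
	proof (cases "t \<in> {0<..<1}")
	 case True
	 then show ?thesis using norm_cos_real_mult_le[of t 1 w] by (simp add: norm_mult mult_left_mono)
	qed (use g0'[of t] in simp)
	have ci: "integrable lborel (%t. g t * cos (2 * w * of_real t))" for w
	 by (rule bi_integrable_bound[OF integrable_mult_left[OF integrable_norm[OF g], of "exp (2 * \<bar>Im w\<bar>)"]])
		 (use cb[of _ w] in \<open>auto intro!: AE_I2\<close>)
	define F where "F = (%t s. u t s * cos (2 * z * of_real s))"
	have Fi: "integrable (lborel \<Otimes>\<^sub>M lborel) (case_prod F)"
	proof (rule bi_integrable_bound)
	 have "integrable (lborel \<Otimes>\<^sub>M lborel) (%(x, t). indicator {0<..<1} x * norm (g x) * (indicator {0..x} t * (1::real)))"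
	 proof (rule triangle_integrable)
		show "integrable lborel (%t. indicator {0..x} t * (1::real))" if "0 < x" for x :: real
		 using that by (simp add: emeasure_lborel_Icc_eq)
		have "\<bar>indicator {0<..<1} x * \<bar>norm (g x)\<bar> * (LBINT t. indicator {0..x} t * \<bar>1::real\<bar>)\<bar> <= norm (g x)" for x
		 by (cases "x \<in> {0<..<1}") (auto simp: abs_mult mult_right_le_one_le)
		then show "integrable lborel (%x. indicator {0<..<1} x * \<bar>norm (g x)\<bar> * (LBINT t. indicator {0..x} t * \<bar>1::real\<bar>))"
		 by (intro bi_integrable_bound[OF integrable_norm[OF g]]) (auto intro!: AE_I2 simp: indicator_def emeasure_lborel_Icc_eq measurable_If)
	 qed simp_all
	 then show "integrable (lborel \<Otimes>\<^sub>M lborel) (%p. (case p of (x, t) => indicator {0<..<1} x * norm (g x) * (indicator {0..x} t * (1::real))) * (c * exp (2 * \<bar>Im z\<bar>)))"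
		by (rule integrable_mult_left)
	 show "case_prod F \<in> borel_measurable (lborel \<Otimes>\<^sub>M lborel)" unfolding F_def by measurable
	 have "norm (F t s) <= norm (indicator {0<..<1} t * norm (g t) * (indicator {0..t} s * (1::real)) * (c * exp (2 * \<bar>Im z\<bar>)))" for t s
	 proof (cases "0 <= s & s <= t & t \<in> {0<..<1}")
		case True
		have "norm (F t s) <= (c * norm (g t)) * exp (2 * 1 * \<bar>Im z\<bar>)"
		 unfolding F_def norm_mult using True by (intro mult_mono ub norm_cos_real_mult_le) (auto simp: c_def)
		then show ?thesis using True by (simp add: c_def abs_mult mult_ac)
	 next
		case False
		then have "F t s = 0" using g0'[of t] by (cases "0 <= s & s <= t") (auto simp: u_def F_def)
		then show ?thesis by simp
	 qed
	 then show "AE p in lborel \<Otimes>\<^sub>M lborel. norm (case_prod F p) <= norm ((case p of (x, t) => indicator {0<..<1} x * norm (g x) * (indicator {0..x} t * (1::real))) * (c * exp (2 * \<bar>Im z\<bar>)))"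
		by (intro AE_I2) (simp add: case_prod_unfold)
	qed
	have inner: "(z\<^sup>2 - \<zeta>\<^sup>2) * (LBINT s. F t s) = g t * cos (2 * z * of_real t) - g t * cos (2 * \<zeta> * of_real t)" for t
	proof (cases "t \<in> {0<..<1}")
	 case True
	 then have t: "0 <= t" by auto
	 let ?\<Phi> = "%s. \<zeta> * cos (2 * \<zeta> * (of_real t - of_real s)) * cos (2 * z * of_real s) - z * sin (2 * \<zeta> * (of_real t - of_real s)) * sin (2 * z * of_real s)"
	 let ?\<phi> = "%s. 2 * (\<zeta>\<^sup>2 - z\<^sup>2) * (sin (2 * \<zeta> * (of_real t - of_real s)) * cos (2 * z * of_real s))"
	 have "(LBINT s. indicator {0..t} s *\<^sub>R ?\<phi> s) = ?\<Phi> t - ?\<Phi> 0"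
	 proof (rule integral_FTC_Icc[OF t])
		fix s
		have "((%w. \<zeta> * cos (2 * \<zeta> * (of_real t - w)) * cos (2 * z * w) - z * sin (2 * \<zeta> * (of_real t - w)) * sin (2 * z * w))
		  has_field_derivative ?\<phi> s) (at (cplx s))"
		 by (auto intro!: derivative_eq_intros simp: power2_eq_square algebra_simps)
		from field_vector_diff_chain_at[OF has_vector_derivative_of_real[OF DERIV_ident] this]
		show "(?\<Phi> has_vector_derivative ?\<phi> s) (at s within {0..t})"
		 by (auto simp: o_def intro: has_vector_derivative_at_within)
	 qed (intro continuous_intros)
	 moreover have "(LBINT s. indicator {0..t} s *\<^sub>R ?\<phi> s) = (LBINT s. (2 * (\<zeta>\<^sup>2 - z\<^sup>2)) * (indicator {0..t} s *\<^sub>R (sin (2 * \<zeta> * (of_real t - of_real s)) * cos (2 * z * of_real s))))"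
		by (intro bi_integral_cong refl) simp
	 ultimately have A: "2 * (\<zeta>\<^sup>2 - z\<^sup>2) * (LBINT s. indicator {0..t} s *\<^sub>R (sin (2 * \<zeta> * (of_real t - of_real s)) * cos (2 * z * of_real s))) = \<zeta> * (cos (2 * z * of_real t) - cos (2 * \<zeta> * of_real t))"
		by (simp only: integral_mult_right_zero) (simp add: right_diff_distrib)
	 have "(LBINT s. F t s) = (LBINT s. (- 2 / \<zeta> * g t) * (indicator {0..t} s *\<^sub>R (sin (2 * \<zeta> * (of_real t - of_real s)) * cos (2 * z * of_real s))))"
		by (intro bi_integral_cong refl) (auto simp: F_def u_def indicator_def)
	 then have "(LBINT s. F t s) = - 2 / \<zeta> * g t * (LBINT s. indicator {0..t} s *\<^sub>R (sin (2 * \<zeta> * (of_real t - of_real s)) * cos (2 * z * of_real s)))"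
		by (simp only: integral_mult_right_zero)
	 then have "(z\<^sup>2 - \<zeta>\<^sup>2) * (LBINT s. F t s) = g t / \<zeta> * (2 * (\<zeta>\<^sup>2 - z\<^sup>2) * (LBINT s. indicator {0..t} s *\<^sub>R (sin (2 * \<zeta> * (of_real t - of_real s)) * cos (2 * z * of_real s))))"
		by (simp only:) (simp add: divide_inverse algebra_simps)
	 also have "... = g t * cos (2 * z * of_real t) - g t * cos (2 * \<zeta> * of_real t)" unfolding A using \<zeta> by (simp add: right_diff_distrib)
	 finally show ?thesis .
	next
	 case False
	 then have "F t = (%s. 0)" using g0'[of t] by (auto simp: F_def u_def fun_eq_iff)
	 then show ?thesis using g0'[of t] False by simp
	qed
	have "(LBINT s. k s * cos (2 * z * of_real s)) = (LBINT s. LBINT t. F t s)"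
	proof (rule integral_cong_AE)
	 have "k s * cos (2 * z * of_real s) = (LBINT t. F t s)" if "s ~= 0" for s
	 proof (cases "s \<in> {0<..<a}")
		case False
		then have "F t s = 0" for t using g0[of t] that by (cases "0 <= s & s <= t") (auto simp: F_def u_def)
		then show ?thesis using False by (simp add: k_def)
	 qed (simp add: k_def F_def)
	 then show "AE s in lborel. k s * cos (2 * z * of_real s) = (LBINT t. F t s)"
		by (intro AE_mp[OF AE_lborel_singleton[of 0] AE_I2]) simp
	 show "(%s. LBINT t. F t s) \<in> borel_measurable lborel" unfolding F_def by measurable
	qed (use km in measurable)
	also have "... = (LBINT t. LBINT s. F t s)" by (rule lborel_pair.Fubini_integral[OF Fi])
	finally have "(z\<^sup>2 - \<zeta>\<^sup>2) * (LBINT s. k s * cos (2 * z * of_real s)) = (LBINT t. (z\<^sup>2 - \<zeta>\<^sup>2) * (LBINT s. F t s))" by simp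
	also have "... = (LBINT t. g t * cos (2 * z * of_real t) - g t * cos (2 * \<zeta> * of_real t))" by (simp only: inner)
	also have "... = (LBINT t. g t * cos (2 * z * of_real t)) - (LBINT t. g t * cos (2 * \<zeta> * of_real t))"
	 by (rule bi_integral_diff[OF ci ci])
	finally show ?thesis .
 qed
 have ks: "\<forall>s. s \<notin> {0<..<a} --> k s = 0" by (simp add: k_def)
 show ?thesis by (rule exI[of _ k], rule exI[of _ "c * (LBINT t. norm (g t))"]) (use km ks kb tr in blast)
qed

section \<open>Annihilators of the closed system\<close>

lemma sl_solution_cong:
 assumes "!!x. x \<in> {0<..<1} ==> q x = q' x"
 shows "sl_solution l q = sl_solution l q'"
proof -
 have "(x \<in> {0<..<1} --> - f'' x + of_real (l * (l + 1) / x\<^sup>2) * f x + of_real (q x) * f x = lam * f x) =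
	(x \<in> {0<..<1} --> - f'' x + of_real (l * (l + 1) / x\<^sup>2) * f x + of_real (q' x) * f x = lam * f x)" for x and f f'' :: "real => complex" and lam
	using assms[of x] by auto
 then show ?thesis by (intro ext) (simp only: sl_solution_def)
qed

text \<open>The weight \<open>y^(-\<delta>)\<close> lies in the dual space when \<open>\<delta> p/(p-1) = 1/2\<close>.\<close>

lemma Lp_imp_wpot:
 fixes q :: "real => real"
 assumes p: "1 < p" and q: "Lp p 0 1 q"
 defines "q1 \<equiv> %x. if x \<in> {0<..<1} then q x else 0"
 shows "q1 \<in> borel_measurable lebesgue" "integrable lebesgue (%x. \<bar>q1 x\<bar> powr p)" "\<exists>N. wpot ((p - 1) / (2 * p)) N q1"
proof -
 have e: "(%x. indicator {0<..<1} x *\<^sub>R q x) = q1" "(%x. indicator {0<..<1} x *\<^sub>R norm (q x) powr p) = (%x. \<bar>q1 x\<bar> powr p)"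
	by (auto simp: q1_def fun_eq_iff)
 show m: "q1 \<in> borel_measurable lebesgue" and i: "integrable lebesgue (%x. \<bar>q1 x\<bar> powr p)"
	using q unfolding Lp_def set_borel_measurable_def set_integrable_def e by auto
 define \<delta> where "\<delta> = (p - 1) / (2 * p)"
 have \<delta>: "0 < \<delta>" "\<delta> < 1" using p by (auto simp: \<delta>_def field_simps)
 have q1: "\<bar>q1 x\<bar> <= indicator {0..1} x + \<bar>q1 x\<bar> powr p" for x
	using le_scale_powr[of "\<bar>q1 x\<bar>" 1 p] p by (auto simp: q1_def)
 have ind: "integrable lebesgue (indicator {0..1} :: real => real)" by (intro integrable_real_indicator) auto
 have q1i: "integrable lebesgue q1"
	by (rule bi_integrable_bound[OF bi_integrable_add[OF ind i] m])
	  (auto intro!: AE_I2 order_trans[OF q1])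
 have "(%x. indicator {0..1} x *\<^sub>R q1 x) = q1" by (auto simp: q1_def fun_eq_iff indicator_def)
 then have ai: "unit_L1 q1" unfolding set_integrable_def using q1i by simp
 have "(%t. t powr (-1/2)) absolutely_integrable_on {0..1::real}"
	by (intro nonnegative_absolutely_integrable_1 has_integral_integrable[OF has_integral_powr_from_0]) auto
 then have pwi: "integrable lebesgue (%t. indicator {0..1::real} t *\<^sub>R t powr (-1/2))" by (simp only: set_integrable_def)
 have wb: "\<bar>q1 y\<bar> * y powr (- \<delta>) <= indicator {0..1} y *\<^sub>R y powr (-1/2) + \<bar>q1 y\<bar> powr p" for y
 proof (cases "y \<in> {0<..<1}")
	case True
	define c where "c = y powr (- \<delta> / (p - 1))"
	have 1: "c * y powr (- \<delta>) = y powr (-1/2)"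
	proof -
	 have "- \<delta> / (p - 1) + - \<delta> = -1/2" using p by (simp add: \<delta>_def field_simps)
	 then show ?thesis by (simp add: c_def powr_add[symmetric])
	qed
	have 2: "c powr (1 - p) * y powr (- \<delta>) = 1"
	proof -
	 have "- \<delta> / (p - 1) * (1 - p) + - \<delta> = 0" using p by (simp add: field_simps)
	 then show ?thesis using True by (simp add: c_def powr_powr powr_add[symmetric])
	qed
	have "\<bar>q1 y\<bar> * y powr (- \<delta>) <= (c + c powr (1 - p) * \<bar>q1 y\<bar> powr p) * y powr (- \<delta>)"
	 using p True by (intro mult_right_mono le_scale_powr) (auto simp: c_def)
	also have "... = c * y powr (- \<delta>) + (c powr (1 - p) * y powr (- \<delta>)) * \<bar>q1 y\<bar> powr p" by (simp add: algebra_simps)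
	also have "... = y powr (-1/2) + \<bar>q1 y\<bar> powr p" unfolding 1 2 by simp
	finally show ?thesis using True by simp
 qed (auto simp: q1_def indicator_def)
 have "integrable lebesgue (%y. \<bar>q1 y\<bar> * y powr (- \<delta>))"
 proof (rule bi_integrable_bound[OF bi_integrable_add[OF pwi i]])
	have "(%y. y powr (- \<delta>)) \<in> borel_measurable lebesgue" by (intro measurable_completion) simp
	then show "(%y. \<bar>q1 y\<bar> * y powr (- \<delta>)) \<in> borel_measurable lebesgue" using m by (intro borel_measurable_times) auto
	show "AE y in lebesgue. norm (\<bar>q1 y\<bar> * y powr (- \<delta>)) <= norm (indicator {0..1} y *\<^sub>R y powr (-1/2) + \<bar>q1 y\<bar> powr p)"
	 using wb by (intro AE_I2) (auto simp: abs_mult intro: order_trans[OF _ abs_ge_self])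
 qed
 moreover have "(%y. indicator {0..1} y *\<^sub>R (\<bar>q1 y\<bar> * y powr (- \<delta>))) = (%y. \<bar>q1 y\<bar> * y powr (- \<delta>))"
	by (auto simp: q1_def fun_eq_iff indicator_def)
 ultimately have "(%y. \<bar>q1 y\<bar> * y powr (- \<delta>)) absolutely_integrable_on {0..1}" by (simp only: set_integrable_def)
 then have "(%y. \<bar>q1 y\<bar> * y powr (- \<delta>)) integrable_on {0..1}" by (rule set_lebesgue_integral_eq_integral(1))
 then have "wpot \<delta> (integral {0..1} (%y. \<bar>q1 y\<bar> * y powr (- \<delta>))) q1"
	using ai \<delta> by (simp add: wpot_def q1_def)
 then show "\<exists>N. wpot ((p - 1) / (2 * p)) N q1" unfolding \<delta>_def by blast
qed

lemma prod_fun_tendsto: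
 assumes q: "unit_L1 q" and qh: "unit_L1 qh"
 shows "(prod_fun l q qh \<longlongrightarrow> prod_fun l q qh lam) (at lam)"
proof -
 have "((%mu. reg_sol l (sl_coeff q mu) 1) \<longlongrightarrow> reg_sol l (sl_coeff q lam) 1) (at lam) &
	((%mu. reg_flux l (sl_coeff q mu) (reg_sol l (sl_coeff q mu)) 1) \<longlongrightarrow> reg_flux l (sl_coeff q lam) (reg_sol l (sl_coeff q lam)) 1) (at lam)"
	if q: "unit_L1 q" for q
 proof -
	obtain C where C: "!!mu x. norm (mu - lam) <= 1 ==> x \<in> {0..1} ==>
		norm (reg_sol l (sl_coeff q mu) x - reg_sol l (sl_coeff q lam) x) <= C * norm (mu - lam)"
	 "!!mu. norm (mu - lam) <= 1 ==> norm (reg_flux l (sl_coeff q mu) (reg_sol l (sl_coeff q mu)) 1 -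
			reg_flux l (sl_coeff q lam) (reg_sol l (sl_coeff q lam)) 1) <= C * norm (mu - lam)"
	 using reg_sol_lipschitz[OF q, of lam l] by metis
	have z: "((%mu. C * norm (mu - lam)) \<longlongrightarrow> 0) (at lam)"
	 by (rule tendsto_eq_intros refl | simp)+
	have ev: "\<forall>\<^sub>F mu in at lam. norm (mu - lam) <= 1"
	 unfolding eventually_at by (intro exI[of _ 1]) (auto simp: dist_norm)
	show ?thesis
	 by (intro conjI; rule LIM_zero_cancel, rule Lim_null_comparison[OF _ z], rule eventually_mono[OF ev]) (auto intro: C)
 qed
 from this[OF q] this[OF qh] show ?thesis
	unfolding prod_fun_wronskian[OF q qh] by (intro tendsto_intros) auto
qed

text \<open>Evaluating at \<open>0\<close>, the factor \<open>\<mu>^(l+1)\<close> kills the moments up to \<open>l\<close>; a zero of \<open>\<Phi>\<close> at 0 kills one more, a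
double zero two more, which matches the three forms of the system.\<close>

lemma closed_system_annihilator:
 fixes g :: "real => complex"
 assumes cl: "closed_system p a (S_system l \<Lambda> S)" and p: "1 < p" and a: "a <= 1"
	and gm[measurable]: "g \<in> borel_measurable borel" and g0: "!!t. t \<notin> {0<..<a} ==> g t = 0"
	and gp: "integrable lborel (%t. norm (g t) powr p)" and SL: "S \<subseteq> \<Lambda>"
	and tr: "!!z. (z\<^sup>2) ^ (l+1) * \<Phi> (z\<^sup>2) = (LBINT t. g t * cos (2 * z * of_real t))"
	and \<Phi>0: "(\<Phi> \<longlongrightarrow> \<Phi> 0) (at 0)" and \<Phi>L: "!!lam. lam \<in> \<Lambda> ==> \<Phi> (of_real lam) = 0"
	and \<Phi>S: "!!lam. lam \<in> S ==> ((%mu. \<Phi> mu / (mu - of_real lam)) \<longlongrightarrow> 0) (at (of_real lam))"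
 shows "AE t in lborel. g t = 0"
proof -
 have g0': "g t = 0" if "t \<notin> {0<..<1}" for t using g0[of t] that a by auto
 have gi: "integrable lborel g" by (rule Lp_integrable[OF p gm g0' gp])
 have Lg: "Lp p 0 a g"
 proof -
	have "(%x. indicator {0<..<a} x *\<^sub>R g x) = g" "(%x. indicator {0<..<a} x *\<^sub>R norm (g x) powr p) = (%x. norm (g x) powr p)"
	 using g0 p by (auto simp: fun_eq_iff indicator_def)
	moreover have "integrable lebesgue (%x. norm (g x) powr p)" using gp by (subst integrable_completion) auto
	moreover have "g \<in> borel_measurable lebesgue" by (intro measurable_completion) simp
	ultimately show ?thesis unfolding Lp_def set_borel_measurable_def set_integrable_def by simp
 qed
 have conv: "(LINT x:{0<..<a}|lebesgue. g x * \<phi> x) = (LBINT x. g x * \<phi> x)" if [measurable]: "\<phi> \<in> borel_measurable borel" for \<phi>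
 proof -
	have "(%x. indicator {0<..<a} x *\<^sub>R (g x * \<phi> x)) = (%x. g x * \<phi> x)" using g0 by (auto simp: fun_eq_iff indicator_def)
	then show ?thesis unfolding set_lebesgue_integral_def by (simp only:) (rule integral_completion, measurable)
 qed
 define m where "m = (%k. LBINT t. g t * of_real (t ^ (2 * k)))"
 define A where "A = (%k. (- 4) ^ k / fact (2 * k) * m k)"
 define H where "H = (%\<mu>. \<mu> ^ (l+1) * \<Phi> \<mu>)"
 have s: "(%k. A k * \<mu> ^ k) sums H \<mu>" for \<mu>
 proof -
	have "H \<mu> = (LBINT t. g t * cos (2 * csqrt \<mu> * of_real t))"
	 using tr[of "csqrt \<mu>"] by (simp only: H_def power2_csqrt)
	moreover have "(%n. (- 4) ^ n / fact (2 * n) * (LBINT t. g t * of_real (t ^ (2 * n))) * ((csqrt \<mu>)\<^sup>2) ^ n) sums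
	  (LBINT t. g t * cos (2 * csqrt \<mu> * of_real t))"
	 by (rule cos_transform_series(2)[OF gi]) (rule g0')
	ultimately show ?thesis by (simp only: A_def m_def power2_csqrt)
 qed
 have v1: "A k = 0" if "k < l + 1" for k
	by (rule power_series_vanishing[OF s _ \<Phi>0 that]) (simp add: H_def)
 have v2: "A (l + 1) = 0" if "0 \<in> \<Lambda>"
 proof -
	have "((%\<mu>. H \<mu> / \<mu> ^ (l + 1)) \<longlongrightarrow> A (l + 1)) (at 0)" by (rule power_series_quotient_limit(2)[OF s v1])
	moreover have "\<forall>\<^sub>F \<mu> in at 0. H \<mu> / \<mu> ^ (l + 1) = \<Phi> \<mu>" by (auto simp: H_def eventually_at_filter)
	ultimately have "(\<Phi> \<longlongrightarrow> A (l + 1)) (at 0)" by (rule Lim_transform_eventually)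
	from tendsto_unique[OF at_neq_bot this \<Phi>0] show ?thesis using \<Phi>L[OF that] by simp
 qed
 have v3: "A (l + 2) = 0" if "0 \<in> S"
 proof -
	have v: "A k = 0" if "k < l + 2" for k
	 using v1[of k] v2 that SL \<open>0 \<in> S\<close> by (cases "k = l + 1") auto
	have "((%\<mu>. H \<mu> / \<mu> ^ (l + 2)) \<longlongrightarrow> A (l + 2)) (at 0)" by (rule power_series_quotient_limit(2)[OF s v])
	moreover have "\<forall>\<^sub>F \<mu> in at 0. H \<mu> / \<mu> ^ (l + 2) = \<Phi> \<mu> / (\<mu> - of_real 0)" by (auto simp: H_def eventually_at_filter)
	ultimately have "((%\<mu>. \<Phi> \<mu> / (\<mu> - of_real 0)) \<longlongrightarrow> A (l + 2)) (at 0)" by (rule Lim_transform_eventually)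
	from tendsto_unique[OF at_neq_bot this] \<Phi>S[OF that] show ?thesis by simp
 qed
 have mom: "m k = 0" if k: "k <= (if 0 \<in> S then l + 2 else if 0 \<in> \<Lambda> then l + 1 else l)" for k
 proof -
	have "A k = 0"
	proof (cases "k <= l")
	 case False
	 then have "k = l + 1 \<or> k = l + 2 \<or> l + 2 < k" by linarith
	 then show ?thesis using v2 v3 k SL by (auto split: if_splits)
	qed (use v1 in simp)
	then show ?thesis by (simp add: A_def)
 qed
 have csn: "(LBINT t. g t * (of_real t * sin (2 * csqrt (of_real lam) * of_real t))) = 0" if lam: "lam \<in> S" for lam
 proof (cases "lam = 0")
	case False
	define z where "z = csqrt (cplx lam)"
	have z: "z ~= 0" "z\<^sup>2 = of_real lam" "0 <= Re z" using False by (auto simp: z_def Re_csqrt)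
	have G0: "(LBINT t. g t * cos (2 * z * of_real t)) = 0" using tr[of z] z \<Phi>L lam SL by (auto simp: subset_iff)
	define h where "h = (%n. inverse (real (Suc n)))"
	have h: "0 < h n" for n by (simp add: h_def)
	have hl: "(%n. cplx (h n)) \<longlonglongrightarrow> of_real 0" unfolding h_def by (intro tendsto_of_real LIMSEQ_inverse_real_of_nat)
	let ?w = "%n. (z + of_real (h n))\<^sup>2"
	have nz: "2 * z + of_real (h n) ~= 0" for n
	proof
	 assume "2 * z + of_real (h n) = 0"
	 then have "Re (2 * z + of_real (h n)) = 0" by (simp only: zero_complex.sel)
	 then show False using z(3) h[of n] by simp
	qed
	have wd: "?w n - of_real lam = of_real (h n) * (2 * z + of_real (h n))" for n
	 unfolding z(2)[symmetric] by (simp add: power2_eq_square algebra_simps)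
	have wl: "?w \<longlonglongrightarrow> of_real lam" using tendsto_power[OF tendsto_add[OF tendsto_const[of z] hl], of 2] z by simp
	have wne: "?w n ~= of_real lam" for n
	proof
	 assume "?w n = of_real lam"
	 then have "of_real (h n) * (2 * z + of_real (h n)) = 0" using wd[of n] by simp
	 then show False using nz[of n] h[of n] by simp
	qed
	have "filterlim ?w (at (of_real lam)) sequentially"
	 unfolding filterlim_at using wl by (intro conjI always_eventually) (auto simp: wne)
	from filterlim_compose[OF \<Phi>S[OF lam] this] have pl: "(%n. \<Phi> (?w n) / (?w n - of_real lam)) \<longlonglongrightarrow> 0" .
	have "(%n. ?w n ^ (l+1) * (\<Phi> (?w n) / (?w n - of_real lam)) * (2 * z + of_real (h n))) \<longlonglongrightarrow> (of_real lam) ^ (l+1) * 0 * (2 * z + of_real 0)"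
	 by (intro tendsto_mult tendsto_power wl pl tendsto_add tendsto_const hl)
	moreover have "?w n ^ (l+1) * (\<Phi> (?w n) / (?w n - of_real lam)) * (2 * z + of_real (h n)) =
		(LBINT t. g t * cos (2 * (z + of_real (h n)) * of_real t)) / of_real (h n)" for n
	 unfolding tr[symmetric] wd using nz[of n] h[of n] by simp
	ultimately have "(%n. (LBINT t. g t * cos (2 * (z + of_real (h n)) * of_real t)) / of_real (h n)) \<longlonglongrightarrow> 0" by simp
	then show ?thesis unfolding z_def[symmetric] h_def by (rule cos_transform_double_zero[OF gi _ G0, rotated]) (rule g0')
 qed simp
 have "(LINT x:{0<..<a}|lebesgue. g x * \<phi> x) = 0" if "\<phi> \<in> S_system l \<Lambda> S" for \<phi>
 proof -
	consider k where "\<phi> = (%x. of_real (x ^ (2 * k)))" "k <= (if 0 \<in> S then l + 2 else if 0 \<in> \<Lambda> then l + 1 else l)"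
	 | lam where "\<phi> = (%x. cos (2 * csqrt (of_real lam) * of_real x))" "lam \<in> \<Lambda>"
	 | lam where "\<phi> = (%x. of_real x * sin (2 * csqrt (of_real lam) * of_real x))" "lam \<in> S"
	 using \<open>\<phi> \<in> S_system l \<Lambda> S\<close> unfolding S_system_def C_system_def by blast
	then show ?thesis
	proof cases
	 case 1
	 have "\<phi> \<in> borel_measurable borel" unfolding 1(1) by measurable
	 from conv[OF this] show ?thesis using mom[OF 1(2)] unfolding 1(1) m_def by (simp only:)
	next
	 case 2
	 have "\<phi> \<in> borel_measurable borel" unfolding 2(1) by (intro borel_measurable_continuous_onI continuous_intros)
	 from conv[OF this] show ?thesis using tr[of "csqrt (of_real lam)"] \<Phi>L[OF 2(2)] unfolding 2(1) by simp
	next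
	 case 3
	 have "\<phi> \<in> borel_measurable borel" unfolding 3(1) by (intro borel_measurable_continuous_onI continuous_intros)
	 from conv[OF this] show ?thesis using csn[OF 3(2)] unfolding 3(1) by (simp only:)
	qed
 qed
 then have "AE x in lebesgue. x \<in> {0<..<a} --> g x = 0" using cl Lg unfolding closed_system_def by blast
 then have "AE x in lborel. x \<in> {0<..<a} --> g x = 0" by (simp only: AE_completion_iff)
 then show ?thesis by eventually_elim (use g0 in blast)
qed

text \<open>If \<open>c\<close> is not 0, then \<open>F\<close> has a zero \<open>w\<close> besides the prescribed ones; the quotient \<open>F(\<mu>)/(\<mu> - w)\<close> satisfies the
hypotheses of the previous lemma.\<close>

lemma transform_constant_eq_0:
 fixes g :: "real => complex"
 assumes cl: "closed_system p a (S_system l \<Lambda> S)" and p: "1 < p" and a: "0 < a" "a <= 1"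
	and gm[measurable]: "g \<in> borel_measurable borel" and g0: "!!t. t \<notin> {0<..<a} ==> g t = 0"
	and gp: "integrable lborel (%t. norm (g t) powr p)" and SL: "S \<subseteq> \<Lambda>" and ne: "\<Lambda> ~= {}"
	and tr: "!!z. (z\<^sup>2) ^ (l+1) * F (z\<^sup>2) = c + (LBINT t. g t * cos (2 * z * of_real t))"
	and F0: "(F \<longlongrightarrow> F 0) (at 0)" and FL: "!!lam. lam \<in> \<Lambda> ==> F (of_real lam) = 0"
	and FS: "!!lam. lam \<in> S ==> ((%mu. F mu / (mu - of_real lam)) \<longlongrightarrow> 0) (at (of_real lam))"
 shows "c = 0"
proof (rule ccontr)
 assume c: "c ~= 0"
 have g0': "g t = 0" if "t \<notin> {0<..<1}" for t using g0[of t] that a by auto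
 have gi: "integrable lborel g" by (rule Lp_integrable[OF p gm g0' gp])
 define G where "G = (%z. LBINT t. g t * cos (2 * z * of_real t))"
 define I where "I = (LBINT t. norm (g t))"
 have I0: "0 <= I" unfolding I_def by (intro bi_integral_nonneg) simp
 define H where "H = (%\<mu>. \<mu> ^ (l+1) * F \<mu>)"
 have HG: "H \<mu> = c + G (csqrt \<mu>)" for \<mu> using tr[of "csqrt \<mu>"] by (simp only: H_def G_def power2_csqrt)
 have Gb: "norm (G z) <= I * exp (2 * \<bar>Im z\<bar>)" for z
 proof -
	have "norm (G z) <= (LBINT t. norm (g t * cos (2 * z * of_real t)))" unfolding G_def by (rule integral_norm_bound)
	also have "... <= (LBINT t. norm (g t) * exp (2 * \<bar>Im z\<bar>))"
	proof (intro integral_mono' integrable_mult_left integrable_norm gi)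
	 fix t
	 show "norm (g t * cos (2 * z * of_real t)) <= norm (g t) * exp (2 * \<bar>Im z\<bar>)"
	 proof (cases "t \<in> {0<..<1}")
		case True
		then show ?thesis using norm_cos_real_mult_le[of t 1 z] by (simp add: norm_mult mult_left_mono)
	 qed (use g0'[of t] in simp)
	qed auto
	finally show ?thesis by (simp add: I_def)
 qed
 have RL: "((%x::real. G (of_real x)) \<longlongrightarrow> 0) at_top" unfolding G_def by (rule riemann_lebesgue[OF gi g0'])
 define A where "A = (%n. c * (if n = 0 then 1 else 0) + (- 4) ^ n / fact (2 * n) * (LBINT t. g t * of_real (t ^ (2 * n))))"
 have s: "(%k. A k * \<mu> ^ k) sums H \<mu>" for \<mu>
 proof -
	have "(%n. (- 4) ^ n / fact (2 * n) * (LBINT t. g t * of_real (t ^ (2 * n))) * ((csqrt \<mu>)\<^sup>2) ^ n) sums G (csqrt \<mu>)"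
	 unfolding G_def by (rule cos_transform_series(2)[OF gi]) (rule g0')
	from sums_add[OF sums_mult[OF powser_sums_if[of 0 \<mu>], of c] this] show ?thesis
	 by (simp add: A_def HG distrib_right mult.assoc)
 qed
 have v: "A k = 0" if "k < l + 1" for k
	by (rule power_series_vanishing[OF s _ F0 that]) (simp add: H_def)
 have Fs: "(%k. A (k + (l + 1)) * \<mu> ^ k) sums F \<mu>" for \<mu>
 proof (cases "\<mu> = 0")
	case True
	have "((%\<mu>. H \<mu> / \<mu> ^ (l + 1)) \<longlongrightarrow> A (l + 1)) (at 0)" by (rule power_series_quotient_limit(2)[OF s v])
	moreover have "\<forall>\<^sub>F \<mu> in at 0. H \<mu> / \<mu> ^ (l + 1) = F \<mu>" by (auto simp: H_def eventually_at_filter)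
	ultimately have "(F \<longlongrightarrow> A (l + 1)) (at 0)" by (rule Lim_transform_eventually)
	from tendsto_unique[OF at_neq_bot this F0] have "A (l + 1) = F 0" .
	then show ?thesis using powser_sums_zero[of "%k. A (k + (l + 1))"] True by simp
 next
	case False
	have "(%k. A (k + (l + 1)) * \<mu> ^ k) sums (H \<mu> / \<mu> ^ (l + 1))"
	 by (rule power_series_quotient_limit(1)[OF s v False])
	moreover have "H \<mu> / \<mu> ^ (l + 1) = F \<mu>" using False by (simp add: H_def)
	ultimately show ?thesis by (simp only:)
 qed
 have Fh: "F holomorphic_on UNIV" by (rule power_series_entire[OF Fs])
 have big: "norm (F \<mu>) <= norm (H \<mu>) / norm \<mu>" if "1 <= norm \<mu>" for \<mu>
 proof -
	have "1 * norm \<mu> <= norm \<mu> ^ l * norm \<mu>" using that one_le_power by (intro mult_right_mono) auto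
	then have "norm \<mu> * norm (F \<mu>) <= norm (H \<mu>)" unfolding H_def norm_mult norm_power
	 by (intro mult_right_mono) (auto simp: mult.commute)
	moreover have "0 < norm \<mu>" using that by linarith
	ultimately show ?thesis by (simp only: pos_le_divide_eq mult.commute)
 qed
 have "compact (F ` cball 0 1)"
	by (intro compact_continuous_image continuous_on_subset[OF holomorphic_on_imp_continuous_on[OF Fh]]) auto
 from compact_imp_bounded[OF this] obtain M where M': "\<forall>y\<in>F ` cball 0 1. norm y <= M" unfolding bounded_iff by blast
 have M: "norm (F \<mu>) <= M" if "norm \<mu> <= 1" for \<mu> using M' that by simp
 have M0: "0 <= M" using order_trans[OF norm_ge_zero M[of 0]] by simp
 have growth: "norm (F \<mu>) <= (M + (norm c + I)) * exp (2 * sqrt (norm \<mu>))" for \<mu>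
 proof (cases "norm \<mu> <= 1")
	case True
	have "M * 1 <= (M + (norm c + I)) * exp (2 * sqrt (norm \<mu>))" using M0 I0 by (intro mult_mono) auto
	then show ?thesis using M[OF True] by simp
 next
	case False
	have im: "\<bar>Im (csqrt \<mu>)\<bar> <= sqrt (norm \<mu>)" using abs_Im_le_cmod[of "csqrt \<mu>"] by (simp add: norm_csqrt)
	have "norm (F \<mu>) <= norm (H \<mu>) / norm \<mu>" using False by (intro big) simp
	also have "... <= norm (H \<mu>) / 1" using False by (intro divide_left_mono) auto
	also have "... <= norm c * 1 + I * exp (2 * \<bar>Im (csqrt \<mu>)\<bar>)"
	 unfolding HG using norm_triangle_ineq[of c "G (csqrt \<mu>)"] Gb[of "csqrt \<mu>"] by simp
	also have "... <= norm c * exp (2 * sqrt (norm \<mu>)) + I * exp (2 * sqrt (norm \<mu>))"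
	 using im I0 by (intro add_mono mult_left_mono) auto
	also have "... <= (M + (norm c + I)) * exp (2 * sqrt (norm \<mu>))" using M0 by (simp add: distrib_right)
	finally show ?thesis .
 qed
 have csr: "csqrt (cplx x) = of_real (sqrt x)" if "0 <= x" for x using that by (simp add: csqrt_of_real_nonneg)
 have lim: "((%x::real. F (of_real x)) \<longlongrightarrow> 0) at_top"
 proof (rule Lim_null_comparison)
	have "norm (F (of_real x)) <= (norm c + I) / x" if x: "1 <= x" for x
	proof -
	 have "norm (F (of_real x)) <= norm (H (of_real x)) / norm (cplx x)" using x by (intro big) simp
	 also have "... <= (norm c + I) / x"
	 proof -
		have "norm (H (of_real x)) <= norm c + I"
		 unfolding HG csr[OF order_trans[OF zero_le_one x]] using norm_triangle_ineq[of c "G (of_real (sqrt x))"] Gb[of "of_real (sqrt x)"] by simp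
		then show ?thesis using x by (simp add: divide_right_mono)
	 qed
	 finally show ?thesis .
	qed
	then show "\<forall>\<^sub>F x in at_top. norm (F (cplx x)) <= (norm c + I) / x"
	 by (rule eventually_mono[OF eventually_ge_at_top])
	show "((%x::real. (norm c + I) / x) \<longlongrightarrow> 0) at_top" by real_asymp
 qed
 have "\<forall>\<^sub>F y in at_top. norm (G (cplx y)) < norm c"
	using tendstoD[OF RL, of "norm c"] c by (simp add: dist_norm)
 then obtain Y where Y: "!!y. Y <= y ==> norm (G (cplx y)) < norm c" by (auto simp: eventually_at_top_linorder)
 define X where "X = (max Y 0)\<^sup>2"
 have Xnz: "F (cplx x) ~= 0" if x: "X <= x" for x
 proof
	assume 0: "F (cplx x) = 0"
	have x0: "0 <= x" using x by (simp add: X_def order_trans[OF zero_le_power2])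
	have "max Y 0 <= sqrt x" using x by (intro real_le_rsqrt) (simp add: X_def)
	then have "norm (G (cplx (sqrt x))) < norm c" by (intro Y) simp
	moreover have "c + G (cplx (sqrt x)) = 0" using HG[of "of_real x"] 0 csr[OF x0] by (simp add: H_def)
	ultimately show False by (metis add_eq_0_iff less_irrefl norm_minus_cancel)
 qed
 obtain lam0 where lam0: "lam0 \<in> \<Lambda>" using ne by blast
 have nc: "\<not> F constant_on UNIV"
	using FL[OF lam0] Xnz[of X] unfolding constant_on_def by (metis UNIV_I order_refl)
 define V where "V = insert 0 {z \<in> cball 0 \<bar>X\<bar>. F z = 0}"
 have "finite {z \<in> cball 0 \<bar>X\<bar>. F z = 0}"
	by (rule holomorphic_compact_finite_zeros[OF Fh open_UNIV connected_UNIV compact_cball subset_UNIV nc])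
 then have "finite V" unfolding V_def by (simp only: finite_insert)
 from order_half_zero_off_negative_axis[OF Fh growth _ lim Xnz[OF order_refl] this]
 obtain w where w: "F w = 0" "w \<notin> V" "\<not> (Im w = 0 & Re w < 0)" by auto
 have w0: "w ~= 0" using w by (auto simp: V_def)
 have wL: "cplx x ~= w" if "x \<in> \<Lambda>" for x
 proof
	assume e: "cplx x = w"
	then have "0 <= x" using w(3) by auto
	moreover have "x < X" using w(1) Xnz[of x] e by force
	ultimately have "w \<in> V" using w(1) e by (auto simp: V_def)
	then show False using w(2) by simp
 qed
 define \<zeta> where "\<zeta> = csqrt w"
 have \<zeta>: "\<zeta> ~= 0" "\<zeta>\<^sup>2 = w" using w0 by (auto simp: \<zeta>_def)
 have G\<zeta>: "G \<zeta> = - c" using HG[of w] w(1) by (simp add: H_def \<zeta>_def eq_neg_iff_add_eq_0 add.commute)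
 have "\<exists>k C. k \<in> borel_measurable borel & (\<forall>s. s \<notin> {0<..<a} --> k s = 0) & (\<forall>s. norm (k s) <= C) &
	(\<forall>z. (z\<^sup>2 - \<zeta>\<^sup>2) * (LBINT s. k s * cos (2 * z * of_real s)) = G z - G \<zeta>)"
	unfolding G_def by (rule cos_transform_quotient[OF gi a(2) _ \<zeta>(1)]) (rule g0)
 then obtain k C where km: "k \<in> borel_measurable borel" and k0: "!!s. s \<notin> {0<..<a} ==> k s = 0" and kC: "!!s. norm (k s) <= C"
	and kt0: "!!z. (z\<^sup>2 - \<zeta>\<^sup>2) * (LBINT s. k s * cos (2 * z * of_real s)) = G z - G \<zeta>"
	by blast
 define K where "K = (%z. LBINT s. k s * cos (2 * z * of_real s))"
 have kt: "(z\<^sup>2 - w) * K z = c + G z" for z using kt0[of z] by (simp add: K_def G\<zeta> \<zeta>(2) add.commute)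
 define \<Phi> where "\<Phi> = (%\<mu>. if \<mu> = w then K \<zeta> / w ^ (l+1) else F \<mu> / (\<mu> - w))"
 have "AE s in lborel. k s = 0"
 proof (rule closed_system_annihilator[OF cl p a(2) km k0 _ SL, where \<Phi> = \<Phi>])
	show "integrable lborel (%s. norm (k s) powr p)"
	proof (rule bi_integrable_bound)
	 show "integrable lborel (%s. indicator {0..1::real} s * (C powr p))" by (intro integrable_mult_left) simp
	 have "norm (k s) powr p <= indicator {0..1} s * C powr p" for s
	 proof (cases "s \<in> {0<..<a}")
		case True
		then show ?thesis using kC[of s] p a by (auto simp: indicator_def intro!: powr_mono2)
	 qed (use k0[of s] in \<open>simp add: indicator_def\<close>)
	 then show "AE s in lborel. norm (norm (k s) powr p) <= norm (indicator {0..1} s * C powr p)"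
		by (intro AE_I2) (auto intro: order_trans[OF _ abs_ge_self])
	qed (use km in measurable)
	show "(z\<^sup>2) ^ (l+1) * \<Phi> (z\<^sup>2) = (LBINT t. k t * cos (2 * z * of_real t))" for z
	proof (cases "z\<^sup>2 = w")
	 case True
	 then have "z\<^sup>2 = \<zeta>\<^sup>2" using \<zeta> by simp
	 then have "z = \<zeta> \<or> z = - \<zeta>" by (simp only: power2_eq_iff)
	 then have "K z = K \<zeta>" by (auto simp: K_def)
	 moreover have "(LBINT t. k t * cos (2 * z * of_real t)) = K z" by (simp only: K_def)
	 ultimately show ?thesis using True w0 by (simp add: \<Phi>_def del: power_Suc)
	next
	 case False
	 then have "(z\<^sup>2) ^ (l+1) * \<Phi> (z\<^sup>2) = (c + G z) / (z\<^sup>2 - w)" unfolding G_def tr[symmetric] by (simp add: \<Phi>_def)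
	 also have "... = K z" using False by (simp add: kt[symmetric])
	 finally show ?thesis by (simp only: K_def)
	qed
	have ev: "\<forall>\<^sub>F \<mu> in at x. F \<mu> / (\<mu> - w) = \<Phi> \<mu>" if "x ~= w" for x
	 using tendsto_imp_eventually_ne[OF tendsto_ident_at that] by eventually_elim (simp add: \<Phi>_def)
	have "((%\<mu>. F \<mu> / (\<mu> - w)) \<longlongrightarrow> F 0 / (0 - w)) (at 0)" using w0 by (intro tendsto_intros F0) auto
	moreover have "F 0 / (0 - w) = \<Phi> 0" using w0 by (simp add: \<Phi>_def)
	ultimately show "(\<Phi> \<longlongrightarrow> \<Phi> 0) (at 0)" using Lim_transform_eventually[OF _ ev[of 0]] w0 by auto
	show "\<Phi> (of_real lam) = 0" if "lam \<in> \<Lambda>" for lam using FL[OF that] wL[OF that] by (simp add: \<Phi>_def)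
	show "((%mu. \<Phi> mu / (mu - of_real lam)) \<longlongrightarrow> 0) (at (of_real lam))" if lam: "lam \<in> S" for lam
	proof -
	 have nw: "of_real lam ~= w" using wL lam SL by auto
	 have "((%mu. (F mu / (mu - of_real lam)) / (mu - w)) \<longlongrightarrow> 0 / (of_real lam - w)) (at (of_real lam))"
		using nw by (intro tendsto_divide FS[OF lam] tendsto_diff tendsto_ident_at tendsto_const) auto
	 moreover have "\<forall>\<^sub>F mu in at (of_real lam). (F mu / (mu - of_real lam)) / (mu - w) = \<Phi> mu / (mu - of_real lam)"
		using ev[OF nw] by eventually_elim (metis divide_divide_eq_left mult.commute)
	 ultimately show ?thesis using Lim_transform_eventually by fastforce
	qed
 qed
 then have Kz: "K z = 0" for z unfolding K_def
 proof (intro integral_eq_zero_AE)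
	assume "AE s in lborel. k s = 0"
	then show "AE s in lborel. k s * cos (2 * z * of_real s) = 0" by eventually_elim simp
 qed
 have "G z = - c" for z using kt[of z] Kz[of z] by (simp add: eq_neg_iff_add_eq_0 add.commute)
 then have "((%x::real. - c) \<longlongrightarrow> 0) at_top" using RL by (simp only:)
 then show False using c by (simp add: tendsto_const_iff)
qed

theorem theorem1p1:
  fixes l :: nat and p a :: real and q qhat :: "real \<Rightarrow> real"
    and \<beta> :: "nat \<Rightarrow> ereal" and lam :: "nat \<Rightarrow> real" and \<Lambda> S :: "real set"
  assumes "1 < p" and "0 < a" and "a \<le> 1"
    and "Lp p 0 1 q"
    and "\<And>n. \<beta> n \<noteq> -\<infinity>"
    and "\<And>n. complex_of_real (lam n) \<in> sl_spectrum (real l) q (\<beta> n)"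
    and "\<Lambda> = range lam"
    and "\<not> filterlim lam at_bot sequentially"
    and "S \<subseteq> \<Lambda>"
    and "closed_system p a (S_system l \<Lambda> S)"
    and "Lp p 0 1 qhat"
    and "AE x in lebesgue. x \<in> {a<..<1} \<longrightarrow> qhat x = q x"
    and "\<And>n. complex_of_real (lam n) \<in> sl_spectrum (real l) qhat (\<beta> n)"
    and "\<And>n. lam n \<in> S \<Longrightarrow>
      norming_const (real l) qhat (\<beta> n) (complex_of_real (lam n)) =
      norming_const (real l) q (\<beta> n) (complex_of_real (lam n))"
  shows "AE x in lebesgue. x \<in> {0<..<a} \<longrightarrow> qhat x = q x"
proof -
 note p = assms(1) and a = assms(2,3)
 define q1 where "q1 = (%x. if x \<in> {0<..<1} then q x else 0)"
 define qh1 where "qh1 = (%x. if x \<in> {0<..<1} then qhat x else 0)"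
 have sol: "sl_solution (real l) q1 = sl_solution (real l) q" "sl_solution (real l) qh1 = sl_solution (real l) qhat"
	by (rule sl_solution_cong, simp add: q1_def, rule sl_solution_cong, simp add: qh1_def)
 have spec: "cplx (lam n) \<in> sl_spectrum (real l) q1 (\<beta> n)" "cplx (lam n) \<in> sl_spectrum (real l) qh1 (\<beta> n)" for n
	using assms(6)[of n] assms(13)[of n] unfolding sl_spectrum_def sol .
 have nrm: "norming_const (real l) qh1 (\<beta> n) (cplx (lam n)) = norming_const (real l) q1 (\<beta> n) (cplx (lam n))"
	if "lam n \<in> S" for n
	using assms(14)[OF that] unfolding norming_const_def sl_psi_def sol .
 have q1: "q1 \<in> borel_measurable lebesgue" "integrable lebesgue (%x. \<bar>q1 x\<bar> powr p)" "\<exists>N. wpot ((p - 1) / (2 * p)) N q1"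
	unfolding q1_def by (rule Lp_imp_wpot[OF p assms(4)])+
 have qh1: "qh1 \<in> borel_measurable lebesgue" "integrable lebesgue (%x. \<bar>qh1 x\<bar> powr p)" "\<exists>N. wpot ((p - 1) / (2 * p)) N qh1"
	unfolding qh1_def by (rule Lp_imp_wpot[OF p assms(11)])+
 obtain N1 N2 where "wpot ((p - 1) / (2 * p)) N1 q1" "wpot ((p - 1) / (2 * p)) N2 qh1" using q1(3) qh1(3) by blast
 then have w: "wpot ((p - 1) / (2 * p)) (max N1 N2) q1" "wpot ((p - 1) / (2 * p)) (max N1 N2) qh1"
	by (auto simp: wpot_def)
 note ai = wpotD(1)[OF w(1)] wpotD(1)[OF w(2)]
 have "(%x. qh1 x - q1 x) \<in> borel_measurable lebesgue" by (intro borel_measurable_diff q1(1) qh1(1))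
 then obtain f0 where f0: "f0 \<in> borel_measurable lborel" "AE x in lborel. qh1 x - q1 x = f0 x"
	using completion_ex_borel_measurable_real by blast
 define f where "f = (%x. indicator {0<..<a} x * f0 x)"
 have fm[measurable]: "f \<in> borel_measurable borel" using f0(1) unfolding f_def by simp
 have fs: "!!x. x \<notin> {0<..<a} ==> f x = 0" by (simp add: f_def)
 have "AE x in lborel. x \<in> {a<..<1} --> qhat x = q x" using assms(12) by (simp only: AE_completion_iff)
 with f0(2) AE_lborel_singleton[of a] have feq: "AE x in lborel. x \<in> {0<..<1} --> qh1 x - q1 x = f x"
 proof eventually_elim
	case (elim x)
	then show ?case using a by (cases "x < a") (auto simp: f_def q1_def qh1_def)
 qed
 have fp: "integrable lborel (%x. \<bar>f x\<bar> powr p)"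
 proof -
	have "integrable lebesgue (%x. \<bar>f x\<bar> powr p)"
	proof (rule bi_integrable_bound)
	 show "integrable lebesgue (%x. 2 powr p * (\<bar>qh1 x\<bar> powr p + \<bar>q1 x\<bar> powr p))"
		by (intro integrable_mult_right bi_integrable_add q1(2) qh1(2))
	 have "AE x in lebesgue. qh1 x - q1 x = f0 x" using f0(2) by (simp only: AE_completion_iff)
	 then show "AE x in lebesgue. norm (\<bar>f x\<bar> powr p) <= norm (2 powr p * (\<bar>qh1 x\<bar> powr p + \<bar>q1 x\<bar> powr p))"
	 proof eventually_elim
		case (elim x)
		have "\<bar>f x\<bar> powr p <= \<bar>qh1 x - q1 x\<bar> powr p" using elim p by (auto simp: f_def indicator_def)
		also have "... <= 2 powr p * (\<bar>qh1 x\<bar> powr p + \<bar>q1 x\<bar> powr p)"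
		 using norm_add_powr_le[OF p, of "qh1 x" "q1 x"] by simp
		finally show ?case by simp
	 qed
	qed (intro measurable_completion, simp)
	then show ?thesis by (subst (asm) integrable_completion) auto
 qed
 have "\<exists>(g :: real => complex) c. g \<in> borel_measurable borel & (\<forall>t. t \<notin> {0<..<a} --> g t = 0) &
	integrable lborel (%t. norm (g t) powr p) &
	(\<forall>z. (z\<^sup>2) ^ (l+1) * prod_fun l q1 qh1 (z\<^sup>2) = c + (LBINT t. g t * cos (2 * z * of_real t))) &
	((AE t in lborel. g t = 0) --> (AE t in lborel. f t = 0))"
	by (rule prod_fun_transform[OF p w a fm _ fp feq]) (rule fs)
 then obtain g c where gm: "g \<in> borel_measurable borel" and g0: "!!t. t \<notin> {0<..<a} ==> g t = 0"
	and gp: "integrable lborel (%t. norm (g t) powr p)"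
	and tr: "!!z. (z\<^sup>2) ^ (l+1) * prod_fun l q1 qh1 (z\<^sup>2) = c + (LBINT t. g t * cos (2 * z * cplx t))"
	and inj: "(AE t in lborel. g t = 0) ==> (AE t in lborel. f t = 0)"
	by blast
 have FL: "prod_fun l q1 qh1 (of_real x) = 0" if "x \<in> \<Lambda>" for x
	using that assms(7) prod_fun_eq_0[OF ai spec] by auto
 have FS: "((%mu. prod_fun l q1 qh1 mu / (mu - of_real x)) \<longlongrightarrow> 0) (at (of_real x))" if x: "x \<in> S" for x
 proof -
	obtain n where n: "x = lam n" using x assms(7,9) by auto
	show ?thesis unfolding n by (rule prod_fun_double_zero[OF ai spec nrm]) (use x n in simp)
 qed
 note F0 = prod_fun_tendsto[OF ai, of l 0]
 have ne: "\<Lambda> ~= {}" using assms(7) by simp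
 have "c = 0"
	by (rule transform_constant_eq_0[OF assms(10) p a gm g0 gp assms(9) ne tr F0 FL FS])
 then have tr0: "(z\<^sup>2) ^ (l+1) * prod_fun l q1 qh1 (z\<^sup>2) = (LBINT t. g t * cos (2 * z * cplx t))" for z
	using tr[of z] by simp
 have "AE t in lborel. g t = 0"
	by (rule closed_system_annihilator[OF assms(10) p a(2) gm g0 gp assms(9) tr0 F0 FL FS])
 from inj[OF this] feq have "AE x in lborel. x \<in> {0<..<a} --> qhat x = q x"
 proof eventually_elim
	case (elim x)
	then show ?case using a by (auto simp: q1_def qh1_def)
 qed
 then show ?thesis by (simp only: AE_completion_iff)
qed

end
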